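(* Let $k$ be an algebraically closed field and let $A$ and $B$ be complete Noetherian local rings containing $k$ such that $A\hat{\otimes}_k B$ is Noetherian. If $A$ and $B$ are domains, then $A\hat{\otimes}_k B$ is a domain.
   Context: With $\mathfrak{m}$, $\mathfrak{n}$ the maximal ideals of $A$, $B$, $A\hat{\otimes}_k B=\varprojlim_{i,j}\,(A/\mathfrak{m}^i)\otimes_k(B/\mathfrak{n}^j)$. *)

theory Defs
  imports "HOL-Algebra.Algebra"
begin

definition local_ring :: "('a, 'b) ring_scheme \<Rightarrow> bool" where
  "local_ring R \<longleftrightarrow> cring R \<and> (\<exists>!m. maximalideal m R)"

definition max_ideal :: "('a, 'b) ring_scheme \<Rightarrow> 'a set" where
  "max_ideal R = (THE m. maximalideal m R)"

text \<open>Powers of an ideal (with I^0 = R), taken in the monoid of ideals.\<close>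
definition ideal_pow :: "('a, 'b) ring_scheme \<Rightarrow> 'a set \<Rightarrow> nat \<Rightarrow> 'a set" where
  "ideal_pow R I n = I [^]\<^bsub>ideals_set R\<^esub> n"

text \<open>I-adic completeness: the canonical map R --> lim R/I^n is bijective.
  A compatible family of residue classes is a sequence of cosets x n of I^n
  with x (n+1) contained in x n.\<close>
definition adically_complete :: "('a, 'b) ring_scheme \<Rightarrow> 'a set \<Rightarrow> bool" where
  "adically_complete R I \<longleftrightarrow>
     (\<forall>x. (\<forall>n. x n \<in> carrier (R Quot (ideal_pow R I n)) \<and> x (Suc n) \<subseteq> x n) \<longrightarrow>
          (\<exists>!a. a \<in> carrier R \<and> (\<forall>n. a \<in> x n)))"

definition complete_noetherian_local_ring :: "('a, 'b) ring_scheme \<Rightarrow> bool" where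
  "complete_noetherian_local_ring R \<longleftrightarrow>
     local_ring R \<and> noetherian_ring R \<and> adically_complete R (max_ideal R)"

text \<open>Formal K-linear combinations of pairs (r,s) in carrier R \<times> carrier S
  (the free K-vector space on carrier R \<times> carrier S).\<close>
definition fsums :: "('k, 'c) ring_scheme \<Rightarrow> ('r, 'd) ring_scheme \<Rightarrow> ('s, 'e) ring_scheme
    \<Rightarrow> ('r \<times> 's \<Rightarrow> 'k) set" where
  "fsums K R S = {f. (\<forall>p. f p \<in> carrier K) \<and> finite {p. f p \<noteq> \<zero>\<^bsub>K\<^esub>}
                     \<and> {p. f p \<noteq> \<zero>\<^bsub>K\<^esub>} \<subseteq> carrier R \<times> carrier S}"

definition fs_zero :: "('k, 'c) ring_scheme \<Rightarrow> 'x \<Rightarrow> 'k" where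
  "fs_zero K = (\<lambda>_. \<zero>\<^bsub>K\<^esub>)"

definition fs_add :: "('k, 'c) ring_scheme \<Rightarrow> ('x \<Rightarrow> 'k) \<Rightarrow> ('x \<Rightarrow> 'k) \<Rightarrow> 'x \<Rightarrow> 'k" where
  "fs_add K f g = (\<lambda>p. f p \<oplus>\<^bsub>K\<^esub> g p)"

definition fs_smul :: "('k, 'c) ring_scheme \<Rightarrow> 'k \<Rightarrow> ('x \<Rightarrow> 'k) \<Rightarrow> 'x \<Rightarrow> 'k" where
  "fs_smul K c f = (\<lambda>p. c \<otimes>\<^bsub>K\<^esub> f p)"

definition fs_neg :: "('k, 'c) ring_scheme \<Rightarrow> ('x \<Rightarrow> 'k) \<Rightarrow> 'x \<Rightarrow> 'k" where
  "fs_neg K f = (\<lambda>p. \<ominus>\<^bsub>K\<^esub> f p)"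

definition fs_delta :: "('k, 'c) ring_scheme \<Rightarrow> 'x \<Rightarrow> 'x \<Rightarrow> 'k" where
  "fs_delta K p = (\<lambda>q. if q = p then \<one>\<^bsub>K\<^esub> else \<zero>\<^bsub>K\<^esub>)"

inductive_set tensor_rel ::
  "('k, 'c) ring_scheme \<Rightarrow> ('r, 'd) ring_scheme \<Rightarrow> ('s, 'e) ring_scheme
     \<Rightarrow> ('k \<Rightarrow> 'r) \<Rightarrow> ('k \<Rightarrow> 's) \<Rightarrow> ('r \<times> 's \<Rightarrow> 'k) set"
  for K R S phi psi where
    zero: "fs_zero K \<in> tensor_rel K R S phi psi"
  | add: "f \<in> tensor_rel K R S phi psi \<Longrightarrow> g \<in> tensor_rel K R S phi psi
          \<Longrightarrow> fs_add K f g \<in> tensor_rel K R S phi psi"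
  | smul: "c \<in> carrier K \<Longrightarrow> f \<in> tensor_rel K R S phi psi
          \<Longrightarrow> fs_smul K c f \<in> tensor_rel K R S phi psi"
  | add_left: "r \<in> carrier R \<Longrightarrow> r' \<in> carrier R \<Longrightarrow> s \<in> carrier S \<Longrightarrow>
       fs_add K (fs_delta K (r \<oplus>\<^bsub>R\<^esub> r', s))
         (fs_neg K (fs_add K (fs_delta K (r, s)) (fs_delta K (r', s))))
       \<in> tensor_rel K R S phi psi"
  | add_right: "r \<in> carrier R \<Longrightarrow> s \<in> carrier S \<Longrightarrow> s' \<in> carrier S \<Longrightarrow>
       fs_add K (fs_delta K (r, s \<oplus>\<^bsub>S\<^esub> s'))
         (fs_neg K (fs_add K (fs_delta K (r, s)) (fs_delta K (r, s'))))
       \<in> tensor_rel K R S phi psi"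
  | smul_left: "c \<in> carrier K \<Longrightarrow> r \<in> carrier R \<Longrightarrow> s \<in> carrier S \<Longrightarrow>
       fs_add K (fs_delta K (phi c \<otimes>\<^bsub>R\<^esub> r, s)) (fs_neg K (fs_smul K c (fs_delta K (r, s))))
       \<in> tensor_rel K R S phi psi"
  | smul_right: "c \<in> carrier K \<Longrightarrow> r \<in> carrier R \<Longrightarrow> s \<in> carrier S \<Longrightarrow>
       fs_add K (fs_delta K (r, psi c \<otimes>\<^bsub>S\<^esub> s)) (fs_neg K (fs_smul K c (fs_delta K (r, s))))
       \<in> tensor_rel K R S phi psi"

definition tclass ::
  "('k, 'c) ring_scheme \<Rightarrow> ('r, 'd) ring_scheme \<Rightarrow> ('s, 'e) ring_scheme
     \<Rightarrow> ('k \<Rightarrow> 'r) \<Rightarrow> ('k \<Rightarrow> 's) \<Rightarrow> ('r \<times> 's \<Rightarrow> 'k) \<Rightarrow> ('r \<times> 's \<Rightarrow> 'k) set" where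
  "tclass K R S phi psi f =
     {g \<in> fsums K R S. fs_add K g (fs_neg K f) \<in> tensor_rel K R S phi psi}"

text \<open>Product of formal sums, extending (r \<otimes> s)(r' \<otimes> s') = rr' \<otimes> ss' bilinearly.\<close>
definition fs_mult ::
  "('k, 'c) ring_scheme \<Rightarrow> ('r, 'd) ring_scheme \<Rightarrow> ('s, 'e) ring_scheme
     \<Rightarrow> ('r \<times> 's \<Rightarrow> 'k) \<Rightarrow> ('r \<times> 's \<Rightarrow> 'k) \<Rightarrow> 'r \<times> 's \<Rightarrow> 'k" where
  "fs_mult K R S f g = (\<lambda>(u, v). finsum K (\<lambda>(p, q). f p \<otimes>\<^bsub>K\<^esub> g q)
      {(p, q). f p \<noteq> \<zero>\<^bsub>K\<^esub> \<and> g q \<noteq> \<zero>\<^bsub>K\<^esub> \<and>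
               fst p \<otimes>\<^bsub>R\<^esub> fst q = u \<and> snd p \<otimes>\<^bsub>S\<^esub> snd q = v})"

definition tensor_ring ::
  "('k, 'c) ring_scheme \<Rightarrow> ('r, 'd) ring_scheme \<Rightarrow> ('s, 'e) ring_scheme
     \<Rightarrow> ('k \<Rightarrow> 'r) \<Rightarrow> ('k \<Rightarrow> 's) \<Rightarrow> ('r \<times> 's \<Rightarrow> 'k) set ring" where
  "tensor_ring K R S phi psi =
    \<lparr>carrier = tclass K R S phi psi ` fsums K R S,
     monoid.mult = (\<lambda>U V. tclass K R S phi psi
               (fs_mult K R S (SOME f. f \<in> U) (SOME g. g \<in> V))),
     one = tclass K R S phi psi (fs_delta K (\<one>\<^bsub>R\<^esub>, \<one>\<^bsub>S\<^esub>)),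
     ring.zero = tclass K R S phi psi (fs_zero K),
     ring.add = (\<lambda>U V. tclass K R S phi psi (fs_add K (SOME f. f \<in> U) (SOME g. g \<in> V)))\<rparr>"

definition fs_push :: "('k, 'c) ring_scheme \<Rightarrow> ('r \<Rightarrow> 'r2) \<Rightarrow> ('s \<Rightarrow> 's2)
     \<Rightarrow> ('r \<times> 's \<Rightarrow> 'k) \<Rightarrow> 'r2 \<times> 's2 \<Rightarrow> 'k" where
  "fs_push K p q f = (\<lambda>(u, v). finsum K f {x. f x \<noteq> \<zero>\<^bsub>K\<^esub> \<and> p (fst x) = u \<and> q (snd x) = v})"

definition tensor_map ::
  "('k, 'c) ring_scheme \<Rightarrow> ('r2, 'd) ring_scheme \<Rightarrow> ('s2, 'e) ring_scheme
     \<Rightarrow> ('k \<Rightarrow> 'r2) \<Rightarrow> ('k \<Rightarrow> 's2) \<Rightarrow> ('r \<Rightarrow> 'r2) \<Rightarrow> ('s \<Rightarrow> 's2)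
     \<Rightarrow> ('r \<times> 's \<Rightarrow> 'k) set \<Rightarrow> ('r2 \<times> 's2 \<Rightarrow> 'k) set" where
  "tensor_map K R2 S2 phi2 psi2 p q U = tclass K R2 S2 phi2 psi2 (fs_push K p q (SOME f. f \<in> U))"

text \<open>Canonical projection R/J \<rightarrow> R/I for J \<subseteq> I, on cosets.\<close>
definition qproj :: "('a, 'b) ring_scheme \<Rightarrow> 'a set \<Rightarrow> 'a set \<Rightarrow> 'a set" where
  "qproj R I U = (\<Union>a\<in>U. I +>\<^bsub>R\<^esub> a)"

definition level ::
  "('k, 'c) ring_scheme \<Rightarrow> ('a, 'd) ring_scheme \<Rightarrow> ('b, 'e) ring_scheme
     \<Rightarrow> ('k \<Rightarrow> 'a) \<Rightarrow> ('k \<Rightarrow> 'b) \<Rightarrow> nat \<Rightarrow> nat \<Rightarrow> ('a set \<times> 'b set \<Rightarrow> 'k) set ring" where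
  "level K A B phi psi i j =
     tensor_ring K (A Quot ideal_pow A (max_ideal A) i) (B Quot ideal_pow B (max_ideal B) j)
       (\<lambda>c. ideal_pow A (max_ideal A) i +>\<^bsub>A\<^esub> phi c)
       (\<lambda>c. ideal_pow B (max_ideal B) j +>\<^bsub>B\<^esub> psi c)"

definition transition ::
  "('k, 'c) ring_scheme \<Rightarrow> ('a, 'd) ring_scheme \<Rightarrow> ('b, 'e) ring_scheme
     \<Rightarrow> ('k \<Rightarrow> 'a) \<Rightarrow> ('k \<Rightarrow> 'b) \<Rightarrow> nat \<Rightarrow> nat
     \<Rightarrow> ('a set \<times> 'b set \<Rightarrow> 'k) set \<Rightarrow> ('a set \<times> 'b set \<Rightarrow> 'k) set" where
  "transition K A B phi psi i j =
     tensor_map K (A Quot ideal_pow A (max_ideal A) i) (B Quot ideal_pow B (max_ideal B) j)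
       (\<lambda>c. ideal_pow A (max_ideal A) i +>\<^bsub>A\<^esub> phi c)
       (\<lambda>c. ideal_pow B (max_ideal B) j +>\<^bsub>B\<^esub> psi c)
       (qproj A (ideal_pow A (max_ideal A) i)) (qproj B (ideal_pow B (max_ideal B) j))"

text \<open>A \<hat>\<otimes>_k B = lim_{i,j} (A/m^i) \<otimes>_k (B/n^j), as the ring of compatible families
  with componentwise operations.\<close>
definition completed_tensor ::
  "('k, 'c) ring_scheme \<Rightarrow> ('a, 'd) ring_scheme \<Rightarrow> ('b, 'e) ring_scheme
     \<Rightarrow> ('k \<Rightarrow> 'a) \<Rightarrow> ('k \<Rightarrow> 'b) \<Rightarrow> (nat \<Rightarrow> nat \<Rightarrow> ('a set \<times> 'b set \<Rightarrow> 'k) set) ring" where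
  "completed_tensor K A B phi psi =
    \<lparr>carrier = {x. (\<forall>i j. x i j \<in> carrier (level K A B phi psi i j)) \<and>
                  (\<forall>i j i' j'. i \<le> i' \<longrightarrow> j \<le> j' \<longrightarrow>
                      transition K A B phi psi i j (x i' j') = x i j)},
     monoid.mult = (\<lambda>x y i j. x i j \<otimes>\<^bsub>level K A B phi psi i j\<^esub> y i j),
     one = (\<lambda>i j. \<one>\<^bsub>level K A B phi psi i j\<^esub>),
     ring.zero = (\<lambda>i j. \<zero>\<^bsub>level K A B phi psi i j\<^esub>),
     ring.add = (\<lambda>x y i j. x i j \<oplus>\<^bsub>level K A B phi psi i j\<^esub> y i j)\<rparr>"

end

theory Submission
  imports Defs Complex_Main
begin

text \<open>A nonzero element of the completed tensor product has a leading term, and leading terms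
  multiply. By Artin--Rees, the powers \<open>a\<^sup>n\<close> of \<open>a \<noteq> 0\<close> lie in the maximal ideal to an order growing
  at most linearly in \<open>n\<close>. Among the submultiplicative ultrametric norms below the adic one that keep
  this growth bound, a minimal one (Zorn) is multiplicative, so it is a norm \<open>N\<close> with \<open>N a \<noteq> 0\<close> whose
  kernel is a prime ideal. A maximal non-unital subalgebra of the fraction field modulo that prime,
  containing all quotients of norm below 1, is the maximal ideal of a valuation ring with
  residue field \<open>k\<close>, because \<open>k\<close> is algebraically closed. It refines \<open>N\<close> to an order of the
  elements in which each equivalence class is one-dimensional over \<open>k\<close> modulo smaller elements.
  With such orders on \<open>A\<close> and on \<open>B\<close>, two nonzero elements of the completed tensor product have
  leading terms \<open>x \<otimes> y\<close> and \<open>x' \<otimes> y'\<close>, and a pair of functionals that vanish on high powers of the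
  maximal ideals detects \<open>xx' \<otimes> yy'\<close> in the product.\<close>

section \<open>Linear functionals on an algebra over a field\<close>

text \<open>No bases of tensor products are used: a tensor is known by its values under pairs of
  functionals. On the completion only functionals that vanish on powers of the maximal ideals make
  sense. This is why a real-valued norm comes before the finer order: a functional vanishing where
  the norm is small vanishes on a power of the ideal, whereas the valuation behind the order may
  have higher rank and need not be comparable with the adic topology. The main obstacle is that a
  norm may have a nonzero kernel and lose an element altogether. Completeness removes it:
  contracting a nonzero element with a functional on \<open>B\<close> converges to an element of
  \<open>A\<close>, so the contractions of both factors are known before the norm on
  \<open>A\<close> is chosen, and the norm is required to be nonzero at their product. The same is
  then done on \<open>B\<close>. Since all norms are at most 1, a lower bound for a product is one
  for each factor; every threshold comes from this. One-dimensional classes reduce the product of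
  two leading terms to a product of two scalars in the field.\<close>

locale scalars = K: field K + cring R
  for K :: "('k, 'c) ring_scheme" and R :: "('a, 'd) ring_scheme" (structure) +
  fixes h :: "'k \<Rightarrow> 'a"
  assumes h_hom: "h \<in> ring_hom K R"
begin

sublocale h: ring_hom_cring K R h
  by unfold_locales (rule h_hom)

definition subsp :: "'a set \<Rightarrow> bool" where
  "subsp H \<longleftrightarrow> H \<subseteq> carrier R \<and> \<zero> \<in> H \<and> (\<forall>x\<in>H. \<forall>y\<in>H. x \<oplus> y \<in> H)
     \<and> (\<forall>c\<in>carrier K. \<forall>x\<in>H. h c \<otimes> x \<in> H)"

definition linf :: "('a \<Rightarrow> 'k) \<Rightarrow> bool" where
  "linf l \<longleftrightarrow> (\<forall>x\<in>carrier R. l x \<in> carrier K)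
     \<and> (\<forall>x\<in>carrier R. \<forall>y\<in>carrier R. l (x \<oplus> y) = l x \<oplus>\<^bsub>K\<^esub> l y)
     \<and> (\<forall>c\<in>carrier K. \<forall>x\<in>carrier R. l (h c \<otimes> x) = c \<otimes>\<^bsub>K\<^esub> l x)"

lemma subspD:
  assumes "subsp H"
  shows "H \<subseteq> carrier R" "\<zero> \<in> H" "\<And>x y. x \<in> H \<Longrightarrow> y \<in> H \<Longrightarrow> x \<oplus> y \<in> H"
    "\<And>c x. c \<in> carrier K \<Longrightarrow> x \<in> H \<Longrightarrow> h c \<otimes> x \<in> H"
    "\<And>x. x \<in> H \<Longrightarrow> x \<in> carrier R"
  using assms unfolding subsp_def by auto

lemma subsp_neg: assumes "subsp H" "x \<in> H" shows "\<ominus> x \<in> H"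
proof -
  have x: "x \<in> carrier R" using subspD(5)[OF assms] .
  have "h (\<ominus>\<^bsub>K\<^esub> \<one>\<^bsub>K\<^esub>) \<otimes> x \<in> H" by (rule subspD(4)[OF assms(1) _ assms(2)]) simp
  moreover have "h (\<ominus>\<^bsub>K\<^esub> \<one>\<^bsub>K\<^esub>) \<otimes> x = \<ominus> x" using x by (simp add: l_minus)
  ultimately show ?thesis by simp
qed

lemma subsp_diff: "subsp H \<Longrightarrow> x \<in> H \<Longrightarrow> y \<in> H \<Longrightarrow> x \<ominus> y \<in> H"
  unfolding a_minus_def by (intro subspD(3) subsp_neg)

lemma linfD:
  assumes "linf l"
  shows "\<And>x. x \<in> carrier R \<Longrightarrow> l x \<in> carrier K"
    "\<And>x y. x \<in> carrier R \<Longrightarrow> y \<in> carrier R \<Longrightarrow> l (x \<oplus> y) = l x \<oplus>\<^bsub>K\<^esub> l y"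
    "\<And>c x. c \<in> carrier K \<Longrightarrow> x \<in> carrier R \<Longrightarrow> l (h c \<otimes> x) = c \<otimes>\<^bsub>K\<^esub> l x"
  using assms unfolding linf_def by auto

lemma linf_zero: "linf l \<Longrightarrow> l \<zero> = \<zero>\<^bsub>K\<^esub>"
  using linfD(3)[of l "\<zero>\<^bsub>K\<^esub>" \<zero>] linfD(1)[of l \<zero>] by simp

lemma linf_neg: "linf l \<Longrightarrow> x \<in> carrier R \<Longrightarrow> l (\<ominus> x) = \<ominus>\<^bsub>K\<^esub> l x"
  using linfD(3)[of l "\<ominus>\<^bsub>K\<^esub> \<one>\<^bsub>K\<^esub>" x] linfD(1)[of l x]
  by (simp add: l_minus K.l_minus)

lemma linf_diff: "linf l \<Longrightarrow> x \<in> carrier R \<Longrightarrow> y \<in> carrier R \<Longrightarrow> l (x \<ominus> y) = l x \<ominus>\<^bsub>K\<^esub> l y"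
  unfolding a_minus_def by (simp add: linfD linf_neg)

lemma linf_finsum:
  assumes "linf l" "finite P" "f \<in> P \<rightarrow> carrier R"
  shows "l (finsum R f P) = finsum K (\<lambda>p. l (f p)) P"
  using assms(2,3)
proof (induction P rule: finite_induct)
  case empty
  then show ?case using linf_zero[OF assms(1)] by simp
next
  case (insert x F)
  then have "f \<in> F \<rightarrow> carrier R" "f x \<in> carrier R" by auto
  moreover have "(\<lambda>p. l (f p)) \<in> F \<rightarrow> carrier K" "l (f x) \<in> carrier K"
    using insert linfD(1)[OF assms(1)] by auto
  ultimately show ?case
    using insert by (simp add: linfD(2)[OF assms(1)] finsum_closed)
qed

lemma linf_mult:
  assumes "linf l" "z \<in> carrier R" shows "linf (\<lambda>x. l (x \<otimes> z))"
  using assms unfolding linf_def by (simp add: l_distr m_assoc)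

text \<open>A subspace \<open>M\<close> maximal among those containing \<open>H\<close> and avoiding
  \<open>e\<close> is a complement of the line through \<open>e\<close>; the functional is the
  coordinate along \<open>e\<close> modulo \<open>M\<close>. Zorn's lemma stands in for the choice
  of a basis.\<close>

lemma functional_exists:
  assumes H: "subsp H" and e: "e \<in> carrier R" "e \<notin> H"
  shows "\<exists>l. linf l \<and> (\<forall>x\<in>H. l x = \<zero>\<^bsub>K\<^esub>) \<and> l e = \<one>\<^bsub>K\<^esub>"
proof -
  define S where "S = {H'. subsp H' \<and> H \<subseteq> H' \<and> e \<notin> H'}"
  have "\<exists>M\<in>S. \<forall>H'\<in>S. M \<subseteq> H' \<longrightarrow> H' = M"
  proof (rule subset_Zorn_nonempty)
    show "S \<noteq> {}" using assms S_def by auto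
  next
    fix \<C> assume ne: "\<C> \<noteq> {}" and ch: "subset.chain S \<C>"
    have mem: "\<And>Z. Z \<in> \<C> \<Longrightarrow> subsp Z \<and> H \<subseteq> Z \<and> e \<notin> Z" using ch by (auto simp: subset.chain_def S_def)
    have tot: "\<And>U Y. U \<in> \<C> \<Longrightarrow> Y \<in> \<C> \<Longrightarrow> U \<subseteq> Y \<or> Y \<subseteq> U"
      using ch by (auto simp: subset.chain_def S_def)
    have "subsp (\<Union>\<C>)"
      unfolding subsp_def
    proof (intro conjI ballI)
      show "\<Union>\<C> \<subseteq> carrier R" using mem subspD(1) by blast
      show "\<zero> \<in> \<Union>\<C>" using mem subspD(2) ne by blast
      show "x \<oplus> y \<in> \<Union>\<C>" if "x \<in> \<Union>\<C>" "y \<in> \<Union>\<C>" for x y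
      proof -
        from that obtain U Y where "U \<in> \<C>" "x \<in> U" "Y \<in> \<C>" "y \<in> Y" by blast
        with tot obtain Z where "Z \<in> \<C>" "x \<in> Z" "y \<in> Z" by blast
        thus ?thesis using mem subspD(3) by blast
      qed
      show "h c \<otimes> x \<in> \<Union>\<C>" if "c \<in> carrier K" "x \<in> \<Union>\<C>" for c x
        using that mem subspD(4) by blast
    qed
    thus "\<Union>\<C> \<in> S" unfolding S_def using mem ne by blast
  qed
  then obtain M where M: "subsp M" "H \<subseteq> M" "e \<notin> M"
    and mx: "\<And>U. subsp U \<Longrightarrow> H \<subseteq> U \<Longrightarrow> e \<notin> U \<Longrightarrow> M \<subseteq> U \<Longrightarrow> U = M" unfolding S_def by auto
  note Mc = subspD[OF M(1)]
  \<comment> \<open>Adding \<open>x\<close> to \<open>M\<close> must capture \<open>e\<close>, say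
    as m + c x. Here c is nonzero because \<open>e\<close> is not in \<open>M\<close>, so the
    relation can be solved for \<open>x\<close>.\<close>
  have ex: "\<exists>c\<in>carrier K. x \<ominus> h c \<otimes> e \<in> M" if x: "x \<in> carrier R" for x
  proof (cases "x \<in> M")
    case True
    hence "x \<ominus> h \<zero>\<^bsub>K\<^esub> \<otimes> e \<in> M" using e x by (simp add: a_minus_def)
    thus ?thesis by blast
  next
    case False
    let ?M = "{m \<oplus> h c \<otimes> x | m c. m \<in> M \<and> c \<in> carrier K}"
    have sub: "subsp ?M" unfolding subsp_def
    proof (intro conjI ballI)
      show "?M \<subseteq> carrier R" using Mc x by auto
      have "\<zero> = \<zero> \<oplus> h \<zero>\<^bsub>K\<^esub> \<otimes> x" using x by simp
      thus "\<zero> \<in> ?M" using Mc by blast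
    next
      fix u v assume "u \<in> ?M" "v \<in> ?M"
      then obtain m c m' c' where *: "m \<in> M" "c \<in> carrier K" "m' \<in> M" "c' \<in> carrier K"
        "u = m \<oplus> h c \<otimes> x" "v = m' \<oplus> h c' \<otimes> x" by blast
      have "u \<oplus> v = (m \<oplus> m') \<oplus> h (c \<oplus>\<^bsub>K\<^esub> c') \<otimes> x"
        using * x Mc(5) by (simp add: l_distr a_ac)
      thus "u \<oplus> v \<in> ?M" using * Mc(3) by blast
    next
      fix d u assume "d \<in> carrier K" "u \<in> ?M"
      then obtain m c where *: "m \<in> M" "c \<in> carrier K" "u = m \<oplus> h c \<otimes> x" by blast
      have "h d \<otimes> u = h d \<otimes> m \<oplus> h (d \<otimes>\<^bsub>K\<^esub> c) \<otimes> x"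
        using * x Mc(5) \<open>d \<in> carrier K\<close> by (simp add: r_distr m_assoc)
      thus "h d \<otimes> u \<in> ?M" using * Mc(4) \<open>d \<in> carrier K\<close> by blast
    qed
    have MM: "M \<subseteq> ?M"
    proof
      fix m assume "m \<in> M"
      moreover from this have "m = m \<oplus> h \<zero>\<^bsub>K\<^esub> \<otimes> x" using x Mc(5) by simp
      ultimately show "m \<in> ?M" by blast
    qed
    have "x = \<zero> \<oplus> h \<one>\<^bsub>K\<^esub> \<otimes> x" using x by simp
    hence "x \<in> ?M" using Mc(2) by blast
    hence "e \<in> ?M" using mx[OF sub _ _ MM] False MM M(2) by blast
    then obtain m c where mc: "m \<in> M" "c \<in> carrier K" "e = m \<oplus> h c \<otimes> x" by blast
    have "c \<noteq> \<zero>\<^bsub>K\<^esub>" using mc M(3) x Mc(5) by auto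
    then have c': "inv\<^bsub>K\<^esub> c \<in> carrier K" "inv\<^bsub>K\<^esub> c \<otimes>\<^bsub>K\<^esub> c = \<one>\<^bsub>K\<^esub>"
      using mc(2) K.field_Units by auto
    have "h (inv\<^bsub>K\<^esub> c) \<otimes> e = h (inv\<^bsub>K\<^esub> c) \<otimes> m \<oplus> h (inv\<^bsub>K\<^esub> c \<otimes>\<^bsub>K\<^esub> c) \<otimes> x"
      using mc c'(1) x Mc(5) by (simp add: r_distr m_assoc del: h.hom_mult) (simp add: m_assoc)
    hence inveq: "h (inv\<^bsub>K\<^esub> c) \<otimes> e = h (inv\<^bsub>K\<^esub> c) \<otimes> m \<oplus> x" using c' x by simp
    hence "x \<ominus> h (inv\<^bsub>K\<^esub> c) \<otimes> e = \<ominus> (h (inv\<^bsub>K\<^esub> c) \<otimes> m)"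
    proof -
      have "x \<ominus> (k \<oplus> x) = \<ominus> k" if "k \<in> carrier R" for k using that x by algebra
      thus ?thesis using inveq c'(1) mc(1) Mc(5) by simp
    qed
    thus ?thesis using c'(1) Mc(4)[OF c'(1) mc(1)] subsp_neg[OF M(1)] by metis
  qed
  have uniq: "c = c'" if "c \<in> carrier K" "c' \<in> carrier K" "x \<in> carrier R"
    "x \<ominus> h c \<otimes> e \<in> M" "x \<ominus> h c' \<otimes> e \<in> M" for x c c'
  proof (rule ccontr)
    assume ne: "c \<noteq> c'"
    let ?d = "c' \<ominus>\<^bsub>K\<^esub> c"
    have d: "?d \<in> carrier K" "?d \<noteq> \<zero>\<^bsub>K\<^esub>" using that ne by auto
    have "(x \<ominus> h c \<otimes> e) \<ominus> (x \<ominus> h c' \<otimes> e) \<in> M" using subsp_diff[OF M(1)] that by blast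
    moreover have "(x \<ominus> h c \<otimes> e) \<ominus> (x \<ominus> h c' \<otimes> e) = h ?d \<otimes> e"
    proof -
      have "h ?d = h c' \<ominus> h c" using that by (simp add: a_minus_def)
      moreover have "(x \<ominus> p \<otimes> e) \<ominus> (x \<ominus> q \<otimes> e) = (q \<ominus> p) \<otimes> e"
        if "p \<in> carrier R" "q \<in> carrier R" for p q
        using that \<open>x \<in> carrier R\<close> e(1) by algebra
      ultimately show ?thesis using that by simp
    qed
    ultimately have "h ?d \<otimes> e \<in> M" by simp
    hence "h (inv\<^bsub>K\<^esub> ?d) \<otimes> (h ?d \<otimes> e) \<in> M" using Mc(4) d K.field_Units by auto
    moreover have "h (inv\<^bsub>K\<^esub> ?d) \<otimes> (h ?d \<otimes> e) = h (inv\<^bsub>K\<^esub> ?d \<otimes>\<^bsub>K\<^esub> ?d) \<otimes> e"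
    proof -
      have "inv\<^bsub>K\<^esub> ?d \<in> carrier K" using d K.field_Units by simp
      thus ?thesis using d(1) e(1) by (simp add: m_assoc del: K.minus_closed)
    qed
    moreover have "inv\<^bsub>K\<^esub> ?d \<otimes>\<^bsub>K\<^esub> ?d = \<one>\<^bsub>K\<^esub>" using d K.field_Units by simp
    ultimately show False using M(3) e(1) by simp
  qed
  define l where "l x = (THE c. c \<in> carrier K \<and> x \<ominus> h c \<otimes> e \<in> M)" for x
  have l: "l x \<in> carrier K" "x \<ominus> h (l x) \<otimes> e \<in> M" if x: "x \<in> carrier R" for x
  proof -
    have "\<exists>!c. c \<in> carrier K \<and> x \<ominus> h c \<otimes> e \<in> M" using ex[OF x] uniq[OF _ _ x] by blast
    from theI'[OF this] show "l x \<in> carrier K" "x \<ominus> h (l x) \<otimes> e \<in> M" unfolding l_def by auto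
  qed
  have lI: "l x = c" if "x \<in> carrier R" "c \<in> carrier K" "x \<ominus> h c \<otimes> e \<in> M" for x c
    using uniq[OF l(1) that(2) that(1) l(2)] that by blast
  have "linf l" unfolding linf_def
  proof (intro conjI ballI)
    fix x y assume xy: "x \<in> carrier R" "y \<in> carrier R"
    have "(x \<ominus> h (l x) \<otimes> e) \<oplus> (y \<ominus> h (l y) \<otimes> e) \<in> M" using l xy Mc(3) by blast
    moreover have "(x \<ominus> h (l x) \<otimes> e) \<oplus> (y \<ominus> h (l y) \<otimes> e) = (x \<oplus> y) \<ominus> h (l x \<oplus>\<^bsub>K\<^esub> l y) \<otimes> e"
    proof -
      have "(x \<ominus> p \<otimes> e) \<oplus> (y \<ominus> q \<otimes> e) = (x \<oplus> y) \<ominus> (p \<oplus> q) \<otimes> e"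
        if "p \<in> carrier R" "q \<in> carrier R" for p q
        using that xy e(1) by algebra
      thus ?thesis using l(1) xy by simp
    qed
    ultimately show "l (x \<oplus> y) = l x \<oplus>\<^bsub>K\<^esub> l y" using lI xy l(1) by simp
  next
    fix c x assume cx: "c \<in> carrier K" "x \<in> carrier R"
    have "h c \<otimes> (x \<ominus> h (l x) \<otimes> e) \<in> M" using l cx Mc(4) by blast
    moreover have "h c \<otimes> (x \<ominus> h (l x) \<otimes> e) = (h c \<otimes> x) \<ominus> h (c \<otimes>\<^bsub>K\<^esub> l x) \<otimes> e"
    proof -
      have "r \<otimes> (x \<ominus> p \<otimes> e) = (r \<otimes> x) \<ominus> (r \<otimes> p) \<otimes> e"
        if "p \<in> carrier R" "r \<in> carrier R" for p r
        using that cx(2) e(1) by algebra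
      thus ?thesis using l(1) cx by simp
    qed
    ultimately show "l (h c \<otimes> x) = c \<otimes>\<^bsub>K\<^esub> l x" using lI cx l(1) by simp
  qed (use l in auto)
  moreover have "l x = \<zero>\<^bsub>K\<^esub>" if "x \<in> H" for x
  proof (rule lI)
    show "x \<in> carrier R" using that H subspD by blast
    show "x \<ominus> h \<zero>\<^bsub>K\<^esub> \<otimes> e \<in> M"
      using that M(2) e \<open>x \<in> carrier R\<close> by (auto simp: a_minus_def)
  qed simp
  moreover have "l e = \<one>\<^bsub>K\<^esub>"
    by (rule lI) (use e Mc in \<open>auto simp: a_minus_def r_neg\<close>)
  ultimately show ?thesis by blast
qed

end

section \<open>Submultiplicative and multiplicative norms\<close>

text \<open>Infima need not be attained, so submultiplicativity of a norm defined by an infimum is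
  checked for arbitrary \<open>r\<close> and \<open>s\<close> above the two values; letting both
  tend down gives the bound.\<close>

lemma le_mult_of_dense:
  fixes c x y :: real
  assumes "\<And>r s. r > x \<Longrightarrow> s > y \<Longrightarrow> c \<le> r * s"
  shows "c \<le> x * y"
proof -
  have "(\<lambda>n. (x + inverse (real (Suc n))) * (y + inverse (real (Suc n)))) \<longlonglongrightarrow> (x + 0) * (y + 0)"
    by (intro tendsto_intros LIMSEQ_inverse_real_of_nat)
  hence "c \<le> (x + 0) * (y + 0)"
    by (rule LIMSEQ_le_const) (intro exI allI impI assms; simp)
  thus ?thesis by simp
qed

context cring
begin

text \<open>The bound by 1 means that multiplication by a ring element, hence by a scalar, never
  increases \<open>N\<close>. Nonzero kernels are allowed on purpose: the minimal norm constructed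
  below may vanish on a prime ideal.\<close>

definition snorm :: "('a \<Rightarrow> real) \<Rightarrow> bool" where
  "snorm N \<longleftrightarrow> (\<forall>x\<in>carrier R. 0 \<le> N x \<and> N x \<le> 1)
     \<and> (\<forall>x\<in>carrier R. \<forall>y\<in>carrier R. N (x \<otimes> y) \<le> N x * N y)
     \<and> (\<forall>x\<in>carrier R. \<forall>y\<in>carrier R. N (x \<oplus> y) \<le> max (N x) (N y))"

lemma snormD:
  assumes "snorm N"
  shows "\<And>x. x \<in> carrier R \<Longrightarrow> 0 \<le> N x" "\<And>x. x \<in> carrier R \<Longrightarrow> N x \<le> 1"
    "\<And>x y. x \<in> carrier R \<Longrightarrow> y \<in> carrier R \<Longrightarrow> N (x \<otimes> y) \<le> N x * N y"
    "\<And>x y. x \<in> carrier R \<Longrightarrow> y \<in> carrier R \<Longrightarrow> N (x \<oplus> y) \<le> max (N x) (N y)"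
  using assms unfolding snorm_def by auto

lemma snorm_le_left: "snorm N \<Longrightarrow> x \<in> carrier R \<Longrightarrow> y \<in> carrier R \<Longrightarrow> N (x \<otimes> y) \<le> N x"
  using snormD(3)[of N x y] mult_left_le[of "N y" "N x"] snormD(1,2)[of N] by fastforce

lemma snorm_pow: "snorm N \<Longrightarrow> x \<in> carrier R \<Longrightarrow> N (x [^] (n::nat)) \<le> N x ^ n"
proof (induction n)
  case 0
  then show ?case using snormD(2)[of N \<one>] by simp
next
  case (Suc n)
  have "N (x [^] n \<otimes> x) \<le> N (x [^] n) * N x" using Suc snormD(3) by simp
  also have "\<dots> \<le> N x ^ n * N x" using Suc snormD(1) by (intro mult_right_mono) auto
  finally show ?case by (simp add: mult.commute)
qed

text \<open>\<open>spec N\<close> is the power-multiplicative norm \<open>lim N (y\<^sup>n)\<^sup>1\<^sup>/\<^sup>n\<close>, in a form that needs no limit.\<close>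
definition growth :: "('a \<Rightarrow> real) \<Rightarrow> 'a \<Rightarrow> real set" where
  "growth N y = {r. 0 < r \<and> (\<exists>C. \<forall>n. N (y [^] (n::nat)) \<le> C * r ^ n)}"

definition spec :: "('a \<Rightarrow> real) \<Rightarrow> 'a \<Rightarrow> real" where
  "spec N y = Inf (growth N y)"

text \<open>Divide \<open>n\<close> by \<open>m\<close> with remainder: the quotient part decays
  like \<open>r ^ n\<close>, and the remainder, being below \<open>m\<close>, costs at most the
  constant factor \<open>1 / r ^ m\<close>. For r at least 1 the bound of norms by 1 is
  enough.\<close>

lemma growthI:
  assumes N: "snorm N" and y: "y \<in> carrier R" and "m > 0" "0 < r" "N (y [^] (m::nat)) \<le> r ^ m"
  shows "r \<in> growth N y"
proof (cases "r \<ge> 1")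
  case True
  have "N (y [^] n) \<le> 1 * r ^ n" for n :: nat
    using snormD(2)[OF N, of "y [^] n"] y one_le_power[OF True, of n] by simp
  thus ?thesis unfolding growth_def using assms(4) by blast
next
  case False
  have "N (y [^] n) \<le> (1 / r ^ m) * r ^ n" for n :: nat
  proof -
    define q where "q = n div m"
    define l where "l = n mod m"
    have n: "n = m * q + l" "l < m" using \<open>m > 0\<close> by (auto simp: q_def l_def)
    have yn: "y [^] n = (y [^] m) [^] q \<otimes> y [^] l" using y n by (simp add: nat_pow_pow nat_pow_mult)
    have "N (y [^] n) \<le> N ((y [^] m) [^] q)" unfolding yn using y snorm_le_left[OF N] by simp
    also have "\<dots> \<le> N (y [^] m) ^ q" using y snorm_pow[OF N] by simp
    also have "\<dots> \<le> (r ^ m) ^ q" using assms snormD(1)[OF N] by (intro power_mono) auto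
    also have "\<dots> = r ^ (m * q)" by (simp add: power_mult)
    finally have 1: "N (y [^] n) \<le> r ^ (m * q)" .
    have "r ^ m \<le> r ^ l" using n False \<open>0 < r\<close> by (intro power_decreasing) auto
    hence "r ^ (m * q) * r ^ m \<le> r ^ (m * q) * r ^ l" using \<open>0 < r\<close> by (intro mult_left_mono) auto
    hence "r ^ (m * q) \<le> (1 / r ^ m) * r ^ n" using \<open>0 < r\<close> n(1) by (simp add: field_simps power_add)
    with 1 show ?thesis by linarith
  qed
  thus ?thesis unfolding growth_def using assms(4) by blast
qed

lemma growth_one: "snorm N \<Longrightarrow> y \<in> carrier R \<Longrightarrow> 1 \<in> growth N y"
  by (rule growthI[of N y 1]) (auto simp: snormD)

lemma growth_bdd: "bdd_below (growth N y)"
  unfolding growth_def by (rule bdd_belowI[of _ 0]) auto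

lemma spec_le: "r \<in> growth N y \<Longrightarrow> spec N y \<le> r"
  unfolding spec_def by (rule cInf_lower[OF _ growth_bdd])

lemma spec_nonneg: "snorm N \<Longrightarrow> y \<in> carrier R \<Longrightarrow> 0 \<le> spec N y"
  unfolding spec_def using growth_one[of N y]
  by (intro cInf_greatest) (blast, simp add: growth_def)

lemma growth_up:
  assumes N: "snorm N" and y: "y \<in> carrier R" and "r \<in> growth N y" "r \<le> s"
  shows "s \<in> growth N y"
proof -
  from assms obtain C where C: "\<And>n::nat. N (y [^] n) \<le> C * r ^ n" "0 < r" unfolding growth_def by blast
  have "0 \<le> C" using C(1)[of 0] snormD(1)[OF N, of \<one>] by simp
  hence "N (y [^] n) \<le> C * s ^ n" for n :: nat
    using C(1)[of n] C(2) assms(4) mult_left_mono[OF power_mono[of r s n], of C] by linarith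
  thus ?thesis using C(2) assms(4) unfolding growth_def by auto
qed

lemma growth_of_spec:
  assumes N: "snorm N" and y: "y \<in> carrier R" and "spec N y < r"
  shows "r \<in> growth N y"
proof -
  have "\<exists>s\<in>growth N y. s < r"
    using assms(3) growth_one[OF N y] growth_bdd unfolding spec_def
    by (metis cInf_less_iff empty_iff)
  thus ?thesis using growth_up[OF N y] by fastforce
qed

lemma growth_mult:
  assumes N: "snorm N" and xy: "x \<in> carrier R" "y \<in> carrier R" and "r \<in> growth N x" "s \<in> growth N y"
  shows "r * s \<in> growth N (x \<otimes> y)"
proof -
  from assms obtain C D where C: "\<And>n::nat. N (x [^] n) \<le> C * r ^ n" "0 < r"
    and D: "\<And>n::nat. N (y [^] n) \<le> D * s ^ n" "0 < s" unfolding growth_def by blast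
  have "0 \<le> C" using C(1)[of 0] snormD(1)[OF N, of \<one>] by simp
  have "N ((x \<otimes> y) [^] n) \<le> (C * D) * (r * s) ^ n" for n :: nat
  proof -
    have "N ((x \<otimes> y) [^] n) \<le> N (x [^] n) * N (y [^] n)"
      using xy snormD(3)[OF N] by (simp add: nat_pow_distrib)
    also have "\<dots> \<le> (C * r ^ n) * (D * s ^ n)"
      using xy snormD(1)[OF N] C D \<open>0 \<le> C\<close> by (intro mult_mono) auto
    finally show ?thesis by (simp add: power_mult_distrib mult_ac)
  qed
  thus ?thesis using C(2) D(2) unfolding growth_def by auto
qed

lemma growth_add:
  assumes N: "snorm N" and xy: "x \<in> carrier R" "y \<in> carrier R" and "r \<in> growth N x" "r \<in> growth N y"
  shows "r \<in> growth N (x \<oplus> y)"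
proof -
  from assms obtain C D where C: "\<And>n::nat. N (x [^] n) \<le> C * r ^ n" "0 < r"
    and D: "\<And>n::nat. N (y [^] n) \<le> D * r ^ n" unfolding growth_def by blast
  have "0 \<le> C" using C(1)[of 0] snormD(1)[OF N, of \<one>] by simp
  \<comment> \<open>Carrying the prefactor turns one factor x + y into two instances of the
    induction hypothesis. The ultrametric inequality takes a maximum, so no binomial coefficients
    arise.\<close>
  have *: "N (x [^] i \<otimes> y [^] j \<otimes> (x \<oplus> y) [^] n) \<le> C * D * r ^ (i + j + n)" for i j n :: nat
  proof (induction n arbitrary: i j)
    case 0
    have "N (x [^] i \<otimes> y [^] j) \<le> N (x [^] i) * N (y [^] j)"
      using xy snormD(3)[OF N] by simp
    also have "\<dots> \<le> (C * r ^ i) * (D * r ^ j)"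
      using xy snormD(1)[OF N] C D \<open>0 \<le> C\<close> by (intro mult_mono) auto
    finally show ?case using xy by (simp add: power_add mult_ac)
  next
    case (Suc n)
    have eq: "x [^] i \<otimes> y [^] j \<otimes> (x \<oplus> y) [^] Suc n =
      x [^] Suc i \<otimes> y [^] j \<otimes> (x \<oplus> y) [^] n \<oplus> x [^] i \<otimes> y [^] Suc j \<otimes> (x \<oplus> y) [^] n"
      using xy by (simp add: m_ac r_distr l_distr)
    have "N (x [^] i \<otimes> y [^] j \<otimes> (x \<oplus> y) [^] Suc n) \<le>
      max (N (x [^] Suc i \<otimes> y [^] j \<otimes> (x \<oplus> y) [^] n)) (N (x [^] i \<otimes> y [^] Suc j \<otimes> (x \<oplus> y) [^] n))"
      unfolding eq using xy by (intro snormD(4)[OF N]) auto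
    also have "\<dots> \<le> C * D * r ^ (i + j + Suc n)"
      using Suc[of "Suc i" j] Suc[of i "Suc j"] by simp
    finally show ?case .
  qed
  have "N ((x \<oplus> y) [^] n) \<le> C * D * r ^ n" for n :: nat
    using *[of 0 0 n] xy by simp
  thus ?thesis using C(2) unfolding growth_def by auto
qed

lemma snorm_spec:
  assumes N: "snorm N" shows "snorm (spec N)"
  unfolding snorm_def
proof (intro conjI ballI)
  fix x assume x: "x \<in> carrier R"
  show "0 \<le> spec N x" by (rule spec_nonneg[OF N x])
  show "spec N x \<le> 1" by (rule spec_le[OF growth_one[OF N x]])
next
  fix x y assume xy: "x \<in> carrier R" "y \<in> carrier R"
  show "spec N (x \<otimes> y) \<le> spec N x * spec N y"
  proof (rule le_mult_of_dense)
    fix r s assume "spec N x < r" "spec N y < s"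
    thus "spec N (x \<otimes> y) \<le> r * s"
      using spec_le[OF growth_mult[OF N xy]] growth_of_spec[OF N] xy by blast
  qed
  show "spec N (x \<oplus> y) \<le> max (spec N x) (spec N y)"
  proof (rule dense_ge)
    fix r assume "max (spec N x) (spec N y) < r"
    thus "spec N (x \<oplus> y) \<le> r"
      by (intro spec_le growth_add[OF N xy] growth_of_spec[OF N] xy) auto
  qed
qed

text \<open>If the root of the norm of the power were below \<open>spec N y\<close>, any
  \<open>r\<close> strictly between them would be an admissible growth rate by
  \<open>growthI\<close>, against the infimum. For a norm equal to its own \<open>spec\<close>, this
  and \<open>snorm_pow\<close> together give power-multiplicativity.\<close>

lemma spec_le_root:
  assumes N: "snorm N" and y: "y \<in> carrier R"
  shows "spec N y ^ m \<le> N (y [^] (m::nat)) \<or> m = 0"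
proof (rule ccontr)
  assume "\<not> ?thesis"
  hence m: "m > 0" and lt: "N (y [^] m) < spec N y ^ m" by auto
  let ?t = "N (y [^] m)"
  have t0: "0 \<le> ?t" using y snormD(1)[OF N] by simp
  have pos: "spec N y > 0" using lt t0 m spec_nonneg[OF N y]
    by (cases "spec N y = 0") (auto simp: power_0_left)
  have rt: "root m ?t < spec N y"
    using real_root_less_mono[OF m lt] real_root_power_cancel[OF m, of "spec N y"] pos by simp
  define r where "r = (root m ?t + spec N y) / 2"
  have r: "root m ?t < r" "r < spec N y" "0 < r"
    using rt pos real_root_ge_zero[OF t0, of m] unfolding r_def by auto
  have "?t = root m ?t ^ m" using m t0 by simp
  also have "\<dots> \<le> r ^ m" using r real_root_ge_zero[OF t0, of m] by (intro power_mono) auto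
  finally have "r \<in> growth N y" using growthI[OF N y m r(3)] by simp
  thus False using spec_le r(2) by fastforce
qed

text \<open>When \<open>N\<close> is power-multiplicative, \<open>twist N z\<close> is again a norm below \<open>N\<close>, and \<open>z\<close> is multiplicative
  for it; so for a minimal norm it coincides with \<open>N\<close>.\<close>
definition twist :: "('a \<Rightarrow> real) \<Rightarrow> 'a \<Rightarrow> 'a \<Rightarrow> real" where
  "twist N z y = (INF n. N (z [^] (n::nat) \<otimes> y) / N z ^ n)"

context
  fixes N z
  assumes N: "snorm N" and z: "z \<in> carrier R" and pos: "N z > 0"
begin

lemma twist_bdd: "y \<in> carrier R \<Longrightarrow> bdd_below (range (\<lambda>n. N (z [^] (n::nat) \<otimes> y) / N z ^ n))"
  using pos z snormD(1)[OF N] by (intro bdd_belowI[of _ 0]) auto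

lemma twist_le: "y \<in> carrier R \<Longrightarrow> twist N z y \<le> N (z [^] (n::nat) \<otimes> y) / N z ^ n"
  unfolding twist_def by (rule cINF_lower[OF twist_bdd]) auto

lemma twist_nonneg: "y \<in> carrier R \<Longrightarrow> 0 \<le> twist N z y"
  unfolding twist_def using pos z snormD(1)[OF N] by (intro cINF_greatest) auto

text \<open>The infimum in \<open>twist\<close> is thus a limit: a strict upper bound attained at
  one index persists, and bounds for several elements can be read off at a common index.\<close>

lemma twist_decr:
  assumes y: "y \<in> carrier R" and "n \<le> m"
  shows "N (z [^] (m::nat) \<otimes> y) / N z ^ m \<le> N (z [^] n \<otimes> y) / N z ^ n"
proof -
  obtain d where m: "m = d + n" using assms(2) by (metis le_iff_add add.commute)
  have "N (z [^] m \<otimes> y) \<le> N (z [^] d) * N (z [^] n \<otimes> y)"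
    unfolding m using snormD(3)[OF N, of "z [^] d" "z [^] n \<otimes> y"] y z
    by (simp add: nat_pow_mult[symmetric] m_assoc)
  also have "\<dots> \<le> N z ^ d * N (z [^] n \<otimes> y)"
    using y z snorm_pow[OF N z] snormD(1)[OF N] by (intro mult_right_mono) auto
  finally show ?thesis using pos unfolding m by (simp add: field_simps power_add)
qed

lemma twist_less:
  assumes y: "y \<in> carrier R" and "twist N z y < r"
  shows "\<exists>n0. \<forall>n\<ge>n0. N (z [^] (n::nat) \<otimes> y) / N z ^ n < r"
proof -
  have "\<exists>n0::nat. N (z [^] n0 \<otimes> y) / N z ^ n0 < r"
    using assms(2) twist_bdd[OF y] unfolding twist_def by (subst (asm) cINF_less_iff) auto
  thus ?thesis using twist_decr[OF y] by (meson order.strict_trans1)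
qed

lemma snorm_twist: "snorm (twist N z)"
  unfolding snorm_def
proof (intro conjI ballI)
  fix x assume x: "x \<in> carrier R"
  show "0 \<le> twist N z x" by (rule twist_nonneg[OF x])
  show "twist N z x \<le> 1" using twist_le[OF x, of 0] snormD(2)[OF N x] x by simp
next
  fix x y assume xy: "x \<in> carrier R" "y \<in> carrier R"
  show "twist N z (x \<otimes> y) \<le> twist N z x * twist N z y"
  proof (rule le_mult_of_dense)
    fix r s assume r: "twist N z x < r" and s: "twist N z y < s"
    obtain n m :: nat where n: "N (z [^] n \<otimes> x) / N z ^ n < r" and m: "N (z [^] m \<otimes> y) / N z ^ m < s"
      using twist_less[OF xy(1) r] twist_less[OF xy(2) s] by auto
    have eq: "z [^] (n + m) \<otimes> (x \<otimes> y) = (z [^] n \<otimes> x) \<otimes> (z [^] m \<otimes> y)"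
      using xy z by (simp add: nat_pow_mult[symmetric] m_ac)
    have "twist N z (x \<otimes> y) \<le> N ((z [^] n \<otimes> x) \<otimes> (z [^] m \<otimes> y)) / N z ^ (n + m)"
      using twist_le[of "x \<otimes> y" "n + m"] xy unfolding eq by simp
    also have "\<dots> \<le> (N (z [^] n \<otimes> x) * N (z [^] m \<otimes> y)) / N z ^ (n + m)"
      using pos xy z snormD(3)[OF N] by (intro divide_right_mono) auto
    also have "\<dots> = (N (z [^] n \<otimes> x) / N z ^ n) * (N (z [^] m \<otimes> y) / N z ^ m)"
      by (simp add: power_add)
    also have "\<dots> \<le> r * s"
    proof (intro mult_mono)
      show "0 \<le> r" using twist_nonneg[OF xy(1)] r by linarith
    qed (use n m pos xy z snormD(1)[OF N] in auto)
    finally show "twist N z (x \<otimes> y) \<le> r * s" .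
  qed
  show "twist N z (x \<oplus> y) \<le> max (twist N z x) (twist N z y)"
  proof (rule dense_ge)
    fix r assume "max (twist N z x) (twist N z y) < r"
    hence lt: "twist N z x < r" "twist N z y < r" by auto
    obtain n where n: "\<And>k::nat. k \<ge> n \<Longrightarrow> N (z [^] k \<otimes> x) / N z ^ k < r"
      using twist_less[OF xy(1) lt(1)] by blast
    obtain m where m: "\<And>k::nat. k \<ge> m \<Longrightarrow> N (z [^] k \<otimes> y) / N z ^ k < r"
      using twist_less[OF xy(2) lt(2)] by blast
    let ?k = "max n m"
    have "N (z [^] ?k \<otimes> (x \<oplus> y)) \<le> max (N (z [^] ?k \<otimes> x)) (N (z [^] ?k \<otimes> y))"
      using snormD(4)[OF N] xy z by (simp add: r_distr)
    also have "\<dots> \<le> r * N z ^ ?k" using n[of ?k] m[of ?k] pos by (simp add: field_simps)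
    finally have "N (z [^] ?k \<otimes> (x \<oplus> y)) / N z ^ ?k \<le> r" using pos by (simp add: field_simps)
    thus "twist N z (x \<oplus> y) \<le> r" using twist_le[of "x \<oplus> y" ?k] xy by simp
  qed
qed

end

text \<open>The lower bound at the powers of \<open>a\<close> survives infima of chains and keeps a
  minimal norm from vanishing at \<open>a\<close>. It is imposed on all powers, not on
  \<open>a\<close> alone, so that passing from \<open>N\<close> to \<open>spec N\<close> can
  preserve it.\<close>

lemma minimal_norm_exists:
  assumes N0: "snorm N0" and a: "a \<in> carrier R" and low: "\<And>n::nat. d ^ n \<le> N0 (a [^] n)"
  shows "\<exists>N. snorm N \<and> (\<forall>x\<in>carrier R. N x \<le> N0 x) \<and> (\<forall>n::nat. d ^ n \<le> N (a [^] n)) \<and>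
    (\<forall>N'. snorm N' \<longrightarrow> (\<forall>x\<in>carrier R. N' x \<le> N x) \<longrightarrow> (\<forall>n::nat. d ^ n \<le> N' (a [^] n))
      \<longrightarrow> (\<forall>x\<in>carrier R. N' x = N x))"
proof -
  \<comment> \<open>Fixing the value 0 off the carrier keeps chains bounded below at every point, so
    pointwise infima exist, and makes the minimal element comparable as a function.\<close>
  define S where "S = {N. snorm N \<and> (\<forall>x. x \<notin> carrier R \<longrightarrow> N x = 0) \<and> (\<forall>x\<in>carrier R. N x \<le> N0 x)
     \<and> (\<forall>n::nat. d ^ n \<le> N (a [^] n))}"
  define P where "P = (\<lambda>N N' :: 'a \<Rightarrow> real. \<forall>x. N' x \<le> N x)"
  have restrict: "(\<lambda>x. if x \<in> carrier R then N x else 0) \<in> S"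
    if "snorm N" "\<forall>x\<in>carrier R. N x \<le> N0 x" "\<forall>n::nat. d ^ n \<le> N (a [^] n)" for N
    using that a unfolding S_def snorm_def by auto
  have "\<exists>m\<in>S. \<forall>N\<in>S. P m N \<longrightarrow> N = m"
  proof (rule predicate_Zorn)
    show "partial_order_on S (relation_of P S)"
      by (rule partial_order_on_relation_ofI) (auto simp: P_def intro: order.trans antisym)
  next
    fix C assume C: "C \<in> Chains (relation_of P S)"
    show "\<exists>u\<in>S. \<forall>N\<in>C. P N u"
    proof (cases "C = {}")
      case True
      then show ?thesis using restrict[OF N0] low by auto
    next
      case False
      have CS: "\<And>N. N \<in> C \<Longrightarrow> N \<in> S" using C unfolding Chains_def relation_of_def by auto
      have tot: "\<And>N N'. N \<in> C \<Longrightarrow> N' \<in> C \<Longrightarrow> P N N' \<or> P N' N"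
        using C unfolding Chains_def relation_of_def by auto
      have sn: "\<And>N. N \<in> C \<Longrightarrow> snorm N" using CS S_def by auto
      define u where "u x = (INF N\<in>C. N x)" for x
      have nonneg: "0 \<le> N x" if "N \<in> C" for N x
        using CS[OF that] unfolding S_def by (cases "x \<in> carrier R") (auto simp: snormD)
      have bdd: "bdd_below ((\<lambda>N. N x) ` C)" for x
        using nonneg by (intro bdd_belowI[of _ 0]) auto
      have ule: "u x \<le> N x" if "N \<in> C" for N x
        unfolding u_def by (rule cINF_lower[OF bdd that])
      have uge: "c \<le> u x" if "\<And>N. N \<in> C \<Longrightarrow> c \<le> N x" for c x
        unfolding u_def by (rule cINF_greatest[OF False that])
      have uless: "\<exists>N\<in>C. N x < r" if "u x < r" for x r
        using that unfolding u_def cINF_less_iff[OF False bdd] .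
      \<comment> \<open>The chain is totally ordered, so the smaller of two witnesses satisfies both
        strict bounds at once.\<close>
      have both: "\<exists>N\<in>C. N x < r \<and> N y < s" if lt: "u x < r" "u y < s" for x y r s
      proof -
        obtain N N' where *: "N \<in> C" "N x < r" "N' \<in> C" "N' y < s"
          using uless[OF lt(1)] uless[OF lt(2)] by blast
        show ?thesis
        proof (cases "P N N'")
          case True
          hence "N' x < r" using *(2) unfolding P_def by (meson le_less_trans)
          thus ?thesis using * by blast
        next
          case False
          hence "N y < s" using tot[OF *(1,3)] *(4) unfolding P_def by (meson le_less_trans)
          thus ?thesis using * by blast
        qed
      qed
      have "snorm u" unfolding snorm_def
      proof (intro conjI ballI)
        fix x assume x: "x \<in> carrier R"
        show "0 \<le> u x" using uge nonneg by blast
        show "u x \<le> 1" using ule False sn snormD(2) x by (meson ex_in_conv order.trans)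
      next
        fix x y assume xy: "x \<in> carrier R" "y \<in> carrier R"
        show "u (x \<otimes> y) \<le> u x * u y"
        proof (rule le_mult_of_dense)
          fix r s assume "u x < r" "u y < s"
          then obtain N where N: "N \<in> C" "N x < r" "N y < s" using both by blast
          have "u (x \<otimes> y) \<le> N x * N y" using ule[OF N(1)] snormD(3)[OF sn[OF N(1)] xy] by (meson order.trans)
          also have "\<dots> \<le> r * s" using N nonneg[OF N(1), of x] nonneg[OF N(1), of y] by (intro mult_mono) linarith+
          finally show "u (x \<otimes> y) \<le> r * s" .
        qed
        show "u (x \<oplus> y) \<le> max (u x) (u y)"
        proof (rule dense_ge)
          fix r assume "max (u x) (u y) < r"
          then obtain N where N: "N \<in> C" "N x < r" "N y < r" using both[of x r y r] by auto
          thus "u (x \<oplus> y) \<le> r" using ule[OF N(1), of "x \<oplus> y"] snormD(4)[OF sn[OF N(1)] xy] by linarith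
        qed
      qed
      moreover have "u x = 0" if "x \<notin> carrier R" for x
      proof -
        have "\<And>N. N \<in> C \<Longrightarrow> N x = 0" using CS that unfolding S_def by auto
        hence "(\<lambda>N. N x) ` C = (\<lambda>_. 0) ` C" by (intro image_cong) auto
        thus ?thesis unfolding u_def using False by simp
      qed
      moreover have "u x \<le> N0 x" if "x \<in> carrier R" for x
      proof -
        obtain N where "N \<in> C" using False by blast
        thus ?thesis using CS[of N] ule[of N x] that unfolding S_def by fastforce
      qed
      moreover have "d ^ n \<le> u (a [^] n)" for n :: nat
        using CS unfolding S_def by (intro uge) auto
      ultimately have "u \<in> S" unfolding S_def by auto
      thus ?thesis using ule unfolding P_def by blast
    qed
  qed
  then obtain N where N: "N \<in> S" and mn: "\<And>N'. N' \<in> S \<Longrightarrow> P N N' \<Longrightarrow> N' = N" by blast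
  have "N' x = N x" if "snorm N'" "\<forall>x\<in>carrier R. N' x \<le> N x" "\<forall>n::nat. d ^ n \<le> N' (a [^] n)"
    "x \<in> carrier R" for N' x
  proof -
    let ?N = "\<lambda>x. if x \<in> carrier R then N' x else 0"
    have "\<forall>x\<in>carrier R. N' x \<le> N0 x" using that(2) N unfolding S_def by (auto intro: order.trans)
    hence "?N \<in> S" using restrict that by blast
    moreover have "P N ?N" using that(2) N unfolding P_def S_def by auto
    ultimately have "?N = N" by (rule mn)
    from fun_cong[OF this, of x] show ?thesis using that(4) by simp
  qed
  thus ?thesis using N unfolding S_def by (intro exI[of _ N]) blast
qed

text \<open>Each of \<open>spec N\<close>, \<open>twist N a\<close> and \<open>twist N z\<close> is
  a norm below \<open>N\<close> that keeps the growth bound at \<open>a\<close>, so minimality makes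
  it equal to \<open>N\<close>. The order matters: power-multiplicativity is needed to evaluate
  \<open>twist N a\<close> at powers of \<open>a\<close>, and multiplicativity at \<open>a\<close>
  to evaluate \<open>twist N z\<close> there.\<close>

theorem multiplicative_norm_exists:
  assumes N0: "snorm N0" and a: "a \<in> carrier R" and d: "0 < d"
    and low: "\<And>n::nat. d ^ n \<le> N0 (a [^] n)"
  shows "\<exists>N. snorm N \<and> (\<forall>x\<in>carrier R. N x \<le> N0 x) \<and> 0 < N a \<and> N \<one> = 1 \<and>
    (\<forall>x\<in>carrier R. \<forall>y\<in>carrier R. N (x \<otimes> y) = N x * N y)"
proof -
  obtain N where NN: "snorm N \<and> (\<forall>x\<in>carrier R. N x \<le> N0 x) \<and> (\<forall>n::nat. d ^ n \<le> N (a [^] n)) \<and>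
    (\<forall>N'. snorm N' \<longrightarrow> (\<forall>x\<in>carrier R. N' x \<le> N x) \<longrightarrow> (\<forall>n::nat. d ^ n \<le> N' (a [^] n))
      \<longrightarrow> (\<forall>x\<in>carrier R. N' x = N x))"
    using minimal_norm_exists[OF N0 a low] by (elim exE)
  have N: "snorm N" and NN0: "\<And>x. x \<in> carrier R \<Longrightarrow> N x \<le> N0 x"
    and Na: "\<And>n::nat. d ^ n \<le> N (a [^] n)"
    and mn: "\<And>N' x. snorm N' \<Longrightarrow> (\<And>x. x \<in> carrier R \<Longrightarrow> N' x \<le> N x) \<Longrightarrow> (\<And>n::nat. d ^ n \<le> N' (a [^] n))
      \<Longrightarrow> x \<in> carrier R \<Longrightarrow> N' x = N x"
    using NN by auto
  have one: "N \<one> = 1" using Na[of 0] snormD(2)[OF N, of \<one>] by simp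
  have spec_le_N: "spec N x \<le> N x" if x: "x \<in> carrier R" for x
  proof (rule dense_ge)
    fix r assume r: "N x < r"
    hence "0 < r" using snormD(1)[OF N x] by linarith
    thus "spec N x \<le> r" using r x by (intro spec_le growthI[OF N x, of 1]) auto
  qed
  have "spec N x = N x" if "x \<in> carrier R" for x
  proof (rule mn[OF snorm_spec[OF N] spec_le_N _ that])
    fix n :: nat
    have "d ^ n \<le> r" if "r \<in> growth N (a [^] n)" for r
    proof (rule ccontr)
      assume "\<not> d ^ n \<le> r"
      hence lt: "r < d ^ n" by simp
      from that obtain C where C: "\<And>m::nat. N ((a [^] n) [^] m) \<le> C * r ^ m" "0 < r"
        unfolding growth_def by blast
      \<comment> \<open>The bound at the power \<open>n * m\<close> of \<open>a\<close> makes the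
        powers of \<open>d ^ n / r\<close> bounded, which is impossible when this ratio exceeds
        1.\<close>
      have "(d ^ n / r) ^ m \<le> C" for m
      proof -
        have "(d ^ n) ^ m \<le> C * r ^ m" using Na[of "n * m"] C(1)[of m] a
          by (simp add: nat_pow_pow power_mult)
        thus ?thesis using C(2) by (simp add: power_divide field_simps)
      qed
      moreover have "1 < d ^ n / r" using lt C(2) by simp
      then obtain m where "C < (d ^ n / r) ^ m" using real_arch_pow by blast
      ultimately show False by (meson not_le)
    qed
    thus "d ^ n \<le> spec N (a [^] n)" unfolding spec_def
      using growth_one[OF N, of "a [^] n"] a by (intro cInf_greatest) auto
  qed
  hence pm: "N (y [^] n) = N y ^ n" if "y \<in> carrier R" for y and n :: nat
    using spec_le_root[OF N that, of n] snorm_pow[OF N that, of n] that one by (cases "n = 0") auto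
  have twist_le_N: "twist N z x \<le> N x" if "z \<in> carrier R" "N z > 0" "x \<in> carrier R" for z x
    using twist_le[OF N that, of 0] that by simp
  have Na_pos: "N a > 0" using Na[of 1] d a by simp
  have "twist N a x = N x" if "x \<in> carrier R" for x
  proof (rule mn[OF snorm_twist[OF N a Na_pos] twist_le_N[OF a Na_pos] _ that])
    fix n :: nat
    have "N (a [^] m \<otimes> a [^] n) / N a ^ m = N a ^ n" for m :: nat
      using pm[OF a, of "m + n"] a Na_pos by (simp add: nat_pow_mult power_add)
    hence "twist N a (a [^] n) = N (a [^] n)" unfolding twist_def using pm[OF a] by simp
    thus "d ^ n \<le> twist N a (a [^] n)" using Na by simp
  qed
  have mult_pow: "N (a [^] n \<otimes> y) = N a ^ n * N y" if y: "y \<in> carrier R" for n :: nat and y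
  proof -
    have "N y \<le> N (a [^] n \<otimes> y) / N a ^ n"
      using twist_le[OF N a Na_pos y, of n] \<open>\<And>x. x \<in> carrier R \<Longrightarrow> twist N a x = N x\<close>[OF y] by simp
    moreover have "N (a [^] n \<otimes> y) \<le> N a ^ n * N y"
      using snormD(3)[OF N, of "a [^] n" y] pm[OF a] a y by simp
    ultimately show ?thesis using Na_pos by (simp add: field_simps)
  qed
  have tw: "twist N z x = N x" if z: "z \<in> carrier R" "N z > 0" and x: "x \<in> carrier R" for z x
  proof (rule mn[OF snorm_twist[OF N z] twist_le_N[OF z] _ x])
    fix n :: nat
    have "N (z [^] m \<otimes> a [^] n) / N z ^ m = N a ^ n" for m :: nat
      using mult_pow[of "z [^] m" n] pm[OF z(1), of m] z a by (simp add: m_comm)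
    hence "twist N z (a [^] n) = N (a [^] n)" unfolding twist_def using pm[OF a] by simp
    thus "d ^ n \<le> twist N z (a [^] n)" using Na by simp
  qed
  have "N (x \<otimes> y) = N x * N y" if xy: "x \<in> carrier R" "y \<in> carrier R" for x y
  proof (cases "N x > 0")
    case True
    have "N y \<le> N (x \<otimes> y) / N x"
      using twist_le[OF N xy(1) True xy(2), of 1] tw[OF xy(1) True xy(2)] xy by simp
    thus ?thesis using snormD(3)[OF N xy] True by (simp add: field_simps)
  next
    case False
    hence "N x = 0" using snormD(1)[OF N xy(1)] by simp
    thus ?thesis using snormD(3)[OF N xy] snormD(1)[OF N, of "x \<otimes> y"] xy by simp
  qed
  thus ?thesis using N NN0 Na_pos one by blast
qed

end

section \<open>Noetherian subrings and Hilbert's basis theorem\<close>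

context cring
begin

definition sideal :: "'a set \<Rightarrow> 'a set \<Rightarrow> bool" where
  "sideal S J \<longleftrightarrow> J \<subseteq> S \<and> \<zero> \<in> J \<and> (\<forall>x\<in>J. \<forall>y\<in>J. x \<oplus> y \<in> J) \<and> (\<forall>s\<in>S. \<forall>x\<in>J. s \<otimes> x \<in> J)"

text \<open>Generation is phrased by a universal property, every \<open>sideal\<close> containing
  \<open>Y\<close> contains \<open>J\<close>, which avoids forming linear combinations over a
  subring.\<close>

definition noeth_subring :: "'a set \<Rightarrow> bool" where
  "noeth_subring S \<longleftrightarrow> subring S R \<and>
     (\<forall>J. sideal S J \<longrightarrow> (\<exists>Y. finite Y \<and> Y \<subseteq> J \<and> (\<forall>J'. sideal S J' \<longrightarrow> Y \<subseteq> J' \<longrightarrow> J \<subseteq> J')))"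

lemma sidealD:
  assumes "sideal S J"
  shows "\<And>x. x \<in> J \<Longrightarrow> x \<in> S" "\<zero> \<in> J" "\<And>x y. x \<in> J \<Longrightarrow> y \<in> J \<Longrightarrow> x \<oplus> y \<in> J"
    "\<And>s x. s \<in> S \<Longrightarrow> x \<in> J \<Longrightarrow> s \<otimes> x \<in> J"
  using assms unfolding sideal_def by auto

lemma sideal_neg:
  assumes S: "subring S R" and J: "sideal S J" and x: "x \<in> J"
  shows "\<ominus> x \<in> J"
proof -
  have "x \<in> carrier R" using sidealD(1)[OF J x] subringE(1)[OF S] by auto
  hence "\<ominus> x = (\<ominus> \<one>) \<otimes> x" by (simp add: l_minus)
  thus ?thesis using sidealD(4)[OF J _ x] subringE(3,5)[OF S] by metis
qed

lemma sideal_Int: "sideal S J \<Longrightarrow> sideal S J' \<Longrightarrow> sideal S (J \<inter> J')"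
  unfolding sideal_def by blast

text \<open>The values at \<open>t\<close> of polynomials of degree below \<open>n\<close> with
  coefficients in \<open>S\<close>. The first facts assume only an additive structure on
  \<open>S\<close>, since the construction serves both a subring here and a non-unital algebra in
  the section on places.\<close>

fun low :: "'a set \<Rightarrow> 'a \<Rightarrow> nat \<Rightarrow> 'a set" where
  "low S t 0 = {\<zero>}"
| "low S t (Suc n) = {s \<otimes> t [^] n \<oplus> y | s y. s \<in> S \<and> y \<in> low S t n}"

definition adjoin :: "'a set \<Rightarrow> 'a \<Rightarrow> 'a set" where
  "adjoin S t = (\<Union>n. low S t n)"

context
  fixes S t
  assumes S_carrier: "S \<subseteq> carrier R" and S_zero: "\<zero> \<in> S"
    and S_add: "\<forall>x\<in>S. \<forall>y\<in>S. x \<oplus> y \<in> S"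
    and t: "t \<in> carrier R"
begin

lemma low_closed: "y \<in> low S t n \<Longrightarrow> y \<in> carrier R"
  by (induction n arbitrary: y) (use S_carrier t in auto)

lemma low_contains_zero: "\<zero> \<in> low S t n"
proof (induction n)
  case (Suc n)
  have "\<zero> = \<zero> \<otimes> t [^] n \<oplus> \<zero>" using t by simp
  thus ?case using Suc S_zero by auto
qed simp

lemma low_le: "n \<le> m \<Longrightarrow> y \<in> low S t n \<Longrightarrow> y \<in> low S t m"
proof (induction rule: dec_induct)
  case (step m)
  hence "y = \<zero> \<otimes> t [^] m \<oplus> y" using low_closed[of y m] t by simp
  thus ?case using step S_zero by auto
qed

lemma low_sum: "x \<in> low S t n \<Longrightarrow> y \<in> low S t n \<Longrightarrow> x \<oplus> y \<in> low S t n"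
proof (induction n arbitrary: x y)
  case (Suc n)
  then obtain r u s v where *: "r \<in> S" "u \<in> low S t n" "s \<in> S" "v \<in> low S t n"
    "x = r \<otimes> t [^] n \<oplus> u" "y = s \<otimes> t [^] n \<oplus> v" by auto
  have "r \<in> carrier R" "s \<in> carrier R" "u \<in> carrier R" "v \<in> carrier R" "t [^] n \<in> carrier R"
    using * S_carrier low_closed t by auto
  hence "x \<oplus> y = (r \<oplus> s) \<otimes> t [^] n \<oplus> (u \<oplus> v)" unfolding *(5,6) by algebra
  thus ?case using Suc.IH[OF *(2,4)] S_add *(1,3) by auto
qed simp

lemma low_scale:
  assumes r: "r \<in> carrier R" "\<And>s. s \<in> S \<Longrightarrow> r \<otimes> s \<in> S"
  shows "y \<in> low S t n \<Longrightarrow> r \<otimes> y \<in> low S t n"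
proof (induction n arbitrary: y)
  case 0 thus ?case using r by simp
next
  case (Suc n)
  then obtain s v where *: "s \<in> S" "v \<in> low S t n" "y = s \<otimes> t [^] n \<oplus> v" by auto
  have "s \<in> carrier R" "v \<in> carrier R" "t [^] n \<in> carrier R"
    using * S_carrier low_closed t by auto
  hence "r \<otimes> y = (r \<otimes> s) \<otimes> t [^] n \<oplus> r \<otimes> v" unfolding *(3) using r(1) by algebra
  thus ?case using Suc.IH[OF *(2)] r(2)[OF *(1)] by auto
qed

lemma low_shift: "y \<in> low S t n \<Longrightarrow> t \<otimes> y \<in> low S t (Suc n)"
proof (induction n arbitrary: y)
  case 0
  have "t \<otimes> \<zero> = \<zero>" using t by simp
  thus ?case using 0 low_contains_zero[of 1] by simp
next
  case (Suc n)
  then obtain s v where *: "s \<in> S" "v \<in> low S t n" "y = s \<otimes> t [^] n \<oplus> v" by auto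
  have "s \<in> carrier R" "v \<in> carrier R" "t [^] n \<in> carrier R"
    using * S_carrier low_closed t by auto
  hence "t \<otimes> y = s \<otimes> t [^] Suc n \<oplus> t \<otimes> v" unfolding *(3) nat_pow_Suc using t by algebra
  thus ?case using Suc.IH[OF *(2)] * by (subst low.simps) blast
qed

lemma low_monomial: "s \<in> S \<Longrightarrow> s \<otimes> t [^] n \<in> low S t (Suc n)"
proof -
  assume s: "s \<in> S"
  hence "s \<otimes> t [^] n = s \<otimes> t [^] n \<oplus> \<zero>" using S_carrier t by auto
  thus ?thesis using s low_contains_zero[of n] by (subst low.simps) blast
qed

lemma low_const: "s \<in> S \<Longrightarrow> s \<in> low S t (Suc n)"
proof -
  assume s: "s \<in> S"
  hence "s \<otimes> t [^] (0::nat) = s" using S_carrier by auto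
  hence "s \<in> low S t (Suc 0)" using low_monomial[OF s, of 0] by simp
  thus ?thesis by (rule low_le[rotated]) simp
qed

end

context
  fixes S t
  assumes S: "subring S R" and t: "t \<in> carrier R"
begin

lemma S_carr: "s \<in> S \<Longrightarrow> s \<in> carrier R" using subringE(1)[OF S] by auto

lemma subring_add_closed: "\<forall>x\<in>S. \<forall>y\<in>S. x \<oplus> y \<in> S" using subringE(7)[OF S] by blast

lemmas subring_low = subringE(1,2)[OF S] subring_add_closed t
lemmas low_carr = low_closed[OF subring_low]
lemmas zero_low = low_contains_zero[OF subring_low]
lemmas low_mono = low_le[OF subring_low]
lemmas low_add = low_sum[OF subring_low]
lemmas low_tmult = low_shift[OF subring_low]

lemma low_smult: "r \<in> S \<Longrightarrow> y \<in> low S t n \<Longrightarrow> r \<otimes> y \<in> low S t n"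
  using low_scale[OF subring_low S_carr] subringE(6)[OF S] by blast

lemma adjoinI: "y \<in> low S t n \<Longrightarrow> y \<in> adjoin S t" unfolding adjoin_def by blast

lemma adjoin_carr: "y \<in> adjoin S t \<Longrightarrow> y \<in> carrier R" unfolding adjoin_def using low_carr by blast

lemma S_adjoin: "s \<in> S \<Longrightarrow> s \<in> adjoin S t"
  using adjoinI low_const[OF subring_low] by blast

lemma adjoin_add: "x \<in> adjoin S t \<Longrightarrow> y \<in> adjoin S t \<Longrightarrow> x \<oplus> y \<in> adjoin S t"
proof -
  assume "x \<in> adjoin S t" "y \<in> adjoin S t"
  then obtain n m where "x \<in> low S t n" "y \<in> low S t m" unfolding adjoin_def by blast
  hence "x \<in> low S t (max n m)" "y \<in> low S t (max n m)"
    using low_mono[of n "max n m"] low_mono[of m "max n m"] by auto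
  thus ?thesis using low_add adjoinI by blast
qed

lemma adjoin_smult: "s \<in> S \<Longrightarrow> y \<in> adjoin S t \<Longrightarrow> s \<otimes> y \<in> adjoin S t"
  unfolding adjoin_def using low_smult by blast

lemma adjoin_tmult: "y \<in> adjoin S t \<Longrightarrow> t \<otimes> y \<in> adjoin S t"
  unfolding adjoin_def using low_tmult by blast

lemma adjoin_tpow: "y \<in> adjoin S t \<Longrightarrow> t [^] (n::nat) \<otimes> y \<in> adjoin S t"
proof (induction n)
  case 0 thus ?case using adjoin_carr by simp
next
  case (Suc n)
  have "t [^] Suc n \<otimes> y = t \<otimes> (t [^] n \<otimes> y)" using t adjoin_carr[OF Suc.prems] by (simp add: m_ac)
  thus ?case using Suc adjoin_tmult by simp
qed

lemma adjoin_mult: "x \<in> adjoin S t \<Longrightarrow> y \<in> adjoin S t \<Longrightarrow> x \<otimes> y \<in> adjoin S t"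
proof -
  assume x: "x \<in> adjoin S t" and y: "y \<in> adjoin S t"
  have "x \<otimes> y \<in> adjoin S t" if "x \<in> low S t n" for n x
    using that
  proof (induction n arbitrary: x)
    case 0 thus ?case using adjoin_carr[OF y] zero_low[of 0] adjoinI by fastforce
  next
    case (Suc n)
    then obtain s v where *: "s \<in> S" "v \<in> low S t n" "x = s \<otimes> t [^] n \<oplus> v" by auto
    have "s \<in> carrier R" "v \<in> carrier R" "t [^] n \<in> carrier R" "y \<in> carrier R"
      using * S_carr low_carr t adjoin_carr[OF y] by auto
    hence "x \<otimes> y = s \<otimes> (t [^] n \<otimes> y) \<oplus> v \<otimes> y" unfolding *(3) by algebra
    thus ?case using adjoin_add[OF adjoin_smult[OF *(1) adjoin_tpow[OF y]] Suc.IH[OF *(2)]] by simp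
  qed
  thus ?thesis using x unfolding adjoin_def by blast
qed

lemma t_adjoin: "t \<in> adjoin S t"
  using adjoin_tmult[OF S_adjoin[OF subringE(3)[OF S]]] t by simp

lemma adjoin_subring: "subring (adjoin S t) R"
proof (rule subringI)
  show "adjoin S t \<subseteq> carrier R" using adjoin_carr by blast
  show "\<one> \<in> adjoin S t" using S_adjoin subringE(3)[OF S] by blast
  fix x assume x: "x \<in> adjoin S t"
  have "\<ominus> \<one> \<in> S" using subringE(3,5)[OF S] by blast
  hence "(\<ominus> \<one>) \<otimes> x \<in> adjoin S t" using adjoin_smult x by blast
  thus "\<ominus> x \<in> adjoin S t" using adjoin_carr[OF x] by (simp add: l_minus)
qed (use adjoin_add adjoin_mult in auto)

lemma adjoin_minimal:
  assumes U: "subring U R" and "S \<subseteq> U" "t \<in> U" shows "adjoin S t \<subseteq> U"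
proof -
  have tn: "t [^] (n::nat) \<in> U" for n
    by (induction n) (use subringE(3,6)[OF U] assms in auto)
  have "y \<in> U" if "y \<in> low S t n" for y n
    using that
    by (induction n arbitrary: y) (use subringE(2,6,7)[OF U] assms tn in \<open>auto simp: subset_eq\<close>)
  thus ?thesis unfolding adjoin_def by blast
qed

text \<open>\<open>t\<close> may be algebraic over \<open>S\<close>, so an element can have several
  expressions; a coefficient counts as leading if it heads any one of them.\<close>

definition lead :: "'a set \<Rightarrow> nat \<Rightarrow> 'a set" where
  "lead J n = {s \<in> S. \<exists>y\<in>low S t n. s \<otimes> t [^] n \<oplus> y \<in> J}"

lemma lead_sideal:
  assumes J: "sideal (adjoin S t) J" shows "sideal S (lead J n)"
  unfolding sideal_def
proof (intro conjI ballI)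
  show "lead J n \<subseteq> S" unfolding lead_def by auto
  have "\<zero> \<otimes> t [^] n \<oplus> \<zero> \<in> J" using sidealD(2)[OF J] t by simp
  thus "\<zero> \<in> lead J n" unfolding lead_def using zero_low subringE(2)[OF S] by blast
next
  fix r s assume "r \<in> lead J n" "s \<in> lead J n"
  then obtain u v where *: "r \<in> S" "s \<in> S" "u \<in> low S t n" "v \<in> low S t n"
    "r \<otimes> t [^] n \<oplus> u \<in> J" "s \<otimes> t [^] n \<oplus> v \<in> J" unfolding lead_def by blast
  have "r \<in> carrier R" "s \<in> carrier R" "u \<in> carrier R" "v \<in> carrier R" "t [^] n \<in> carrier R"
    using * S_carr low_carr t by auto
  hence "(r \<otimes> t [^] n \<oplus> u) \<oplus> (s \<otimes> t [^] n \<oplus> v) = (r \<oplus> s) \<otimes> t [^] n \<oplus> (u \<oplus> v)" by algebra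
  thus "r \<oplus> s \<in> lead J n" unfolding lead_def
    using sidealD(3)[OF J *(5,6)] low_add[OF *(3,4)] subringE(7)[OF S *(1,2)] by auto
next
  fix r s assume r: "r \<in> S" and "s \<in> lead J n"
  then obtain v where *: "s \<in> S" "v \<in> low S t n" "s \<otimes> t [^] n \<oplus> v \<in> J" unfolding lead_def by blast
  have "r \<in> carrier R" "s \<in> carrier R" "v \<in> carrier R" "t [^] n \<in> carrier R"
    using * r S_carr low_carr t by auto
  hence "r \<otimes> (s \<otimes> t [^] n \<oplus> v) = (r \<otimes> s) \<otimes> t [^] n \<oplus> r \<otimes> v" by algebra
  thus "r \<otimes> s \<in> lead J n" unfolding lead_def
    using sidealD(4)[OF J S_adjoin[OF r] *(3)] low_smult[OF r *(2)] subringE(6)[OF S r *(1)] by auto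
qed

lemma lead_mono:
  assumes J: "sideal (adjoin S t) J" and "n \<le> m" "s \<in> lead J n" shows "s \<in> lead J m"
  using assms(2)
proof (induction rule: dec_induct)
  case base show ?case by (rule assms)
next
  case (step k)
  then obtain v where *: "s \<in> S" "v \<in> low S t k" "s \<otimes> t [^] k \<oplus> v \<in> J" unfolding lead_def by blast
  have "s \<in> carrier R" "v \<in> carrier R" "t [^] k \<in> carrier R"
    using * S_carr low_carr t by auto
  hence "t \<otimes> (s \<otimes> t [^] k \<oplus> v) = s \<otimes> t [^] Suc k \<oplus> t \<otimes> v" unfolding nat_pow_Suc using t by algebra
  thus ?case unfolding lead_def
    using sidealD(4)[OF J t_adjoin *(3)] low_tmult[OF *(2)] *(1) by auto
qed

text \<open>The ideals of leading coefficients increase with the degree, and finite generation of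
  their union makes them constant from some \<open>n0\<close> on. Generators for the degrees up to
  \<open>n0\<close>, lifted to \<open>J\<close>, generate \<open>J\<close>: an element is reduced by
  subtracting one with the same leading coefficient.\<close>

lemma hilbert_basis:
  assumes "noeth_subring S" shows "noeth_subring (adjoin S t)"
  unfolding noeth_subring_def
proof (intro conjI allI impI adjoin_subring)
  have fg: "\<And>J. sideal S J \<Longrightarrow> \<exists>Y. finite Y \<and> Y \<subseteq> J \<and> (\<forall>J'. sideal S J' \<longrightarrow> Y \<subseteq> J' \<longrightarrow> J \<subseteq> J')"
    using assms unfolding noeth_subring_def by blast
  fix J assume J: "sideal (adjoin S t) J"
  have sU: "sideal S (\<Union>n. lead J n)" unfolding sideal_def
  proof (intro conjI ballI)
    show "(\<Union>n. lead J n) \<subseteq> S" unfolding lead_def by blast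
    show "\<zero> \<in> (\<Union>n. lead J n)" using sidealD(2)[OF lead_sideal[OF J]] by blast
    fix x y assume "x \<in> (\<Union>n. lead J n)" "y \<in> (\<Union>n. lead J n)"
    then obtain n m where "x \<in> lead J n" "y \<in> lead J m" by blast
    hence "x \<in> lead J (max n m)" "y \<in> lead J (max n m)"
      using lead_mono[OF J, of n "max n m"] lead_mono[OF J, of m "max n m"] by auto
    thus "x \<oplus> y \<in> (\<Union>n. lead J n)" using sidealD(3)[OF lead_sideal[OF J]] by blast
  next
    fix s x assume "s \<in> S" "x \<in> (\<Union>n. lead J n)"
    thus "s \<otimes> x \<in> (\<Union>n. lead J n)" using sidealD(4)[OF lead_sideal[OF J]] by blast
  qed
  then obtain Y where Y: "finite Y" "Y \<subseteq> (\<Union>n. lead J n)"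
    "\<And>J'. sideal S J' \<Longrightarrow> Y \<subseteq> J' \<Longrightarrow> (\<Union>n. lead J n) \<subseteq> J'" using fg[OF sU] by blast
  have "\<exists>n. Y \<subseteq> lead J n" using Y(1,2)
  proof (induction Y rule: finite_induct)
    case (insert y F)
    then obtain n m where nm: "F \<subseteq> lead J n" "y \<in> lead J m" by blast
    have "F \<subseteq> lead J (max n m)" using nm(1) lead_mono[OF J, of n "max n m"] by auto
    moreover have "y \<in> lead J (max n m)" using nm(2) lead_mono[OF J, of m "max n m"] by auto
    ultimately show ?case by blast
  qed simp
  then obtain n0 where "Y \<subseteq> lead J n0" by blast
  hence n0: "lead J n \<subseteq> lead J n0" for n using Y(3)[OF lead_sideal[OF J]] by blast
  have "\<forall>n. \<exists>Z. finite Z \<and> Z \<subseteq> lead J n \<and> (\<forall>J'. sideal S J' \<longrightarrow> Z \<subseteq> J' \<longrightarrow> lead J n \<subseteq> J')"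
    using fg[OF lead_sideal[OF J]] by blast
  then obtain Z where Z: "\<And>n. finite (Z n)" "\<And>n. Z n \<subseteq> lead J n"
    "\<And>n J'. sideal S J' \<Longrightarrow> Z n \<subseteq> J' \<Longrightarrow> lead J n \<subseteq> J'" by metis
  have "\<forall>n. \<forall>s\<in>Z n. \<exists>y\<in>low S t n. s \<otimes> t [^] n \<oplus> y \<in> J" using Z(2) unfolding lead_def by blast
  then obtain w where w: "\<And>n s. s \<in> Z n \<Longrightarrow> w n s \<in> low S t n \<and> s \<otimes> t [^] n \<oplus> w n s \<in> J" by metis
  define W where "W = (\<Union>n\<in>{..n0}. (\<lambda>s. s \<otimes> t [^] n \<oplus> w n s) ` Z n)"
  have "J \<subseteq> J1" if J1: "sideal (adjoin S t) J1" "W \<subseteq> J1" for J1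
  proof -
    \<comment> \<open>Intersecting with \<open>J\<close> keeps the elements subtracted below inside
      \<open>J\<close>, so the remainder is again in \<open>J\<close> and of lower degree.\<close>
    define J' where "J' = J1 \<inter> J"
    have J': "sideal (adjoin S t) J'" unfolding J'_def using J J1 sideal_Int by blast
    have WJ: "W \<subseteq> J'" unfolding J'_def using J1 w unfolding W_def by blast
    have small: "lead J n \<subseteq> lead J' n" if "n \<le> n0" for n
    proof (rule Z(3)[OF lead_sideal[OF J']])
      show "Z n \<subseteq> lead J' n"
      proof
        fix s assume s: "s \<in> Z n"
        hence "s \<otimes> t [^] n \<oplus> w n s \<in> J'" using WJ that unfolding W_def by blast
        thus "s \<in> lead J' n" using s Z(2)[of n] w[OF s] unfolding lead_def by blast
      qed
    qed
    have lead_le: "lead J n \<subseteq> lead J' n" for n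
    proof (cases "n \<le> n0")
      case False
      thus ?thesis using n0[of n] small[of n0] lead_mono[OF J', of n0 n] by auto
    qed (rule small)
    have "p \<in> J'" if "p \<in> J" "p \<in> low S t n" for p n
      using that
    proof (induction n arbitrary: p)
      case 0 thus ?case using sidealD(2)[OF J'] by simp
    next
      case (Suc n)
      then obtain s y where sy: "s \<in> S" "y \<in> low S t n" "p = s \<otimes> t [^] n \<oplus> y" by auto
      hence "s \<in> lead J n" using Suc.prems unfolding lead_def by blast
      then obtain y' where y': "y' \<in> low S t n" "s \<otimes> t [^] n \<oplus> y' \<in> J'"
        using lead_le unfolding lead_def by blast
      let ?z = "s \<otimes> t [^] n \<oplus> y'"
      have carr: "s \<in> carrier R" "y \<in> carrier R" "y' \<in> carrier R" "t [^] n \<in> carrier R"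
        using sy y' S_carr low_carr t by auto
      have nz: "\<ominus> ?z \<in> J'" by (rule sideal_neg[OF adjoin_subring J' y'(2)])
      have "p \<oplus> \<ominus> ?z \<in> J" using nz Suc.prems(1) sidealD(3)[OF J] unfolding J'_def by blast
      moreover have "p \<oplus> \<ominus> ?z = y \<oplus> (\<ominus> \<one>) \<otimes> y'" unfolding sy(3) using carr by algebra
      moreover have "y \<oplus> (\<ominus> \<one>) \<otimes> y' \<in> low S t n"
        using sy(2) y'(1) subringE(3,5)[OF S] low_add low_smult by blast
      ultimately have "p \<oplus> \<ominus> ?z \<in> J'" using Suc.IH by simp
      hence "?z \<oplus> (p \<oplus> \<ominus> ?z) \<in> J'" using sidealD(3)[OF J' y'(2)] by blast
      moreover have "?z \<oplus> (p \<oplus> \<ominus> ?z) = p" unfolding sy(3) using carr by algebra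
      ultimately show ?case by simp
    qed
    moreover have "\<exists>n. p \<in> low S t n" if "p \<in> J" for p
      using sidealD(1)[OF J that] unfolding adjoin_def by blast
    ultimately show ?thesis unfolding J'_def by blast
  qed
  moreover have "finite W" unfolding W_def using Z(1) by blast
  moreover have "W \<subseteq> J" unfolding W_def using w by blast
  ultimately show "\<exists>Y. finite Y \<and> Y \<subseteq> J \<and> (\<forall>J'. sideal (adjoin S t) J' \<longrightarrow> Y \<subseteq> J' \<longrightarrow> J \<subseteq> J')"
    by blast
qed

end

text \<open>The bound \<open>U\<close> confines the extension. It will be the Rees algebra, so that
  the Noetherian subring found has its coefficients in the right powers of the ideal.\<close>

lemma noeth_subring_finite_ext:
  assumes "noeth_subring S0" "S0 \<subseteq> U" "subring U R" "finite Y" "Y \<subseteq> U"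
  shows "\<exists>S. noeth_subring S \<and> S0 \<subseteq> S \<and> Y \<subseteq> S \<and> S \<subseteq> U"
  using assms(4,5)
proof (induction Y rule: finite_induct)
  case empty
  thus ?case using assms by blast
next
  case (insert y F)
  then obtain S where S: "noeth_subring S" "S0 \<subseteq> S" "F \<subseteq> S" "S \<subseteq> U" by blast
  have sr: "subring S R" and y: "y \<in> carrier R"
    using S(1) insert.prems subringE(1)[OF assms(3)] unfolding noeth_subring_def by auto
  have "S \<subseteq> adjoin S y" using S_adjoin[OF sr y] by blast
  thus ?case
    using hilbert_basis[OF sr y S(1)] t_adjoin[OF sr y] adjoin_minimal[OF sr y assms(3) S(4)] S insert.prems
    by (intro exI[of _ "adjoin S y"]) auto
qed

end

section \<open>Ideal powers and the Artin--Rees lemma\<close>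

lemma ideal_pow_0: "ideal_pow R I 0 = carrier R"
  by (simp add: ideal_pow_def nat_pow_def ideals_set_def)

lemma ideal_pow_Suc: "ideal_pow R I (Suc n) = ideal_prod R (ideal_pow R I n) I"
  by (simp add: ideal_pow_def nat_pow_def ideals_set_def)

context ring
begin

lemma ideal_pow_ideal: "ideal I R \<Longrightarrow> ideal (ideal_pow R I n) R"
proof (induction n)
  case 0 thus ?case by (simp add: ideal_pow_0 oneideal)
next
  case (Suc n) thus ?case by (simp add: ideal_pow_Suc ideal_prod_is_ideal)
qed

lemma ideal_pow_1: assumes I: "ideal I R" shows "ideal_pow R I (Suc 0) = I"
proof
  show "I \<subseteq> ideal_pow R I (Suc 0)"
  proof
    fix x assume x: "x \<in> I"
    have "\<one> \<otimes> x \<in> ideal_prod R (carrier R) I" using x by (intro ideal_prod.prod) auto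
    thus "x \<in> ideal_pow R I (Suc 0)" using ideal.Icarr[OF I x] by (simp add: ideal_pow_Suc ideal_pow_0)
  qed
  show "ideal_pow R I (Suc 0) \<subseteq> I"
    using ideal_prod_inter[OF oneideal I] by (simp add: ideal_pow_Suc ideal_pow_0)
qed

lemma ideal_pow_Suc_subset: "ideal I R \<Longrightarrow> ideal_pow R I (Suc n) \<subseteq> ideal_pow R I n"
  using ideal_prod_inter[OF ideal_pow_ideal, of I I n] by (simp add: ideal_pow_Suc)

lemma ideal_pow_antimono: "ideal I R \<Longrightarrow> n \<le> m \<Longrightarrow> ideal_pow R I m \<subseteq> ideal_pow R I n"
  by (rule lift_Suc_antimono_le[of "ideal_pow R I"]) (use ideal_pow_Suc_subset in auto)

lemma ideal_pow_carr: "ideal I R \<Longrightarrow> x \<in> ideal_pow R I n \<Longrightarrow> x \<in> carrier R"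
  using ideal.Icarr[OF ideal_pow_ideal] by blast

lemma ideal_add: "ideal I R \<Longrightarrow> x \<in> I \<Longrightarrow> y \<in> I \<Longrightarrow> x \<oplus> y \<in> I"
  by (simp add: additive_subgroup.a_closed ideal.axioms(1))

lemma ideal_neg: "ideal I R \<Longrightarrow> x \<in> I \<Longrightarrow> \<ominus> x \<in> I"
  by (simp add: additive_subgroup.a_inv_closed ideal.axioms(1))

lemma ideal_zero: "ideal I R \<Longrightarrow> \<zero> \<in> I"
  by (simp add: additive_subgroup.zero_closed ideal.axioms(1))

lemma ideal_finsum:
  assumes "ideal I R" "finite A" "\<And>i. i \<in> A \<Longrightarrow> f i \<in> I"
  shows "finsum R f A \<in> I"
  using assms(2,3)
proof (induction A rule: finite_induct)
  case empty thus ?case using ideal_zero[OF assms(1)] by simp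
next
  case (insert a A)
  hence "f \<in> A \<rightarrow> carrier R" "f a \<in> carrier R" using ideal.Icarr[OF assms(1)] by auto
  thus ?case using insert ideal_add[OF assms(1)] by simp
qed

lemma ideal_pow_mult:
  assumes I: "ideal I R" and x: "x \<in> ideal_pow R I m"
  shows "y \<in> ideal_pow R I n \<Longrightarrow> x \<otimes> y \<in> ideal_pow R I (m + n)"
proof (induction n arbitrary: y)
  case 0
  thus ?case using ideal.I_r_closed[OF ideal_pow_ideal[OF I] x] by (simp add: ideal_pow_0)
next
  case (Suc n)
  have xc: "x \<in> carrier R" using ideal_pow_carr[OF I x] .
  from Suc.prems have "y \<in> ideal_prod R (ideal_pow R I n) I" by (simp add: ideal_pow_Suc)
  hence "x \<otimes> y \<in> ideal_pow R I (m + Suc n) \<and> y \<in> carrier R"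
  proof (induction rule: ideal_prod.induct)
    case (prod i j)
    have c: "i \<in> carrier R" "j \<in> carrier R"
      using prod ideal_pow_carr[OF I] ideal.Icarr[OF I] by auto
    have "(x \<otimes> i) \<otimes> j \<in> ideal_prod R (ideal_pow R I (m + n)) I"
      using Suc.IH prod by (intro ideal_prod.prod)
    thus ?case using c xc by (simp add: m_assoc ideal_pow_Suc)
  next
    case (sum s1 s2)
    thus ?case using ideal_add[OF ideal_pow_ideal[OF I]] xc by (simp add: r_distr)
  qed
  thus ?case by blast
qed

end

text \<open>The Artin-Rees lemma for a principal ideal in a domain. In a Noetherian subring of the
  Rees algebra the multiples of \<open>a\<close> form a finitely generated ideal. Dividing its
  generators by \<open>a\<close> loses at most a fixed number \<open>c\<close> of powers of
  \<open>I\<close>, and combinations with coefficients in that subring lose no more.\<close>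

lemma artin_rees_principal:
  fixes A (structure)
  assumes "noetherian_ring A" "domain A" and I: "ideal I A"
    and a: "a \<in> carrier A" "a \<noteq> \<zero>"
  shows "\<exists>c. \<forall>n. \<forall>y\<in>carrier A. a \<otimes> y \<in> ideal_pow A I n \<longrightarrow> y \<in> ideal_pow A I (n - c)"
proof -
  interpret noetherian_ring A by fact
  interpret domain A by fact
  define P where "P = UP A"
  interpret U: UP_cring A P by unfold_locales (simp add: P_def)
  let ?c = "up_ring.coeff P"
  let ?I = "ideal_pow A I"
  note Iid = ideal_pow_ideal[OF I]
  define rees where "rees = {p \<in> carrier P. \<forall>n. ?c p n \<in> ?I n}"
  have rees: "subring rees P"
  proof (rule U.P.subringI)
    show "rees \<subseteq> carrier P" unfolding rees_def by auto
    show "\<one>\<^bsub>P\<^esub> \<in> rees" unfolding rees_def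
      using ideal_zero[OF Iid] by (auto simp: ideal_pow_0)
    show "\<ominus>\<^bsub>P\<^esub> h \<in> rees" if "h \<in> rees" for h
      using that ideal_neg[OF Iid] unfolding rees_def by auto
    show "h1 \<oplus>\<^bsub>P\<^esub> h2 \<in> rees" if "h1 \<in> rees" "h2 \<in> rees" for h1 h2
      using that ideal_add[OF Iid] unfolding rees_def by auto
    show "h1 \<otimes>\<^bsub>P\<^esub> h2 \<in> rees" if "h1 \<in> rees" "h2 \<in> rees" for h1 h2
    proof -
      have "(\<Oplus>i\<in>{..n}. ?c h1 i \<otimes> ?c h2 (n - i)) \<in> ?I n" for n
      proof (rule ideal_finsum[OF Iid])
        fix i assume "i \<in> {..n}"
        thus "?c h1 i \<otimes> ?c h2 (n - i) \<in> ?I n"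
          using ideal_pow_mult[OF I, of "?c h1 i" i "?c h2 (n - i)" "n - i"] that
          unfolding rees_def by auto
      qed simp
      thus ?thesis using that unfolding rees_def by simp
    qed
  qed
  define S0 where "S0 = (\<lambda>x. up_ring.monom P x 0) ` carrier A"
  have S0sub: "subring S0 P"
  proof (rule U.P.subringI)
    show "S0 \<subseteq> carrier P" unfolding S0_def by auto
    show "\<one>\<^bsub>P\<^esub> \<in> S0" unfolding S0_def using U.monom_one by (intro image_eqI[of _ _ \<one>]) auto
    show "\<ominus>\<^bsub>P\<^esub> h \<in> S0" if "h \<in> S0" for h
      using that unfolding S0_def by (auto simp: U.monom_a_inv[symmetric] simp del: U.monom_a_inv)
    show "h1 \<oplus>\<^bsub>P\<^esub> h2 \<in> S0" if "h1 \<in> S0" "h2 \<in> S0" for h1 h2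
      using that unfolding S0_def by (auto simp: U.monom_add[symmetric] simp del: U.monom_add)
    show "h1 \<otimes>\<^bsub>P\<^esub> h2 \<in> S0" if "h1 \<in> S0" "h2 \<in> S0" for h1 h2
    proof -
      from that obtain x y where xy: "x \<in> carrier A" "y \<in> carrier A" "h1 = up_ring.monom P x 0" "h2 = up_ring.monom P y 0"
        unfolding S0_def by blast
      have "h1 \<otimes>\<^bsub>P\<^esub> h2 = up_ring.monom P (x \<otimes> y) 0" using xy U.monom_mult[of x y 0 0] by simp
      thus ?thesis using xy unfolding S0_def by blast
    qed
  qed
  have S0: "U.P.noeth_subring S0" unfolding U.P.noeth_subring_def
  proof (intro conjI allI impI S0sub)
    fix J assume J: "U.P.sideal S0 J"
    have idl: "ideal {x \<in> carrier A. up_ring.monom P x 0 \<in> J'} A" if J': "U.P.sideal S0 J'" for J'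
    proof (rule idealI)
      show "ring A" by (rule ring_axioms)
      show "subgroup {x \<in> carrier A. up_ring.monom P x 0 \<in> J'} (add_monoid A)"
      proof
        show "inv\<^bsub>add_monoid A\<^esub> x \<in> {x \<in> carrier A. up_ring.monom P x 0 \<in> J'}"
          if "x \<in> {x \<in> carrier A. up_ring.monom P x 0 \<in> J'}" for x
          using that U.P.sideal_neg[OF S0sub J'] by (auto simp: a_inv_def[symmetric])
      qed (use U.P.sidealD(2,3)[OF J'] in auto)
      fix x y assume xy: "x \<in> {x \<in> carrier A. up_ring.monom P x 0 \<in> J'}" "y \<in> carrier A"
      have "up_ring.monom P y 0 \<otimes>\<^bsub>P\<^esub> up_ring.monom P x 0 \<in> J'" using xy by (intro U.P.sidealD(4)[OF J']) (auto simp: S0_def)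
      hence "up_ring.monom P (y \<otimes> x) 0 \<in> J'" using xy U.monom_mult[of y x 0 0] by simp
      thus "y \<otimes> x \<in> {x \<in> carrier A. up_ring.monom P x 0 \<in> J'}" "x \<otimes> y \<in> {x \<in> carrier A. up_ring.monom P x 0 \<in> J'}"
        using xy by (auto simp: m_comm)
    qed
    obtain Xs where Xs: "Xs \<subseteq> carrier A" "finite Xs" "{x \<in> carrier A. up_ring.monom P x 0 \<in> J} = Idl Xs"
      using finetely_gen[OF idl[OF J]] by blast
    have "J \<subseteq> J'" if J': "U.P.sideal S0 J'" "(\<lambda>x. up_ring.monom P x 0) ` Xs \<subseteq> J'" for J'
    proof
      fix p assume p: "p \<in> J"
      then obtain x where x: "x \<in> carrier A" "p = up_ring.monom P x 0"
        using U.P.sidealD(1)[OF J p] unfolding S0_def by blast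
      have "Idl Xs \<subseteq> {x \<in> carrier A. up_ring.monom P x 0 \<in> J'}"
        using J'(2) Xs(1) by (intro genideal_minimal[OF idl[OF J'(1)]]) auto
      thus "p \<in> J'" using p x Xs(3) by blast
    qed
    moreover have "(\<lambda>x. up_ring.monom P x 0) ` Xs \<subseteq> J"
      using Xs(3) genideal_self[OF Xs(1)] by blast
    ultimately show "\<exists>Y. finite Y \<and> Y \<subseteq> J \<and> (\<forall>J'. U.P.sideal S0 J' \<longrightarrow> Y \<subseteq> J' \<longrightarrow> J \<subseteq> J')"
      using Xs(2) by (intro exI[of _ "(\<lambda>x. up_ring.monom P x 0) ` Xs"]) auto
  qed
  have S0r: "S0 \<subseteq> rees" unfolding S0_def rees_def using ideal_zero[OF Iid] by (auto simp: ideal_pow_0)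
  obtain Xs where Xs: "Xs \<subseteq> carrier A" "finite Xs" "I = Idl Xs" using finetely_gen[OF I] by blast
  have XI: "Xs \<subseteq> I" using genideal_self[OF Xs(1)] Xs(3) by simp
  define X1 where "X1 = (\<lambda>x. up_ring.monom P x 1) ` Xs"
  have "up_ring.monom P x 1 \<in> rees" if x: "x \<in> I" for x
  proof -
    have "x \<in> ?I 1" "x \<in> carrier A" using x ideal_pow_1[OF I] ideal.Icarr[OF I] by auto
    thus ?thesis unfolding rees_def using ideal_zero[OF Iid] by auto
  qed
  hence X1r: "X1 \<subseteq> rees" "finite X1" unfolding X1_def using Xs(2) XI by auto
  \<comment> \<open>\<open>S\<close> contains the constants and a linear monomial for each generator
    of \<open>I\<close>. This suffices to contain every monomial of degree n with coefficient in the
    n-th power of \<open>I\<close>.\<close>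
  obtain S where S: "U.P.noeth_subring S" "S0 \<subseteq> S" "X1 \<subseteq> S" "S \<subseteq> rees"
    using U.P.noeth_subring_finite_ext[OF S0 S0r rees X1r(2,1)] by blast
  have Ssub: "subring S P" using S(1) unfolding U.P.noeth_subring_def by blast
  have Scarr: "S \<subseteq> carrier P" using subringE(1)[OF Ssub] .
  have mono_const: "up_ring.monom P y 0 \<otimes>\<^bsub>P\<^esub> up_ring.monom P x n = up_ring.monom P (y \<otimes> x) n"
    if "x \<in> carrier A" "y \<in> carrier A" for x y n using U.monom_mult[of y x 0 n] that by simp
  have idS: "ideal {u \<in> carrier A. up_ring.monom P u 1 \<in> S} A"
  proof (rule idealI)
    show "ring A" by (rule ring_axioms)
    show "subgroup {x \<in> carrier A. up_ring.monom P x 1 \<in> S} (add_monoid A)"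
    proof
      show "inv\<^bsub>add_monoid A\<^esub> x \<in> {x \<in> carrier A. up_ring.monom P x 1 \<in> S}"
        if "x \<in> {x \<in> carrier A. up_ring.monom P x 1 \<in> S}" for x
        using that subringE(5)[OF Ssub] by (auto simp: a_inv_def[symmetric])
    qed (use subringE(2,7)[OF Ssub] in auto)
    fix x y assume xy: "x \<in> {x \<in> carrier A. up_ring.monom P x 1 \<in> S}" "y \<in> carrier A"
    have "up_ring.monom P y 0 \<otimes>\<^bsub>P\<^esub> up_ring.monom P x 1 \<in> S"
      using xy S(2) by (intro subringE(6)[OF Ssub]) (auto simp: S0_def)
    hence "up_ring.monom P (y \<otimes> x) 1 \<in> S" using xy mono_const by simp
    thus "y \<otimes> x \<in> {x \<in> carrier A. up_ring.monom P x 1 \<in> S}" "x \<otimes> y \<in> {x \<in> carrier A. up_ring.monom P x 1 \<in> S}"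
      using xy by (auto simp: m_comm)
  qed
  have "I \<subseteq> {u \<in> carrier A. up_ring.monom P u 1 \<in> S}"
    unfolding Xs(3) by (rule genideal_minimal[OF idS]) (use Xs(1) S(3) in \<open>auto simp: X1_def\<close>)
  hence I1: "up_ring.monom P u 1 \<in> S" if "u \<in> I" for u using that by blast
  have In: "up_ring.monom P u n \<in> S" if "u \<in> ?I n" for u n
    using that
  proof (induction n arbitrary: u)
    case 0 thus ?case using S(2) by (auto simp: S0_def ideal_pow_0)
  next
    case (Suc n)
    hence "u \<in> ideal_prod A (?I n) I" by (simp add: ideal_pow_Suc)
    hence "up_ring.monom P u (Suc n) \<in> S \<and> u \<in> carrier A"
    proof (induction rule: ideal_prod.induct)
      case (prod i j)
      have c: "i \<in> carrier A" "j \<in> carrier A"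
        using prod ideal_pow_carr[OF I] ideal.Icarr[OF I] by auto
      have "up_ring.monom P i n \<otimes>\<^bsub>P\<^esub> up_ring.monom P j 1 \<in> S"
        using Suc.IH prod I1 by (intro subringE(6)[OF Ssub]) auto
      thus ?case using c U.monom_mult[of i j n 1] by simp
    next
      case (sum s1 s2)
      thus ?case using subringE(7)[OF Ssub] by simp
    qed
    thus ?case by blast
  qed
  define a0 where "a0 = up_ring.monom P a 0"
  have a0: "a0 \<in> carrier P" "a0 \<in> S" unfolding a0_def using a S(2) by (auto simp: S0_def)
  have a0c: "?c (a0 \<otimes>\<^bsub>P\<^esub> q) n = a \<otimes> ?c q n" if "q \<in> carrier P" for q n
    unfolding a0_def using U.monom_mult_is_smult[OF a(1) that] that a(1) by simp
  \<comment> \<open>The quotient \<open>q\<close> ranges over the whole polynomial ring: how far its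
    coefficients fall short of the powers of \<open>I\<close> is exactly the question.\<close>
  define J where "J = {p \<in> S. \<exists>q\<in>carrier P. p = a0 \<otimes>\<^bsub>P\<^esub> q}"
  have Jid: "U.P.sideal S J" unfolding U.P.sideal_def
  proof (intro conjI ballI)
    show "J \<subseteq> S" unfolding J_def by auto
    have "\<zero>\<^bsub>P\<^esub> = a0 \<otimes>\<^bsub>P\<^esub> \<zero>\<^bsub>P\<^esub>" using a0 by simp
    thus "\<zero>\<^bsub>P\<^esub> \<in> J" unfolding J_def using subringE(2)[OF Ssub] by blast
  next
    fix x y assume "x \<in> J" "y \<in> J"
    then obtain q r where *: "x \<in> S" "y \<in> S" "q \<in> carrier P" "r \<in> carrier P"
      "x = a0 \<otimes>\<^bsub>P\<^esub> q" "y = a0 \<otimes>\<^bsub>P\<^esub> r" unfolding J_def by blast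
    have "x \<oplus>\<^bsub>P\<^esub> y = a0 \<otimes>\<^bsub>P\<^esub> (q \<oplus>\<^bsub>P\<^esub> r)" using * a0 by (simp add: U.P.r_distr)
    thus "x \<oplus>\<^bsub>P\<^esub> y \<in> J" unfolding J_def using * subringE(7)[OF Ssub] by blast
  next
    fix s x assume s: "s \<in> S" and "x \<in> J"
    then obtain q where *: "x \<in> S" "q \<in> carrier P" "x = a0 \<otimes>\<^bsub>P\<^esub> q" unfolding J_def by blast
    have sc: "s \<in> carrier P" using s Scarr by blast
    have "s \<otimes>\<^bsub>P\<^esub> x = a0 \<otimes>\<^bsub>P\<^esub> (s \<otimes>\<^bsub>P\<^esub> q)" using * a0 sc by (simp add: U.P.m_lcomm)
    thus "s \<otimes>\<^bsub>P\<^esub> x \<in> J" unfolding J_def using * s sc subringE(6)[OF Ssub] by blast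
  qed
  obtain Y where Y: "finite Y" "Y \<subseteq> J" "\<And>J'. U.P.sideal S J' \<Longrightarrow> Y \<subseteq> J' \<Longrightarrow> J \<subseteq> J'"
    using S(1) Jid unfolding U.P.noeth_subring_def by blast
  have "\<forall>p\<in>Y. \<exists>q\<in>carrier P. p = a0 \<otimes>\<^bsub>P\<^esub> q" using Y(2) unfolding J_def by blast
  then obtain q where q: "\<And>p. p \<in> Y \<Longrightarrow> q p \<in> carrier P \<and> p = a0 \<otimes>\<^bsub>P\<^esub> q p" by metis
  \<comment> \<open>Beyond degree \<open>c\<close> the finitely many quotients vanish, and up to
    degree \<open>c\<close> the truncated exponent \<open>n - c\<close> is 0, so membership in that
    power of \<open>I\<close> is no condition.\<close>
  define c where "c = (\<Sum>p\<in>Y. deg A (q p))"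
  have cq: "?c (q p) n = \<zero>" if "p \<in> Y" "n > c" for p n
  proof -
    have "deg A (q p) \<le> c" unfolding c_def using that Y(1) by (intro member_le_sum) auto
    thus ?thesis using U.deg_aboveD[of "q p" n] q[OF that(1)] that(2) by simp
  qed
  \<comment> \<open>The multiples of \<open>a\<close> whose quotient loses at most \<open>c\<close>.
    They are stable under \<open>S\<close>, whose coefficient of degree i lies in the i-th power of
    \<open>I\<close>: a convolution term lies in the power i + (n - i - c), which is at least n - c
    even with truncated subtraction.\<close>
  define J' where "J' = {p \<in> S. \<exists>q\<in>carrier P. p = a0 \<otimes>\<^bsub>P\<^esub> q \<and> (\<forall>n. ?c q n \<in> ?I (n - c))}"
  have J'id: "U.P.sideal S J'" unfolding U.P.sideal_def
  proof (intro conjI ballI)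
    show "J' \<subseteq> S" unfolding J'_def by auto
    have "\<zero>\<^bsub>P\<^esub> = a0 \<otimes>\<^bsub>P\<^esub> \<zero>\<^bsub>P\<^esub>" using a0 by simp
    thus "\<zero>\<^bsub>P\<^esub> \<in> J'" unfolding J'_def using subringE(2)[OF Ssub] ideal_zero[OF Iid]
      by (auto intro!: bexI[of _ "\<zero>\<^bsub>P\<^esub>"])
  next
    fix x y assume "x \<in> J'" "y \<in> J'"
    then obtain q r where *: "x \<in> S" "y \<in> S" "q \<in> carrier P" "r \<in> carrier P"
      "x = a0 \<otimes>\<^bsub>P\<^esub> q" "y = a0 \<otimes>\<^bsub>P\<^esub> r" "\<And>n. ?c q n \<in> ?I (n - c)" "\<And>n. ?c r n \<in> ?I (n - c)"
      unfolding J'_def by blast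
    have "x \<oplus>\<^bsub>P\<^esub> y = a0 \<otimes>\<^bsub>P\<^esub> (q \<oplus>\<^bsub>P\<^esub> r)" using * a0 by (simp add: U.P.r_distr)
    moreover have "?c (q \<oplus>\<^bsub>P\<^esub> r) n \<in> ?I (n - c)" for n using * ideal_add[OF Iid] by simp
    ultimately show "x \<oplus>\<^bsub>P\<^esub> y \<in> J'" unfolding J'_def using * subringE(7)[OF Ssub] by blast
  next
    fix s x assume s: "s \<in> S" and "x \<in> J'"
    then obtain q where *: "x \<in> S" "q \<in> carrier P" "x = a0 \<otimes>\<^bsub>P\<^esub> q" "\<And>n. ?c q n \<in> ?I (n - c)"
      unfolding J'_def by blast
    have sc: "s \<in> carrier P" and sr: "\<And>n. ?c s n \<in> ?I n" using s S(4) unfolding rees_def by auto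
    have "s \<otimes>\<^bsub>P\<^esub> x = a0 \<otimes>\<^bsub>P\<^esub> (s \<otimes>\<^bsub>P\<^esub> q)" using * a0 sc by (simp add: U.P.m_lcomm)
    moreover have "?c (s \<otimes>\<^bsub>P\<^esub> q) n \<in> ?I (n - c)" for n
    proof -
      have "(\<Oplus>i\<in>{..n}. ?c s i \<otimes> ?c q (n - i)) \<in> ?I (n - c)"
      proof (rule ideal_finsum[OF Iid])
        fix i assume i: "i \<in> {..n}"
        have mem: "?c s i \<otimes> ?c q (n - i) \<in> ?I (i + (n - i - c))"
          by (rule ideal_pow_mult[OF I sr *(4)])
        thus "?c s i \<otimes> ?c q (n - i) \<in> ?I (n - c)"
        proof -
          have "n - c \<le> i + (n - i - c)" using i by simp
          thus ?thesis using mem ideal_pow_antimono[OF I] by blast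
        qed
      qed simp
      thus ?thesis using sc * by simp
    qed
    moreover have "s \<otimes>\<^bsub>P\<^esub> x \<in> S" by (rule subringE(6)[OF Ssub s *(1)])
    moreover have "s \<otimes>\<^bsub>P\<^esub> q \<in> carrier P" using sc * by simp
    ultimately show "s \<otimes>\<^bsub>P\<^esub> x \<in> J'" unfolding J'_def by blast
  qed
  have "Y \<subseteq> J'"
  proof
    fix p assume p: "p \<in> Y"
    have "?c (q p) n \<in> ?I (n - c)" for n
      using cq[OF p] ideal_zero[OF Iid] q[OF p] by (cases "n > c") (auto simp: ideal_pow_0)
    thus "p \<in> J'" unfolding J'_def using q[OF p] Y(2) p unfolding J_def by blast
  qed
  hence JJ': "J \<subseteq> J'" by (rule Y(3)[OF J'id])
  \<comment> \<open>Apply \<open>J \<subseteq> J'\<close> to the monomial of degree \<open>n\<close>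
    with coefficient a y; cancelling \<open>a\<close> in the domain identifies \<open>y\<close> with
    a coefficient of the quotient.\<close>
  have "y \<in> ?I (n - c)" if y: "y \<in> carrier A" "a \<otimes> y \<in> ?I n" for n y
  proof -
    have "a0 \<otimes>\<^bsub>P\<^esub> up_ring.monom P y n = up_ring.monom P (a \<otimes> y) n" unfolding a0_def using mono_const y a by simp
    hence "a0 \<otimes>\<^bsub>P\<^esub> up_ring.monom P y n \<in> S" using In[OF y(2)] by simp
    moreover have "up_ring.monom P y n \<in> carrier P" using y(1) by simp
    ultimately have "a0 \<otimes>\<^bsub>P\<^esub> up_ring.monom P y n \<in> J" unfolding J_def by blast
    then obtain r where r: "r \<in> carrier P" "a0 \<otimes>\<^bsub>P\<^esub> up_ring.monom P y n = a0 \<otimes>\<^bsub>P\<^esub> r" "?c r n \<in> ?I (n - c)"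
      using JJ' unfolding J'_def by blast
    have "a \<otimes> y = a \<otimes> ?c r n" using a0c[of "up_ring.monom P y n" n] a0c[OF r(1), of n] r(2) y(1) by simp
    hence "y = ?c r n" using m_lcancel[OF a(2,1) y(1)] r(1) by simp
    thus ?thesis using r(3) by simp
  qed
  thus ?thesis by blast
qed

section \<open>The adic norm and multiplicative norms below it\<close>

definition adic_norm :: "('a, 'b) ring_scheme \<Rightarrow> 'a set \<Rightarrow> 'a \<Rightarrow> real" where
  "adic_norm R I x = Inf {(1/2) ^ n | n. x \<in> ideal_pow R I n}"

context cring
begin

context
  fixes I
  assumes I: "ideal I R"
begin

lemma adic_bdd: "bdd_below {(1/2::real) ^ n | n. x \<in> ideal_pow R I n}"
  by (rule bdd_belowI[of _ 0]) auto

lemma adic_norm_le: "x \<in> ideal_pow R I n \<Longrightarrow> adic_norm R I x \<le> (1/2) ^ n"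
  unfolding adic_norm_def by (rule cInf_lower[OF _ adic_bdd]) auto

lemma adic_nonempty: "x \<in> carrier R \<Longrightarrow> {(1/2::real) ^ n | n. x \<in> ideal_pow R I n} \<noteq> {}"
  using ideal_pow_0[of R I] by blast

lemma adic_norm_ge:
  assumes "x \<in> carrier R" "x \<notin> ideal_pow R I (Suc n)"
  shows "(1/2) ^ n \<le> adic_norm R I x"
  unfolding adic_norm_def
proof (rule cInf_greatest[OF adic_nonempty[OF assms(1)]])
  fix r :: real assume "r \<in> {(1/2) ^ n | n. x \<in> ideal_pow R I n}"
  then obtain m where m: "r = (1/2) ^ m" "x \<in> ideal_pow R I m" by blast
  hence "m \<le> n" using assms(2) ideal_pow_antimono[OF I, of "Suc n" m] by force
  thus "(1/2) ^ n \<le> r" unfolding m(1) by (intro power_decreasing) auto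
qed

lemma adic_norm_less:
  assumes "x \<in> carrier R" "adic_norm R I x < r"
  shows "\<exists>n. x \<in> ideal_pow R I n \<and> (1/2) ^ n < r"
  using assms(2) unfolding adic_norm_def
  by (subst (asm) cInf_less_iff[OF adic_nonempty[OF assms(1)] adic_bdd]) auto

lemma snorm_adic: "snorm (adic_norm R I)"
  unfolding snorm_def
proof (intro conjI ballI)
  fix x assume x: "x \<in> carrier R"
  show "0 \<le> adic_norm R I x"
    unfolding adic_norm_def by (rule cInf_greatest[OF adic_nonempty[OF x]]) auto
  show "adic_norm R I x \<le> 1" using adic_norm_le[of x 0] x by (simp add: ideal_pow_0)
next
  fix x y assume xy: "x \<in> carrier R" "y \<in> carrier R"
  show "adic_norm R I (x \<otimes> y) \<le> adic_norm R I x * adic_norm R I y"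
  proof (rule le_mult_of_dense)
    fix r s assume "adic_norm R I x < r" "adic_norm R I y < s"
    then obtain n m where n: "x \<in> ideal_pow R I n" "(1/2) ^ n < r" and m: "y \<in> ideal_pow R I m" "(1/2) ^ m < s"
      using adic_norm_less xy by meson
    have "adic_norm R I (x \<otimes> y) \<le> (1/2) ^ (n + m)" by (rule adic_norm_le[OF ideal_pow_mult[OF I n(1) m(1)]])
    also have "\<dots> = (1/2) ^ n * (1/2) ^ m" by (simp add: power_add)
    also have "\<dots> \<le> r * s" using n m by (intro mult_mono less_imp_le)
        (auto intro: le_less_trans[of 0 "(1/2) ^ n"])
    finally show "adic_norm R I (x \<otimes> y) \<le> r * s" .
  qed
  show "adic_norm R I (x \<oplus> y) \<le> max (adic_norm R I x) (adic_norm R I y)"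
  proof (rule dense_ge)
    fix r assume "max (adic_norm R I x) (adic_norm R I y) < r"
    then obtain n m where n: "x \<in> ideal_pow R I n" "(1/2) ^ n < r" and m: "y \<in> ideal_pow R I m" "(1/2) ^ m < r"
      using adic_norm_less[OF xy(1), of r] adic_norm_less[OF xy(2), of r] by auto
    let ?k = "min n m"
    have "x \<oplus> y \<in> ideal_pow R I ?k"
      using ideal_pow_antimono[OF I, of ?k n] ideal_pow_antimono[OF I, of ?k m] n m
      by (intro ideal_add[OF ideal_pow_ideal[OF I]]) auto
    hence "adic_norm R I (x \<oplus> y) \<le> (1/2) ^ ?k" by (rule adic_norm_le)
    also have "\<dots> \<le> r" using n m by (auto simp: min_def)
    finally show "adic_norm R I (x \<oplus> y) \<le> r" .
  qed
qed

end
end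

lemma multiplicative_adic_norm:
  fixes A (structure)
  assumes "noetherian_ring A" "domain A" and I: "ideal I A" "\<one> \<notin> I"
    and a: "a \<in> carrier A" "a \<noteq> \<zero>"
  shows "\<exists>N. cring.snorm A N \<and> 0 < N a \<and> N \<one> = 1
    \<and> (\<forall>x\<in>carrier A. \<forall>y\<in>carrier A. N (x \<otimes> y) = N x * N y)
    \<and> (\<forall>n. \<forall>x\<in>ideal_pow A I n. N x \<le> (1/2) ^ n)"
proof -
  interpret domain A by fact
  obtain c where c: "\<And>n y. y \<in> carrier A \<Longrightarrow> a \<otimes> y \<in> ideal_pow A I n \<Longrightarrow> y \<in> ideal_pow A I (n - c)"
    using artin_rees_principal[OF assms(1,2) I(1) a] by blast
  \<comment> \<open>Each cancellation of \<open>a\<close> costs at most \<open>c\<close> in the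
    exponent, and 1 is not in \<open>I\<close>; so the n-th power of \<open>a\<close> lies no deeper
    than c n. This is the growth rate \<open>(1/2) ^ c\<close> used below.\<close>
  have an: "a [^] n \<notin> ideal_pow A I (Suc (c * n))" for n :: nat
  proof (induction n)
    case 0 thus ?case using I by (simp add: ideal_pow_1)
  next
    case (Suc n)
    show ?case
    proof
      assume "a [^] Suc n \<in> ideal_pow A I (Suc (c * Suc n))"
      hence "a [^] n \<in> ideal_pow A I (Suc (c * Suc n) - c)" using a by (intro c) (auto simp: m_comm)
      moreover have "Suc (c * Suc n) - c = Suc (c * n)" by simp
      ultimately show False using Suc by simp
    qed
  qed
  have "((1/2) ^ c) ^ n \<le> adic_norm A I (a [^] n)" for n :: nat
    using adic_norm_ge[OF I(1) _ an] a by (simp add: power_mult)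
  then obtain N where N: "snorm N" "\<And>x. x \<in> carrier A \<Longrightarrow> N x \<le> adic_norm A I x" "0 < N a" "N \<one> = 1"
    "\<forall>x\<in>carrier A. \<forall>y\<in>carrier A. N (x \<otimes> y) = N x * N y"
    using multiplicative_norm_exists[OF snorm_adic[OF I(1)] a(1), of "(1/2) ^ c"] by auto
  moreover have "N x \<le> (1/2) ^ n" if "x \<in> ideal_pow A I n" for x n
    using N(2)[OF ideal_pow_carr[OF I(1) that]] adic_norm_le[OF I(1) that] by linarith
  ultimately show ?thesis by blast
qed

section \<open>Fractions over a prime ideal\<close>

context domain
begin

text \<open>A fraction is a whole equivalence class of pairs, so equal fractions are equal sets. The
  operations work on chosen representatives, and \<open>rep_frac\<close> shows that the choice is
  harmless.\<close>

definition frac :: "'a \<Rightarrow> 'a \<Rightarrow> ('a \<times> 'a) set" where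
  "frac a b = {(c, d). c \<in> carrier R \<and> d \<in> carrier R \<and> d \<noteq> \<zero> \<and> a \<otimes> d = c \<otimes> b}"

definition num :: "('a \<times> 'a) set \<Rightarrow> 'a" where "num U = fst (SOME p. p \<in> U)"
definition den :: "('a \<times> 'a) set \<Rightarrow> 'a" where "den U = snd (SOME p. p \<in> U)"

definition fraction_field :: "('a \<times> 'a) set ring" where
  "fraction_field =
    \<lparr>carrier = {frac a b | a b. a \<in> carrier R \<and> b \<in> carrier R \<and> b \<noteq> \<zero>},
     monoid.mult = (\<lambda>U V. frac (num U \<otimes> num V) (den U \<otimes> den V)),
     one = frac \<one> \<one>,
     ring.zero = frac \<zero> \<one>,
     ring.add = (\<lambda>U V. frac (num U \<otimes> den V \<oplus> num V \<otimes> den U) (den U \<otimes> den V))\<rparr>"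

lemma frac_eq:
  assumes "a \<in> carrier R" "b \<in> carrier R" "b \<noteq> \<zero>" "c \<in> carrier R" "d \<in> carrier R" "d \<noteq> \<zero>"
  shows "frac a b = frac c d \<longleftrightarrow> a \<otimes> d = c \<otimes> b"
proof
  assume "frac a b = frac c d"
  moreover have "(c, d) \<in> frac c d" using assms unfolding frac_def by auto
  ultimately show "a \<otimes> d = c \<otimes> b" unfolding frac_def by auto
next
  have *: "frac a b \<subseteq> frac c d" if eq: "a \<otimes> d = c \<otimes> b"
    and carr: "a \<in> carrier R" "b \<in> carrier R" "b \<noteq> \<zero>" "c \<in> carrier R" "d \<in> carrier R" for a b c d
  proof
    fix p assume "p \<in> frac a b"
    then obtain x y where p: "p = (x, y)" "x \<in> carrier R" "y \<in> carrier R" "y \<noteq> \<zero>" "a \<otimes> y = x \<otimes> b"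
      unfolding frac_def by blast
    have "b \<otimes> (c \<otimes> y) = (c \<otimes> b) \<otimes> y" using carr p(2,3) by (simp add: m_ac)
    also have "\<dots> = (a \<otimes> d) \<otimes> y" using eq by simp
    also have "\<dots> = (a \<otimes> y) \<otimes> d" using carr p(2,3) by (simp add: m_ac)
    also have "\<dots> = b \<otimes> (x \<otimes> d)" unfolding p(5) using carr p(2,3) by (simp add: m_ac)
    finally have "c \<otimes> y = x \<otimes> d" by (subst (asm) m_lcancel) (use carr p(2,3) in auto)
    thus "p \<in> frac c d" unfolding frac_def using p by simp
  qed
  assume "a \<otimes> d = c \<otimes> b"
  thus "frac a b = frac c d" using *[of a d c b] *[of c b a d] assms by (intro equalityI) auto
qed

lemma rep_frac:
  assumes "a \<in> carrier R" "b \<in> carrier R" "b \<noteq> \<zero>"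
  shows "num (frac a b) \<in> carrier R" "den (frac a b) \<in> carrier R" "den (frac a b) \<noteq> \<zero>"
    "a \<otimes> den (frac a b) = num (frac a b) \<otimes> b"
proof -
  have "(a, b) \<in> frac a b" using assms unfolding frac_def by auto
  hence "(SOME p. p \<in> frac a b) \<in> frac a b" by (rule someI)
  thus "num (frac a b) \<in> carrier R" "den (frac a b) \<in> carrier R" "den (frac a b) \<noteq> \<zero>"
    "a \<otimes> den (frac a b) = num (frac a b) \<otimes> b"
    unfolding num_def den_def by (auto simp: frac_def[of a b])
qed

lemma frac_mult:
  assumes "a \<in> carrier R" "b \<in> carrier R" "b \<noteq> \<zero>" "c \<in> carrier R" "d \<in> carrier R" "d \<noteq> \<zero>"
  shows "frac a b \<otimes>\<^bsub>fraction_field\<^esub> frac c d = frac (a \<otimes> c) (b \<otimes> d)"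
proof -
  note r = rep_frac[OF assms(1-3)] and s = rep_frac[OF assms(4-6)]
  let ?p = "num (frac a b)" and ?q = "den (frac a b)" and ?u = "num (frac c d)" and ?v = "den (frac c d)"
  have "(?p \<otimes> ?u) \<otimes> (b \<otimes> d) = (?p \<otimes> b) \<otimes> (?u \<otimes> d)" using assms r s by (simp add: m_ac)
  also have "\<dots> = (a \<otimes> ?q) \<otimes> (c \<otimes> ?v)" using r(4) s(4) by simp
  also have "\<dots> = (a \<otimes> c) \<otimes> (?q \<otimes> ?v)" using assms r(1-3) s(1-3) by (simp add: m_ac)
  finally have "(?p \<otimes> ?u) \<otimes> (b \<otimes> d) = (a \<otimes> c) \<otimes> (?q \<otimes> ?v)" .
  thus ?thesis unfolding fraction_field_def monoid.simps ring.simps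
    using assms r(1-3) s(1-3) by (subst frac_eq) (auto simp: integral_iff)
qed

lemma frac_add:
  assumes "a \<in> carrier R" "b \<in> carrier R" "b \<noteq> \<zero>" "c \<in> carrier R" "d \<in> carrier R" "d \<noteq> \<zero>"
  shows "frac a b \<oplus>\<^bsub>fraction_field\<^esub> frac c d = frac (a \<otimes> d \<oplus> c \<otimes> b) (b \<otimes> d)"
proof -
  note r = rep_frac[OF assms(1-3)] and s = rep_frac[OF assms(4-6)]
  let ?p = "num (frac a b)" and ?q = "den (frac a b)" and ?u = "num (frac c d)" and ?v = "den (frac c d)"
  have "(?p \<otimes> ?v \<oplus> ?u \<otimes> ?q) \<otimes> (b \<otimes> d) = (?p \<otimes> b) \<otimes> (?v \<otimes> d) \<oplus> (?u \<otimes> d) \<otimes> (?q \<otimes> b)"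
    using assms r(1-3) s(1-3) by algebra
  also have "\<dots> = (a \<otimes> ?q) \<otimes> (?v \<otimes> d) \<oplus> (c \<otimes> ?v) \<otimes> (?q \<otimes> b)" using r(4) s(4) by simp
  also have "\<dots> = (a \<otimes> d \<oplus> c \<otimes> b) \<otimes> (?q \<otimes> ?v)" using assms r(1-3) s(1-3) by algebra
  finally have "(?p \<otimes> ?v \<oplus> ?u \<otimes> ?q) \<otimes> (b \<otimes> d) = (a \<otimes> d \<oplus> c \<otimes> b) \<otimes> (?q \<otimes> ?v)" .
  thus ?thesis unfolding fraction_field_def monoid.simps ring.simps
    using assms r(1-3) s(1-3) by (subst frac_eq) (auto simp: integral_iff)
qed

lemma fracE:
  assumes "x \<in> carrier fraction_field"
  obtains a b where "x = frac a b" "a \<in> carrier R" "b \<in> carrier R" "b \<noteq> \<zero>"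
  using assms unfolding fraction_field_def by auto

lemma frac_carrier: "a \<in> carrier R \<Longrightarrow> b \<in> carrier R \<Longrightarrow> b \<noteq> \<zero> \<Longrightarrow> frac a b \<in> carrier fraction_field"
  unfolding fraction_field_def by auto

lemma frac_one: "\<one>\<^bsub>fraction_field\<^esub> = frac \<one> \<one>" and frac_zero: "\<zero>\<^bsub>fraction_field\<^esub> = frac \<zero> \<one>"
  unfolding fraction_field_def by auto

lemma cring_fraction_field: "cring fraction_field"
proof (rule cringI)
  show "abelian_group fraction_field"
  proof (rule abelian_groupI)
    fix x y z assume "x \<in> carrier fraction_field" "y \<in> carrier fraction_field" "z \<in> carrier fraction_field"
    then obtain a b c d e f where *: "x = frac a b" "a \<in> carrier R" "b \<in> carrier R" "b \<noteq> \<zero>"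
      "y = frac c d" "c \<in> carrier R" "d \<in> carrier R" "d \<noteq> \<zero>"
      "z = frac e f" "e \<in> carrier R" "f \<in> carrier R" "f \<noteq> \<zero>" by (auto elim!: fracE)
    have nz: "b \<otimes> d \<noteq> \<zero>" "d \<otimes> f \<noteq> \<zero>" using * by (auto simp: integral_iff)
    show "x \<oplus>\<^bsub>fraction_field\<^esub> y \<oplus>\<^bsub>fraction_field\<^esub> z = x \<oplus>\<^bsub>fraction_field\<^esub> (y \<oplus>\<^bsub>fraction_field\<^esub> z)"
    proof -
      have "(a \<otimes> d \<oplus> c \<otimes> b) \<otimes> f \<oplus> e \<otimes> (b \<otimes> d) = a \<otimes> (d \<otimes> f) \<oplus> (c \<otimes> f \<oplus> e \<otimes> d) \<otimes> b"
        using *(2,3,6,7,10,11) by algebra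
      thus ?thesis using * nz by (simp add: frac_add m_assoc)
    qed
  next
    fix x y assume "x \<in> carrier fraction_field" "y \<in> carrier fraction_field"
    then obtain a b c d where *: "x = frac a b" "a \<in> carrier R" "b \<in> carrier R" "b \<noteq> \<zero>"
      "y = frac c d" "c \<in> carrier R" "d \<in> carrier R" "d \<noteq> \<zero>" by (auto elim!: fracE)
    have nz: "b \<otimes> d \<noteq> \<zero>" using * by (auto simp: integral_iff)
    show "x \<oplus>\<^bsub>fraction_field\<^esub> y \<in> carrier fraction_field"
      using * nz by (simp add: frac_add frac_carrier)
    show "x \<oplus>\<^bsub>fraction_field\<^esub> y = y \<oplus>\<^bsub>fraction_field\<^esub> x"
      using * nz by (simp add: frac_add m_ac a_ac)
  next
    show "\<zero>\<^bsub>fraction_field\<^esub> \<in> carrier fraction_field" by (simp add: frac_zero frac_carrier)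
  next
    fix x assume "x \<in> carrier fraction_field"
    then obtain a b where *: "x = frac a b" "a \<in> carrier R" "b \<in> carrier R" "b \<noteq> \<zero>" by (auto elim!: fracE)
    show "\<zero>\<^bsub>fraction_field\<^esub> \<oplus>\<^bsub>fraction_field\<^esub> x = x"
      using * by (simp add: frac_zero frac_add)
    have "frac (\<ominus> a) b \<oplus>\<^bsub>fraction_field\<^esub> x = \<zero>\<^bsub>fraction_field\<^esub>"
      unfolding frac_zero using * by (simp add: frac_add frac_eq integral_iff l_minus l_neg)
    thus "\<exists>y\<in>carrier fraction_field. y \<oplus>\<^bsub>fraction_field\<^esub> x = \<zero>\<^bsub>fraction_field\<^esub>"
      using * by (intro bexI[of _ "frac (\<ominus> a) b"]) (auto intro: frac_carrier)
  qed
  show "comm_monoid fraction_field"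
  proof (rule comm_monoidI)
    fix x y z assume "x \<in> carrier fraction_field" "y \<in> carrier fraction_field" "z \<in> carrier fraction_field"
    then obtain a b c d e f where *: "x = frac a b" "a \<in> carrier R" "b \<in> carrier R" "b \<noteq> \<zero>"
      "y = frac c d" "c \<in> carrier R" "d \<in> carrier R" "d \<noteq> \<zero>"
      "z = frac e f" "e \<in> carrier R" "f \<in> carrier R" "f \<noteq> \<zero>" by (auto elim!: fracE)
    have nz: "b \<otimes> d \<noteq> \<zero>" "d \<otimes> f \<noteq> \<zero>" using * by (auto simp: integral_iff)
    show "x \<otimes>\<^bsub>fraction_field\<^esub> y \<otimes>\<^bsub>fraction_field\<^esub> z = x \<otimes>\<^bsub>fraction_field\<^esub> (y \<otimes>\<^bsub>fraction_field\<^esub> z)"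
      using * nz by (simp add: frac_mult m_assoc)
  next
    fix x y assume "x \<in> carrier fraction_field" "y \<in> carrier fraction_field"
    then obtain a b c d where *: "x = frac a b" "a \<in> carrier R" "b \<in> carrier R" "b \<noteq> \<zero>"
      "y = frac c d" "c \<in> carrier R" "d \<in> carrier R" "d \<noteq> \<zero>" by (auto elim!: fracE)
    have nz: "b \<otimes> d \<noteq> \<zero>" using * by (auto simp: integral_iff)
    show "x \<otimes>\<^bsub>fraction_field\<^esub> y \<in> carrier fraction_field"
      using * nz by (simp add: frac_mult frac_carrier)
    show "x \<otimes>\<^bsub>fraction_field\<^esub> y = y \<otimes>\<^bsub>fraction_field\<^esub> x"
      using * nz by (simp add: frac_mult m_comm)
  next
    show "\<one>\<^bsub>fraction_field\<^esub> \<in> carrier fraction_field" by (simp add: frac_one frac_carrier)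
  next
    fix x assume "x \<in> carrier fraction_field"
    then obtain a b where *: "x = frac a b" "a \<in> carrier R" "b \<in> carrier R" "b \<noteq> \<zero>" by (auto elim!: fracE)
    show "\<one>\<^bsub>fraction_field\<^esub> \<otimes>\<^bsub>fraction_field\<^esub> x = x"
      using * by (simp add: frac_one frac_mult)
  qed
  fix x y z assume "x \<in> carrier fraction_field" "y \<in> carrier fraction_field" "z \<in> carrier fraction_field"
  then obtain a b c d e f where *: "x = frac a b" "a \<in> carrier R" "b \<in> carrier R" "b \<noteq> \<zero>"
    "y = frac c d" "c \<in> carrier R" "d \<in> carrier R" "d \<noteq> \<zero>"
    "z = frac e f" "e \<in> carrier R" "f \<in> carrier R" "f \<noteq> \<zero>" by (auto elim!: fracE)
  have nz: "b \<otimes> d \<noteq> \<zero>" "d \<otimes> f \<noteq> \<zero>" "b \<otimes> f \<noteq> \<zero>" using * by (auto simp: integral_iff)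
  show "(x \<oplus>\<^bsub>fraction_field\<^esub> y) \<otimes>\<^bsub>fraction_field\<^esub> z =
    x \<otimes>\<^bsub>fraction_field\<^esub> z \<oplus>\<^bsub>fraction_field\<^esub> y \<otimes>\<^bsub>fraction_field\<^esub> z"
  proof -
    have "((a \<otimes> d \<oplus> c \<otimes> b) \<otimes> e) \<otimes> ((b \<otimes> f) \<otimes> (d \<otimes> f))
      = ((a \<otimes> e) \<otimes> (d \<otimes> f) \<oplus> (c \<otimes> e) \<otimes> (b \<otimes> f)) \<otimes> ((b \<otimes> d) \<otimes> f)"
      using *(2,3,6,7,10,11) by algebra
    thus ?thesis using * nz by (simp add: frac_mult frac_add frac_eq integral_iff)
  qed
qed

lemma field_fraction_field: "field fraction_field"
proof (rule cring.cring_fieldI2[OF cring_fraction_field])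
  show "\<zero>\<^bsub>fraction_field\<^esub> \<noteq> \<one>\<^bsub>fraction_field\<^esub>" by (simp add: frac_one frac_zero frac_eq)
  fix x assume "x \<in> carrier fraction_field" "x \<noteq> \<zero>\<^bsub>fraction_field\<^esub>"
  then obtain a b where *: "x = frac a b" "a \<in> carrier R" "b \<in> carrier R" "b \<noteq> \<zero>" by (auto elim!: fracE)
  have "a \<noteq> \<zero>" using * \<open>x \<noteq> \<zero>\<^bsub>fraction_field\<^esub>\<close> by (auto simp: frac_zero frac_eq)
  hence "x \<otimes>\<^bsub>fraction_field\<^esub> frac b a = \<one>\<^bsub>fraction_field\<^esub>" "frac b a \<in> carrier fraction_field"
    using * by (auto simp: frac_mult frac_one frac_eq integral_iff m_ac frac_carrier)
  thus "\<exists>y\<in>carrier fraction_field. x \<otimes>\<^bsub>fraction_field\<^esub> y = \<one>\<^bsub>fraction_field\<^esub>" by blast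
qed

lemma fraction_hom: "(\<lambda>a. frac a \<one>) \<in> ring_hom R fraction_field"
  by (rule ring_hom_memI) (auto simp: frac_carrier frac_mult frac_add frac_one)

lemma fraction_hom_eq: "a \<in> carrier R \<Longrightarrow> b \<in> carrier R \<Longrightarrow> frac a \<one> = frac b \<one> \<longleftrightarrow> a = b"
  by (simp add: frac_eq)

end

text \<open>\<open>F\<close> is the fraction field of the quotient by \<open>q\<close>. For the
  kernel of a multiplicative norm it is the field in which the ratios compared by that norm
  live.\<close>

lemma residue_field_exists:
  fixes A :: "('a, 'd) ring_scheme" (structure)
  assumes "primeideal q A"
  shows "\<exists>(F :: ('a set \<times> 'a set) set ring) \<iota>. field F \<and> \<iota> \<in> ring_hom A F
    \<and> (\<forall>x\<in>carrier A. \<iota> x = \<zero>\<^bsub>F\<^esub> \<longleftrightarrow> x \<in> q)"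
proof -
  interpret primeideal q A by fact
  interpret D: domain "A Quot q" by (rule quotient_is_domain)
  let ?i = "\<lambda>x. D.frac (q +> x) \<one>\<^bsub>A Quot q\<^esub>"
  have "?i = (\<lambda>a. D.frac a \<one>\<^bsub>A Quot q\<^esub>) \<circ> (+>) q" by auto
  hence "?i \<in> ring_hom A D.fraction_field"
    using ring_hom_trans[OF rcos_ring_hom D.fraction_hom] by simp
  moreover have "?i x = \<zero>\<^bsub>D.fraction_field\<^esub> \<longleftrightarrow> x \<in> q" if x: "x \<in> carrier A" for x
  proof -
    have xc: "q +> x \<in> carrier (A Quot q)" using ring_hom_closed[OF rcos_ring_hom x] .
    have "?i x = \<zero>\<^bsub>D.fraction_field\<^esub> \<longleftrightarrow> q +> x = \<zero>\<^bsub>A Quot q\<^esub>"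
      unfolding D.frac_zero using D.fraction_hom_eq[OF xc D.zero_closed] by simp
    also have "\<dots> \<longleftrightarrow> q +> x = q" by (simp add: FactRing_def)
    also have "\<dots> \<longleftrightarrow> x \<in> q" using x a_rcos_const a_rcos_self by blast
    finally show ?thesis .
  qed
  ultimately show ?thesis using D.field_fraction_field
    by (intro exI[of _ D.fraction_field] exI[of _ ?i]) auto
qed

section \<open>Places of a field over an algebraically closed subfield\<close>

locale field_over = scalars K F h + F: field F + K: algebraically_closed K
  for K :: "('k, 'c) ring_scheme" and F :: "('a, 'd) ring_scheme" (structure) and h
begin

text \<open>Candidates for the maximal ideal of a valuation ring with residue field
  \<open>K\<close>. Ordering these non-unital algebras by inclusion replaces the pairs of a ring and
  a prime ideal in Chevalley's extension theorem.\<close>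

definition nsub :: "'a set \<Rightarrow> bool" where
  "nsub M \<longleftrightarrow> subsp M \<and> (\<forall>x\<in>M. \<forall>y\<in>M. x \<otimes> y \<in> M) \<and> \<one> \<notin> M"

lemma nsubI:
  assumes "M \<subseteq> carrier F" "\<zero> \<in> M" "\<And>x y. x \<in> M \<Longrightarrow> y \<in> M \<Longrightarrow> x \<oplus> y \<in> M"
    "\<And>c x. c \<in> carrier K \<Longrightarrow> x \<in> M \<Longrightarrow> h c \<otimes> x \<in> M"
    "\<And>x y. x \<in> M \<Longrightarrow> y \<in> M \<Longrightarrow> x \<otimes> y \<in> M" "\<one> \<notin> M"
  shows "nsub M"
  unfolding nsub_def subsp_def by (intro conjI ballI assms)

lemma maximal_nsub_exists:
  assumes "nsub M0"
  shows "\<exists>M. nsub M \<and> M0 \<subseteq> M \<and> (\<forall>M'. nsub M' \<longrightarrow> M \<subseteq> M' \<longrightarrow> M' = M)"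
proof -
  define S where "S = {M. nsub M \<and> M0 \<subseteq> M}"
  have "\<exists>M\<in>S. \<forall>M'\<in>S. M \<subseteq> M' \<longrightarrow> M' = M"
  proof (rule subset_Zorn_nonempty)
    show "S \<noteq> {}" using assms S_def by auto
  next
    fix \<C> assume ne: "\<C> \<noteq> {}" and ch: "subset.chain S \<C>"
    have mem: "\<And>U. U \<in> \<C> \<Longrightarrow> nsub U \<and> M0 \<subseteq> U" using ch by (auto simp: subset.chain_def S_def)
    have sub: "\<And>U. U \<in> \<C> \<Longrightarrow> subsp U" using mem unfolding nsub_def by blast
    have tot: "\<And>U Y. U \<in> \<C> \<Longrightarrow> Y \<in> \<C> \<Longrightarrow> U \<subseteq> Y \<or> Y \<subseteq> U"
      using ch by (auto simp: subset.chain_def)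
    have two: "\<exists>U\<in>\<C>. x \<in> U \<and> y \<in> U" if "x \<in> \<Union>\<C>" "y \<in> \<Union>\<C>" for x y
      using that tot by blast
    have "nsub (\<Union>\<C>)"
    proof (rule nsubI)
      show "\<Union>\<C> \<subseteq> carrier F" using sub subspD(1) by blast
      show "\<zero> \<in> \<Union>\<C>" using sub subspD(2) ne by blast
      show "x \<oplus> y \<in> \<Union>\<C>" if "x \<in> \<Union>\<C>" "y \<in> \<Union>\<C>" for x y
        using two[OF that] sub subspD(3) by blast
      show "x \<otimes> y \<in> \<Union>\<C>" if "x \<in> \<Union>\<C>" "y \<in> \<Union>\<C>" for x y
        using two[OF that] mem unfolding nsub_def by blast
      show "h c \<otimes> x \<in> \<Union>\<C>" if "c \<in> carrier K" "x \<in> \<Union>\<C>" for c x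
        using that sub subspD(4) by blast
      show "\<one> \<notin> \<Union>\<C>" using mem unfolding nsub_def by blast
    qed
    thus "\<Union>\<C> \<in> S" unfolding S_def using mem ne by blast
  qed
  then obtain M where "M \<in> S" "\<And>M'. M' \<in> S \<Longrightarrow> M \<subseteq> M' \<Longrightarrow> M' = M" by blast
  thus ?thesis unfolding S_def by (intro exI[of _ M]) auto
qed

context
  fixes M
  assumes M: "nsub M" and maximal: "\<forall>M'. nsub M' \<longrightarrow> M \<subseteq> M' \<longrightarrow> M' = M"
begin

lemma Ms: "subsp M" using M unfolding nsub_def by blast
lemma Mcarr: "x \<in> M \<Longrightarrow> x \<in> carrier F" using subspD(5)[OF Ms] .
lemma Msub: "M \<subseteq> carrier F" using Mcarr by blast
lemmas Mzero = subspD(2)[OF Ms] and Madd = subspD(3)[OF Ms] and Mscal = subspD(4)[OF Ms]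
  and Mneg = subsp_neg[OF Ms] and Mdiff = subsp_diff[OF Ms]
lemma Madd_closed: "\<forall>x\<in>M. \<forall>y\<in>M. x \<oplus> y \<in> M" using Madd by blast
lemma Mmult: "x \<in> M \<Longrightarrow> y \<in> M \<Longrightarrow> x \<otimes> y \<in> M" using M unfolding nsub_def by blast
lemma Mone: "\<one> \<notin> M" using M unfolding nsub_def by blast

lemma M_one_minus: "m \<in> M \<Longrightarrow> s \<in> M \<Longrightarrow> (\<one> \<ominus> m) \<otimes> s \<in> M"
proof -
  assume ms: "m \<in> M" "s \<in> M"
  have "(\<one> \<ominus> m) \<otimes> s = s \<ominus> m \<otimes> s" using Mcarr ms by algebra
  thus ?thesis using ms Mdiff Mmult by simp
qed

text \<open>Elements 1 - m behave as units: allowing division by powers of one of them enlarges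
  \<open>M\<close> to an algebra \<open>M'\<close> that still avoids 1, so maximality gives
  \<open>M' = M\<close>.\<close>

lemma unit_cancel:
  assumes m: "m \<in> M" and x: "x \<in> carrier F" "x \<otimes> (\<one> \<ominus> m) \<in> M"
  shows "x \<in> M"
proof -
  let ?u = "\<one> \<ominus> m"
  have mc: "m \<in> carrier F" and uc: "?u \<in> carrier F" using Mcarr[OF m] by auto
  have pow: "x \<otimes> ?u [^] n \<in> M" if "x \<in> M" for x and n :: nat
  proof (induction n)
    case (Suc n)
    have "x \<otimes> ?u [^] Suc n = ?u \<otimes> (x \<otimes> ?u [^] n)" using Mcarr[OF that] uc by (simp add: m_ac)
    thus ?case using M_one_minus[OF m Suc] by simp
  qed (use that Mcarr in simp)
  \<comment> \<open>Powers of \<open>?u\<close> stay congruent to 1 modulo \<open>M\<close>. If one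
    of them were in \<open>M\<close>, so would be 1; hence \<open>M'\<close> avoids 1.\<close>
  have pow1: "?u [^] n \<ominus> \<one> \<in> M" for n :: nat
  proof (induction n)
    case (Suc n)
    have "?u [^] Suc n \<ominus> \<one> = ?u \<otimes> (?u [^] n \<ominus> \<one>) \<ominus> m"
    proof -
      have "w \<otimes> ?u \<ominus> \<one> = ?u \<otimes> (w \<ominus> \<one>) \<ominus> m" if "w \<in> carrier F" for w
        using that mc by algebra
      thus ?thesis using uc by simp
    qed
    thus ?case using M_one_minus[OF m Suc] Mdiff m by simp
  qed (use Mzero in \<open>simp add: a_minus_def r_neg\<close>)
  define M' where "M' = {x \<in> carrier F. \<exists>n::nat. x \<otimes> ?u [^] n \<in> M}"
  have M'I: "x \<in> M'" if "x \<in> carrier F" "x \<otimes> ?u [^] n \<in> M" for x and n :: nat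
    using that unfolding M'_def by blast
  have "nsub M'"
  proof (rule nsubI)
    show "M' \<subseteq> carrier F" unfolding M'_def by auto
    show "\<zero> \<in> M'" by (rule M'I[of _ 0]) (use Mzero in auto)
  next
    fix x y assume "x \<in> M'" "y \<in> M'"
    then obtain n k :: nat where *: "x \<in> carrier F" "y \<in> carrier F" "x \<otimes> ?u [^] n \<in> M" "y \<otimes> ?u [^] k \<in> M"
      unfolding M'_def by blast
    have "(x \<otimes> ?u [^] n) \<otimes> ?u [^] k \<oplus> (y \<otimes> ?u [^] k) \<otimes> ?u [^] n \<in> M"
      using pow[OF *(3)] pow[OF *(4)] Madd by blast
    moreover have "(x \<otimes> p) \<otimes> q \<oplus> (y \<otimes> q) \<otimes> p = (x \<oplus> y) \<otimes> (p \<otimes> q)"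
      if "p \<in> carrier F" "q \<in> carrier F" for p q using that *(1,2) by algebra
    ultimately show "x \<oplus> y \<in> M'" using * uc by (intro M'I[of _ "n + k"]) (auto simp: nat_pow_mult[symmetric])
    have "(x \<otimes> ?u [^] n) \<otimes> (y \<otimes> ?u [^] k) \<in> M" using Mmult * by blast
    moreover have "(x \<otimes> p) \<otimes> (y \<otimes> q) = (x \<otimes> y) \<otimes> (p \<otimes> q)"
      if "p \<in> carrier F" "q \<in> carrier F" for p q using that *(1,2) by algebra
    ultimately show "x \<otimes> y \<in> M'" using * uc by (intro M'I[of _ "n + k"]) (auto simp: nat_pow_mult[symmetric])
  next
    fix c x assume c: "c \<in> carrier K" and "x \<in> M'"
    then obtain n :: nat where *: "x \<in> carrier F" "x \<otimes> ?u [^] n \<in> M" unfolding M'_def by blast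
    have "h c \<otimes> (x \<otimes> ?u [^] n) \<in> M" using Mscal c * by blast
    thus "h c \<otimes> x \<in> M'" using * uc c by (intro M'I[of _ n]) (auto simp: m_assoc)
  next
    show "\<one> \<notin> M'"
    proof
      assume "\<one> \<in> M'"
      then obtain n :: nat where n: "?u [^] n \<in> M" unfolding M'_def using uc by auto
      have "w \<ominus> (w \<ominus> \<one>) = \<one>" if "w \<in> carrier F" for w using that by algebra
      hence "?u [^] n \<ominus> (?u [^] n \<ominus> \<one>) = \<one>" using uc by simp
      thus False using Mdiff[OF n pow1[of n]] Mone by simp
    qed
  qed
  moreover have "M \<subseteq> M'" using Mcarr by (auto intro: M'I[of _ 0])
  ultimately have "M' = M" by (rule maximal[rule_format])
  moreover have "x \<in> M'" by (rule M'I[of _ 1]) (use x uc in auto)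
  ultimately show ?thesis by simp
qed

text \<open>Multiplying a polynomial in y = 1/x by the n-th power of x reverses it into a polynomial
  in x. Only its constant term lands in degree n; this is the \<open>m\<close> removed beforehand,
  so the rest has degree below n.\<close>

lemma reverse_low:
  assumes x: "x \<in> carrier F" and y: "y \<in> carrier F" and xy: "x \<otimes> y = \<one>"
  shows "w \<in> low M y k \<Longrightarrow> k \<le> Suc n \<Longrightarrow> \<exists>m\<in>M. (w \<ominus> m) \<otimes> x [^] n \<in> low M x n"
proof (induction k arbitrary: w)
  case 0
  hence "(w \<ominus> \<zero>) \<otimes> x [^] n \<in> low M x n"
    using low_contains_zero[OF Msub Mzero Madd_closed x] x by (simp add: a_minus_def)
  thus ?case using Mzero by blast
next
  case (Suc k)
  then obtain s v where sv: "s \<in> M" "v \<in> low M y k" "w = s \<otimes> y [^] k \<oplus> v" by auto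
  have c: "s \<in> carrier F" "v \<in> carrier F"
    using sv Mcarr low_closed[OF Msub Mzero Madd_closed y] by auto
  show ?case
  proof (cases "k = 0")
    case True
    have "(w \<ominus> s) \<otimes> x [^] n = \<zero>" using sv c x True by (simp add: a_minus_def r_neg)
    thus ?thesis using sv(1) low_contains_zero[OF Msub Mzero Madd_closed x] by metis
  next
    case False
    obtain m where m: "m \<in> M" "(v \<ominus> m) \<otimes> x [^] n \<in> low M x n" using Suc sv by auto
    have n: "n = k + (n - k)" using Suc by simp
    have "y [^] k \<otimes> x [^] n = (y [^] k \<otimes> x [^] k) \<otimes> x [^] (n - k)"
      using x y by (subst (1) n) (simp add: nat_pow_mult[symmetric] m_assoc)
    also have "y [^] k \<otimes> x [^] k = \<one>"
      using x y xy by (simp add: nat_pow_distrib[symmetric] m_comm)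
    finally have yx: "y [^] k \<otimes> x [^] n = x [^] (n - k)" using x by simp
    have "s \<otimes> x [^] (n - k) \<in> low M x n"
      using low_le[OF Msub Mzero Madd_closed x, of "Suc (n - k)" n] low_monomial[OF Msub Mzero Madd_closed x sv(1)]
        False Suc.prems(2) by auto
    hence "s \<otimes> x [^] (n - k) \<oplus> (v \<ominus> m) \<otimes> x [^] n \<in> low M x n"
      using low_sum[OF Msub Mzero Madd_closed x _ m(2)] by blast
    moreover have "(s \<otimes> p \<oplus> v \<ominus> m) \<otimes> q = s \<otimes> (p \<otimes> q) \<oplus> (v \<ominus> m) \<otimes> q"
      if "p \<in> carrier F" "q \<in> carrier F" for p q using that c Mcarr[OF m(1)] by algebra
    ultimately have "(w \<ominus> m) \<otimes> x [^] n \<in> low M x n" using x y yx sv(3) by simp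
    thus ?thesis using m(1) by blast
  qed
qed

text \<open>The degree descent in Chevalley's theorem: the relation in \<open>y\<close> rewrites 1 -
  m0 times the top power of \<open>x\<close> by lower powers, and 1 = m0 + (1 - m0) 1 then becomes a
  shorter relation in \<open>x\<close>.\<close>

lemma low_one_reduce:
  assumes x: "x \<in> carrier F" and y: "y \<in> carrier F" and xy: "x \<otimes> y = \<one>"
    and 1: "\<one> \<in> low M x n" and k: "\<one> \<in> low M y k" "k \<le> n"
  shows "\<exists>n'<n. \<one> \<in> low M x n'"
proof (cases n)
  case 0 thus ?thesis using 1 by auto
next
  case (Suc n')
  from 1 obtain m v where mv: "m \<in> M" "v \<in> low M x n'" "\<one> = m \<otimes> x [^] n' \<oplus> v"
    unfolding Suc by auto
  have c: "m \<in> carrier F" "v \<in> carrier F" using mv Mcarr low_closed[OF Msub Mzero Madd_closed x] by auto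
  obtain m0 where m0: "m0 \<in> M" "(\<one> \<ominus> m0) \<otimes> x [^] n' \<in> low M x n'"
    using reverse_low[OF x y xy k(1)] k(2) Suc by auto
  have m0c: "m0 \<in> carrier F" using Mcarr m0 by blast
  \<comment> \<open>The constant \<open>m0\<close> is an expression of degree 0 and is placed in
    \<open>low M x n'\<close> only for positive \<open>n'\<close>.\<close>
  have "n' \<noteq> 0"
  proof
    assume "n' = 0"
    hence "\<one> = m" using mv c by simp
    thus False using mv Mone by simp
  qed
  hence "m0 \<in> low M x n'" using low_const[OF Msub Mzero Madd_closed x m0(1), of "n' - 1"] by simp
  moreover have "m \<otimes> ((\<one> \<ominus> m0) \<otimes> x [^] n') \<in> low M x n'"
    using low_scale[OF Msub Mzero Madd_closed x c(1) Mmult[OF mv(1)] m0(2)] .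
  moreover have "(\<one> \<ominus> m0) \<otimes> v \<in> low M x n'"
    using low_scale[OF Msub Mzero Madd_closed x _ M_one_minus[OF m0(1)] mv(2)] m0c by simp
  ultimately have "m0 \<oplus> (m \<otimes> ((\<one> \<ominus> m0) \<otimes> x [^] n') \<oplus> (\<one> \<ominus> m0) \<otimes> v) \<in> low M x n'"
    using low_sum[OF Msub Mzero Madd_closed x] by blast
  moreover have "m0 \<oplus> (m \<otimes> ((\<one> \<ominus> m0) \<otimes> p) \<oplus> (\<one> \<ominus> m0) \<otimes> v) = m0 \<oplus> (\<one> \<ominus> m0) \<otimes> (m \<otimes> p \<oplus> v)"
    if "p \<in> carrier F" for p using that c m0c by algebra
  moreover have "m0 \<oplus> (\<one> \<ominus> m0) \<otimes> \<one> = \<one>" using m0c by algebra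
  ultimately have "\<one> \<in> low M x n'" using x mv(3) by simp
  thus ?thesis using Suc by blast
qed

text \<open>The polynomials in \<open>x\<close> with coefficients in \<open>M\<close> form a
  non-unital algebra containing \<open>M\<close>. If it avoids 1, maximality makes it equal to
  \<open>M\<close>, and its linear monomials fall back into \<open>M\<close>.\<close>

lemma stable_of_not_one:
  assumes x: "x \<in> carrier F" and 1: "\<And>n. \<one> \<notin> low M x n" and m: "m \<in> M"
  shows "x \<otimes> m \<in> M"
proof -
  note B = Msub Mzero Madd_closed x
  let ?N = "\<Union>n. low M x n"
  have shift: "x [^] (k::nat) \<otimes> z \<in> ?N" if "z \<in> ?N" for k z
  proof (induction k)
    case 0 thus ?case using that low_closed[OF B] by auto
  next
    case (Suc k)
    have zc: "z \<in> carrier F" using that low_closed[OF B] by blast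
    have eq: "x [^] Suc k \<otimes> z = x \<otimes> (x [^] k \<otimes> z)" using x zc by (simp add: m_ac)
    obtain n where "x [^] k \<otimes> z \<in> low M x n" using Suc by blast
    from low_shift[OF B this] show ?case unfolding eq by blast
  qed
  have add: "y \<oplus> z \<in> ?N" if "y \<in> ?N" "z \<in> ?N" for y z
  proof -
    from that obtain n k where "y \<in> low M x n" "z \<in> low M x k" by blast
    hence "y \<in> low M x (max n k)" "z \<in> low M x (max n k)"
      using low_le[OF B, of n "max n k"] low_le[OF B, of k "max n k"] by auto
    thus ?thesis using low_sum[OF B] by blast
  qed
  have "nsub ?N"
  proof (rule nsubI)
    show "?N \<subseteq> carrier F" using low_closed[OF B] by blast
    show "\<zero> \<in> ?N" using low_contains_zero[OF B] by blast
    show "h c \<otimes> z \<in> ?N" if "c \<in> carrier K" "z \<in> ?N" for c z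
      using low_scale[OF B, of "h c"] Mscal that by auto
    show "\<one> \<notin> ?N" using 1 by blast
    show "y \<otimes> z \<in> ?N" if y: "y \<in> ?N" and z: "z \<in> ?N" for y z
    proof -
      have "y \<otimes> z \<in> ?N" if "y \<in> low M x n" for n y
        using that
      proof (induction n arbitrary: y)
        case 0
        moreover have "z \<in> carrier F" using z low_closed[OF B] by blast
        ultimately show ?case using low_contains_zero[OF B] by auto
      next
        case (Suc n)
        then obtain s v where sv: "s \<in> M" "v \<in> low M x n" "y = s \<otimes> x [^] n \<oplus> v" by auto
        have c: "s \<in> carrier F" "v \<in> carrier F" "z \<in> carrier F"
          using sv Mcarr low_closed[OF B] z by auto
        have "s \<otimes> (x [^] n \<otimes> z) \<in> ?N"
          using shift[OF z, of n] low_scale[OF B c(1) Mmult[OF sv(1)]] by auto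
        hence "s \<otimes> (x [^] n \<otimes> z) \<oplus> v \<otimes> z \<in> ?N" using add Suc.IH[OF sv(2)] by blast
        moreover have "y \<otimes> z = s \<otimes> (x [^] n \<otimes> z) \<oplus> v \<otimes> z"
          unfolding sv(3) using c x by (simp add: l_distr m_assoc)
        ultimately show ?case by simp
      qed
      thus ?thesis using y by blast
    qed
  qed (use add in blast)
  moreover have "M \<subseteq> ?N" using low_const[OF B] by blast
  ultimately have N: "?N = M" by (rule maximal[rule_format])
  have "m \<otimes> x [^] (1::nat) \<in> ?N" using low_monomial[OF B m] by blast
  thus ?thesis unfolding N using x Mcarr[OF m] by (simp add: m_comm)
qed

text \<open>Otherwise 1 is a polynomial over \<open>M\<close> both in \<open>x\<close> and in
  \<open>y\<close>; with minimal lengths for both, \<open>low_one_reduce\<close> shortens the longer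
  one.\<close>

lemma stable_dichotomy:
  assumes x: "x \<in> carrier F" and y: "y \<in> carrier F" and xy: "x \<otimes> y = \<one>"
  shows "(\<forall>m\<in>M. x \<otimes> m \<in> M) \<or> (\<forall>m\<in>M. y \<otimes> m \<in> M)"
proof (rule ccontr)
  assume "\<not> ?thesis"
  hence ex: "\<exists>n. \<one> \<in> low M x n" "\<exists>n. \<one> \<in> low M y n" using stable_of_not_one x y by blast+
  define n where "n = (LEAST n. \<one> \<in> low M x n)"
  define k where "k = (LEAST n. \<one> \<in> low M y n)"
  have n: "\<one> \<in> low M x n" "\<And>i. i < n \<Longrightarrow> \<one> \<notin> low M x i"
    unfolding n_def using LeastI_ex[OF ex(1)] not_less_Least by auto
  have k: "\<one> \<in> low M y k" "\<And>i. i < k \<Longrightarrow> \<one> \<notin> low M y i"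
    unfolding k_def using LeastI_ex[OF ex(2)] not_less_Least by auto
  have yx: "y \<otimes> x = \<one>" using xy m_comm[OF x y] by simp
  show False
    using low_one_reduce[OF x y xy n(1) k(1)] low_one_reduce[OF y x yx k(1) n(1)] n(2) k(2)
    by (cases "k \<le> n") auto
qed

text \<open>Coefficient lists start with the highest degree. Preserving the head guarantees that
  splitting off a root leaves a quotient with nonzero leading coefficient, as the induction over
  linear factors requires.\<close>

lemma synthetic_division:
  assumes x: "x \<in> carrier F" and a: "a \<in> carrier K"
  shows "set p \<subseteq> carrier K \<Longrightarrow> p \<noteq> [] \<Longrightarrow> \<exists>q. set q \<subseteq> carrier K \<and> length q = length p - 1
    \<and> (length p > 1 \<longrightarrow> hd q = hd p)
    \<and> eval (map h p) x = (x \<ominus> h a) \<otimes> eval (map h q) x \<oplus> h (K.eval p a)"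
proof (induction p rule: rev_induct)
  case (snoc c r)
  have c: "c \<in> carrier K" "set r \<subseteq> carrier K" using snoc.prems by auto
  show ?case
  proof (cases "r = []")
    case True
    thus ?thesis using c x a by (intro exI[of _ "[]"]) auto
  next
    case False
    then obtain q where q: "set q \<subseteq> carrier K" "length q = length r - 1" "length r > 1 \<longrightarrow> hd q = hd r"
      "eval (map h r) x = (x \<ominus> h a) \<otimes> eval (map h q) x \<oplus> h (K.eval r a)"
      using snoc.IH c(2) by blast
    have hs: "set (map h r) \<subseteq> carrier F" "set (map h q) \<subseteq> carrier F" using c q by auto
    have e1: "eval (map h (r @ [c])) x = eval (map h r) x \<otimes> x \<oplus> h c"
      using eval_append_aux[OF hs(1) _ x, of "h c"] c x by simp
    have e2: "eval (map h (q @ [K.eval r a])) x = eval (map h q) x \<otimes> x \<oplus> h (K.eval r a)"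
      using eval_append_aux[OF hs(2) _ x, of "h (K.eval r a)"] K.eval_in_carrier[OF c(2) a] by simp
    have e3: "K.eval (r @ [c]) a = K.eval r a \<otimes>\<^bsub>K\<^esub> a \<oplus>\<^bsub>K\<^esub> c"
      using K.eval_append_aux[OF c(2) c(1) a] .
    have rc: "K.eval r a \<in> carrier K" using K.eval_in_carrier[OF c(2) a] .
    have qc: "eval (map h q) x \<in> carrier F" using eval_in_carrier[OF hs(2) x] .
    have "((x \<ominus> \<alpha>) \<otimes> Q \<oplus> \<rho>) \<otimes> x \<oplus> \<gamma> = (x \<ominus> \<alpha>) \<otimes> (Q \<otimes> x \<oplus> \<rho>) \<oplus> (\<rho> \<otimes> \<alpha> \<oplus> \<gamma>)"
      if "\<alpha> \<in> carrier F" "Q \<in> carrier F" "\<rho> \<in> carrier F" "\<gamma> \<in> carrier F" for \<alpha> Q \<rho> \<gamma>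
      using that x by algebra
    from this[of "h a" "eval (map h q) x" "h (K.eval r a)" "h c"]
    have "eval (map h (r @ [c])) x =
      (x \<ominus> h a) \<otimes> eval (map h (q @ [K.eval r a])) x \<oplus> h (K.eval (r @ [c]) a)"
      unfolding e1 e2 e3 q(4) using a c qc rc by simp
    moreover have "hd (q @ [K.eval r a]) = hd (r @ [c])"
    proof (cases "length r > 1")
      case True
      hence "q \<noteq> []" using q(2) by auto
      thus ?thesis using True q(3) False by simp
    next
      case len: False
      then obtain b where "r = [b]" using False by (cases r) auto
      thus ?thesis using q(2) c(2) a by simp
    qed
    ultimately show ?thesis using q rc False
      by (intro exI[of _ "q @ [K.eval r a]"]) (auto simp: Suc_diff_Suc[symmetric])
  qed
qed simp

text \<open>If no x - c lay in \<open>M\<close>, maximality would make each of them invertible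
  modulo \<open>M\<close> within K[x]. Polynomials over an algebraically closed field split, so
  every nonzero polynomial in \<open>x\<close> would be invertible too. But an inverse of
  \<open>x\<close> itself yields a nonzero polynomial, x p0 - 1 up to evaluation, with value in
  \<open>M\<close>, and its invertibility would put 1 into \<open>M\<close>.\<close>

lemma residue_of_stable:
  assumes x: "x \<in> carrier F" and st: "\<And>m. m \<in> M \<Longrightarrow> x \<otimes> m \<in> M"
  shows "\<exists>c\<in>carrier K. x \<ominus> h c \<in> M"
proof (rule ccontr)
  assume neg: "\<not> ?thesis"
  let ?k = "h ` carrier K"
  have k: "subring ?k F" 
    by (rule ring_hom_ring.img_is_subring[OF ring_hom_ringI2[OF K.ring_axioms ring_axioms h_hom] K.carrier_is_subring])
  note kl = subring_low[OF k x]
  define Q where "Q = adjoin ?k x"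
  have Q: "subring Q F" unfolding Q_def by (rule adjoin_subring[OF k x])
  have xQ: "x \<in> Q" unfolding Q_def by (rule t_adjoin[OF k x])
  have kQ: "h c \<in> Q" if "c \<in> carrier K" for c using S_adjoin[OF k x] that unfolding Q_def by blast
  have Qc: "p \<in> carrier F" if "p \<in> Q" for p using subringE(1)[OF Q] that by blast
  have MQ: "p \<otimes> m \<in> M" if p: "p \<in> Q" and m: "m \<in> M" for p m
  proof -
    have xm: "x [^] (n::nat) \<otimes> m \<in> M" for n
    proof (induction n)
      case (Suc n)
      have "x [^] Suc n \<otimes> m = x \<otimes> (x [^] n \<otimes> m)" using x Mcarr[OF m] by (simp add: m_ac)
      thus ?case using st Suc by simp
    qed (use m Mcarr in simp)
    have "p \<otimes> m \<in> M" if "p \<in> low ?k x n" for n p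
      using that
    proof (induction n arbitrary: p)
      case 0 thus ?case using Mzero Mcarr[OF m] by simp
    next
      case (Suc n)
      then obtain c v where cv: "c \<in> carrier K" "v \<in> low ?k x n" "p = h c \<otimes> x [^] n \<oplus> v" by auto
      have "v \<in> carrier F" using low_closed[OF kl cv(2)] .
      hence "p \<otimes> m = h c \<otimes> (x [^] n \<otimes> m) \<oplus> v \<otimes> m"
        unfolding cv(3) using cv(1) x Mcarr[OF m] by (simp add: l_distr m_assoc)
      thus ?case using Madd[OF Mscal[OF cv(1) xm] Suc.IH[OF cv(2)]] by simp
    qed
    thus ?thesis using p unfolding Q_def adjoin_def by blast
  qed
  \<comment> \<open>Otherwise adding to \<open>M\<close> the multiples of x - c by \<open>Q\<close>
    gives a non-unital algebra without 1, hence nothing beyond \<open>M\<close>, and x - c itself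
    would lie in \<open>M\<close>.\<close>
  have inv: "\<exists>p\<in>Q. \<one> \<ominus> (x \<ominus> h c) \<otimes> p \<in> M" if c: "c \<in> carrier K" for c
  proof (rule ccontr)
    assume no: "\<not> ?thesis"
    let ?u = "x \<ominus> h c"
    have uQ: "?u \<in> Q" using subringE(7)[OF Q xQ subringE(5)[OF Q kQ[OF c]]] by (simp add: a_minus_def)
    have uc: "?u \<in> carrier F" by (rule Qc[OF uQ])
    let ?N = "{m \<oplus> ?u \<otimes> p | m p. m \<in> M \<and> p \<in> Q}"
    have NI: "z \<in> ?N" if "m \<in> M" "p \<in> Q" "z = m \<oplus> ?u \<otimes> p" for z m p using that by blast
    have "nsub ?N"
    proof (rule nsubI)
      show "?N \<subseteq> carrier F" using Mcarr Qc uc by auto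
      show "\<zero> \<in> ?N" by (rule NI[OF Mzero subringE(2)[OF Q]]) (use uc in simp)
    next
      fix y z assume "y \<in> ?N" "z \<in> ?N"
      then obtain m p m' p' where *: "m \<in> M" "p \<in> Q" "m' \<in> M" "p' \<in> Q"
        "y = m \<oplus> ?u \<otimes> p" "z = m' \<oplus> ?u \<otimes> p'" by blast
      have cc: "m \<in> carrier F" "p \<in> carrier F" "m' \<in> carrier F" "p' \<in> carrier F" using * Mcarr Qc by auto
      have eq: "(m \<oplus> u \<otimes> p) \<oplus> (m' \<oplus> u \<otimes> p') = (m \<oplus> m') \<oplus> u \<otimes> (p \<oplus> p')"
        "(m \<oplus> u \<otimes> p) \<otimes> (m' \<oplus> u \<otimes> p') = (m \<otimes> m' \<oplus> ((u \<otimes> p') \<otimes> m \<oplus> (u \<otimes> p) \<otimes> m')) \<oplus> u \<otimes> (p \<otimes> (u \<otimes> p'))"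
        if "u \<in> carrier F" for u using that cc by algebra+
      show "y \<oplus> z \<in> ?N"
        by (rule NI[OF Madd[OF *(1,3)] subringE(7)[OF Q *(2,4)]]) (use * eq(1)[OF uc] in simp)
      have up: "?u \<otimes> p \<in> Q" "?u \<otimes> p' \<in> Q" using subringE(6)[OF Q uQ] * by auto
      show "y \<otimes> z \<in> ?N"
        by (rule NI[OF Madd[OF Mmult[OF *(1,3)] Madd[OF MQ[OF up(2) *(1)] MQ[OF up(1) *(3)]]]
              subringE(6)[OF Q *(2) up(2)]]) (use * eq(2)[OF uc] in simp)
    next
      fix d z assume d: "d \<in> carrier K" and "z \<in> ?N"
      then obtain m p where *: "m \<in> M" "p \<in> Q" "z = m \<oplus> ?u \<otimes> p" by blast
      have cc: "m \<in> carrier F" "p \<in> carrier F" using * Mcarr Qc by auto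
      have eq: "e \<otimes> (m \<oplus> u \<otimes> p) = e \<otimes> m \<oplus> u \<otimes> (e \<otimes> p)" if "u \<in> carrier F" "e \<in> carrier F" for u e
        using that cc by algebra
      show "h d \<otimes> z \<in> ?N"
        by (rule NI[OF Mscal[OF d *(1)] subringE(6)[OF Q kQ[OF d] *(2)]])
          (use * eq[OF uc, of "h d"] d in simp)
    next
      show "\<one> \<notin> ?N"
      proof
        assume "\<one> \<in> ?N"
        then obtain m p where *: "m \<in> M" "p \<in> Q" "\<one> = m \<oplus> ?u \<otimes> p" by blast
        have cc: "m \<in> carrier F" "?u \<otimes> p \<in> carrier F" using * Mcarr Qc uc by auto
        have "\<one> \<ominus> ?u \<otimes> p = m"
        proof -
          have "(m \<oplus> w) \<ominus> w = m" if "w \<in> carrier F" for w using that cc(1) by algebra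
          thus ?thesis using cc(2) *(3) by metis
        qed
        thus False using no * by auto
      qed
    qed
    moreover have "M \<subseteq> ?N"
    proof
      fix m assume m: "m \<in> M"
      show "m \<in> ?N" by (rule NI[OF m subringE(2)[OF Q]]) (use uc Mcarr[OF m] in simp)
    qed
    ultimately have "?N = M" by (rule maximal[rule_format])
    moreover have "?u \<in> ?N" by (rule NI[OF Mzero subringE(3)[OF Q]]) (use uc in simp)
    ultimately show False using neg c by blast
  qed
  \<comment> \<open>Induction on the number of coefficients: drop a zero head, invert a constant, or
    split off a root. Inverses of two factors multiply to an inverse of the product because the
    errors stay in \<open>M\<close> under sums and products.\<close>
  have unit: "\<exists>r\<in>Q. \<one> \<ominus> eval (map h p) x \<otimes> r \<in> M"
    if "set p \<subseteq> carrier K" "\<exists>c\<in>set p. c \<noteq> \<zero>\<^bsub>K\<^esub>" for p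
    using that
  proof (induction "length p" arbitrary: p rule: less_induct)
    case less
    then obtain c r where p: "p = c # r" by (cases p) auto
    have cr: "c \<in> carrier K" "set r \<subseteq> carrier K" using less p by auto
    have rc: "eval (map h r) x \<in> carrier F" using cr x by (intro eval_in_carrier) auto
    show ?case
    proof (cases "c = \<zero>\<^bsub>K\<^esub>")
      case True
      hence "eval (map h p) x = eval (map h r) x" using p rc x by simp
      thus ?thesis using less.hyps[of r] less.prems p True cr by auto
    next
      case c0: False
      show ?thesis
      proof (cases "r = []")
        case True
        have ci: "inv\<^bsub>K\<^esub> c \<in> carrier K" "c \<otimes>\<^bsub>K\<^esub> inv\<^bsub>K\<^esub> c = \<one>\<^bsub>K\<^esub>" using c0 cr K.field_Units by auto
        have "eval (map h p) x \<otimes> h (inv\<^bsub>K\<^esub> c) = h (c \<otimes>\<^bsub>K\<^esub> inv\<^bsub>K\<^esub> c)"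
          using p True cr ci(1) x by simp
        hence "\<one> \<ominus> eval (map h p) x \<otimes> h (inv\<^bsub>K\<^esub> c) = \<zero>" using ci by (simp add: a_minus_def r_neg)
        thus ?thesis using kQ[OF ci(1)] Mzero by (intro bexI[of _ "h (inv\<^bsub>K\<^esub> c)"]) simp_all
      next
        case False
        have pp: "p \<in> carrier (poly_ring K)"
          using less.prems c0 p unfolding univ_poly_carrier[symmetric] polynomial_def by auto
        have deg: "degree p > 0" using p False by simp
        have "size (K.roots p) = degree p" using K.roots_over_carrier[OF pp] unfolding K.splitted_def .
        then obtain a where "a \<in># K.roots p" using deg by (metis size_empty less_irrefl multiset_nonemptyE)
        hence "K.is_root p a" using K.roots_mem_iff_is_root[OF pp] by blast
        hence a: "a \<in> carrier K" "K.eval p a = \<zero>\<^bsub>K\<^esub>" unfolding K.is_root_def by auto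
        obtain q where q: "set q \<subseteq> carrier K" "length q = length p - 1" "length p > 1 \<longrightarrow> hd q = hd p"
          "eval (map h p) x = (x \<ominus> h a) \<otimes> eval (map h q) x \<oplus> h (K.eval p a)"
          using synthetic_division[OF x a(1) less.prems(1)] p by blast
        have qn: "q \<noteq> []" "length q < length p" "hd q = c" using q p False by (auto simp: Suc_le_eq)
        obtain r where r: "r \<in> Q" "\<one> \<ominus> eval (map h q) x \<otimes> r \<in> M"
          using less.hyps[OF qn(2) q(1)] qn c0 by (metis hd_in_set)
        obtain s where s: "s \<in> Q" "\<one> \<ominus> (x \<ominus> h a) \<otimes> s \<in> M" using inv[OF a(1)] by blast
        have qc: "eval (map h q) x \<in> carrier F" using q(1) x by (intro eval_in_carrier) auto
        have ep: "eval (map h p) x = (x \<ominus> h a) \<otimes> eval (map h q) x"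
          using q(4) a x qc by simp
        let ?u = "\<one> \<ominus> eval (map h q) x \<otimes> r" and ?v = "\<one> \<ominus> (x \<ominus> h a) \<otimes> s"
        have "\<one> \<ominus> (w \<otimes> q) \<otimes> (r \<otimes> s) = ((\<one> \<ominus> q \<otimes> r) \<oplus> (\<one> \<ominus> w \<otimes> s)) \<ominus> (\<one> \<ominus> q \<otimes> r) \<otimes> (\<one> \<ominus> w \<otimes> s)"
          if "w \<in> carrier F" "q \<in> carrier F" for w q using that Qc[OF r(1)] Qc[OF s(1)] by algebra
        hence "\<one> \<ominus> eval (map h p) x \<otimes> (r \<otimes> s) = (?u \<oplus> ?v) \<ominus> ?u \<otimes> ?v"
          unfolding ep using qc x a by simp
        hence "\<one> \<ominus> eval (map h p) x \<otimes> (r \<otimes> s) \<in> M" using Mdiff Madd Mmult r s by simp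
        thus ?thesis using subringE(6)[OF Q r(1) s(1)] by blast
      qed
    qed
  qed
  have repr: "\<exists>p. set p \<subseteq> carrier K \<and> length p = n \<and> eval (map h p) x = y" if "y \<in> low ?k x n" for y n
    using that
  proof (induction n arbitrary: y)
    case (Suc n)
    then obtain c v where cv: "c \<in> carrier K" "v \<in> low ?k x n" "y = h c \<otimes> x [^] n \<oplus> v" by auto
    then obtain p where "set p \<subseteq> carrier K" "length p = n" "eval (map h p) x = v" using Suc.IH by blast
    thus ?case using cv by (intro exI[of _ "c # p"]) auto
  qed simp
  obtain p0 where p0: "p0 \<in> Q" "\<one> \<ominus> (x \<ominus> h \<zero>\<^bsub>K\<^esub>) \<otimes> p0 \<in> M" using inv[of "\<zero>\<^bsub>K\<^esub>"] by auto
  obtain p where p: "set p \<subseteq> carrier K" "eval (map h p) x = p0"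
    using repr p0(1) unfolding Q_def adjoin_def by blast
  \<comment> \<open>The last entry is the constant term, so this list represents x p(x) - 1; the
    entry also shows that the polynomial is nonzero.\<close>
  let ?p = "p @ [\<ominus>\<^bsub>K\<^esub> \<one>\<^bsub>K\<^esub>]"
  have hp: "set (map h p) \<subseteq> carrier F" using p by auto
  have "eval (map h ?p) x = p0 \<otimes> x \<oplus> h (\<ominus>\<^bsub>K\<^esub> \<one>\<^bsub>K\<^esub>)"
    using eval_append_aux[OF hp _ x, of "h (\<ominus>\<^bsub>K\<^esub> \<one>\<^bsub>K\<^esub>)"] p(2) by simp
  also have "\<dots> = \<ominus> (\<one> \<ominus> (x \<ominus> h \<zero>\<^bsub>K\<^esub>) \<otimes> p0)"
  proof -
    have "p0 \<otimes> x \<oplus> \<ominus> \<one> = \<ominus> (\<one> \<ominus> (x \<ominus> \<zero>) \<otimes> p0)" using x Qc[OF p0(1)] by algebra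
    thus ?thesis by simp
  qed
  finally have eM: "eval (map h ?p) x \<in> M" using Mneg[OF p0(2)] by simp
  have "\<ominus>\<^bsub>K\<^esub> \<one>\<^bsub>K\<^esub> \<noteq> \<zero>\<^bsub>K\<^esub>" using K.one_not_zero by (metis K.add.inv_eq_1_iff K.one_closed a_inv_def)
  then obtain r where r: "r \<in> Q" "\<one> \<ominus> eval (map h ?p) x \<otimes> r \<in> M"
    using unit[of ?p] p(1) by auto
  have "r \<otimes> eval (map h ?p) x \<in> M" by (rule MQ[OF r(1) eM])
  hence "(\<one> \<ominus> eval (map h ?p) x \<otimes> r) \<oplus> r \<otimes> eval (map h ?p) x \<in> M" using Madd r(2) by blast
  moreover have "(\<one> \<ominus> w \<otimes> r) \<oplus> r \<otimes> w = \<one>" if "w \<in> carrier F" for w using that Qc[OF r(1)] by algebra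
  ultimately show False using Mone Mcarr[OF eM] by simp
qed

lemma place_trichotomy:
  assumes x: "x \<in> carrier F" and y: "y \<in> carrier F" and xy: "x \<otimes> y = \<one>"
  shows "x \<in> M \<or> y \<in> M \<or> (\<exists>c\<in>carrier K. c \<noteq> \<zero>\<^bsub>K\<^esub> \<and> x \<ominus> h c \<in> M)"
proof -
  consider (x) "\<forall>m\<in>M. x \<otimes> m \<in> M" | (y) "\<forall>m\<in>M. y \<otimes> m \<in> M" using stable_dichotomy[OF assms] by blast
  thus ?thesis
  proof cases
    case x': x
    then obtain c where c: "c \<in> carrier K" "x \<ominus> h c \<in> M" using residue_of_stable[OF x] by blast
    show ?thesis
    proof (cases "c = \<zero>\<^bsub>K\<^esub>")
      case True
      hence "x \<ominus> h c = x" using x by (simp add: a_minus_def)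
      thus ?thesis using c by simp
    qed (use c in blast)
  next
    case y': y
    then obtain c where c: "c \<in> carrier K" "y \<ominus> h c \<in> M" using residue_of_stable[OF y] by blast
    show ?thesis
    proof (cases "c = \<zero>\<^bsub>K\<^esub>")
      case True
      hence "y \<ominus> h c = y" using y by (simp add: a_minus_def)
      thus ?thesis using c by simp
    next
      case False
      define d where "d = inv\<^bsub>K\<^esub> c"
      have d: "d \<in> carrier K" "c \<otimes>\<^bsub>K\<^esub> d = \<one>\<^bsub>K\<^esub>" "d \<noteq> \<zero>\<^bsub>K\<^esub>"
      proof -
        have "c \<in> Units K" using False c(1) K.field_Units by simp
        thus "d \<in> carrier K" "c \<otimes>\<^bsub>K\<^esub> d = \<one>\<^bsub>K\<^esub>" unfolding d_def by auto
        thus "d \<noteq> \<zero>\<^bsub>K\<^esub>" using c(1) by auto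
      qed
      let ?m = "h d \<otimes> (y \<ominus> h c)"
      have m: "?m \<in> M" using Mscal d(1) c(2) by blast
      have hcd: "h c \<otimes> h d = \<one>" using d c(1) by (metis h.hom_mult h.hom_one)
      have cc: "h c \<in> carrier F" "h d \<in> carrier F" using c d by auto
      \<comment> \<open>When x y and \<gamma> \<delta> are both 1 the last bracket vanishes. What
        remains expresses x - 1/c, times an element congruent to 1, as a multiple of y - c;
        \<open>unit_cancel\<close> then removes that factor.\<close>
      have "(x \<ominus> \<delta>) \<otimes> (\<one> \<ominus> \<ominus> (\<delta> \<otimes> (y \<ominus> \<gamma>))) =
         \<ominus> (\<delta> \<otimes> (\<delta> \<otimes> (y \<ominus> \<gamma>))) \<oplus> (x \<otimes> (\<one> \<ominus> \<gamma> \<otimes> \<delta>) \<oplus> \<delta> \<otimes> (x \<otimes> y \<ominus> \<one>))"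
        if "\<gamma> \<in> carrier F" "\<delta> \<in> carrier F" for \<gamma> \<delta>
        using that x y by algebra
      from this[OF cc] have "(x \<ominus> h d) \<otimes> (\<one> \<ominus> \<ominus> ?m) =
         \<ominus> (h d \<otimes> ?m) \<oplus> (x \<otimes> (\<one> \<ominus> \<one>) \<oplus> h d \<otimes> (\<one> \<ominus> \<one>))" unfolding hcd xy .
      also have "\<dots> = \<ominus> (h d \<otimes> ?m)" using x cc Mcarr[OF m] by (simp add: a_minus_def r_neg)
      finally have "(x \<ominus> h d) \<otimes> (\<one> \<ominus> \<ominus> ?m) \<in> M" using Mneg Mscal[OF d(1) m] by simp
      hence "x \<ominus> h d \<in> M" using unit_cancel[OF Mneg[OF m]] x cc by simp
      thus ?thesis using d by blast
    qed
  qed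
qed

end

end

section \<open>Leading orders\<close>

text \<open>\<open>gt x y\<close> says that \<open>x/y\<close> lies in the maximal ideal of a valuation ring with residue field \<open>K\<close>.\<close>
definition (in scalars) leading_order :: "('a \<Rightarrow> real) \<Rightarrow> ('a \<Rightarrow> 'a \<Rightarrow> bool) \<Rightarrow> bool" where
  "leading_order N gt \<longleftrightarrow>
     (\<forall>y\<in>carrier R. N y \<noteq> 0 \<longrightarrow> subsp {x. gt x y} \<and> \<not> gt y y \<and> (\<forall>x\<in>carrier R. N x < N y \<longrightarrow> gt x y))
   \<and> (\<forall>x y z. N y \<noteq> 0 \<longrightarrow> gt x y \<longrightarrow> gt y z \<longrightarrow> gt x z)
   \<and> (\<forall>x y w. w \<in> carrier R \<longrightarrow> N w \<noteq> 0 \<longrightarrow> gt x y \<longrightarrow> gt (x \<otimes> w) (y \<otimes> w))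
   \<and> (\<forall>x\<in>carrier R. \<forall>y\<in>carrier R. N x \<noteq> 0 \<longrightarrow> N y \<noteq> 0 \<longrightarrow>
        gt x y \<or> gt y x \<or> (\<exists>c\<in>carrier K. c \<noteq> \<zero>\<^bsub>K\<^esub> \<and> gt (x \<ominus> h c \<otimes> y) y))"

lemma (in scalars) leading_order_exists:
  assumes K: "algebraically_closed K"
    and N: "snorm N" "N \<one> = 1" "\<And>x y. x \<in> carrier R \<Longrightarrow> y \<in> carrier R \<Longrightarrow> N (x \<otimes> y) = N x * N y"
      "N \<zero> = 0"
  shows "\<exists>gt. leading_order N gt"
proof -
  define q where "q = {x \<in> carrier R. N x = 0}"
  note nn = snormD(1)[OF N(1)]
  have neg: "N (\<ominus> x) \<le> N x" if "x \<in> carrier R" for x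
  proof -
    have "N ((\<ominus> \<one>) \<otimes> x) \<le> 1 * N x" unfolding N(3)[OF a_inv_closed[OF one_closed] that]
      using snormD(2)[OF N(1), of "\<ominus> \<one>"] nn[OF that] by (intro mult_right_mono) auto
    thus ?thesis using that by (simp add: l_minus)
  qed
  have qid: "ideal q R"
  proof (rule idealI)
    show "ring R" by (rule ring_axioms)
    show "subgroup q (add_monoid R)"
    proof
      show "x \<otimes>\<^bsub>add_monoid R\<^esub> y \<in> q" if "x \<in> q" "y \<in> q" for x y
        using that snormD(4)[OF N(1), of x y] nn[of "x \<oplus> y"] unfolding q_def by simp
      show "inv\<^bsub>add_monoid R\<^esub> x \<in> q" if "x \<in> q" for x
        using that neg[of x] nn[of "\<ominus> x"] unfolding q_def a_inv_def[symmetric] by simp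
    qed (use N(4) in \<open>auto simp: q_def\<close>)
  qed (auto simp: q_def N(3))
  have qprime: "primeideal q R"
  proof (rule primeidealI[OF qid cring_axioms])
    have "\<one> \<notin> q" using N(2) unfolding q_def by simp
    thus "carrier R \<noteq> q" using one_closed by blast
  qed (auto simp: q_def N(3))
  obtain F :: "('a set \<times> 'a set) set ring" and \<iota> where F: "field F" "\<iota> \<in> ring_hom R F"
    and ker: "\<And>x. x \<in> carrier R \<Longrightarrow> \<iota> x = \<zero>\<^bsub>F\<^esub> \<longleftrightarrow> x \<in> q"
    using residue_field_exists[OF qprime] by blast
  interpret F: field F by fact
  interpret i: ring_hom_cring R F \<iota> by unfold_locales (rule F(2))
  let ?h = "\<lambda>c. \<iota> (h c)"
  have hF: "?h \<in> ring_hom K F" using ring_hom_trans[OF h_hom F(2)] by (simp add: comp_def)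
  interpret FO: field_over K F ?h
    by (intro field_over.intro scalars.intro scalars_axioms.intro K.field_axioms F.is_cring F(1) K hF)
  \<comment> \<open>The condition \<open>N x < N y\<close> forces \<open>N y\<close> to be positive,
    so the image of \<open>y\<close> is nonzero and \<open>z\<close> is a genuine quotient.\<close>
  define M0 where "M0 = {z \<in> carrier F. \<exists>x\<in>carrier R. \<exists>y\<in>carrier R. N x < N y \<and> z \<otimes>\<^bsub>F\<^esub> \<iota> y = \<iota> x}"
  have M0I: "z \<in> M0" if "z \<in> carrier F" "x \<in> carrier R" "y \<in> carrier R" "N x < N y" "z \<otimes>\<^bsub>F\<^esub> \<iota> y = \<iota> x" for x y z
    using that unfolding M0_def by blast
  have "FO.nsub M0"
  proof (rule FO.nsubI)
    show "M0 \<subseteq> carrier F" unfolding M0_def by auto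
    show "\<zero>\<^bsub>F\<^esub> \<in> M0" by (rule M0I[of _ \<zero> \<one>]) (use N in auto)
  next
    fix z z' assume "z \<in> M0" "z' \<in> M0"
    then obtain x y x' y' where *: "z \<in> carrier F" "z' \<in> carrier F" "x \<in> carrier R" "y \<in> carrier R"
      "x' \<in> carrier R" "y' \<in> carrier R" "N x < N y" "N x' < N y'"
      "z \<otimes>\<^bsub>F\<^esub> \<iota> y = \<iota> x" "z' \<otimes>\<^bsub>F\<^esub> \<iota> y' = \<iota> x'" unfolding M0_def by blast
    have pos: "0 < N y" "0 < N y'" using * nn[of x] nn[of x'] by auto
    have "N (x \<otimes> y' \<oplus> x' \<otimes> y) \<le> max (N x * N y') (N x' * N y)"
      using snormD(4)[OF N(1), of "x \<otimes> y'" "x' \<otimes> y"] * N(3) by simp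
    also have "\<dots> < N (y \<otimes> y')"
      using pos * by (auto simp: N(3) mult.commute[of "N x'"])
    finally have lt: "N (x \<otimes> y' \<oplus> x' \<otimes> y) < N (y \<otimes> y')" .
    have carr: "\<iota> y \<in> carrier F" "\<iota> y' \<in> carrier F" using * by auto
    have "(z \<oplus>\<^bsub>F\<^esub> z') \<otimes>\<^bsub>F\<^esub> (\<iota> y \<otimes>\<^bsub>F\<^esub> \<iota> y') = (z \<otimes>\<^bsub>F\<^esub> \<iota> y) \<otimes>\<^bsub>F\<^esub> \<iota> y' \<oplus>\<^bsub>F\<^esub> (z' \<otimes>\<^bsub>F\<^esub> \<iota> y') \<otimes>\<^bsub>F\<^esub> \<iota> y"
      using *(1,2) carr by (simp add: F.l_distr F.r_distr F.m_ac)
    thus "z \<oplus>\<^bsub>F\<^esub> z' \<in> M0" using * lt by (intro M0I[of _ "x \<otimes> y' \<oplus> x' \<otimes> y" "y \<otimes> y'"]) auto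
    have "N (x \<otimes> x') < N (y \<otimes> y')"
      using * pos nn[of x] nn[of x'] by (simp add: N(3) mult_strict_mono)
    moreover have "(z \<otimes>\<^bsub>F\<^esub> z') \<otimes>\<^bsub>F\<^esub> (\<iota> y \<otimes>\<^bsub>F\<^esub> \<iota> y') = (z \<otimes>\<^bsub>F\<^esub> \<iota> y) \<otimes>\<^bsub>F\<^esub> (z' \<otimes>\<^bsub>F\<^esub> \<iota> y')"
      using *(1,2) carr by (simp add: F.m_ac)
    ultimately show "z \<otimes>\<^bsub>F\<^esub> z' \<in> M0" using * by (intro M0I[of _ "x \<otimes> x'" "y \<otimes> y'"]) auto
  next
    fix c z assume c: "c \<in> carrier K" and "z \<in> M0"
    then obtain x y where *: "z \<in> carrier F" "x \<in> carrier R" "y \<in> carrier R" "N x < N y"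
      "z \<otimes>\<^bsub>F\<^esub> \<iota> y = \<iota> x" unfolding M0_def by blast
    have "N (h c \<otimes> x) \<le> N x" using snorm_le_left[OF N(1), of x "h c"] * c by (simp add: m_comm)
    hence "N (h c \<otimes> x) < N y" using * by simp
    thus "\<iota> (h c) \<otimes>\<^bsub>F\<^esub> z \<in> M0" using * c by (intro M0I[of _ "h c \<otimes> x" y]) (auto simp: F.m_assoc)
  next
    show "\<one>\<^bsub>F\<^esub> \<notin> M0"
    proof
      assume "\<one>\<^bsub>F\<^esub> \<in> M0"
      then obtain x y where *: "x \<in> carrier R" "y \<in> carrier R" "N x < N y" "\<iota> y = \<iota> x"
        unfolding M0_def by auto
      \<comment> \<open>Equal images mean that y - x has norm 0, and the ultrametric inequality then
        bounds \<open>N y\<close> by \<open>N x\<close>.\<close>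
      hence "\<iota> (y \<ominus> x) = \<zero>\<^bsub>F\<^esub>" by (simp add: a_minus_def F.r_neg)
      hence "N (y \<ominus> x) = 0" using ker[of "y \<ominus> x"] * unfolding q_def by simp
      moreover have "y = (y \<ominus> x) \<oplus> x" using * by algebra
      hence "N y \<le> max (N (y \<ominus> x)) (N x)" using snormD(4)[OF N(1), of "y \<ominus> x" x] * by simp
      ultimately show False using * nn[of x] by simp
    qed
  qed
  then obtain M where M: "FO.nsub M" "M0 \<subseteq> M" "\<forall>M'. FO.nsub M' \<longrightarrow> M \<subseteq> M' \<longrightarrow> M' = M"
    using FO.maximal_nsub_exists by blast
  note Mc = FO.Mcarr[OF M(1,3)]
  \<comment> \<open>Only the denominator \<open>y\<close> must have nonzero norm: an
    \<open>x\<close> of norm 0 has image 0 and counts as beyond every such \<open>y\<close>.\<close>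
  define gt where "gt x y \<longleftrightarrow> x \<in> carrier R \<and> y \<in> carrier R \<and> N y \<noteq> 0 \<and> (\<exists>z\<in>M. z \<otimes>\<^bsub>F\<^esub> \<iota> y = \<iota> x)" for x y
  have gtI: "gt x y" if "x \<in> carrier R" "y \<in> carrier R" "N y \<noteq> 0" "z \<in> M" "z \<otimes>\<^bsub>F\<^esub> \<iota> y = \<iota> x" for x y z
    using that unfolding gt_def by blast
  have inv: "\<exists>z\<in>carrier F. \<iota> y \<otimes>\<^bsub>F\<^esub> z = \<one>\<^bsub>F\<^esub>" if "y \<in> carrier R" "N y \<noteq> 0" for y
  proof -
    have "\<iota> y \<noteq> \<zero>\<^bsub>F\<^esub>" using ker that unfolding q_def by auto
    hence "\<iota> y \<in> Units F" using that F.field_Units by simp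
    thus ?thesis using F.Units_r_inv F.Units_inv_closed by blast
  qed
  have sub: "subsp {x. gt x y}" if y: "y \<in> carrier R" "N y \<noteq> 0" for y
    unfolding subsp_def
  proof (intro conjI ballI)
    show "{x. gt x y} \<subseteq> carrier R" unfolding gt_def by auto
    show "\<zero> \<in> {x. gt x y}" using gtI[OF _ y FO.Mzero[OF M(1,3)], of \<zero>] y by auto
  next
    fix x x' assume "x \<in> {x. gt x y}" "x' \<in> {x. gt x y}"
    then obtain z z' where *: "x \<in> carrier R" "x' \<in> carrier R" "z \<in> M" "z' \<in> M"
      "z \<otimes>\<^bsub>F\<^esub> \<iota> y = \<iota> x" "z' \<otimes>\<^bsub>F\<^esub> \<iota> y = \<iota> x'" unfolding gt_def by auto
    thus "x \<oplus> x' \<in> {x. gt x y}"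
      using gtI[OF _ y FO.Madd[OF M(1,3) *(3,4)], of "x \<oplus> x'"] Mc y by (simp add: F.l_distr)
  next
    fix c x assume c: "c \<in> carrier K" and "x \<in> {x. gt x y}"
    then obtain z where *: "x \<in> carrier R" "z \<in> M" "z \<otimes>\<^bsub>F\<^esub> \<iota> y = \<iota> x" unfolding gt_def by auto
    thus "h c \<otimes> x \<in> {x. gt x y}"
      using gtI[OF _ y FO.Mscal[OF M(1,3) c *(2)], of "h c \<otimes> x"] Mc y c by (simp add: F.m_assoc)
  qed
  have irrefl: "\<not> gt y y" for y
  proof
    assume "gt y y"
    then obtain z where *: "y \<in> carrier R" "N y \<noteq> 0" "z \<in> M" "z \<otimes>\<^bsub>F\<^esub> \<iota> y = \<iota> y" unfolding gt_def by blast
    obtain w where w: "w \<in> carrier F" "\<iota> y \<otimes>\<^bsub>F\<^esub> w = \<one>\<^bsub>F\<^esub>" using inv * by blast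
    have "z = z \<otimes>\<^bsub>F\<^esub> (\<iota> y \<otimes>\<^bsub>F\<^esub> w)" using w Mc[OF *(3)] by simp
    also have "\<dots> = (z \<otimes>\<^bsub>F\<^esub> \<iota> y) \<otimes>\<^bsub>F\<^esub> w"
      by (rule F.m_assoc[symmetric]) (use *(1) w(1) Mc[OF *(3)] in auto)
    also have "\<dots> = \<iota> y \<otimes>\<^bsub>F\<^esub> w" using *(4) by simp
    finally show False using w FO.Mone[OF M(1,3)] *(3) by simp
  qed
  have small: "gt x y" if xy: "x \<in> carrier R" "y \<in> carrier R" "N y \<noteq> 0" "N x < N y" for x y
  proof -
    obtain w where w: "w \<in> carrier F" "\<iota> y \<otimes>\<^bsub>F\<^esub> w = \<one>\<^bsub>F\<^esub>" using inv xy by blast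
    have eq: "(\<iota> x \<otimes>\<^bsub>F\<^esub> w) \<otimes>\<^bsub>F\<^esub> \<iota> y = \<iota> x"
    proof -
      have "(\<iota> x \<otimes>\<^bsub>F\<^esub> w) \<otimes>\<^bsub>F\<^esub> \<iota> y = \<iota> x \<otimes>\<^bsub>F\<^esub> (\<iota> y \<otimes>\<^bsub>F\<^esub> w)" using w(1) xy by (simp add: F.m_ac)
      thus ?thesis using w xy by simp
    qed
    hence "\<iota> x \<otimes>\<^bsub>F\<^esub> w \<in> M" using M(2) M0I[OF _ xy(1,2,4) eq] w xy by auto
    thus ?thesis using gtI[OF xy(1,2,3) _ eq] by blast
  qed
  have trans: "gt x z" if "gt x y" "gt y z" for x y z
  proof -
    from that obtain u v where *: "x \<in> carrier R" "y \<in> carrier R" "z \<in> carrier R" "N z \<noteq> 0" "u \<in> M" "v \<in> M"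
      "u \<otimes>\<^bsub>F\<^esub> \<iota> y = \<iota> x" "v \<otimes>\<^bsub>F\<^esub> \<iota> z = \<iota> y" unfolding gt_def by blast
    have "(u \<otimes>\<^bsub>F\<^esub> v) \<otimes>\<^bsub>F\<^esub> \<iota> z = \<iota> x" using * Mc[OF *(5)] Mc[OF *(6)] by (simp add: F.m_assoc)
    thus ?thesis using gtI[OF *(1,3,4) FO.Mmult[OF M(1,3) *(5,6)]] by blast
  qed
  have mult: "gt (x \<otimes> w) (y \<otimes> w)" if w: "w \<in> carrier R" "N w \<noteq> 0" and "gt x y" for x y w
  proof -
    from that obtain u where *: "x \<in> carrier R" "y \<in> carrier R" "N y \<noteq> 0" "u \<in> M" "u \<otimes>\<^bsub>F\<^esub> \<iota> y = \<iota> x"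
      unfolding gt_def by blast
    have "u \<otimes>\<^bsub>F\<^esub> \<iota> (y \<otimes> w) = u \<otimes>\<^bsub>F\<^esub> (\<iota> y \<otimes>\<^bsub>F\<^esub> \<iota> w)" using *(2) w by simp
    also have "\<dots> = (u \<otimes>\<^bsub>F\<^esub> \<iota> y) \<otimes>\<^bsub>F\<^esub> \<iota> w"
      by (rule F.m_assoc[symmetric]) (use *(2) w Mc[OF *(4)] in auto)
    finally have "u \<otimes>\<^bsub>F\<^esub> \<iota> (y \<otimes> w) = \<iota> (x \<otimes> w)" using * w by simp
    thus ?thesis using gtI[of "x \<otimes> w" "y \<otimes> w" u] * w N(3) by simp
  qed
  have tri: "gt x y \<or> gt y x \<or> (\<exists>c\<in>carrier K. c \<noteq> \<zero>\<^bsub>K\<^esub> \<and> gt (x \<ominus> h c \<otimes> y) y)"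
    if x: "x \<in> carrier R" "N x \<noteq> 0" and y: "y \<in> carrier R" "N y \<noteq> 0" for x y
  proof -
    obtain u where u: "u \<in> carrier F" "\<iota> x \<otimes>\<^bsub>F\<^esub> u = \<one>\<^bsub>F\<^esub>" using inv[OF x] by blast
    obtain v where v: "v \<in> carrier F" "\<iota> y \<otimes>\<^bsub>F\<^esub> v = \<one>\<^bsub>F\<^esub>" using inv[OF y] by blast
    define z where "z = \<iota> x \<otimes>\<^bsub>F\<^esub> v"
    define w where "w = \<iota> y \<otimes>\<^bsub>F\<^esub> u"
    have c: "\<iota> x \<in> carrier F" "\<iota> y \<in> carrier F" using x y by auto
    have zw: "z \<in> carrier F" "w \<in> carrier F" using c u v by (auto simp: z_def w_def)
    have zy: "z \<otimes>\<^bsub>F\<^esub> \<iota> y = \<iota> x"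
    proof -
      have "z \<otimes>\<^bsub>F\<^esub> \<iota> y = \<iota> x \<otimes>\<^bsub>F\<^esub> (\<iota> y \<otimes>\<^bsub>F\<^esub> v)" unfolding z_def using c v(1) by (simp add: F.m_ac)
      thus ?thesis using v c by simp
    qed
    have wx: "w \<otimes>\<^bsub>F\<^esub> \<iota> x = \<iota> y"
    proof -
      have "w \<otimes>\<^bsub>F\<^esub> \<iota> x = \<iota> y \<otimes>\<^bsub>F\<^esub> (\<iota> x \<otimes>\<^bsub>F\<^esub> u)" unfolding w_def using c u(1) by (simp add: F.m_ac)
      thus ?thesis using u c by simp
    qed
    have "z \<otimes>\<^bsub>F\<^esub> w = (\<iota> x \<otimes>\<^bsub>F\<^esub> u) \<otimes>\<^bsub>F\<^esub> (\<iota> y \<otimes>\<^bsub>F\<^esub> v)"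
      unfolding z_def w_def using c u(1) v(1) by (simp add: F.m_ac)
    hence "z \<otimes>\<^bsub>F\<^esub> w = \<one>\<^bsub>F\<^esub>" using u v by simp
    from FO.place_trichotomy[OF M(1,3) zw this]
    consider "z \<in> M" | "w \<in> M" | c where "c \<in> carrier K" "c \<noteq> \<zero>\<^bsub>K\<^esub>" "z \<ominus>\<^bsub>F\<^esub> \<iota> (h c) \<in> M" by blast
    thus ?thesis
    proof cases
      case 1 thus ?thesis using gtI[OF x(1) y _ zy] by blast
    next
      case 2 thus ?thesis using gtI[OF y(1) x _ wx] by blast
    next
      case (3 d)
      have "(z \<ominus>\<^bsub>F\<^esub> \<delta>) \<otimes>\<^bsub>F\<^esub> \<eta> = z \<otimes>\<^bsub>F\<^esub> \<eta> \<ominus>\<^bsub>F\<^esub> \<delta> \<otimes>\<^bsub>F\<^esub> \<eta>"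
        if "\<delta> \<in> carrier F" "\<eta> \<in> carrier F" for \<delta> \<eta>
        using that zw(1) by (simp add: a_minus_def F.l_distr F.l_minus)
      hence "(z \<ominus>\<^bsub>F\<^esub> \<iota> (h d)) \<otimes>\<^bsub>F\<^esub> \<iota> y = \<iota> x \<ominus>\<^bsub>F\<^esub> \<iota> (h d) \<otimes>\<^bsub>F\<^esub> \<iota> y" using 3 c zy by simp
      also have "\<dots> = \<iota> (x \<ominus> h d \<otimes> y)" using x y 3 by (simp add: a_minus_def)
      finally have "gt (x \<ominus> h d \<otimes> y) y" using gtI[OF _ y 3(3)] x y 3(1) by simp
      thus ?thesis using 3 by blast
    qed
  qed
  have "leading_order N gt" unfolding leading_order_def
  proof (intro conjI ballI allI impI)
    show "gt x z" if "gt x y" "gt y z" for x y z by (rule trans[OF that])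
    show "gt (x \<otimes> w) (y \<otimes> w)" if "w \<in> carrier R" "N w \<noteq> 0" "gt x y" for x y w by (rule mult[OF that])
  qed (rule sub irrefl small tri; assumption)+
  thus ?thesis by blast
qed

section \<open>Complete Noetherian domains\<close>

context abelian_monoid
begin

lemma finsum_swap:
  assumes "finite P" "finite Q" "\<And>p q. p \<in> P \<Longrightarrow> q \<in> Q \<Longrightarrow> f p q \<in> carrier G"
  shows "(\<Oplus>p\<in>P. \<Oplus>q\<in>Q. f p q) = (\<Oplus>q\<in>Q. \<Oplus>p\<in>P. f p q)"
  using assms(1,3)
proof (induction P rule: finite_induct)
  case (insert x F)
  have c: "(\<lambda>q. f x q) \<in> Q \<rightarrow> carrier G" "(\<lambda>q. \<Oplus>p\<in>F. f p q) \<in> Q \<rightarrow> carrier G"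
    "(\<lambda>p. \<Oplus>q\<in>Q. f p q) \<in> F \<rightarrow> carrier G" "(\<Oplus>q\<in>Q. f x q) \<in> carrier G"
    using insert.prems by (auto intro!: finsum_closed)
  have "(\<Oplus>p\<in>insert x F. \<Oplus>q\<in>Q. f p q) = (\<Oplus>q\<in>Q. f x q) \<oplus> (\<Oplus>p\<in>F. \<Oplus>q\<in>Q. f p q)"
    using insert c by (intro finsum_insert) auto
  also have "\<dots> = (\<Oplus>q\<in>Q. f x q) \<oplus> (\<Oplus>q\<in>Q. \<Oplus>p\<in>F. f p q)" using insert by simp
  also have "\<dots> = (\<Oplus>q\<in>Q. f x q \<oplus> (\<Oplus>p\<in>F. f p q))" using finsum_addf[OF c(1,2)] by simp
  also have "\<dots> = (\<Oplus>q\<in>Q. \<Oplus>p\<in>insert x F. f p q)"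
    using insert by (intro finsum_cong') (auto intro!: finsum_closed simp: finsum_insert Pi_iff)
  finally show ?case .
qed simp

lemma finsum_single:
  assumes "finite A" "i \<in> A" "f i \<in> carrier G" "\<And>j. j \<in> A \<Longrightarrow> j \<noteq> i \<Longrightarrow> f j = \<zero>"
  shows "finsum G f A = f i"
proof -
  have "finsum G f A = finsum G f (insert i (A - {i}))" using assms(2) by (simp add: insert_absorb)
  also have "\<dots> = f i \<oplus> finsum G f (A - {i})"
    using assms by (intro finsum_insert) auto
  also have "finsum G f (A - {i}) = (\<Oplus>j\<in>A - {i}. \<zero>)" using assms(4) by (intro finsum_cong') auto
  finally show ?thesis using assms(3) by simp
qed

lemma finsum_neutral_subset:
  assumes "finite A" "B \<subseteq> A" "\<And>j. j \<in> B \<Longrightarrow> f j \<in> carrier G" "\<And>j. j \<in> A - B \<Longrightarrow> f j = \<zero>"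
  shows "finsum G f A = finsum G f B"
proof -
  have B: "finite B" using assms finite_subset by blast
  have "finsum G f A = finsum G f (B \<union> (A - B))" using assms(2) by (simp add: Un_absorb1)
  also have "\<dots> = finsum G f B \<oplus> finsum G f (A - B)"
    using assms B by (intro finsum_Un_disjoint) auto
  also have "finsum G f (A - B) = (\<Oplus>j\<in>A - B. \<zero>)" using assms(4) by (intro finsum_cong') auto
  finally show ?thesis using assms(3) by (simp add: finsum_closed Pi_iff)
qed

lemma finsum_nonzero_term:
  assumes "finsum G f A \<noteq> \<zero>" shows "\<exists>i\<in>A. f i \<noteq> \<zero>"
proof (rule ccontr)
  assume "\<not> ?thesis"
  hence "finsum G f A = (\<Oplus>j\<in>A. \<zero>)" by (intro finsum_cong') auto
  thus False using assms by simp
qed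

end

lemma (in cring) finsum_times:
  assumes "finite P" "finite Q" "f \<in> P \<rightarrow> carrier R" "g \<in> Q \<rightarrow> carrier R"
  shows "finsum R f P \<otimes> finsum R g Q = (\<Oplus>z\<in>P \<times> Q. f (fst z) \<otimes> g (snd z))"
  using assms(1,3)
proof (induction P rule: finite_induct)
  case empty
  thus ?case using assms(4) by simp
next
  case (insert x F)
  have c: "f x \<in> carrier R" "finsum R f F \<in> carrier R" "finsum R g Q \<in> carrier R"
    using insert assms(4) by (auto intro!: finsum_closed)
  have eq: "insert x F \<times> Q = (Pair x) ` Q \<union> F \<times> Q" by auto
  have "(\<Oplus>z\<in>insert x F \<times> Q. f (fst z) \<otimes> g (snd z))
    = (\<Oplus>z\<in>Pair x ` Q. f (fst z) \<otimes> g (snd z)) \<oplus> (\<Oplus>z\<in>F \<times> Q. f (fst z) \<otimes> g (snd z))"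
    unfolding eq using insert assms by (intro finsum_Un_disjoint) (auto simp: Pi_iff)
  also have "(\<Oplus>z\<in>Pair x ` Q. f (fst z) \<otimes> g (snd z)) = (\<Oplus>q\<in>Q. f x \<otimes> g q)"
    using insert assms by (subst finsum_reindex) (auto simp: Pi_iff inj_on_def)
  also have "\<dots> = f x \<otimes> finsum R g Q" using assms c by (simp add: finsum_rdistr)
  finally show ?case using insert c by (simp add: l_distr finsum_insert)
qed

lemma finite_total_has_least:
  assumes "finite Z" "Z \<noteq> {}"
    and trans: "\<And>x y z. x \<in> Z \<Longrightarrow> y \<in> Z \<Longrightarrow> z \<in> Z \<Longrightarrow> r x y \<Longrightarrow> r y z \<Longrightarrow> r x z"
    and total: "\<And>x y. x \<in> Z \<Longrightarrow> y \<in> Z \<Longrightarrow> x \<noteq> y \<Longrightarrow> r x y \<or> r y x"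
  shows "\<exists>m\<in>Z. \<forall>z\<in>Z. z \<noteq> m \<longrightarrow> r m z"
  using assms
proof (induction Z rule: finite_ne_induct)
  case (insert x F)
  obtain m where m: "m \<in> F" "\<And>z. z \<in> F \<Longrightarrow> z \<noteq> m \<Longrightarrow> r m z"
    using insert.IH insert.prems by (metis insertCI)
  show ?case
  proof (cases "r m x")
    case True thus ?thesis using m by blast
  next
    case False
    hence "r x m" using insert.prems(2)[of x m] m(1) insert.hyps by blast
    hence "r x z" if "z \<in> F" for z using m insert.prems(1)[of x m z] that by (cases "z = m") auto
    thus ?thesis by blast
  qed
qed simp

section \<open>Continuous functionals and limits in a complete domain\<close>

locale complete_domain = scalars K R h + domain R
  for K :: "('k, 'c) ring_scheme" and R :: "('a, 'd) ring_scheme" (structure) and h +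
  fixes I
  assumes ac: "algebraically_closed K" and noeth: "noetherian_ring R"
    and I: "ideal I R" "\<one> \<notin> I" and complete: "adically_complete R I"
begin

abbreviation "ipow n \<equiv> ideal_pow R I n"

text \<open>These are the functionals of the quotient by \<open>ipow n\<close>, read on
  \<open>R\<close>; over all \<open>n\<close> they are the functionals continuous for the adic
  topology.\<close>

definition cont :: "nat \<Rightarrow> ('a \<Rightarrow> 'k) \<Rightarrow> bool" where
  "cont n l \<longleftrightarrow> linf l \<and> (\<forall>x\<in>ipow n. l x = \<zero>\<^bsub>K\<^esub>)"

text \<open>The pair works on two scales: \<open>N\<close> is small deep in the ideal and so
  controls truncation, and \<open>gt\<close> refines \<open>N\<close> where norms agree.\<close>

definition val :: "('a \<Rightarrow> real) \<Rightarrow> ('a \<Rightarrow> 'a \<Rightarrow> bool) \<Rightarrow> bool" where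
  "val N gt \<longleftrightarrow> snorm N \<and> N \<zero> = 0 \<and> (\<forall>x\<in>carrier R. \<forall>y\<in>carrier R. N (x \<otimes> y) = N x * N y)
     \<and> (\<forall>n. \<forall>x\<in>ipow n. N x \<le> (1/2) ^ n) \<and> leading_order N gt"

lemma cont_mono: "cont n l \<Longrightarrow> n \<le> m \<Longrightarrow> cont m l"
  unfolding cont_def using ideal_pow_antimono[OF I(1), of n m] by blast

lemma subsp_ideal: "ideal J R \<Longrightarrow> subsp J"
  unfolding subsp_def using ideal_add ideal_zero ideal.Icarr ideal.I_l_closed by (metis h.hom_closed subsetI)

lemma separate:
  assumes "x \<in> carrier R" "y \<in> carrier R" "\<And>l. cont n l \<Longrightarrow> l x = l y"
  shows "x \<ominus> y \<in> ipow n"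
proof (rule ccontr)
  assume "x \<ominus> y \<notin> ipow n"
  then obtain l where l: "linf l" "\<forall>z\<in>ipow n. l z = \<zero>\<^bsub>K\<^esub>" "l (x \<ominus> y) = \<one>\<^bsub>K\<^esub>"
    using functional_exists[OF subsp_ideal[OF ideal_pow_ideal[OF I(1)]], of "x \<ominus> y" n] assms by auto
  hence "l x = l y" using assms(3) unfolding cont_def by blast
  hence "l (x \<ominus> y) = \<zero>\<^bsub>K\<^esub>" using linf_diff[OF l(1)] linfD(1)[OF l(1)] assms by (simp add: a_minus_def K.r_neg)
  thus False using l by simp
qed

lemma limit_exists:
  assumes a: "\<And>n. a n \<in> carrier R" and cauchy: "\<And>n. a (Suc n) \<ominus> a n \<in> ipow n"
  shows "\<exists>x\<in>carrier R. \<forall>n. x \<ominus> a n \<in> ipow n"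
proof -
  have mem: "x \<in> ipow n +> a n \<longleftrightarrow> x \<ominus> a n \<in> ipow n" if x: "x \<in> carrier R" for x n
  proof
    assume "x \<in> ipow n +> a n"
    then obtain i where i: "i \<in> ipow n" "x = i \<oplus> a n" unfolding a_r_coset_def' by blast
    have "x \<ominus> a n = i" unfolding i(2) using a ideal_pow_carr[OF I(1) i(1)] by algebra
    thus "x \<ominus> a n \<in> ipow n" using i by simp
  next
    assume "x \<ominus> a n \<in> ipow n"
    moreover have "x = (x \<ominus> a n) \<oplus> a n" using x a by algebra
    ultimately show "x \<in> ipow n +> a n" unfolding a_r_coset_def' by blast
  qed
  define U where "U n = ipow n +> a n" for n
  have "U n \<in> carrier (R Quot ipow n)" for n
    unfolding U_def FactRing_def A_RCOSETS_def' using a by auto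
  moreover have "U (Suc n) \<subseteq> U n" for n
  proof
    fix x assume "x \<in> U (Suc n)"
    then obtain i where i: "i \<in> ipow (Suc n)" "x = i \<oplus> a (Suc n)" unfolding U_def a_r_coset_def' by blast
    have ic: "i \<in> carrier R" and ip: "i \<in> ipow n"
      using i ideal_pow_carr[OF I(1)] ideal_pow_Suc_subset[OF I(1)] by auto
    have "x \<ominus> a n = i \<oplus> (a (Suc n) \<ominus> a n)" unfolding i(2) using a ic by algebra
    hence "x \<ominus> a n \<in> ipow n" using ideal_add[OF ideal_pow_ideal[OF I(1)] ip cauchy] by simp
    thus "x \<in> U n" unfolding U_def using mem i(2) ic a by simp
  qed
  ultimately obtain x where "x \<in> carrier R" "\<forall>n. x \<in> U n"
    using complete unfolding adically_complete_def by metis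
  thus ?thesis using mem unfolding U_def by blast
qed

text \<open>This contracts a compatible family of tensors with a functional on the other factor,
  whose values are the scalars \<kappa>. Compatibility is known only through functionals, which by
  \<open>separate\<close> is enough to make the contractions at the successive levels a Cauchy
  sequence; completeness provides the limit.\<close>

lemma represent:
  assumes fin: "\<And>i. finite (P i)" and \<alpha>: "\<And>i p. p \<in> P i \<Longrightarrow> \<alpha> i p \<in> carrier R"
    and \<kappa>: "\<And>i p. p \<in> P i \<Longrightarrow> \<kappa> i p \<in> carrier K"
    and compat: "\<And>i l. cont i l \<Longrightarrow> (\<Oplus>\<^bsub>K\<^esub>p\<in>P (Suc i). l (\<alpha> (Suc i) p) \<otimes>\<^bsub>K\<^esub> \<kappa> (Suc i) p)
        = (\<Oplus>\<^bsub>K\<^esub>p\<in>P i. l (\<alpha> i p) \<otimes>\<^bsub>K\<^esub> \<kappa> i p)"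
  shows "\<exists>a\<in>carrier R. \<forall>i l. cont i l \<longrightarrow> l a = (\<Oplus>\<^bsub>K\<^esub>p\<in>P i. l (\<alpha> i p) \<otimes>\<^bsub>K\<^esub> \<kappa> i p)"
proof -
  define a where "a i = (\<Oplus>p\<in>P i. h (\<kappa> i p) \<otimes> \<alpha> i p)" for i
  have ac: "a i \<in> carrier R" for i unfolding a_def using \<alpha> \<kappa> by (intro finsum_closed) auto
  have la: "l (a i) = (\<Oplus>\<^bsub>K\<^esub>p\<in>P i. l (\<alpha> i p) \<otimes>\<^bsub>K\<^esub> \<kappa> i p)" if "linf l" for l i
  proof -
    have "l (a i) = (\<Oplus>\<^bsub>K\<^esub>p\<in>P i. l (h (\<kappa> i p) \<otimes> \<alpha> i p))"
      unfolding a_def using \<alpha> \<kappa> by (intro linf_finsum[OF that fin]) auto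
    also have "\<dots> = (\<Oplus>\<^bsub>K\<^esub>p\<in>P i. l (\<alpha> i p) \<otimes>\<^bsub>K\<^esub> \<kappa> i p)"
      using \<alpha> \<kappa> linfD[OF that] by (intro K.finsum_cong') (auto simp: K.m_comm)
    finally show ?thesis .
  qed
  have cauchy: "a (Suc i) \<ominus> a i \<in> ipow i" for i
    by (rule separate[OF ac ac]) (use la compat in \<open>auto simp: cont_def\<close>)
  from limit_exists[of a, OF ac this] obtain x
    where x: "x \<in> carrier R" "\<And>n. x \<ominus> a n \<in> ipow n" by auto
  have "l x = l (a i)" if "cont i l" for l i
  proof -
    have "l (x \<ominus> a i) = \<zero>\<^bsub>K\<^esub>" using that x(2) unfolding cont_def by blast
    thus ?thesis using that x(1) ac linf_diff[of l x "a i"] linfD(1)[of l] unfolding cont_def by simp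
  qed
  thus ?thesis using x(1) la unfolding cont_def by metis
qed

lemma val_exists:
  assumes a: "a \<in> carrier R" "a \<noteq> \<zero>"
  shows "\<exists>N gt. val N gt \<and> 0 < N a"
proof -
  obtain N where N: "snorm N" "0 < N a" "N \<one> = 1"
    "\<forall>x\<in>carrier R. \<forall>y\<in>carrier R. N (x \<otimes> y) = N x * N y" "\<forall>n. \<forall>x\<in>ipow n. N x \<le> (1/2) ^ n"
    using multiplicative_adic_norm[OF noeth domain_axioms I a] by blast
  \<comment> \<open>Zero lies in every power of the ideal, so its norm is below every power of
    1/2.\<close>
  have "N \<zero> \<le> (1/2) ^ n" for n using N(5) ideal_zero[OF ideal_pow_ideal[OF I(1)]] by blast
  hence "N \<zero> \<le> 0" by (intro LIMSEQ_le_const[OF LIMSEQ_power_zero[of "1/2::real"]]) auto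
  hence N0: "N \<zero> = 0" using snormD(1)[OF N(1) zero_closed] by simp
  obtain gt where "leading_order N gt" using leading_order_exists[OF ac N(1,3) _ N0] N(4) by blast
  thus ?thesis unfolding val_def using N N0 by blast
qed

section \<open>Echelon families and functionals adapted to a norm with its order\<close>

context
  fixes N gt
  assumes val: "val N gt"
begin

lemma val_snorm: "snorm N" using val unfolding val_def by blast
lemma val_zero: "N \<zero> = 0" using val unfolding val_def by blast
lemma val_nonneg: "x \<in> carrier R \<Longrightarrow> 0 \<le> N x" using snormD(1)[OF val_snorm] .
lemma val_le1: "x \<in> carrier R \<Longrightarrow> N x \<le> 1" using snormD(2)[OF val_snorm] .
lemma val_mult: "x \<in> carrier R \<Longrightarrow> y \<in> carrier R \<Longrightarrow> N (x \<otimes> y) = N x * N y"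
  using val unfolding val_def by blast
lemma val_pow: "x \<in> ipow n \<Longrightarrow> N x \<le> (1/2) ^ n" using val unfolding val_def by blast
lemma val_order: "leading_order N gt" using val unfolding val_def by blast

lemma gt_subsp: "y \<in> carrier R \<Longrightarrow> N y \<noteq> 0 \<Longrightarrow> subsp {x. gt x y}"
  using val_order unfolding leading_order_def by blast
lemma gt_irrefl: "y \<in> carrier R \<Longrightarrow> N y \<noteq> 0 \<Longrightarrow> \<not> gt y y"
  using val_order unfolding leading_order_def by blast
lemma gt_small: "x \<in> carrier R \<Longrightarrow> y \<in> carrier R \<Longrightarrow> N x < N y \<Longrightarrow> gt x y"
proof -
  assume xy: "x \<in> carrier R" "y \<in> carrier R" "N x < N y"
  hence "N y \<noteq> 0" using val_nonneg[of x] by auto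
  thus ?thesis using val_order xy unfolding leading_order_def by blast
qed
lemma gt_trans: "N y \<noteq> 0 \<Longrightarrow> gt x y \<Longrightarrow> gt y z \<Longrightarrow> gt x z"
  using val_order unfolding leading_order_def by blast
lemma gt_mult: "w \<in> carrier R \<Longrightarrow> N w \<noteq> 0 \<Longrightarrow> gt x y \<Longrightarrow> gt (x \<otimes> w) (y \<otimes> w)"
  using val_order unfolding leading_order_def by blast
lemma gt_trichotomy:
  "x \<in> carrier R \<Longrightarrow> y \<in> carrier R \<Longrightarrow> N x \<noteq> 0 \<Longrightarrow> N y \<noteq> 0 \<Longrightarrow>
    gt x y \<or> gt y x \<or> (\<exists>c\<in>carrier K. c \<noteq> \<zero>\<^bsub>K\<^esub> \<and> gt (x \<ominus> h c \<otimes> y) y)"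
  using val_order unfolding leading_order_def by blast

text \<open>The elements of norm below \<open>c\<close> form a subspace that misses
  \<open>a\<close>. It contains a power of the ideal, because the norm tends to 0 along the powers,
  so by \<open>cont_of_threshold\<close> the functional lives at a finite level.\<close>

lemma threshold_functional:
  assumes a: "a \<in> carrier R" and c: "0 < c" "c \<le> N a"
  shows "\<exists>l. linf l \<and> (\<forall>x\<in>carrier R. N x < c \<longrightarrow> l x = \<zero>\<^bsub>K\<^esub>) \<and> l a = \<one>\<^bsub>K\<^esub>"
proof -
  let ?H = "{x \<in> carrier R. N x < c}"
  have "subsp ?H" unfolding subsp_def
  proof (intro conjI ballI)
    show "\<zero> \<in> ?H" using val_zero c by simp
    fix x y assume xy: "x \<in> ?H" "y \<in> ?H"
    hence "N (x \<oplus> y) \<le> max (N x) (N y)" using snormD(4)[OF val_snorm] by simp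
    thus "x \<oplus> y \<in> ?H" using xy by (auto simp: max_def split: if_splits)
  next
    fix d x assume d: "d \<in> carrier K" and x: "x \<in> ?H"
    have "N (h d \<otimes> x) \<le> N x" using snorm_le_left[OF val_snorm, of x "h d"] x d by (simp add: m_comm)
    thus "h d \<otimes> x \<in> ?H" using x d by simp
  qed auto
  from functional_exists[OF this a] obtain l where "linf l" "\<forall>x\<in>?H. l x = \<zero>\<^bsub>K\<^esub>" "l a = \<one>\<^bsub>K\<^esub>"
    using c by auto
  thus ?thesis by blast
qed

lemma cont_of_threshold:
  assumes "linf l" "\<And>x. x \<in> carrier R \<Longrightarrow> N x < c \<Longrightarrow> l x = \<zero>\<^bsub>K\<^esub>" "(1/2) ^ n < c"
  shows "cont n l"
  unfolding cont_def using assms val_pow ideal_pow_carr[OF I(1)] by (meson le_less_trans)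

text \<open>The functionals of the quotient by the kernel of \<open>N\<close>. Threshold functionals
  and leading functionals both are of this kind, and so is their composition with a
  multiplication.\<close>

definition lker :: "('a \<Rightarrow> 'k) \<Rightarrow> bool" where
  "lker l \<longleftrightarrow> linf l \<and> (\<forall>y\<in>carrier R. N y = 0 \<longrightarrow> l y = \<zero>\<^bsub>K\<^esub>)"

text \<open>Membership in the span of \<open>E\<close> modulo the kernel of \<open>N\<close>, tested by functionals.\<close>
definition spanned :: "'a set \<Rightarrow> 'a \<Rightarrow> bool" where
  "spanned E x \<longleftrightarrow> (\<exists>c. (\<forall>e. c e \<in> carrier K) \<and> (\<forall>l. lker l \<longrightarrow> l x = (\<Oplus>\<^bsub>K\<^esub>e\<in>E. c e \<otimes>\<^bsub>K\<^esub> l e)))"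

lemma lker_mult: "lker l \<Longrightarrow> z \<in> carrier R \<Longrightarrow> lker (\<lambda>x. l (x \<otimes> z))"
  unfolding lker_def using linf_mult val_mult by auto

lemma spanned_null:
  assumes "E \<subseteq> carrier R" "x \<in> carrier R" "N x = 0" shows "spanned E x"
  unfolding spanned_def
proof (intro exI[of _ "\<lambda>_. \<zero>\<^bsub>K\<^esub>"] conjI allI impI)
  fix l assume l: "lker l"
  have "(\<Oplus>\<^bsub>K\<^esub>e\<in>E. \<zero>\<^bsub>K\<^esub> \<otimes>\<^bsub>K\<^esub> l e) = (\<Oplus>\<^bsub>K\<^esub>e\<in>E. \<zero>\<^bsub>K\<^esub>)"
    using l assms(1) linfD(1)[of l] unfolding lker_def by (intro K.finsum_cong') auto
  thus "l x = (\<Oplus>\<^bsub>K\<^esub>e\<in>E. \<zero>\<^bsub>K\<^esub> \<otimes>\<^bsub>K\<^esub> l e)" using l assms unfolding lker_def by simp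
qed simp

lemma spanned_mono:
  assumes "finite E'" "E \<subseteq> E'" "E' \<subseteq> carrier R" "spanned E x" shows "spanned E' x"
proof -
  obtain c where c: "\<And>e. c e \<in> carrier K" "\<And>l. lker l \<Longrightarrow> l x = (\<Oplus>\<^bsub>K\<^esub>e\<in>E. c e \<otimes>\<^bsub>K\<^esub> l e)"
    using assms(4) unfolding spanned_def by blast
  let ?c = "\<lambda>e. if e \<in> E then c e else \<zero>\<^bsub>K\<^esub>"
  have "l x = (\<Oplus>\<^bsub>K\<^esub>e\<in>E'. ?c e \<otimes>\<^bsub>K\<^esub> l e)" if l: "lker l" for l
  proof -
    have lc: "l e \<in> carrier K" if "e \<in> E'" for e using l that assms(3) linfD(1)[of l] unfolding lker_def by blast
    have "(\<Oplus>\<^bsub>K\<^esub>e\<in>E'. ?c e \<otimes>\<^bsub>K\<^esub> l e) = (\<Oplus>\<^bsub>K\<^esub>e\<in>E. ?c e \<otimes>\<^bsub>K\<^esub> l e)"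
      using assms lc c(1) by (intro K.finsum_neutral_subset) auto
    also have "\<dots> = (\<Oplus>\<^bsub>K\<^esub>e\<in>E. c e \<otimes>\<^bsub>K\<^esub> l e)"
      using assms lc c(1) by (intro K.finsum_cong') auto
    finally show ?thesis using c(2)[OF l] by simp
  qed
  thus ?thesis unfolding spanned_def using c(1) by (intro exI[of _ ?c]) auto
qed

lemma spanned_add:
  assumes E: "finite E" "E \<subseteq> carrier R" and x: "x \<in> carrier R" "y \<in> carrier R" "spanned E x" "spanned E y"
  shows "spanned E (x \<oplus> y)"
proof -
  obtain c d where c: "\<And>e. c e \<in> carrier K" "\<And>l. lker l \<Longrightarrow> l x = (\<Oplus>\<^bsub>K\<^esub>e\<in>E. c e \<otimes>\<^bsub>K\<^esub> l e)"
    and d: "\<And>e. d e \<in> carrier K" "\<And>l. lker l \<Longrightarrow> l y = (\<Oplus>\<^bsub>K\<^esub>e\<in>E. d e \<otimes>\<^bsub>K\<^esub> l e)"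
    using x unfolding spanned_def by blast
  have "l (x \<oplus> y) = (\<Oplus>\<^bsub>K\<^esub>e\<in>E. (c e \<oplus>\<^bsub>K\<^esub> d e) \<otimes>\<^bsub>K\<^esub> l e)" if l: "lker l" for l
  proof -
    have lc: "l e \<in> carrier K" if "e \<in> E" for e using l that E(2) linfD(1)[of l] unfolding lker_def by blast
    have "(\<Oplus>\<^bsub>K\<^esub>e\<in>E. (c e \<oplus>\<^bsub>K\<^esub> d e) \<otimes>\<^bsub>K\<^esub> l e) = (\<Oplus>\<^bsub>K\<^esub>e\<in>E. c e \<otimes>\<^bsub>K\<^esub> l e \<oplus>\<^bsub>K\<^esub> d e \<otimes>\<^bsub>K\<^esub> l e)"
      using lc c d by (intro K.finsum_cong') (auto simp: K.l_distr)
    also have "\<dots> = l x \<oplus>\<^bsub>K\<^esub> l y" unfolding c(2)[OF l] d(2)[OF l]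
      using lc c d by (intro K.finsum_addf) auto
    finally show ?thesis using l x linfD(2)[of l x y] unfolding lker_def by simp
  qed
  thus ?thesis unfolding spanned_def using c d by (intro exI[of _ "\<lambda>e. c e \<oplus>\<^bsub>K\<^esub> d e"]) auto
qed

lemma spanned_elem:
  assumes E: "finite E" "E \<subseteq> carrier R" and e: "e \<in> E" and d: "d \<in> carrier K"
  shows "spanned E (h d \<otimes> e)"
proof -
  let ?c = "\<lambda>e'. if e' = e then d else \<zero>\<^bsub>K\<^esub>"
  have "l (h d \<otimes> e) = (\<Oplus>\<^bsub>K\<^esub>e'\<in>E. ?c e' \<otimes>\<^bsub>K\<^esub> l e')" if l: "lker l" for l
  proof -
    have lc: "l e \<in> carrier K" if "e \<in> E" for e using l that E(2) linfD(1)[of l] unfolding lker_def by blast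
    have "(\<Oplus>\<^bsub>K\<^esub>e'\<in>E. ?c e' \<otimes>\<^bsub>K\<^esub> l e') = ?c e \<otimes>\<^bsub>K\<^esub> l e"
      using E e d lc by (intro K.finsum_single) auto
    thus ?thesis using l d e E(2) linfD(3)[of l d e] unfolding lker_def by auto
  qed
  thus ?thesis unfolding spanned_def using d by (intro exI[of _ ?c]) auto
qed

text \<open>Distinct members lie in different classes of the order, as in an echelon basis, so their
  leading terms cannot cancel. Norm 0 is excluded because \<open>gt\<close> is controlled only
  against elements of nonzero norm.\<close>

definition indep :: "'a set \<Rightarrow> bool" where
  "indep E \<longleftrightarrow> finite E \<and> E \<subseteq> carrier R \<and> (\<forall>e\<in>E. N e \<noteq> 0)
     \<and> (\<forall>e\<in>E. \<forall>e'\<in>E. e \<noteq> e' \<longrightarrow> gt e e' \<or> gt e' e)"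

text \<open>Gaussian elimination: an element equivalent to a basis vector is replaced by a strictly
  smaller one, which terminates because it exceeds fewer and fewer basis vectors.\<close>
lemma indep_insert:
  assumes E: "indep E"
  shows "x \<in> carrier R \<Longrightarrow> \<exists>E'. indep E' \<and> E \<subseteq> E' \<and> spanned E' x"
proof (induction "card {e \<in> E. \<not> gt x e}" arbitrary: x rule: less_induct)
  case less
  have Ec: "finite E" "E \<subseteq> carrier R" "\<And>e. e \<in> E \<Longrightarrow> N e \<noteq> 0" using E unfolding indep_def by auto
  show ?case
  proof (cases "N x = 0")
    case True
    thus ?thesis using E spanned_null[OF Ec(2) less.prems] by blast
  next
    case x0: False
    show ?thesis
    proof (cases "\<forall>e\<in>E. gt x e \<or> gt e x")
      case True
      have i: "indep (insert x E)" using E True x0 less.prems unfolding indep_def by auto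
      have "spanned (insert x E) (h \<one>\<^bsub>K\<^esub> \<otimes> x)"
        using i unfolding indep_def by (intro spanned_elem) auto
      thus ?thesis using i less.prems by (intro exI[of _ "insert x E"]) auto
    next
      case False
      then obtain e where e: "e \<in> E" "\<not> gt x e" "\<not> gt e x" by blast
      hence ec: "e \<in> carrier R" "N e \<noteq> 0" using Ec by auto
      obtain c where c: "c \<in> carrier K" "gt (x \<ominus> h c \<otimes> e) e"
        using gt_trichotomy[OF less.prems ec(1) x0 ec(2)] e by blast
      let ?z = "x \<ominus> h c \<otimes> e"
      have zc: "?z \<in> carrier R" using less.prems ec c by simp
      \<comment> \<open>\<open>x\<close> and \<open>e\<close> are equivalent, so if \<open>x\<close>
        is beyond \<open>e'\<close> then so is \<open>e\<close>, and with it \<open>?z\<close> by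
        transitivity. The vector \<open>e\<close> itself leaves the set, because \<open>?z\<close>
        is beyond \<open>e\<close> and \<open>x\<close> is not.\<close>
      have "{e' \<in> E. \<not> gt ?z e'} \<subset> {e' \<in> E. \<not> gt x e'}"
      proof
        show "{e' \<in> E. \<not> gt ?z e'} \<subseteq> {e' \<in> E. \<not> gt x e'}"
        proof safe
          fix e' assume e': "e' \<in> E" "\<not> gt ?z e'" "gt x e'"
          have "e' \<noteq> e" using e' e by blast
          hence "gt e e' \<or> gt e' e" using E e e' unfolding indep_def by blast
          moreover have "\<not> gt e' e" using gt_trans[of e' x e] Ec(3)[OF e'(1)] e' e by blast
          ultimately have "gt e e'" by blast
          thus False using gt_trans[OF ec(2) c(2)] e'(2) by blast
        qed
        show "{e' \<in> E. \<not> gt ?z e'} \<noteq> {e' \<in> E. \<not> gt x e'}" using e c by blast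
      qed
      hence "card {e' \<in> E. \<not> gt ?z e'} < card {e' \<in> E. \<not> gt x e'}"
        using Ec(1) by (intro psubset_card_mono) auto
      then obtain E' where E': "indep E'" "E \<subseteq> E'" "spanned E' ?z" using less.hyps zc by blast
      have E'c: "finite E'" "E' \<subseteq> carrier R" using E'(1) unfolding indep_def by auto
      have "spanned E' (?z \<oplus> h c \<otimes> e)"
        using spanned_add[OF E'c zc _ E'(3)] spanned_elem[OF E'c, of e c] e E' c ec by auto
      moreover have "?z \<oplus> h c \<otimes> e = x"
      proof -
        have "(x \<ominus> w) \<oplus> w = x" if "w \<in> carrier R" for w using that less.prems by algebra
        thus ?thesis using c ec by simp
      qed
      ultimately show ?thesis using E' by auto
    qed
  qed
qed

lemma indep_exists:
  assumes "finite Y" "Y \<subseteq> carrier R"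
  shows "\<exists>E. indep E \<and> (\<forall>x\<in>Y. spanned E x)"
  using assms
proof (induction Y rule: finite_induct)
  case empty
  have "indep {}" unfolding indep_def by simp
  thus ?case by blast
next
  case (insert x Y)
  then obtain E where E: "indep E" "\<forall>x\<in>Y. spanned E x" by auto
  obtain E' where E': "indep E'" "E \<subseteq> E'" "spanned E' x" using indep_insert[OF E(1)] insert.prems by blast
  hence "\<forall>y\<in>Y. spanned E' y" using E(2) spanned_mono[of E' E] unfolding indep_def by blast
  thus ?case using E' by blast
qed

text \<open>The elements beyond \<open>x\<close> form a subspace without \<open>x\<close>, so a
  functional separates them. Elements of norm 0 are among them, hence \<open>lker\<close>.\<close>

lemma leading_functional:
  assumes x: "x \<in> carrier R" "N x \<noteq> 0"
  shows "\<exists>l. lker l \<and> (\<forall>y. gt y x \<longrightarrow> l y = \<zero>\<^bsub>K\<^esub>) \<and> l x = \<one>\<^bsub>K\<^esub>"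
proof -
  obtain l where l: "linf l" "\<forall>y\<in>{y. gt y x}. l y = \<zero>\<^bsub>K\<^esub>" "l x = \<one>\<^bsub>K\<^esub>"
    using functional_exists[OF gt_subsp[OF x] x(1)] gt_irrefl[OF x] by auto
  moreover have "lker l" unfolding lker_def
    using l gt_small[OF _ x(1)] x val_nonneg[OF x(1)] by (auto simp: less_le)
  ultimately show ?thesis by blast
qed

end

end

section \<open>Leading terms of tensors\<close>

locale complete_domain_pair = A: complete_domain K A hA I + B: complete_domain K B hB J
  for K :: "('k, 'c) ring_scheme" and A :: "('a, 'd) ring_scheme" and B :: "('b, 'e) ring_scheme"
    and hA hB I J
begin

text \<open>The value of l \<otimes> m at the tensor \<Sum> \<alpha> p \<otimes> \<beta> p, without
  forming a tensor product.\<close>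

definition pairing :: "'x set \<Rightarrow> ('x \<Rightarrow> 'a) \<Rightarrow> ('x \<Rightarrow> 'b) \<Rightarrow> ('a \<Rightarrow> 'k) \<Rightarrow> ('b \<Rightarrow> 'k) \<Rightarrow> 'k" where
  "pairing P \<alpha> \<beta> l m = (\<Oplus>\<^bsub>K\<^esub>p\<in>P. l (\<alpha> p) \<otimes>\<^bsub>K\<^esub> m (\<beta> p))"

context
  fixes N gt N' gt'
  assumes vA: "A.val N gt" and vB: "B.val N' gt'"
begin

text \<open>Expanding both factors in echelon families writes the tensor as a combination of pure
  tensors of their members. The expansions hold only modulo the kernels of the two norms, hence the
  restriction to functionals vanishing there.\<close>

lemma normal_form:
  assumes P: "finite P" "\<alpha> \<in> P \<rightarrow> carrier A" "\<beta> \<in> P \<rightarrow> carrier B"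
  shows "\<exists>E E' C. A.indep N gt E \<and> B.indep N' gt' E' \<and> (\<forall>z. C z \<in> carrier K) \<and>
    (\<forall>l m. A.lker N l \<longrightarrow> B.lker N' m \<longrightarrow>
      pairing P \<alpha> \<beta> l m = (\<Oplus>\<^bsub>K\<^esub>z\<in>E \<times> E'. C z \<otimes>\<^bsub>K\<^esub> (l (fst z) \<otimes>\<^bsub>K\<^esub> m (snd z))))"
proof -
  have "\<exists>E. A.indep N gt E \<and> (\<forall>x\<in>\<alpha> ` P. A.spanned N E x)"
    using P by (intro A.indep_exists[OF vA]) auto
  then obtain E where E: "A.indep N gt E" "\<And>p. p \<in> P \<Longrightarrow> A.spanned N E (\<alpha> p)" by blast
  have "\<exists>E'. B.indep N' gt' E' \<and> (\<forall>x\<in>\<beta> ` P. B.spanned N' E' x)"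
    using P by (intro B.indep_exists[OF vB]) auto
  then obtain E' where E': "B.indep N' gt' E'" "\<And>p. p \<in> P \<Longrightarrow> B.spanned N' E' (\<beta> p)" by blast
  have fE: "finite E" "E \<subseteq> carrier A" using E(1) unfolding A.indep_def[OF vA] by auto
  have fE': "finite E'" "E' \<subseteq> carrier B" using E'(1) unfolding B.indep_def[OF vB] by auto
  have "\<forall>p\<in>P. \<exists>c. (\<forall>e. c e \<in> carrier K) \<and> (\<forall>l. A.lker N l \<longrightarrow> l (\<alpha> p) = (\<Oplus>\<^bsub>K\<^esub>e\<in>E. c e \<otimes>\<^bsub>K\<^esub> l e))"
    using E(2) unfolding A.spanned_def[OF vA] by blast
  then obtain c where c: "\<forall>p\<in>P. (\<forall>e. c p e \<in> carrier K) \<and>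
      (\<forall>l. A.lker N l \<longrightarrow> l (\<alpha> p) = (\<Oplus>\<^bsub>K\<^esub>e\<in>E. c p e \<otimes>\<^bsub>K\<^esub> l e))" by (rule bchoice[THEN exE])
  have "\<forall>p\<in>P. \<exists>c. (\<forall>e. c e \<in> carrier K) \<and> (\<forall>l. B.lker N' l \<longrightarrow> l (\<beta> p) = (\<Oplus>\<^bsub>K\<^esub>e\<in>E'. c e \<otimes>\<^bsub>K\<^esub> l e))"
    using E'(2) unfolding B.spanned_def[OF vB] by blast
  then obtain d where d: "\<forall>p\<in>P. (\<forall>e. d p e \<in> carrier K) \<and>
      (\<forall>l. B.lker N' l \<longrightarrow> l (\<beta> p) = (\<Oplus>\<^bsub>K\<^esub>e\<in>E'. d p e \<otimes>\<^bsub>K\<^esub> l e))" by (rule bchoice[THEN exE])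
  have cc: "c p e \<in> carrier K" "d p e' \<in> carrier K" if "p \<in> P" for p e e' using c d that by auto
  define C where "C z = (\<Oplus>\<^bsub>K\<^esub>p\<in>P. c p (fst z) \<otimes>\<^bsub>K\<^esub> d p (snd z))" for z
  have CK: "C z \<in> carrier K" for z unfolding C_def using cc by (intro A.K.finsum_closed) auto
  have "pairing P \<alpha> \<beta> l m = (\<Oplus>\<^bsub>K\<^esub>z\<in>E \<times> E'. C z \<otimes>\<^bsub>K\<^esub> (l (fst z) \<otimes>\<^bsub>K\<^esub> m (snd z)))"
    if l: "A.lker N l" and m: "B.lker N' m" for l m
  proof -
    have lE: "l e \<in> carrier K" if "e \<in> E" for e
      using l fE(2) that A.linfD(1)[of l] unfolding A.lker_def[OF vA] by blast
    have mE: "m e \<in> carrier K" if "e \<in> E'" for e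
      using m fE'(2) that B.linfD(1)[of m] unfolding B.lker_def[OF vB] by blast
    have lm: "l (fst z) \<otimes>\<^bsub>K\<^esub> m (snd z) \<in> carrier K" if "z \<in> E \<times> E'" for z using that lE mE by auto
    have one: "l (\<alpha> p) \<otimes>\<^bsub>K\<^esub> m (\<beta> p) = (\<Oplus>\<^bsub>K\<^esub>z\<in>E \<times> E'. (c p (fst z) \<otimes>\<^bsub>K\<^esub> d p (snd z)) \<otimes>\<^bsub>K\<^esub> (l (fst z) \<otimes>\<^bsub>K\<^esub> m (snd z)))"
      if p: "p \<in> P" for p
    proof -
      have "l (\<alpha> p) \<otimes>\<^bsub>K\<^esub> m (\<beta> p) = (\<Oplus>\<^bsub>K\<^esub>e\<in>E. c p e \<otimes>\<^bsub>K\<^esub> l e) \<otimes>\<^bsub>K\<^esub> (\<Oplus>\<^bsub>K\<^esub>e\<in>E'. d p e \<otimes>\<^bsub>K\<^esub> m e)"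
        using c d p l m by auto
      also have "\<dots> = (\<Oplus>\<^bsub>K\<^esub>z\<in>E \<times> E'. (c p (fst z) \<otimes>\<^bsub>K\<^esub> l (fst z)) \<otimes>\<^bsub>K\<^esub> (d p (snd z) \<otimes>\<^bsub>K\<^esub> m (snd z)))"
        using fE fE' lE mE cc[OF p] by (intro A.K.finsum_times) auto
      also have "\<dots> = (\<Oplus>\<^bsub>K\<^esub>z\<in>E \<times> E'. (c p (fst z) \<otimes>\<^bsub>K\<^esub> d p (snd z)) \<otimes>\<^bsub>K\<^esub> (l (fst z) \<otimes>\<^bsub>K\<^esub> m (snd z)))"
        using lE mE cc[OF p] by (intro A.K.finsum_cong') (auto simp: A.K.m_ac)
      finally show ?thesis .
    qed
    have "pairing P \<alpha> \<beta> l m = (\<Oplus>\<^bsub>K\<^esub>p\<in>P. \<Oplus>\<^bsub>K\<^esub>z\<in>E \<times> E'. (c p (fst z) \<otimes>\<^bsub>K\<^esub> d p (snd z)) \<otimes>\<^bsub>K\<^esub> (l (fst z) \<otimes>\<^bsub>K\<^esub> m (snd z)))"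
      unfolding pairing_def
      by (intro A.K.finsum_cong' refl Pi_I A.K.finsum_closed A.K.m_closed one) (use cc lE mE in auto)
    also have "\<dots> = (\<Oplus>\<^bsub>K\<^esub>z\<in>E \<times> E'. \<Oplus>\<^bsub>K\<^esub>p\<in>P. (c p (fst z) \<otimes>\<^bsub>K\<^esub> d p (snd z)) \<otimes>\<^bsub>K\<^esub> (l (fst z) \<otimes>\<^bsub>K\<^esub> m (snd z)))"
      using P(1) fE(1) fE'(1) cc lE mE by (intro A.K.finsum_swap A.K.m_closed) auto
    also have "\<dots> = (\<Oplus>\<^bsub>K\<^esub>z\<in>E \<times> E'. C z \<otimes>\<^bsub>K\<^esub> (l (fst z) \<otimes>\<^bsub>K\<^esub> m (snd z)))"
    proof (rule A.K.finsum_cong'[OF refl])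
      show "(\<lambda>z. C z \<otimes>\<^bsub>K\<^esub> (l (fst z) \<otimes>\<^bsub>K\<^esub> m (snd z))) \<in> E \<times> E' \<rightarrow> carrier K"
        using CK lm by auto
      fix z assume z: "z \<in> E \<times> E'"
      show "(\<Oplus>\<^bsub>K\<^esub>p\<in>P. (c p (fst z) \<otimes>\<^bsub>K\<^esub> d p (snd z)) \<otimes>\<^bsub>K\<^esub> (l (fst z) \<otimes>\<^bsub>K\<^esub> m (snd z))) = C z \<otimes>\<^bsub>K\<^esub> (l (fst z) \<otimes>\<^bsub>K\<^esub> m (snd z))"
        unfolding C_def using P(1) cc lm[OF z] by (intro A.K.finsum_ldistr[symmetric]) auto
    qed
    finally show ?thesis .
  qed
  thus ?thesis using E(1) E'(1) CK by blast
qed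

definition size :: "'a \<times> 'b \<Rightarrow> real" where "size z = N (fst z) * N' (snd z)"

text \<open>Lexicographic: the product of the norms first, then the two orders to break ties. The
  real size comes first because it is multiplicative and comparable with thresholds; the orders
  alone would not control the norms of the leading term.\<close>

definition before :: "'a \<times> 'b \<Rightarrow> 'a \<times> 'b \<Rightarrow> bool" where
  "before a b \<longleftrightarrow> size b < size a \<or> (size a = size b \<and>
     (gt (fst b) (fst a) \<or> (fst a = fst b \<and> gt' (snd b) (snd a))))"

lemma leading_term:
  assumes E: "A.indep N gt E" "B.indep N' gt' E'" and Z: "Z \<subseteq> E \<times> E'" "Z \<noteq> {}"
  shows "\<exists>m\<in>Z. \<forall>z\<in>Z. z \<noteq> m \<longrightarrow> before m z"
proof (rule finite_total_has_least)
  have e: "finite E" "finite E'" "\<And>x. x \<in> E \<Longrightarrow> N x \<noteq> 0" "\<And>x. x \<in> E' \<Longrightarrow> N' x \<noteq> 0"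
    "\<And>x y. x \<in> E \<Longrightarrow> y \<in> E \<Longrightarrow> x \<noteq> y \<Longrightarrow> gt x y \<or> gt y x"
    "\<And>x y. x \<in> E' \<Longrightarrow> y \<in> E' \<Longrightarrow> x \<noteq> y \<Longrightarrow> gt' x y \<or> gt' y x"
    using E unfolding A.indep_def[OF vA] B.indep_def[OF vB] by auto
  show "finite Z" using Z e finite_subset by blast
  show "Z \<noteq> {}" by fact
  fix x y assume xy: "x \<in> Z" "y \<in> Z"
  hence m: "fst x \<in> E" "snd x \<in> E'" "fst y \<in> E" "snd y \<in> E'" using Z by auto
  show "before x y \<or> before y x" if "x \<noteq> y"
  proof (cases "size x = size y")
    case True
    show ?thesis
    proof (cases "fst x = fst y")
      case t: True
      hence "snd x \<noteq> snd y" using that by (simp add: prod_eq_iff)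
      thus ?thesis unfolding before_def using e(6)[OF m(2,4)] True t by auto
    next
      case False
      thus ?thesis unfolding before_def using e(5)[OF m(1,3)] True by auto
    qed
  next
    case False
    thus ?thesis unfolding before_def by auto
  qed
  fix z assume "z \<in> Z" and b: "before x y" "before y z"
  have t1: "gt (fst z) (fst y) \<Longrightarrow> gt (fst y) (fst x) \<Longrightarrow> gt (fst z) (fst x)"
    using A.gt_trans[OF vA e(3)[OF m(3)]] by blast
  have t2: "gt' (snd z) (snd y) \<Longrightarrow> gt' (snd y) (snd x) \<Longrightarrow> gt' (snd z) (snd x)"
    using B.gt_trans[OF vB e(4)[OF m(4)]] by blast
  show "before x z"
  proof (cases "size x = size y \<and> size y = size z")
    case False
    hence "size z < size x" using b unfolding before_def by auto
    thus ?thesis unfolding before_def by blast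
  next
    case True
    thus ?thesis using b t1 t2 unfolding before_def by auto
  qed
qed

lemma gt_mult_both:
  assumes "x \<in> carrier A" "y \<in> carrier A" "x0 \<in> carrier A" "y0 \<in> carrier A"
    "N x \<noteq> 0" "N y \<noteq> 0" "N x0 \<noteq> 0" "N y0 \<noteq> 0"
    "x = x0 \<or> gt x x0" "y = y0 \<or> gt y y0" "gt x x0 \<or> gt y y0"
  shows "gt (x \<otimes>\<^bsub>A\<^esub> y) (x0 \<otimes>\<^bsub>A\<^esub> y0)"
proof -
  have 1: "gt (x \<otimes>\<^bsub>A\<^esub> y) (x0 \<otimes>\<^bsub>A\<^esub> y)" if "gt x x0" using A.gt_mult[OF vA assms(2,6) that] .
  have 2: "gt (x0 \<otimes>\<^bsub>A\<^esub> y) (x0 \<otimes>\<^bsub>A\<^esub> y0)" if "gt y y0"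
    using A.gt_mult[OF vA assms(3,7) that] assms by (simp add: A.m_comm)
  have nz: "N (x0 \<otimes>\<^bsub>A\<^esub> y) \<noteq> 0" using A.val_mult[OF vA] assms by simp
  show ?thesis using 1 2 A.gt_trans[OF vA nz] assms(9-11) by blast
qed

lemma gt_mult_both':
  assumes "x \<in> carrier B" "y \<in> carrier B" "x0 \<in> carrier B" "y0 \<in> carrier B"
    "N' x \<noteq> 0" "N' y \<noteq> 0" "N' x0 \<noteq> 0" "N' y0 \<noteq> 0"
    "x = x0 \<or> gt' x x0" "y = y0 \<or> gt' y y0" "gt' x x0 \<or> gt' y y0"
  shows "gt' (x \<otimes>\<^bsub>B\<^esub> y) (x0 \<otimes>\<^bsub>B\<^esub> y0)"
proof -
  have 1: "gt' (x \<otimes>\<^bsub>B\<^esub> y) (x0 \<otimes>\<^bsub>B\<^esub> y)" if "gt' x x0" using B.gt_mult[OF vB assms(2,6) that] .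
  have 2: "gt' (x0 \<otimes>\<^bsub>B\<^esub> y) (x0 \<otimes>\<^bsub>B\<^esub> y0)" if "gt' y y0"
    using B.gt_mult[OF vB assms(3,7) that] assms by (simp add: B.m_comm)
  have nz: "N' (x0 \<otimes>\<^bsub>B\<^esub> y) \<noteq> 0" using B.val_mult[OF vB] assms by simp
  show ?thesis using 1 2 B.gt_trans[OF vB nz] assms(9-11) by blast
qed

text \<open>A pair of functionals kills a pure tensor through either factor, so it is enough that
  one factor falls beyond the leading one. A drop in total size forces a drop in one of the norms.
  With equal sizes the tie-breaking orders drop in the first factor or, where the first components
  agree, in the second.\<close>

lemma gt_product:
  assumes z: "z = z0 \<or> before z0 z" and w: "w = w0 \<or> before w0 w" and ne: "(z, w) \<noteq> (z0, w0)"
    and cA: "\<And>u. u \<in> {z, z0, w, w0} \<Longrightarrow> fst u \<in> carrier A \<and> N (fst u) \<noteq> 0"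
    and cB: "\<And>u. u \<in> {z, z0, w, w0} \<Longrightarrow> snd u \<in> carrier B \<and> N' (snd u) \<noteq> 0"
  shows "gt (fst z \<otimes>\<^bsub>A\<^esub> fst w) (fst z0 \<otimes>\<^bsub>A\<^esub> fst w0) \<or> gt' (snd z \<otimes>\<^bsub>B\<^esub> snd w) (snd z0 \<otimes>\<^bsub>B\<^esub> snd w0)"
proof -
  have pos: "0 < N (fst u)" "0 < N' (snd u)" if "u \<in> {z, z0, w, w0}" for u
    using cA[OF that] cB[OF that] A.val_nonneg[OF vA] B.val_nonneg[OF vB] by (simp_all add: less_le)
  have spos: "0 < size u" if "u \<in> {z, z0, w, w0}" for u
    unfolding size_def using pos[OF that] by simp
  have cAz: "fst z \<otimes>\<^bsub>A\<^esub> fst w \<in> carrier A" and cAz0: "fst z0 \<otimes>\<^bsub>A\<^esub> fst w0 \<in> carrier A"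
    using cA by simp_all
  have cBz: "snd z \<otimes>\<^bsub>B\<^esub> snd w \<in> carrier B" and cBz0: "snd z0 \<otimes>\<^bsub>B\<^esub> snd w0 \<in> carrier B"
    using cB by simp_all
  have sz: "size z \<le> size z0" "size w \<le> size w0" using z w unfolding before_def by auto
  show ?thesis
  proof (cases "size z = size z0 \<and> size w = size w0")
    case False
    hence "size z * size w < size z0 * size w0"
    proof (cases "size z < size z0")
      case True
      thus ?thesis using sz spos[of w] spos[of z0] spos[of z] by (intro mult_less_le_imp_less) auto
    next
      case f: False
      hence "size w < size w0" using False sz by auto
      thus ?thesis using sz spos[of w] spos[of z0] spos[of z] by (intro mult_le_less_imp_less) auto
    qed
    hence "N (fst z \<otimes>\<^bsub>A\<^esub> fst w) * N' (snd z \<otimes>\<^bsub>B\<^esub> snd w) < N (fst z0 \<otimes>\<^bsub>A\<^esub> fst w0) * N' (snd z0 \<otimes>\<^bsub>B\<^esub> snd w0)"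
      using A.val_mult[OF vA] B.val_mult[OF vB] cA cB unfolding size_def by (simp add: mult_ac)
    hence "N (fst z \<otimes>\<^bsub>A\<^esub> fst w) < N (fst z0 \<otimes>\<^bsub>A\<^esub> fst w0) \<or> N' (snd z \<otimes>\<^bsub>B\<^esub> snd w) < N' (snd z0 \<otimes>\<^bsub>B\<^esub> snd w0)"
    proof (rule contrapos_pp)
      assume "\<not> (N (fst z \<otimes>\<^bsub>A\<^esub> fst w) < N (fst z0 \<otimes>\<^bsub>A\<^esub> fst w0) \<or> N' (snd z \<otimes>\<^bsub>B\<^esub> snd w) < N' (snd z0 \<otimes>\<^bsub>B\<^esub> snd w0))"
      hence "N (fst z0 \<otimes>\<^bsub>A\<^esub> fst w0) * N' (snd z0 \<otimes>\<^bsub>B\<^esub> snd w0) \<le> N (fst z \<otimes>\<^bsub>A\<^esub> fst w) * N' (snd z \<otimes>\<^bsub>B\<^esub> snd w)"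
        using A.val_nonneg[OF vA cAz] B.val_nonneg[OF vB cBz0] by (intro mult_mono) auto
      thus "\<not> N (fst z \<otimes>\<^bsub>A\<^esub> fst w) * N' (snd z \<otimes>\<^bsub>B\<^esub> snd w) < N (fst z0 \<otimes>\<^bsub>A\<^esub> fst w0) * N' (snd z0 \<otimes>\<^bsub>B\<^esub> snd w0)"
        by simp
    qed
    thus ?thesis using A.gt_small[OF vA cAz cAz0] B.gt_small[OF vB cBz cBz0] by blast
  next
    case True
    have z1: "fst z = fst z0 \<or> gt (fst z) (fst z0)" and w1: "fst w = fst w0 \<or> gt (fst w) (fst w0)"
      using z w True unfolding before_def by auto
    show ?thesis
    proof (cases "gt (fst z) (fst z0) \<or> gt (fst w) (fst w0)")
      case g: True
      show ?thesis using gt_mult_both[OF _ _ _ _ _ _ _ _ z1 w1 g] cA by auto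
    next
      case False
      hence f: "fst z = fst z0" "fst w = fst w0" using z1 w1 by auto
      have z2: "snd z = snd z0 \<or> gt' (snd z) (snd z0)" and w2: "snd w = snd w0 \<or> gt' (snd w) (snd w0)"
        using z w True False unfolding before_def by auto
      have g: "gt' (snd z) (snd z0) \<or> gt' (snd w) (snd w0)"
        using ne f z2 w2 by (auto simp: prod_eq_iff)
      show ?thesis using gt_mult_both'[OF _ _ _ _ _ _ _ _ z2 w2 g] cB by auto
    qed
  qed
qed

text \<open>A pairing with thresholds \<open>c\<close> and \<open>c'\<close> can be nonzero only
  through a term whose components have norms at least \<open>c\<close> and \<open>c'\<close>. The
  leading term is at least as large as that one. Restricting the normal form to its nonzero
  coefficients makes the leading coefficient nonzero.\<close>

lemma leading_decomposition:
  assumes P: "finite P" "\<alpha> \<in> P \<rightarrow> carrier A" "\<beta> \<in> P \<rightarrow> carrier B"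
    and c: "0 < c" "0 < c'"
    and l: "A.linf l" "\<forall>x\<in>carrier A. N x < c \<longrightarrow> l x = \<zero>\<^bsub>K\<^esub>"
    and m: "B.linf m" "\<forall>x\<in>carrier B. N' x < c' \<longrightarrow> m x = \<zero>\<^bsub>K\<^esub>"
    and nz: "pairing P \<alpha> \<beta> l m \<noteq> \<zero>\<^bsub>K\<^esub>"
  shows "\<exists>Z C z0. finite Z \<and> z0 \<in> Z \<and> (\<forall>z\<in>Z. fst z \<in> carrier A \<and> N (fst z) \<noteq> 0)
    \<and> (\<forall>z\<in>Z. snd z \<in> carrier B \<and> N' (snd z) \<noteq> 0) \<and> (\<forall>z. C z \<in> carrier K) \<and> C z0 \<noteq> \<zero>\<^bsub>K\<^esub>
    \<and> (\<forall>z\<in>Z. z = z0 \<or> before z0 z) \<and> c * c' \<le> size z0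
    \<and> (\<forall>l m. A.lker N l \<longrightarrow> B.lker N' m \<longrightarrow>
      pairing P \<alpha> \<beta> l m = (\<Oplus>\<^bsub>K\<^esub>z\<in>Z. C z \<otimes>\<^bsub>K\<^esub> (l (fst z) \<otimes>\<^bsub>K\<^esub> m (snd z))))"
proof -
  obtain E E' C where E: "A.indep N gt E" "B.indep N' gt' E'" and C: "\<And>z. C z \<in> carrier K"
    and nf: "\<And>l m. A.lker N l \<Longrightarrow> B.lker N' m \<Longrightarrow>
      pairing P \<alpha> \<beta> l m = (\<Oplus>\<^bsub>K\<^esub>z\<in>E \<times> E'. C z \<otimes>\<^bsub>K\<^esub> (l (fst z) \<otimes>\<^bsub>K\<^esub> m (snd z)))"
    using normal_form[OF P] by blast
  have eA: "finite E" "\<And>x. x \<in> E \<Longrightarrow> x \<in> carrier A \<and> N x \<noteq> 0" using E(1) unfolding A.indep_def[OF vA] by auto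
  have eB: "finite E'" "\<And>x. x \<in> E' \<Longrightarrow> x \<in> carrier B \<and> N' x \<noteq> 0" using E(2) unfolding B.indep_def[OF vB] by auto
  define Z where "Z = {z \<in> E \<times> E'. C z \<noteq> \<zero>\<^bsub>K\<^esub>}"
  have fZ: "finite Z" "Z \<subseteq> E \<times> E'" using eA eB unfolding Z_def by auto
  have lA: "l x \<in> carrier K" if "A.lker N l" "x \<in> E" for l x
    using that eA(2) A.linfD(1)[of l x] unfolding A.lker_def[OF vA] by blast
  have mB: "m x \<in> carrier K" if "B.lker N' m" "x \<in> E'" for m x
    using that eB(2) B.linfD(1)[of m x] unfolding B.lker_def[OF vB] by blast
  have nf': "pairing P \<alpha> \<beta> l m = (\<Oplus>\<^bsub>K\<^esub>z\<in>Z. C z \<otimes>\<^bsub>K\<^esub> (l (fst z) \<otimes>\<^bsub>K\<^esub> m (snd z)))"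
    if lm: "A.lker N l" "B.lker N' m" for l m
    unfolding nf[OF lm]
  proof (rule A.K.finsum_neutral_subset)
    show "finite (E \<times> E')" using eA eB by auto
    show "Z \<subseteq> E \<times> E'" by fact
  next
    fix j assume "j \<in> Z"
    hence "fst j \<in> E" "snd j \<in> E'" using fZ by auto
    thus "C j \<otimes>\<^bsub>K\<^esub> (l (fst j) \<otimes>\<^bsub>K\<^esub> m (snd j)) \<in> carrier K" using C lA[OF lm(1)] mB[OF lm(2)] by simp
  next
    fix j assume "j \<in> E \<times> E' - Z"
    hence "fst j \<in> E" "snd j \<in> E'" "C j = \<zero>\<^bsub>K\<^esub>" unfolding Z_def by auto
    thus "C j \<otimes>\<^bsub>K\<^esub> (l (fst j) \<otimes>\<^bsub>K\<^esub> m (snd j)) = \<zero>\<^bsub>K\<^esub>" using lA[OF lm(1)] mB[OF lm(2)] by simp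
  qed
  have lk: "A.lker N l" "B.lker N' m" using l m c unfolding A.lker_def[OF vA] B.lker_def[OF vB] by auto
  obtain z where z: "z \<in> Z" "C z \<otimes>\<^bsub>K\<^esub> (l (fst z) \<otimes>\<^bsub>K\<^esub> m (snd z)) \<noteq> \<zero>\<^bsub>K\<^esub>"
    using A.K.finsum_nonzero_term nz unfolding nf'[OF lk] by blast
  have zE: "fst z \<in> E" "snd z \<in> E'" using z(1) fZ by auto
  have "l (fst z) \<noteq> \<zero>\<^bsub>K\<^esub>" "m (snd z) \<noteq> \<zero>\<^bsub>K\<^esub>"
    using z(2) C[of z] lA[OF lk(1) zE(1)] mB[OF lk(2) zE(2)] by auto
  hence "c \<le> N (fst z)" "c' \<le> N' (snd z)" using l(2) m(2) eA(2)[OF zE(1)] eB(2)[OF zE(2)] not_le by blast+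
  hence zc: "c * c' \<le> size z" unfolding size_def using c by (intro mult_mono) auto
  obtain z0 where z0: "z0 \<in> Z" "\<And>z. z \<in> Z \<Longrightarrow> z \<noteq> z0 \<Longrightarrow> before z0 z"
    using leading_term[OF E fZ(2)] z(1) by blast
  have "size z \<le> size z0" using z0(2)[OF z(1)] unfolding before_def by (cases "z = z0") auto
  hence "c * c' \<le> size z0" using zc by simp
  moreover have "\<forall>z\<in>Z. fst z \<in> carrier A \<and> N (fst z) \<noteq> 0" "\<forall>z\<in>Z. snd z \<in> carrier B \<and> N' (snd z) \<noteq> 0"
    using fZ(2) eA(2) eB(2) by auto
  moreover have "C z0 \<noteq> \<zero>\<^bsub>K\<^esub>" using z0(1) unfolding Z_def by blast
  ultimately show ?thesis using fZ(1) z0 C nf' by (intro exI[of _ Z] exI[of _ C] exI[of _ z0]) blast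
qed

text \<open>The sum over \<open>q\<close> is the value of t \<otimes> u at the product of the two
  tensors. With \<open>t\<close> and \<open>u\<close> the leading functionals of the components of
  the product of the leading terms, every other pair of terms is killed and the two leading
  coefficients multiply. The size of that product is at least \<open>(c * c') ^ 2\<close>; since
  both norms are at most 1, this bounds each of them from below and turns \<open>t\<close> and
  \<open>u\<close> into threshold functionals.\<close>

lemma product_detected:
  assumes P: "finite P" "\<alpha> \<in> P \<rightarrow> carrier A" "\<beta> \<in> P \<rightarrow> carrier B"
    and Q: "finite Q" "\<gamma> \<in> Q \<rightarrow> carrier A" "\<delta> \<in> Q \<rightarrow> carrier B"
    and c: "0 < c" "0 < c'"
    and l: "A.linf l" "\<forall>x\<in>carrier A. N x < c \<longrightarrow> l x = \<zero>\<^bsub>K\<^esub>"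
    and m: "B.linf m" "\<forall>x\<in>carrier B. N' x < c' \<longrightarrow> m x = \<zero>\<^bsub>K\<^esub>"
    and l': "A.linf l'" "\<forall>x\<in>carrier A. N x < c \<longrightarrow> l' x = \<zero>\<^bsub>K\<^esub>"
    and m': "B.linf m'" "\<forall>x\<in>carrier B. N' x < c' \<longrightarrow> m' x = \<zero>\<^bsub>K\<^esub>"
    and nz: "pairing P \<alpha> \<beta> l m \<noteq> \<zero>\<^bsub>K\<^esub>" "pairing Q \<gamma> \<delta> l' m' \<noteq> \<zero>\<^bsub>K\<^esub>"
  shows "\<exists>t u. A.linf t \<and> B.linf u \<and> (\<forall>x\<in>carrier A. N x < (c * c') ^ 2 \<longrightarrow> t x = \<zero>\<^bsub>K\<^esub>)
    \<and> (\<forall>x\<in>carrier B. N' x < (c * c') ^ 2 \<longrightarrow> u x = \<zero>\<^bsub>K\<^esub>)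
    \<and> (\<Oplus>\<^bsub>K\<^esub>q\<in>Q. pairing P \<alpha> \<beta> (\<lambda>x. t (x \<otimes>\<^bsub>A\<^esub> \<gamma> q)) (\<lambda>x. u (x \<otimes>\<^bsub>B\<^esub> \<delta> q))) \<noteq> \<zero>\<^bsub>K\<^esub>"
proof -
  obtain Z C z0 where Z: "finite Z" "z0 \<in> Z" "\<forall>z\<in>Z. fst z \<in> carrier A \<and> N (fst z) \<noteq> 0"
    "\<forall>z\<in>Z. snd z \<in> carrier B \<and> N' (snd z) \<noteq> 0" "\<forall>z. C z \<in> carrier K" "C z0 \<noteq> \<zero>\<^bsub>K\<^esub>"
    "\<forall>z\<in>Z. z = z0 \<or> before z0 z" "c * c' \<le> size z0"
    and nfZ: "\<forall>l m. A.lker N l \<longrightarrow> B.lker N' m \<longrightarrow>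
      pairing P \<alpha> \<beta> l m = (\<Oplus>\<^bsub>K\<^esub>z\<in>Z. C z \<otimes>\<^bsub>K\<^esub> (l (fst z) \<otimes>\<^bsub>K\<^esub> m (snd z)))"
    using leading_decomposition[OF P c l m nz(1)] by (elim exE conjE) rule
  obtain W D w0 where W: "finite W" "w0 \<in> W" "\<forall>z\<in>W. fst z \<in> carrier A \<and> N (fst z) \<noteq> 0"
    "\<forall>z\<in>W. snd z \<in> carrier B \<and> N' (snd z) \<noteq> 0" "\<forall>z. D z \<in> carrier K" "D w0 \<noteq> \<zero>\<^bsub>K\<^esub>"
    "\<forall>z\<in>W. z = w0 \<or> before w0 z" "c * c' \<le> size w0"
    and nfW: "\<forall>l m. A.lker N l \<longrightarrow> B.lker N' m \<longrightarrow>
      pairing Q \<gamma> \<delta> l m = (\<Oplus>\<^bsub>K\<^esub>z\<in>W. D z \<otimes>\<^bsub>K\<^esub> (l (fst z) \<otimes>\<^bsub>K\<^esub> m (snd z)))"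
    using leading_decomposition[OF Q c l' m' nz(2)] by (elim exE conjE) rule
  define x0 where "x0 = fst z0 \<otimes>\<^bsub>A\<^esub> fst w0"
  define y0 where "y0 = snd z0 \<otimes>\<^bsub>B\<^esub> snd w0"
  have z0c: "fst z0 \<in> carrier A" "N (fst z0) \<noteq> 0" "snd z0 \<in> carrier B" "N' (snd z0) \<noteq> 0" using Z(2-4) by auto
  have w0c: "fst w0 \<in> carrier A" "N (fst w0) \<noteq> 0" "snd w0 \<in> carrier B" "N' (snd w0) \<noteq> 0" using W(2-4) by auto
  have x0: "x0 \<in> carrier A" "N x0 \<noteq> 0" "N x0 = N (fst z0) * N (fst w0)"
    using z0c w0c A.val_mult[OF vA] unfolding x0_def by auto
  have y0: "y0 \<in> carrier B" "N' y0 \<noteq> 0" "N' y0 = N' (snd z0) * N' (snd w0)"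
    using z0c w0c B.val_mult[OF vB] unfolding y0_def by auto
  have "(c * c') ^ 2 \<le> size z0 * size w0"
  proof -
    have "0 < c * c'" using c by simp
    thus ?thesis unfolding power2_eq_square using Z(8) W(8) by (intro mult_mono) linarith+
  qed
  also have "\<dots> = N x0 * N' y0" unfolding size_def x0(3) y0(3) by (simp add: mult_ac)
  finally have big: "(c * c') ^ 2 \<le> N x0 * N' y0" .
  have bx: "(c * c') ^ 2 \<le> N x0"
    using big A.val_nonneg[OF vA x0(1)] B.val_le1[OF vB y0(1)] mult_left_le[of "N' y0" "N x0"] by linarith
  have byy: "(c * c') ^ 2 \<le> N' y0"
    using big B.val_nonneg[OF vB y0(1)] A.val_le1[OF vA x0(1)] mult_right_le_one_le[of "N' y0" "N x0"]
      A.val_nonneg[OF vA x0(1)] by (simp add: mult.commute)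
  obtain t where t: "A.lker N t" "\<forall>y. gt y x0 \<longrightarrow> t y = \<zero>\<^bsub>K\<^esub>" "t x0 = \<one>\<^bsub>K\<^esub>"
    using A.leading_functional[OF vA x0(1,2)] by blast
  obtain u where u: "B.lker N' u" "\<forall>y. gt' y y0 \<longrightarrow> u y = \<zero>\<^bsub>K\<^esub>" "u y0 = \<one>\<^bsub>K\<^esub>"
    using B.leading_functional[OF vB y0(1,2)] by blast
  have tl: "A.linf t" and ul: "B.linf u" using t u unfolding A.lker_def[OF vA] B.lker_def[OF vB] by auto
  have tc: "t x \<in> carrier K" if "x \<in> carrier A" for x by (rule A.linfD(1)[OF tl that])
  have uc: "u x \<in> carrier K" if "x \<in> carrier B" for x by (rule B.linfD(1)[OF ul that])
  let ?f = "\<lambda>z w. t (fst z \<otimes>\<^bsub>A\<^esub> fst w) \<otimes>\<^bsub>K\<^esub> u (snd z \<otimes>\<^bsub>B\<^esub> snd w)"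
  have fc: "?f z w \<in> carrier K" if "z \<in> Z" "w \<in> W" for z w using that Z W tc uc by auto
  have kill: "?f z w = \<zero>\<^bsub>K\<^esub>" if zw: "z \<in> Z" "w \<in> W" "(z, w) \<noteq> (z0, w0)" for z w
  proof -
    have "gt (fst z \<otimes>\<^bsub>A\<^esub> fst w) x0 \<or> gt' (snd z \<otimes>\<^bsub>B\<^esub> snd w) y0"
      unfolding x0_def y0_def using zw Z(2-4,7) W(2-4,7) by (intro gt_product) auto
    thus ?thesis using t(2) u(2) tc uc zw Z W by auto
  qed
  have Qc: "\<gamma> q \<in> carrier A" "\<delta> q \<in> carrier B" if "q \<in> Q" for q using Q(2,3) that by auto
  have gK: "t (fst z \<otimes>\<^bsub>A\<^esub> \<gamma> q) \<otimes>\<^bsub>K\<^esub> u (snd z \<otimes>\<^bsub>B\<^esub> \<delta> q) \<in> carrier K" if "z \<in> Z" "q \<in> Q" for z q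
    using that Z(3,4) Qc by (intro A.K.m_closed tc uc A.m_closed B.m_closed) auto
  \<comment> \<open>Multiplication by the components of \<open>z\<close> is moved into the
    functionals, which keeps them zero on the kernels, so the expansion of the second tensor applies
    to them.\<close>
  have inner: "(\<Oplus>\<^bsub>K\<^esub>q\<in>Q. t (fst z \<otimes>\<^bsub>A\<^esub> \<gamma> q) \<otimes>\<^bsub>K\<^esub> u (snd z \<otimes>\<^bsub>B\<^esub> \<delta> q)) = (\<Oplus>\<^bsub>K\<^esub>w\<in>W. D w \<otimes>\<^bsub>K\<^esub> ?f z w)"
    if z: "z \<in> Z" for z
  proof -
    have zc: "fst z \<in> carrier A" "snd z \<in> carrier B" using z Z by auto
    have k: "A.lker N (\<lambda>x. t (x \<otimes>\<^bsub>A\<^esub> fst z))" "B.lker N' (\<lambda>x. u (x \<otimes>\<^bsub>B\<^esub> snd z))"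
      using A.lker_mult[OF vA t(1) zc(1)] B.lker_mult[OF vB u(1) zc(2)] by auto
    have "(\<Oplus>\<^bsub>K\<^esub>q\<in>Q. t (fst z \<otimes>\<^bsub>A\<^esub> \<gamma> q) \<otimes>\<^bsub>K\<^esub> u (snd z \<otimes>\<^bsub>B\<^esub> \<delta> q))
      = pairing Q \<gamma> \<delta> (\<lambda>x. t (x \<otimes>\<^bsub>A\<^esub> fst z)) (\<lambda>x. u (x \<otimes>\<^bsub>B\<^esub> snd z))"
      unfolding pairing_def using Q(1) Qc zc tc uc
      by (intro A.K.finsum_cong') (auto simp: A.m_comm B.m_comm)
    also have "\<dots> = (\<Oplus>\<^bsub>K\<^esub>w\<in>W. D w \<otimes>\<^bsub>K\<^esub> (t (fst w \<otimes>\<^bsub>A\<^esub> fst z) \<otimes>\<^bsub>K\<^esub> u (snd w \<otimes>\<^bsub>B\<^esub> snd z)))"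
      using nfW k by blast
    also have "\<dots> = (\<Oplus>\<^bsub>K\<^esub>w\<in>W. D w \<otimes>\<^bsub>K\<^esub> ?f z w)"
    proof (rule A.K.finsum_cong'[OF refl])
      show "(\<lambda>w. D w \<otimes>\<^bsub>K\<^esub> ?f z w) \<in> W \<rightarrow> carrier K"
        using W(5) by (intro Pi_I A.K.m_closed[OF _ fc[OF z]]) blast
      fix w assume w: "w \<in> W"
      have "fst w \<in> carrier A" "snd w \<in> carrier B" using W(3,4) w by blast+
      thus "D w \<otimes>\<^bsub>K\<^esub> (t (fst w \<otimes>\<^bsub>A\<^esub> fst z) \<otimes>\<^bsub>K\<^esub> u (snd w \<otimes>\<^bsub>B\<^esub> snd z)) = D w \<otimes>\<^bsub>K\<^esub> ?f z w"
        using A.m_comm[of "fst w" "fst z"] B.m_comm[of "snd w" "snd z"] zc by simp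
    qed
    finally show ?thesis .
  qed
  have "(\<Oplus>\<^bsub>K\<^esub>q\<in>Q. pairing P \<alpha> \<beta> (\<lambda>x. t (x \<otimes>\<^bsub>A\<^esub> \<gamma> q)) (\<lambda>x. u (x \<otimes>\<^bsub>B\<^esub> \<delta> q)))
    = (\<Oplus>\<^bsub>K\<^esub>q\<in>Q. \<Oplus>\<^bsub>K\<^esub>z\<in>Z. C z \<otimes>\<^bsub>K\<^esub> (t (fst z \<otimes>\<^bsub>A\<^esub> \<gamma> q) \<otimes>\<^bsub>K\<^esub> u (snd z \<otimes>\<^bsub>B\<^esub> \<delta> q)))"
  proof (rule A.K.finsum_cong'[OF refl])
    show "(\<lambda>q. \<Oplus>\<^bsub>K\<^esub>z\<in>Z. C z \<otimes>\<^bsub>K\<^esub> (t (fst z \<otimes>\<^bsub>A\<^esub> \<gamma> q) \<otimes>\<^bsub>K\<^esub> u (snd z \<otimes>\<^bsub>B\<^esub> \<delta> q))) \<in> Q \<rightarrow> carrier K"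
      using gK Z(5) by (intro Pi_I A.K.finsum_closed A.K.m_closed[of "C _"]) blast+
    fix q assume q: "q \<in> Q"
    show "pairing P \<alpha> \<beta> (\<lambda>x. t (x \<otimes>\<^bsub>A\<^esub> \<gamma> q)) (\<lambda>x. u (x \<otimes>\<^bsub>B\<^esub> \<delta> q))
      = (\<Oplus>\<^bsub>K\<^esub>z\<in>Z. C z \<otimes>\<^bsub>K\<^esub> (t (fst z \<otimes>\<^bsub>A\<^esub> \<gamma> q) \<otimes>\<^bsub>K\<^esub> u (snd z \<otimes>\<^bsub>B\<^esub> \<delta> q)))"
      using nfZ A.lker_mult[OF vA t(1) funcset_mem[OF Q(2) q]] B.lker_mult[OF vB u(1) funcset_mem[OF Q(3) q]] by blast
  qed
  also have "\<dots> = (\<Oplus>\<^bsub>K\<^esub>z\<in>Z. \<Oplus>\<^bsub>K\<^esub>q\<in>Q. C z \<otimes>\<^bsub>K\<^esub> (t (fst z \<otimes>\<^bsub>A\<^esub> \<gamma> q) \<otimes>\<^bsub>K\<^esub> u (snd z \<otimes>\<^bsub>B\<^esub> \<delta> q)))"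
    using Q(1) Z(1,5) gK by (intro A.K.finsum_swap A.K.m_closed[of "C _"]) blast+
  also have "\<dots> = (\<Oplus>\<^bsub>K\<^esub>z\<in>Z. C z \<otimes>\<^bsub>K\<^esub> (\<Oplus>\<^bsub>K\<^esub>w\<in>W. D w \<otimes>\<^bsub>K\<^esub> ?f z w))"
  proof (rule A.K.finsum_cong'[OF refl])
    show "(\<lambda>z. C z \<otimes>\<^bsub>K\<^esub> (\<Oplus>\<^bsub>K\<^esub>w\<in>W. D w \<otimes>\<^bsub>K\<^esub> ?f z w)) \<in> Z \<rightarrow> carrier K"
      using fc Z(5) W(5) by (intro Pi_I A.K.m_closed[of "C _"] A.K.finsum_closed A.K.m_closed[of "D _"]) blast+
    fix z assume z: "z \<in> Z"
    show "(\<Oplus>\<^bsub>K\<^esub>q\<in>Q. C z \<otimes>\<^bsub>K\<^esub> (t (fst z \<otimes>\<^bsub>A\<^esub> \<gamma> q) \<otimes>\<^bsub>K\<^esub> u (snd z \<otimes>\<^bsub>B\<^esub> \<delta> q)))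
      = C z \<otimes>\<^bsub>K\<^esub> (\<Oplus>\<^bsub>K\<^esub>w\<in>W. D w \<otimes>\<^bsub>K\<^esub> ?f z w)"
      unfolding inner[OF z, symmetric] using Q(1) Z(5) gK[OF z] by (intro A.K.finsum_rdistr[symmetric] Pi_I) blast+
  qed
  also have "\<dots> = C z0 \<otimes>\<^bsub>K\<^esub> (\<Oplus>\<^bsub>K\<^esub>w\<in>W. D w \<otimes>\<^bsub>K\<^esub> ?f z0 w)"
  proof (rule A.K.finsum_single[OF Z(1,2)])
    show "C z0 \<otimes>\<^bsub>K\<^esub> (\<Oplus>\<^bsub>K\<^esub>w\<in>W. D w \<otimes>\<^bsub>K\<^esub> ?f z0 w) \<in> carrier K"
      using fc[OF Z(2)] Z(5) W(5) by (intro A.K.m_closed[of "C _"] A.K.finsum_closed A.K.m_closed[of "D _"] Pi_I) blast+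
    fix z assume z: "z \<in> Z" "z \<noteq> z0"
    have "(\<Oplus>\<^bsub>K\<^esub>w\<in>W. D w \<otimes>\<^bsub>K\<^esub> ?f z w) = (\<Oplus>\<^bsub>K\<^esub>w\<in>W. \<zero>\<^bsub>K\<^esub>)"
    proof (rule A.K.finsum_cong'[OF refl])
      fix w assume w: "w \<in> W"
      have "D w \<in> carrier K" using W(5) by blast
      thus "D w \<otimes>\<^bsub>K\<^esub> ?f z w = \<zero>\<^bsub>K\<^esub>" using kill[OF z(1) w] z(2) by simp
    qed simp
    moreover have "C z \<in> carrier K" using Z(5) by blast
    ultimately show "C z \<otimes>\<^bsub>K\<^esub> (\<Oplus>\<^bsub>K\<^esub>w\<in>W. D w \<otimes>\<^bsub>K\<^esub> ?f z w) = \<zero>\<^bsub>K\<^esub>" by simp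
  qed
  also have "(\<Oplus>\<^bsub>K\<^esub>w\<in>W. D w \<otimes>\<^bsub>K\<^esub> ?f z0 w) = D w0 \<otimes>\<^bsub>K\<^esub> ?f z0 w0"
  proof (rule A.K.finsum_single[OF W(1,2)])
    show "D w0 \<otimes>\<^bsub>K\<^esub> ?f z0 w0 \<in> carrier K" using fc[OF Z(2) W(2)] W(5) by blast
    fix w assume w: "w \<in> W" "w \<noteq> w0"
    have "D w \<in> carrier K" using W(5) by blast
    thus "D w \<otimes>\<^bsub>K\<^esub> ?f z0 w = \<zero>\<^bsub>K\<^esub>" using kill[OF Z(2) w(1)] w(2) by simp
  qed
  also have "?f z0 w0 = \<one>\<^bsub>K\<^esub>" using t(3) u(3) unfolding x0_def y0_def by simp
  finally have "(\<Oplus>\<^bsub>K\<^esub>q\<in>Q. pairing P \<alpha> \<beta> (\<lambda>x. t (x \<otimes>\<^bsub>A\<^esub> \<gamma> q)) (\<lambda>x. u (x \<otimes>\<^bsub>B\<^esub> \<delta> q))) = C z0 \<otimes>\<^bsub>K\<^esub> D w0"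
    using W(5)[rule_format, of w0] by simp
  moreover have "C z0 \<otimes>\<^bsub>K\<^esub> D w0 \<noteq> \<zero>\<^bsub>K\<^esub>" using Z(6) W(6) A.K.integral[OF _ Z(5)[rule_format] W(5)[rule_format]] by blast
  moreover have "t x = \<zero>\<^bsub>K\<^esub>" if "x \<in> carrier A" "N x < (c * c') ^ 2" for x
    using t(2) A.gt_small[OF vA that(1) x0(1)] that(2) bx by auto
  moreover have "u x = \<zero>\<^bsub>K\<^esub>" if "x \<in> carrier B" "N' x < (c * c') ^ 2" for x
    using u(2) B.gt_small[OF vB that(1) y0(1)] that(2) byy by auto
  ultimately show ?thesis using tl ul by (intro exI[of _ t] exI[of _ u]) auto
qed

end

end

section \<open>Compatible families and their contractions\<close>

context complete_domain_pair
begin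

text \<open>Representatives \<open>\<Sum>\<^sub>p \<alpha> i j p \<otimes> \<beta> i j p\<close> at the levels \<open>i, j\<close> of an element of the completed tensor
  product; compatibility is expressed through continuous functionals only.\<close>
definition family :: "(nat \<Rightarrow> nat \<Rightarrow> 'x set) \<Rightarrow> (nat \<Rightarrow> nat \<Rightarrow> 'x \<Rightarrow> 'a) \<Rightarrow> (nat \<Rightarrow> nat \<Rightarrow> 'x \<Rightarrow> 'b) \<Rightarrow> bool" where
  "family P \<alpha> \<beta> \<longleftrightarrow> (\<forall>i j. finite (P i j) \<and> \<alpha> i j \<in> P i j \<rightarrow> carrier A \<and> \<beta> i j \<in> P i j \<rightarrow> carrier B)
     \<and> (\<forall>i j i' j' l m. i \<le> i' \<longrightarrow> j \<le> j' \<longrightarrow> A.cont i l \<longrightarrow> B.cont j m \<longrightarrow>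
          pairing (P i' j') (\<alpha> i' j') (\<beta> i' j') l m = pairing (P i j) (\<alpha> i j) (\<beta> i j) l m)"

lemma familyD:
  assumes "family P \<alpha> \<beta>"
  shows "finite (P i j)" "\<alpha> i j \<in> P i j \<rightarrow> carrier A" "\<beta> i j \<in> P i j \<rightarrow> carrier B"
    "i \<le> i' \<Longrightarrow> j \<le> j' \<Longrightarrow> A.cont i l \<Longrightarrow> B.cont j m \<Longrightarrow>
      pairing (P i' j') (\<alpha> i' j') (\<beta> i' j') l m = pairing (P i j) (\<alpha> i j) (\<beta> i j) l m"
  using assms unfolding family_def by blast+

text \<open>The contraction id \<otimes> m of an element of the completed tensor product.
  Completeness of \<open>A\<close> makes it an actual element of \<open>A\<close>, at which a norm
  can be required not to vanish.\<close>

lemma slice_left: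
  assumes F: "family P \<alpha> \<beta>" and m: "B.cont j m"
  shows "\<exists>a\<in>carrier A. \<forall>i l. A.cont i l \<longrightarrow> l a = pairing (P i j) (\<alpha> i j) (\<beta> i j) l m"
  unfolding pairing_def
proof (rule A.represent)
  fix i
  show "finite (P i j)" by (rule familyD(1)[OF F])
  show "\<alpha> i j p \<in> carrier A" if "p \<in> P i j" for p using familyD(2)[OF F] that by blast
  show "m (\<beta> i j p) \<in> carrier K" if "p \<in> P i j" for p
    using familyD(3)[OF F] that m B.linfD(1)[of m] unfolding B.cont_def by blast
  show "(\<Oplus>\<^bsub>K\<^esub>p\<in>P (Suc i) j. l (\<alpha> (Suc i) j p) \<otimes>\<^bsub>K\<^esub> m (\<beta> (Suc i) j p)) =
      (\<Oplus>\<^bsub>K\<^esub>p\<in>P i j. l (\<alpha> i j p) \<otimes>\<^bsub>K\<^esub> m (\<beta> i j p))" if "A.cont i l" for l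
    using familyD(4)[OF F _ _ that m, of "Suc i" j] unfolding pairing_def by simp
qed

lemma pairing_commute:
  assumes "\<alpha> \<in> P \<rightarrow> carrier A" "\<beta> \<in> P \<rightarrow> carrier B" "A.linf l" "B.linf m"
  shows "pairing P \<alpha> \<beta> l m = (\<Oplus>\<^bsub>K\<^esub>p\<in>P. m (\<beta> p) \<otimes>\<^bsub>K\<^esub> l (\<alpha> p))"
proof -
  have "l (\<alpha> p) \<in> carrier K" "m (\<beta> p) \<in> carrier K" if "p \<in> P" for p
    using assms A.linfD(1)[OF assms(3)] B.linfD(1)[OF assms(4)] that by blast+
  thus ?thesis unfolding pairing_def by (intro A.K.finsum_cong') (auto simp: A.K.m_comm)
qed

lemma slice_right:
  assumes F: "family P \<alpha> \<beta>" and l: "A.cont i l"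
  shows "\<exists>b\<in>carrier B. \<forall>j m. B.cont j m \<longrightarrow> m b = pairing (P i j) (\<alpha> i j) (\<beta> i j) l m"
proof -
  have ll: "A.linf l" using l unfolding A.cont_def by blast
  have comm: "pairing (P i j) (\<alpha> i j) (\<beta> i j) l m = (\<Oplus>\<^bsub>K\<^esub>p\<in>P i j. m (\<beta> i j p) \<otimes>\<^bsub>K\<^esub> l (\<alpha> i j p))"
    if "B.cont j' m" for j j' m
    using pairing_commute[OF familyD(2,3)[OF F] ll] that unfolding B.cont_def by blast
  have "\<exists>b\<in>carrier B. \<forall>j m. B.cont j m \<longrightarrow> m b = (\<Oplus>\<^bsub>K\<^esub>p\<in>P i j. m (\<beta> i j p) \<otimes>\<^bsub>K\<^esub> l (\<alpha> i j p))"
  proof (rule B.represent)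
    fix j
    show "finite (P i j)" by (rule familyD(1)[OF F])
    show "\<beta> i j p \<in> carrier B" if "p \<in> P i j" for p using familyD(3)[OF F] that by blast
    show "l (\<alpha> i j p) \<in> carrier K" if "p \<in> P i j" for p
      using familyD(2)[OF F] that ll A.linfD(1)[of l] by blast
    show "(\<Oplus>\<^bsub>K\<^esub>p\<in>P i (Suc j). m (\<beta> i (Suc j) p) \<otimes>\<^bsub>K\<^esub> l (\<alpha> i (Suc j) p)) =
        (\<Oplus>\<^bsub>K\<^esub>p\<in>P i j. m (\<beta> i j p) \<otimes>\<^bsub>K\<^esub> l (\<alpha> i j p))" if "B.cont j m" for m
      using familyD(4)[OF F _ _ l that, of i "Suc j"] comm[OF that] by simp
  qed
  thus ?thesis using comm by metis
qed

text \<open>Neither norm may annihilate either element, so they are chosen in turn. Contracting with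
  \<open>m1\<close>, \<open>m2\<close> gives nonzero \<open>a1\<close>, \<open>a2\<close>, and
  \<open>N\<close> is taken nonzero at their product. Threshold functionals \<open>f\<close>,
  \<open>g\<close> normalized at \<open>a1\<close>, \<open>a2\<close> contract the families on the
  other side to nonzero \<open>b1\<close>, \<open>b2\<close>, which determine \<open>N'\<close>. The
  pairs \<open>f\<close>, \<open>f'\<close> and \<open>g\<close>, \<open>g'\<close> then detect the
  two elements with thresholds for both norms, as \<open>product_detected\<close> demands.\<close>

theorem no_zero_divisors:
  assumes F: "family P \<alpha> \<beta>" and G: "family Q \<gamma> \<delta>"
    and nzF: "A.cont i1 l1" "B.cont j1 m1" "pairing (P i1 j1) (\<alpha> i1 j1) (\<beta> i1 j1) l1 m1 \<noteq> \<zero>\<^bsub>K\<^esub>"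
    and nzG: "A.cont i2 l2" "B.cont j2 m2" "pairing (Q i2 j2) (\<gamma> i2 j2) (\<delta> i2 j2) l2 m2 \<noteq> \<zero>\<^bsub>K\<^esub>"
  shows "\<exists>n t u. A.cont n t \<and> B.cont n u \<and>
    (\<Oplus>\<^bsub>K\<^esub>q\<in>Q n n. pairing (P n n) (\<alpha> n n) (\<beta> n n)
      (\<lambda>x. t (x \<otimes>\<^bsub>A\<^esub> \<gamma> n n q)) (\<lambda>x. u (x \<otimes>\<^bsub>B\<^esub> \<delta> n n q))) \<noteq> \<zero>\<^bsub>K\<^esub>"
proof -
  obtain a1 where a1: "a1 \<in> carrier A" "\<And>i l. A.cont i l \<Longrightarrow> l a1 = pairing (P i j1) (\<alpha> i j1) (\<beta> i j1) l m1"
    using slice_left[OF F nzF(2)] by blast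
  obtain a2 where a2: "a2 \<in> carrier A" "\<And>i l. A.cont i l \<Longrightarrow> l a2 = pairing (Q i j2) (\<gamma> i j2) (\<delta> i j2) l m2"
    using slice_left[OF G nzG(2)] by blast
  have l0: "l1 \<zero>\<^bsub>A\<^esub> = \<zero>\<^bsub>K\<^esub>" "l2 \<zero>\<^bsub>A\<^esub> = \<zero>\<^bsub>K\<^esub>"
    using nzF(1) nzG(1) A.linf_zero unfolding A.cont_def by blast+
  have "l1 a1 \<noteq> \<zero>\<^bsub>K\<^esub>" "l2 a2 \<noteq> \<zero>\<^bsub>K\<^esub>"
    using nzF(3) nzG(3) a1(2)[OF nzF(1)] a2(2)[OF nzG(1)] by simp_all
  hence nz: "a1 \<noteq> \<zero>\<^bsub>A\<^esub>" "a2 \<noteq> \<zero>\<^bsub>A\<^esub>" using l0 by metis+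
  have a: "a1 \<otimes>\<^bsub>A\<^esub> a2 \<in> carrier A" "a1 \<otimes>\<^bsub>A\<^esub> a2 \<noteq> \<zero>\<^bsub>A\<^esub>" using a1(1) a2(1) nz A.integral[OF _ a1(1) a2(1)] by auto
  obtain N gt where vA: "A.val N gt" and Na: "0 < N (a1 \<otimes>\<^bsub>A\<^esub> a2)" using A.val_exists[OF a] by blast
  define c where "c = N (a1 \<otimes>\<^bsub>A\<^esub> a2)"
  have c0: "0 < c" using Na c_def by simp
  have "c = N a1 * N a2" unfolding c_def using A.val_mult[OF vA] a1 a2 by simp
  \<comment> \<open>The norm is at most 1, so its value at the product is a lower bound at both
    factors and one threshold serves \<open>f\<close> and \<open>g\<close>.\<close>
  hence ca: "c \<le> N a1" "c \<le> N a2"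
    using A.val_nonneg[OF vA a1(1)] A.val_nonneg[OF vA a2(1)] A.val_le1[OF vA a1(1)] A.val_le1[OF vA a2(1)]
      mult_left_le[of "N a2" "N a1"] mult_left_le[of "N a1" "N a2"] by (simp_all add: mult.commute)
  obtain f where f: "A.linf f" "\<forall>x\<in>carrier A. N x < c \<longrightarrow> f x = \<zero>\<^bsub>K\<^esub>" "f a1 = \<one>\<^bsub>K\<^esub>"
    using A.threshold_functional[OF vA a1(1) c0 ca(1)] by blast
  obtain g where g: "A.linf g" "\<forall>x\<in>carrier A. N x < c \<longrightarrow> g x = \<zero>\<^bsub>K\<^esub>" "g a2 = \<one>\<^bsub>K\<^esub>"
    using A.threshold_functional[OF vA a2(1) c0 ca(2)] by blast
  obtain n where n: "(1/2) ^ n < c" using real_arch_pow_inv[OF c0, of "1/2"] by auto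
  have fn: "A.cont n f" and gn: "A.cont n g"
    using A.cont_of_threshold[OF vA f(1) _ n] A.cont_of_threshold[OF vA g(1) _ n] f(2) g(2) by auto
  obtain b1 where b1: "b1 \<in> carrier B" "\<And>j m. B.cont j m \<Longrightarrow> m b1 = pairing (P n j) (\<alpha> n j) (\<beta> n j) f m"
    using slice_right[OF F fn] by blast
  obtain b2 where b2: "b2 \<in> carrier B" "\<And>j m. B.cont j m \<Longrightarrow> m b2 = pairing (Q n j) (\<gamma> n j) (\<delta> n j) g m"
    using slice_right[OF G gn] by blast
  \<comment> \<open>Contracting with \<open>f\<close> and \<open>m1\<close> in either order gives
    the same scalar, so \<open>m1 b1 = f a1\<close>; this shows that \<open>b1\<close> is nonzero,
    and likewise \<open>b2\<close>.\<close>
  have "m1 b1 = \<one>\<^bsub>K\<^esub>" "m2 b2 = \<one>\<^bsub>K\<^esub>"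
    using b1(2)[OF nzF(2)] a1(2)[OF fn] f(3) b2(2)[OF nzG(2)] a2(2)[OF gn] g(3) by auto
  moreover have "m1 \<zero>\<^bsub>B\<^esub> = \<zero>\<^bsub>K\<^esub>" "m2 \<zero>\<^bsub>B\<^esub> = \<zero>\<^bsub>K\<^esub>"
    using nzF(2) nzG(2) B.linf_zero unfolding B.cont_def by blast+
  ultimately have nzb: "b1 \<noteq> \<zero>\<^bsub>B\<^esub>" "b2 \<noteq> \<zero>\<^bsub>B\<^esub>" using A.K.one_not_zero by metis+
  have b: "b1 \<otimes>\<^bsub>B\<^esub> b2 \<in> carrier B" "b1 \<otimes>\<^bsub>B\<^esub> b2 \<noteq> \<zero>\<^bsub>B\<^esub>" using b1(1) b2(1) nzb B.integral[OF _ b1(1) b2(1)] by auto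
  obtain N' gt' where vB: "B.val N' gt'" and Nb: "0 < N' (b1 \<otimes>\<^bsub>B\<^esub> b2)" using B.val_exists[OF b] by blast
  define c' where "c' = N' (b1 \<otimes>\<^bsub>B\<^esub> b2)"
  have c0': "0 < c'" using Nb c'_def by simp
  have "c' = N' b1 * N' b2" unfolding c'_def using B.val_mult[OF vB] b1 b2 by simp
  hence cb: "c' \<le> N' b1" "c' \<le> N' b2"
    using B.val_nonneg[OF vB b1(1)] B.val_nonneg[OF vB b2(1)] B.val_le1[OF vB b1(1)] B.val_le1[OF vB b2(1)]
      mult_left_le[of "N' b2" "N' b1"] mult_left_le[of "N' b1" "N' b2"] by (simp_all add: mult.commute)
  obtain f' where f': "B.linf f'" "\<forall>x\<in>carrier B. N' x < c' \<longrightarrow> f' x = \<zero>\<^bsub>K\<^esub>" "f' b1 = \<one>\<^bsub>K\<^esub>"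
    using B.threshold_functional[OF vB b1(1) c0' cb(1)] by blast
  obtain g' where g': "B.linf g'" "\<forall>x\<in>carrier B. N' x < c' \<longrightarrow> g' x = \<zero>\<^bsub>K\<^esub>" "g' b2 = \<one>\<^bsub>K\<^esub>"
    using B.threshold_functional[OF vB b2(1) c0' cb(2)] by blast
  obtain n' where n': "(1/2) ^ n' < c'" using real_arch_pow_inv[OF c0', of "1/2"] by auto
  have fn': "B.cont n' f'" and gn': "B.cont n' g'"
    using B.cont_of_threshold[OF vB f'(1) _ n'] B.cont_of_threshold[OF vB g'(1) _ n'] f'(2) g'(2) by auto
  have cc: "0 < (c * c') ^ 2" using c0 c0' by simp
  obtain k where k: "(1/2) ^ k < (c * c') ^ 2" using real_arch_pow_inv[OF cc, of "1/2"] by auto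
  \<comment> \<open>A level deep enough for the four functionals already chosen and, through
    \<open>k\<close>, for the functionals \<open>t\<close>, \<open>u\<close> still to come, whose
    threshold is known in advance.\<close>
  define M where "M = max k (max n n')"
  have "(1/2::real) ^ M \<le> (1/2) ^ k" by (rule power_decreasing) (auto simp: M_def)
  hence M3: "(1/2) ^ M < (c * c') ^ 2" using k by linarith
  have "n \<le> M" "n' \<le> M" unfolding M_def by auto
  note M = this M3
  have pf: "pairing (P M M) (\<alpha> M M) (\<beta> M M) f f' \<noteq> \<zero>\<^bsub>K\<^esub>"
    using familyD(4)[OF F M(1,2) fn fn'] b1(2)[OF fn'] f'(3) A.K.one_not_zero by metis
  have pg: "pairing (Q M M) (\<gamma> M M) (\<delta> M M) g g' \<noteq> \<zero>\<^bsub>K\<^esub>"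
    using familyD(4)[OF G M(1,2) gn gn'] b2(2)[OF gn'] g'(3) A.K.one_not_zero by metis
  obtain t u where tu: "A.linf t" "B.linf u" "\<forall>x\<in>carrier A. N x < (c * c') ^ 2 \<longrightarrow> t x = \<zero>\<^bsub>K\<^esub>"
    "\<forall>x\<in>carrier B. N' x < (c * c') ^ 2 \<longrightarrow> u x = \<zero>\<^bsub>K\<^esub>"
    "(\<Oplus>\<^bsub>K\<^esub>q\<in>Q M M. pairing (P M M) (\<alpha> M M) (\<beta> M M)
      (\<lambda>x. t (x \<otimes>\<^bsub>A\<^esub> \<gamma> M M q)) (\<lambda>x. u (x \<otimes>\<^bsub>B\<^esub> \<delta> M M q))) \<noteq> \<zero>\<^bsub>K\<^esub>"
    using product_detected[OF vA vB familyD(1-3)[OF F, of M M] familyD(1-3)[OF G, of M M] c0 c0'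
      f(1,2) f'(1,2) g(1,2) g'(1,2) pf pg] by (elim exE conjE) rule
  have "A.cont M t" "B.cont M u"
    using A.cont_of_threshold[OF vA tu(1) _ M(3)] B.cont_of_threshold[OF vB tu(2) _ M(3)] tu(3,4) by auto
  thus ?thesis using tu(5) by blast
qed

end

section \<open>Formal sums and tensor products\<close>

locale tensor_pair = R: scalars K R phi + S: scalars K S psi
  for K :: "('k, 'c) ring_scheme" and R :: "('r, 'd) ring_scheme" and S :: "('s, 'e) ring_scheme"
    and phi psi
begin

abbreviation "rel \<equiv> tensor_rel K R S phi psi"

definition supp :: "('r \<times> 's \<Rightarrow> 'k) \<Rightarrow> ('r \<times> 's) set" where "supp f = {p. f p \<noteq> \<zero>\<^bsub>K\<^esub>}"

text \<open>The linear extension of a function on pairs to formal sums; for bilinear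
  \<open>b\<close> it is the form induced on the tensor product.\<close>

definition ev :: "('r \<times> 's \<Rightarrow> 'k) \<Rightarrow> ('r \<times> 's \<Rightarrow> 'k) \<Rightarrow> 'k" where
  "ev b f = (\<Oplus>\<^bsub>K\<^esub>p\<in>supp f. f p \<otimes>\<^bsub>K\<^esub> b p)"

definition bilin :: "('r \<times> 's \<Rightarrow> 'k) \<Rightarrow> bool" where
  "bilin b \<longleftrightarrow> (\<forall>s\<in>carrier S. R.linf (\<lambda>r. b (r, s))) \<and> (\<forall>r\<in>carrier R. S.linf (\<lambda>s. b (r, s)))"

lemma bilin_closed: "bilin b \<Longrightarrow> p \<in> carrier R \<times> carrier S \<Longrightarrow> b p \<in> carrier K"
  unfolding bilin_def using R.linfD(1) by fastforce

lemma fsumsD: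
  assumes "f \<in> fsums K R S"
  shows "f p \<in> carrier K" "finite (supp f)" "supp f \<subseteq> carrier R \<times> carrier S"
  using assms unfolding fsums_def supp_def by blast+

lemma fsumsI:
  assumes "\<And>p. f p \<in> carrier K" "finite T" "T \<subseteq> carrier R \<times> carrier S" "\<And>p. p \<notin> T \<Longrightarrow> f p = \<zero>\<^bsub>K\<^esub>"
  shows "f \<in> fsums K R S"
proof -
  have "{p. f p \<noteq> \<zero>\<^bsub>K\<^esub>} \<subseteq> T" using assms(4) by blast
  thus ?thesis unfolding fsums_def using assms(1-3) finite_subset by blast
qed

lemma ev_superset:
  assumes f: "f \<in> fsums K R S" and b: "bilin b" and T: "finite T" "supp f \<subseteq> T" "T \<subseteq> carrier R \<times> carrier S"
  shows "ev b f = (\<Oplus>\<^bsub>K\<^esub>p\<in>T. f p \<otimes>\<^bsub>K\<^esub> b p)"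
  unfolding ev_def
proof (rule R.K.finsum_neutral_subset[symmetric, OF T(1,2)])
  fix i
  show "f i \<otimes>\<^bsub>K\<^esub> b i \<in> carrier K" if "i \<in> supp f"
    using fsumsD(1)[OF f] bilin_closed[OF b] T(2,3) that by blast
  show "f i \<otimes>\<^bsub>K\<^esub> b i = \<zero>\<^bsub>K\<^esub>" if i: "i \<in> T - supp f"
  proof -
    have "f i = \<zero>\<^bsub>K\<^esub>" using i unfolding supp_def by blast
    moreover have "b i \<in> carrier K" using bilin_closed[OF b] T(3) i by blast
    ultimately show ?thesis by simp
  qed
qed

lemma ev_closed: "f \<in> fsums K R S \<Longrightarrow> bilin b \<Longrightarrow> ev b f \<in> carrier K"
  unfolding ev_def using fsumsD bilin_closed by (intro R.K.finsum_closed) blast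

lemma zero_fsums: "fs_zero K \<in> fsums K R S"
  by (rule fsumsI[of _ "{}"]) (auto simp: fs_zero_def)

lemma add_fsums: "f \<in> fsums K R S \<Longrightarrow> g \<in> fsums K R S \<Longrightarrow> fs_add K f g \<in> fsums K R S"
proof (rule fsumsI[of _ "supp f \<union> supp g"])
  assume fg: "f \<in> fsums K R S" "g \<in> fsums K R S"
  show "fs_add K f g p \<in> carrier K" for p unfolding fs_add_def using fsumsD(1) fg by simp
  show "finite (supp f \<union> supp g)" using fsumsD(2) fg by simp
  show "supp f \<union> supp g \<subseteq> carrier R \<times> carrier S" using fsumsD(3) fg by blast
qed (auto simp: supp_def fs_add_def)

lemma smul_fsums: "c \<in> carrier K \<Longrightarrow> f \<in> fsums K R S \<Longrightarrow> fs_smul K c f \<in> fsums K R S"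
proof (rule fsumsI[of _ "supp f"])
  assume cf: "c \<in> carrier K" "f \<in> fsums K R S"
  show "fs_smul K c f p \<in> carrier K" for p unfolding fs_smul_def using fsumsD(1) cf by simp
  show "finite (supp f)" "supp f \<subseteq> carrier R \<times> carrier S" using fsumsD(2,3) cf by blast+
qed (auto simp: supp_def fs_smul_def)

lemma neg_eq_smul: "f \<in> fsums K R S \<Longrightarrow> fs_neg K f = fs_smul K (\<ominus>\<^bsub>K\<^esub> \<one>\<^bsub>K\<^esub>) f"
  unfolding fs_neg_def fs_smul_def using fsumsD(1) by (intro ext) (simp add: R.K.l_minus)

lemma neg_fsums: "f \<in> fsums K R S \<Longrightarrow> fs_neg K f \<in> fsums K R S"
  by (simp add: neg_eq_smul smul_fsums)

lemma delta_fsums: "p \<in> carrier R \<times> carrier S \<Longrightarrow> fs_delta K p \<in> fsums K R S"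
  by (rule fsumsI[of _ "{p}"]) (auto simp: fs_delta_def)

lemma ev_zero: "ev b (fs_zero K) = \<zero>\<^bsub>K\<^esub>"
  unfolding ev_def supp_def fs_zero_def by simp

lemma ev_add:
  assumes f: "f \<in> fsums K R S" and g: "g \<in> fsums K R S" and b: "bilin b"
  shows "ev b (fs_add K f g) = ev b f \<oplus>\<^bsub>K\<^esub> ev b g"
proof -
  let ?T = "supp f \<union> supp g"
  have T: "finite ?T" "?T \<subseteq> carrier R \<times> carrier S" using fsumsD[OF f] fsumsD[OF g] by auto
  have bT: "b p \<in> carrier K" if "p \<in> ?T" for p using bilin_closed[OF b] T(2) that by blast
  have sub: "supp (fs_add K f g) \<subseteq> ?T" unfolding supp_def fs_add_def by auto
  have "ev b (fs_add K f g) = (\<Oplus>\<^bsub>K\<^esub>p\<in>?T. fs_add K f g p \<otimes>\<^bsub>K\<^esub> b p)"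
    by (rule ev_superset[OF add_fsums[OF f g] b T(1) sub T(2)])
  also have "\<dots> = (\<Oplus>\<^bsub>K\<^esub>p\<in>?T. f p \<otimes>\<^bsub>K\<^esub> b p \<oplus>\<^bsub>K\<^esub> g p \<otimes>\<^bsub>K\<^esub> b p)"
    using fsumsD(1)[OF f] fsumsD(1)[OF g] bT
    by (intro R.K.finsum_cong') (auto simp: fs_add_def R.K.l_distr)
  also have "\<dots> = (\<Oplus>\<^bsub>K\<^esub>p\<in>?T. f p \<otimes>\<^bsub>K\<^esub> b p) \<oplus>\<^bsub>K\<^esub> (\<Oplus>\<^bsub>K\<^esub>p\<in>?T. g p \<otimes>\<^bsub>K\<^esub> b p)"
    using fsumsD(1)[OF f] fsumsD(1)[OF g] bT by (intro R.K.finsum_addf) auto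
  also have "\<dots> = ev b f \<oplus>\<^bsub>K\<^esub> ev b g"
    using ev_superset[OF f b T(1) _ T(2)] ev_superset[OF g b T(1) _ T(2)] by simp
  finally show ?thesis .
qed

lemma ev_smul:
  assumes c: "c \<in> carrier K" and f: "f \<in> fsums K R S" and b: "bilin b"
  shows "ev b (fs_smul K c f) = c \<otimes>\<^bsub>K\<^esub> ev b f"
proof -
  have T: "finite (supp f)" "supp f \<subseteq> carrier R \<times> carrier S" using fsumsD[OF f] by auto
  have bT: "b p \<in> carrier K" if "p \<in> supp f" for p using bilin_closed[OF b] T(2) that by blast
  have sub: "supp (fs_smul K c f) \<subseteq> supp f" unfolding supp_def fs_smul_def using c by auto
  have "ev b (fs_smul K c f) = (\<Oplus>\<^bsub>K\<^esub>p\<in>supp f. fs_smul K c f p \<otimes>\<^bsub>K\<^esub> b p)"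
    by (rule ev_superset[OF smul_fsums[OF c f] b T(1) sub T(2)])
  also have "\<dots> = (\<Oplus>\<^bsub>K\<^esub>p\<in>supp f. c \<otimes>\<^bsub>K\<^esub> (f p \<otimes>\<^bsub>K\<^esub> b p))"
    using fsumsD(1)[OF f] bT c by (intro R.K.finsum_cong') (auto simp: fs_smul_def R.K.m_assoc)
  also have "\<dots> = c \<otimes>\<^bsub>K\<^esub> ev b f"
    unfolding ev_def using fsumsD(1)[OF f] bT c T(1) by (intro R.K.finsum_rdistr[symmetric]) auto
  finally show ?thesis .
qed

lemma ev_neg: "f \<in> fsums K R S \<Longrightarrow> bilin b \<Longrightarrow> ev b (fs_neg K f) = \<ominus>\<^bsub>K\<^esub> ev b f"
  using ev_smul[of "\<ominus>\<^bsub>K\<^esub> \<one>\<^bsub>K\<^esub>" f b] ev_closed[of f b] by (simp add: neg_eq_smul R.K.l_minus)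

lemma ev_delta:
  assumes p: "p \<in> carrier R \<times> carrier S" and b: "bilin b" shows "ev b (fs_delta K p) = b p"
proof -
  have "ev b (fs_delta K p) = (\<Oplus>\<^bsub>K\<^esub>q\<in>{p}. fs_delta K p q \<otimes>\<^bsub>K\<^esub> b q)"
    by (rule ev_superset[OF delta_fsums[OF p] b]) (use p in \<open>auto simp: supp_def fs_delta_def\<close>)
  thus ?thesis using bilin_closed[OF b p] by (simp add: fs_delta_def)
qed

lemma ev_diff: "f \<in> fsums K R S \<Longrightarrow> g \<in> fsums K R S \<Longrightarrow> bilin b \<Longrightarrow>
    ev b (fs_add K f (fs_neg K g)) = ev b f \<ominus>\<^bsub>K\<^esub> ev b g"
  by (simp add: ev_add neg_fsums ev_neg a_minus_def)

lemma rel_fsums: "f \<in> rel \<Longrightarrow> f \<in> fsums K R S"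
  by (induction rule: tensor_rel.induct)
    (auto intro!: zero_fsums add_fsums smul_fsums neg_fsums delta_fsums)

lemma ev_rel: "f \<in> rel \<Longrightarrow> bilin b \<Longrightarrow> ev b f = \<zero>\<^bsub>K\<^esub>"
proof (induction rule: tensor_rel.induct)
  case zero
  show ?case by (rule ev_zero)
next
  case (add f g)
  thus ?case by (simp add: ev_add rel_fsums)
next
  case (smul c f)
  thus ?case by (simp add: ev_smul rel_fsums)
next
  case (add_left r r' s)
  have "b (r \<oplus>\<^bsub>R\<^esub> r', s) = b (r, s) \<oplus>\<^bsub>K\<^esub> b (r', s)"
    using add_left R.linfD(2)[of "\<lambda>r. b (r, s)" r r'] unfolding bilin_def by blast
  thus ?case using add_left bilin_closed[OF add_left(4)]
    by (simp add: ev_diff ev_add ev_delta delta_fsums add_fsums R.K.r_neg a_minus_def)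
next
  case (add_right r s s')
  have "b (r, s \<oplus>\<^bsub>S\<^esub> s') = b (r, s) \<oplus>\<^bsub>K\<^esub> b (r, s')"
    using add_right S.linfD(2)[of "\<lambda>s. b (r, s)" s s'] unfolding bilin_def by blast
  thus ?case using add_right bilin_closed[OF add_right(4)]
    by (simp add: ev_diff ev_add ev_delta delta_fsums add_fsums R.K.r_neg a_minus_def)
next
  case (smul_left c r s)
  have "b (phi c \<otimes>\<^bsub>R\<^esub> r, s) = c \<otimes>\<^bsub>K\<^esub> b (r, s)"
    using smul_left R.linfD(3)[of "\<lambda>r. b (r, s)" c r] unfolding bilin_def by blast
  thus ?case using smul_left bilin_closed[OF smul_left(4)]
    by (simp add: ev_diff ev_smul ev_delta delta_fsums smul_fsums R.K.r_neg a_minus_def)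
next
  case (smul_right c r s)
  have "b (r, psi c \<otimes>\<^bsub>S\<^esub> s) = c \<otimes>\<^bsub>K\<^esub> b (r, s)"
    using smul_right S.linfD(3)[of "\<lambda>s. b (r, s)" c s] unfolding bilin_def by blast
  thus ?case using smul_right bilin_closed[OF smul_right(4)]
    by (simp add: ev_diff ev_smul ev_delta delta_fsums smul_fsums R.K.r_neg a_minus_def)
qed

lemma bilin_tensor: "R.linf l \<Longrightarrow> S.linf m \<Longrightarrow> bilin (\<lambda>p. l (fst p) \<otimes>\<^bsub>K\<^esub> m (snd p))"
  unfolding bilin_def R.linf_def S.linf_def
  by (auto simp: R.K.l_distr R.K.r_distr R.K.m_ac)

definition eqv :: "('r \<times> 's \<Rightarrow> 'k) \<Rightarrow> ('r \<times> 's \<Rightarrow> 'k) \<Rightarrow> bool" where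
  "eqv f g \<longleftrightarrow> f \<in> fsums K R S \<and> g \<in> fsums K R S \<and> fs_add K f (fs_neg K g) \<in> rel"

lemma eqv_refl: "f \<in> fsums K R S \<Longrightarrow> eqv f f"
proof -
  assume f: "f \<in> fsums K R S"
  have "fs_add K f (fs_neg K f) = fs_zero K"
    unfolding fs_add_def fs_neg_def fs_zero_def using fsumsD(1)[OF f] by (simp add: R.K.r_neg)
  thus ?thesis unfolding eqv_def using f tensor_rel.zero by simp
qed

lemma eqv_sym: "eqv f g \<Longrightarrow> eqv g f"
proof -
  assume e: "eqv f g"
  hence fg: "f \<in> fsums K R S" "g \<in> fsums K R S" unfolding eqv_def by auto
  have eq: "fs_add K g (fs_neg K f) = fs_smul K (\<ominus>\<^bsub>K\<^esub> \<one>\<^bsub>K\<^esub>) (fs_add K f (fs_neg K g))"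
    unfolding fs_add_def fs_neg_def fs_smul_def using fsumsD(1)[OF fg(1)] fsumsD(1)[OF fg(2)]
    by (intro ext) (simp add: R.K.l_minus R.K.minus_add R.K.a_comm)
  have "fs_smul K (\<ominus>\<^bsub>K\<^esub> \<one>\<^bsub>K\<^esub>) (fs_add K f (fs_neg K g)) \<in> rel"
    using e unfolding eqv_def by (intro tensor_rel.smul) auto
  thus ?thesis unfolding eqv_def eq using fg by simp
qed

lemma eqv_trans: "eqv f g \<Longrightarrow> eqv g k \<Longrightarrow> eqv f k"
proof -
  assume e: "eqv f g" "eqv g k"
  hence fg: "f \<in> fsums K R S" "g \<in> fsums K R S" "k \<in> fsums K R S" unfolding eqv_def by auto
  have "fs_add K f (fs_neg K k) = fs_add K (fs_add K f (fs_neg K g)) (fs_add K g (fs_neg K k))"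
  proof
    fix p
    have "f p \<in> carrier K" "g p \<in> carrier K" "k p \<in> carrier K" using fsumsD(1) fg by auto
    hence "f p \<oplus>\<^bsub>K\<^esub> \<ominus>\<^bsub>K\<^esub> k p = (f p \<oplus>\<^bsub>K\<^esub> \<ominus>\<^bsub>K\<^esub> g p) \<oplus>\<^bsub>K\<^esub> (g p \<oplus>\<^bsub>K\<^esub> \<ominus>\<^bsub>K\<^esub> k p)"
      by (simp add: R.K.a_assoc R.K.r_neg2 R.K.r_neg1)
    thus "fs_add K f (fs_neg K k) p = fs_add K (fs_add K f (fs_neg K g)) (fs_add K g (fs_neg K k)) p"
      unfolding fs_add_def fs_neg_def .
  qed
  thus ?thesis using e tensor_rel.add unfolding eqv_def by metis
qed

lemma eqv_add: "eqv f g \<Longrightarrow> eqv f' g' \<Longrightarrow> eqv (fs_add K f f') (fs_add K g g')"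
proof -
  assume e: "eqv f g" "eqv f' g'"
  hence fg: "f \<in> fsums K R S" "g \<in> fsums K R S" "f' \<in> fsums K R S" "g' \<in> fsums K R S" unfolding eqv_def by auto
  have eq: "fs_add K (fs_add K f f') (fs_neg K (fs_add K g g')) = fs_add K (fs_add K f (fs_neg K g)) (fs_add K f' (fs_neg K g'))"
  proof
    fix p
    have "f p \<in> carrier K" "g p \<in> carrier K" "f' p \<in> carrier K" "g' p \<in> carrier K" using fsumsD(1) fg by auto
    hence "(f p \<oplus>\<^bsub>K\<^esub> f' p) \<oplus>\<^bsub>K\<^esub> \<ominus>\<^bsub>K\<^esub> (g p \<oplus>\<^bsub>K\<^esub> g' p) = (f p \<oplus>\<^bsub>K\<^esub> \<ominus>\<^bsub>K\<^esub> g p) \<oplus>\<^bsub>K\<^esub> (f' p \<oplus>\<^bsub>K\<^esub> \<ominus>\<^bsub>K\<^esub> g' p)"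
      by (simp add: R.K.minus_add R.K.a_ac)
    thus "fs_add K (fs_add K f f') (fs_neg K (fs_add K g g')) p = fs_add K (fs_add K f (fs_neg K g)) (fs_add K f' (fs_neg K g')) p"
      unfolding fs_add_def fs_neg_def .
  qed
  have "fs_add K (fs_add K f (fs_neg K g)) (fs_add K f' (fs_neg K g')) \<in> rel"
    using e unfolding eqv_def by (intro tensor_rel.add[of "fs_add K f (fs_neg K g)"]) blast+
  thus ?thesis unfolding eqv_def eq using fg add_fsums by simp
qed

lemma add_assoc_fs: "f \<in> fsums K R S \<Longrightarrow> g \<in> fsums K R S \<Longrightarrow> k \<in> fsums K R S \<Longrightarrow>
    fs_add K (fs_add K f g) k = fs_add K f (fs_add K g k)"
  unfolding fs_add_def using fsumsD(1) by (intro ext) (simp add: R.K.a_assoc)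

lemma add_comm_fs: "f \<in> fsums K R S \<Longrightarrow> g \<in> fsums K R S \<Longrightarrow> fs_add K f g = fs_add K g f"
  unfolding fs_add_def using fsumsD(1) by (intro ext) (simp add: R.K.a_comm)

lemma zero_fs: "f \<in> fsums K R S \<Longrightarrow> fs_add K f (fs_zero K) = f" "f \<in> fsums K R S \<Longrightarrow> fs_add K (fs_zero K) f = f"
  unfolding fs_add_def fs_zero_def using fsumsD(1) by (auto intro!: ext)

lemma eqv_rel: "f \<in> rel \<Longrightarrow> eqv g f \<Longrightarrow> g \<in> rel"
proof -
  assume f: "f \<in> rel" and e: "eqv g f"
  have fs: "f \<in> fsums K R S" "g \<in> fsums K R S" using e unfolding eqv_def by auto
  have "fs_add K (fs_add K g (fs_neg K f)) f = g"
  proof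
    fix p
    have "f p \<in> carrier K" "g p \<in> carrier K" using fsumsD(1) fs by auto
    thus "fs_add K (fs_add K g (fs_neg K f)) f p = g p"
      unfolding fs_add_def fs_neg_def by (simp add: R.K.a_assoc R.K.l_neg)
  qed
  thus ?thesis using tensor_rel.add[of "fs_add K g (fs_neg K f)" K R S phi psi f] e f unfolding eqv_def by simp
qed

lemma ev_eqv: "eqv f g \<Longrightarrow> bilin b \<Longrightarrow> ev b f = ev b g"
proof -
  assume e: "eqv f g" and b: "bilin b"
  have fs: "f \<in> fsums K R S" "g \<in> fsums K R S" using e unfolding eqv_def by auto
  have "ev b f \<ominus>\<^bsub>K\<^esub> ev b g = \<zero>\<^bsub>K\<^esub>" using ev_rel[OF _ b] e ev_diff[OF fs b] unfolding eqv_def by auto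
  thus ?thesis using ev_closed[OF fs(1) b] ev_closed[OF fs(2) b] by simp
qed

text \<open>Lists allow repeated pairs and carry no coefficients, which are absorbed into the left
  factor. The length of the list is the induction measure for the separation of points
  below.\<close>

fun pure_sum :: "('r \<times> 's) list \<Rightarrow> 'r \<times> 's \<Rightarrow> 'k" where
  "pure_sum [] = fs_zero K"
| "pure_sum (p # ps) = fs_add K (fs_delta K p) (pure_sum ps)"

lemma pure_sum_fsums: "set ps \<subseteq> carrier R \<times> carrier S \<Longrightarrow> pure_sum ps \<in> fsums K R S"
  by (induction ps) (auto intro!: zero_fsums add_fsums delta_fsums)

lemma eqv_delta_add_left:
  assumes "r \<in> carrier R" "r' \<in> carrier R" "s \<in> carrier S"
  shows "eqv (fs_delta K (r \<oplus>\<^bsub>R\<^esub> r', s)) (fs_add K (fs_delta K (r, s)) (fs_delta K (r', s)))"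
  unfolding eqv_def using assms by (auto intro!: delta_fsums add_fsums tensor_rel.add_left)

lemma eqv_delta_add_right:
  assumes "r \<in> carrier R" "s \<in> carrier S" "s' \<in> carrier S"
  shows "eqv (fs_delta K (r, s \<oplus>\<^bsub>S\<^esub> s')) (fs_add K (fs_delta K (r, s)) (fs_delta K (r, s')))"
  unfolding eqv_def using assms by (auto intro!: delta_fsums add_fsums tensor_rel.add_right)

lemma eqv_delta_smul_left:
  assumes "c \<in> carrier K" "r \<in> carrier R" "s \<in> carrier S"
  shows "eqv (fs_delta K (phi c \<otimes>\<^bsub>R\<^esub> r, s)) (fs_smul K c (fs_delta K (r, s)))"
  unfolding eqv_def using assms by (auto intro!: delta_fsums smul_fsums tensor_rel.smul_left)

lemma eqv_delta_smul_right:
  assumes "c \<in> carrier K" "r \<in> carrier R" "s \<in> carrier S"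
  shows "eqv (fs_delta K (r, psi c \<otimes>\<^bsub>S\<^esub> s)) (fs_smul K c (fs_delta K (r, s)))"
  unfolding eqv_def using assms by (auto intro!: delta_fsums smul_fsums tensor_rel.smul_right)

lemma eqv_delta_move:
  assumes "c \<in> carrier K" "r \<in> carrier R" "s \<in> carrier S"
  shows "eqv (fs_delta K (r, psi c \<otimes>\<^bsub>S\<^esub> s)) (fs_delta K (phi c \<otimes>\<^bsub>R\<^esub> r, s))"
  using eqv_trans[OF eqv_delta_smul_right[OF assms] eqv_sym[OF eqv_delta_smul_left[OF assms]]] .

lemma smul_zero_fs: "f \<in> fsums K R S \<Longrightarrow> fs_smul K \<zero>\<^bsub>K\<^esub> f = fs_zero K"
  unfolding fs_smul_def fs_zero_def using fsumsD(1) by (intro ext) simp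

lemma eqv_delta_zero:
  "s \<in> carrier S \<Longrightarrow> eqv (fs_delta K (\<zero>\<^bsub>R\<^esub>, s)) (fs_zero K)"
  "r \<in> carrier R \<Longrightarrow> eqv (fs_delta K (r, \<zero>\<^bsub>S\<^esub>)) (fs_zero K)"
  using eqv_delta_smul_left[of "\<zero>\<^bsub>K\<^esub>" "\<zero>\<^bsub>R\<^esub>" s] eqv_delta_smul_right[of "\<zero>\<^bsub>K\<^esub>" r "\<zero>\<^bsub>S\<^esub>"]
  by (auto simp: smul_zero_fs delta_fsums)

lemma eqv_pure_sum:
  assumes "finite T"
  shows "f \<in> fsums K R S \<Longrightarrow> supp f \<subseteq> T \<Longrightarrow> \<exists>ps. set ps \<subseteq> carrier R \<times> carrier S \<and> eqv f (pure_sum ps)"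
  using assms
proof (induction T arbitrary: f rule: finite_induct)
  case empty
  hence "f = fs_zero K" unfolding supp_def fs_zero_def by auto
  thus ?case using eqv_refl[OF zero_fsums] by (intro exI[of _ "[]"]) simp
next
  case (insert p T)
  show ?case
  proof (cases "p \<in> supp f")
    case False
    hence "supp f \<subseteq> T" using insert.prems(2) by blast
    thus ?thesis using insert.IH insert.prems(1) by blast
  next
    case True
    hence p: "p \<in> carrier R \<times> carrier S" using fsumsD(3)[OF insert.prems(1)] by blast
    then obtain r s where rs: "p = (r, s)" "r \<in> carrier R" "s \<in> carrier S" by blast
    let ?g = "f(p := \<zero>\<^bsub>K\<^esub>)"
    have g: "?g \<in> fsums K R S"
      by (rule fsumsI[of _ "supp f"]) (use fsumsD[OF insert.prems(1)] in \<open>auto simp: supp_def\<close>)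
    have "supp ?g \<subseteq> T" using insert.prems(2) unfolding supp_def by auto
    then obtain ps where ps: "set ps \<subseteq> carrier R \<times> carrier S" "eqv ?g (pure_sum ps)" using insert.IH g by blast
    have fp: "f p \<in> carrier K" by (rule fsumsD(1)[OF insert.prems(1)])
    have f: "f = fs_add K (fs_smul K (f p) (fs_delta K p)) ?g"
      unfolding fs_add_def fs_smul_def fs_delta_def using fsumsD(1)[OF insert.prems(1)] by (intro ext) auto
    have "eqv (fs_smul K (f p) (fs_delta K p)) (fs_delta K (phi (f p) \<otimes>\<^bsub>R\<^esub> r, s))"
      unfolding rs(1) using eqv_sym[OF eqv_delta_smul_left] fp rs by blast
    hence "eqv f (pure_sum ((phi (f p) \<otimes>\<^bsub>R\<^esub> r, s) # ps))"
      using eqv_add[OF _ ps(2)] f by (metis pure_sum.simps(2))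
    moreover have "set ((phi (f p) \<otimes>\<^bsub>R\<^esub> r, s) # ps) \<subseteq> carrier R \<times> carrier S" using ps(1) rs fp by auto
    ultimately show ?thesis by blast
  qed
qed

fun spn :: "('r \<times> 's) list \<Rightarrow> 's set" where
  "spn [] = {\<zero>\<^bsub>S\<^esub>}"
| "spn (p # ps) = {psi c \<otimes>\<^bsub>S\<^esub> snd p \<oplus>\<^bsub>S\<^esub> v | c v. c \<in> carrier K \<and> v \<in> spn ps}"

lemma spn_subsp: "set ps \<subseteq> carrier R \<times> carrier S \<Longrightarrow> S.subsp (spn ps)"
proof (induction ps)
  case Nil
  thus ?case unfolding S.subsp_def by auto
next
  case (Cons p ps)
  hence IH: "S.subsp (spn ps)" and p: "snd p \<in> carrier S" by auto
  note i = S.subspD[OF IH]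
  show ?case unfolding S.subsp_def
  proof (intro conjI ballI)
    show "spn (p # ps) \<subseteq> carrier S" using i p by auto
    have "\<zero>\<^bsub>S\<^esub> = psi \<zero>\<^bsub>K\<^esub> \<otimes>\<^bsub>S\<^esub> snd p \<oplus>\<^bsub>S\<^esub> \<zero>\<^bsub>S\<^esub>" using p by simp
    thus "\<zero>\<^bsub>S\<^esub> \<in> spn (p # ps)" using i(2) R.K.zero_closed by (subst spn.simps) blast
  next
    fix x y assume "x \<in> spn (p # ps)" "y \<in> spn (p # ps)"
    then obtain c v d w where *: "c \<in> carrier K" "v \<in> spn ps" "x = psi c \<otimes>\<^bsub>S\<^esub> snd p \<oplus>\<^bsub>S\<^esub> v"
      "d \<in> carrier K" "w \<in> spn ps" "y = psi d \<otimes>\<^bsub>S\<^esub> snd p \<oplus>\<^bsub>S\<^esub> w" by auto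
    have "x \<oplus>\<^bsub>S\<^esub> y = psi (c \<oplus>\<^bsub>K\<^esub> d) \<otimes>\<^bsub>S\<^esub> snd p \<oplus>\<^bsub>S\<^esub> (v \<oplus>\<^bsub>S\<^esub> w)"
      using * i(5) p by (simp add: S.l_distr S.a_ac)
    thus "x \<oplus>\<^bsub>S\<^esub> y \<in> spn (p # ps)" using * i(3) R.K.a_closed by (subst spn.simps) blast
  next
    fix d x assume d: "d \<in> carrier K" and "x \<in> spn (p # ps)"
    then obtain c v where *: "c \<in> carrier K" "v \<in> spn ps" "x = psi c \<otimes>\<^bsub>S\<^esub> snd p \<oplus>\<^bsub>S\<^esub> v" by auto
    have "psi d \<otimes>\<^bsub>S\<^esub> x = psi (d \<otimes>\<^bsub>K\<^esub> c) \<otimes>\<^bsub>S\<^esub> snd p \<oplus>\<^bsub>S\<^esub> (psi d \<otimes>\<^bsub>S\<^esub> v)"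
      using * i(5) p d by (simp add: S.r_distr S.m_assoc)
    thus "psi d \<otimes>\<^bsub>S\<^esub> x \<in> spn (p # ps)" using * i(4) d R.K.m_closed by (subst spn.simps) blast
  qed
qed

lemma snd_spn: "set ps \<subseteq> carrier R \<times> carrier S \<Longrightarrow> p \<in> set ps \<Longrightarrow> snd p \<in> spn ps"
proof (induction ps)
  case (Cons q ps)
  hence IH: "S.subsp (spn ps)" and q: "snd q \<in> carrier S" using spn_subsp by auto
  note i = S.subspD[OF IH]
  show ?case
  proof (cases "p = q")
    case True
    have "snd q = psi \<one>\<^bsub>K\<^esub> \<otimes>\<^bsub>S\<^esub> snd q \<oplus>\<^bsub>S\<^esub> \<zero>\<^bsub>S\<^esub>" using q by simp
    thus ?thesis using True i(2) R.K.one_closed by (subst spn.simps) blast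
  next
    case False
    hence p: "snd p \<in> spn ps" using Cons by auto
    hence "snd p = psi \<zero>\<^bsub>K\<^esub> \<otimes>\<^bsub>S\<^esub> snd q \<oplus>\<^bsub>S\<^esub> snd p" using q i(5) by simp
    thus ?thesis using p R.K.zero_closed by (subst spn.simps) blast
  qed
qed simp

text \<open>If \<open>s\<close> is a combination of the second components, bilinearity distributes r
  \<otimes> s over the existing summands by changing first components only, so the list gets no
  longer.\<close>

lemma absorb:
  assumes "r \<in> carrier R"
  shows "set ps \<subseteq> carrier R \<times> carrier S \<Longrightarrow> s \<in> spn ps \<Longrightarrow>
    \<exists>qs. length qs = length ps \<and> set qs \<subseteq> carrier R \<times> carrier S
      \<and> eqv (fs_add K (fs_delta K (r, s)) (pure_sum ps)) (pure_sum qs)"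
proof (induction ps arbitrary: s)
  case Nil
  hence s: "s = \<zero>\<^bsub>S\<^esub>" by simp
  have "eqv (fs_add K (fs_delta K (r, \<zero>\<^bsub>S\<^esub>)) (fs_zero K)) (fs_add K (fs_zero K) (fs_zero K))"
    by (intro eqv_add eqv_delta_zero(2) eqv_refl zero_fsums assms)
  thus ?case using s by (intro exI[of _ "[]"]) (simp add: zero_fs zero_fsums)
next
  case (Cons p ps)
  obtain r1 s1 where p: "p = (r1, s1)" "r1 \<in> carrier R" "s1 \<in> carrier S" using Cons.prems by auto
  from Cons.prems obtain c v where cv: "c \<in> carrier K" "v \<in> spn ps" "s = psi c \<otimes>\<^bsub>S\<^esub> s1 \<oplus>\<^bsub>S\<^esub> v"
    unfolding p(1) by auto
  have ps: "set ps \<subseteq> carrier R \<times> carrier S" using Cons.prems by simp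
  have v: "v \<in> carrier S" using S.subspD(5)[OF spn_subsp[OF ps] cv(2)] .
  obtain qs where qs: "length qs = length ps" "set qs \<subseteq> carrier R \<times> carrier S"
    "eqv (fs_add K (fs_delta K (r, v)) (pure_sum ps)) (pure_sum qs)" using Cons.IH[OF ps cv(2)] by blast
  have w: "phi c \<otimes>\<^bsub>R\<^esub> r \<in> carrier R" "psi c \<otimes>\<^bsub>S\<^esub> s1 \<in> carrier S" using cv p assms by auto
  let ?d = "\<lambda>r s. fs_delta K (r, s)"
  have fs: "?d (phi c \<otimes>\<^bsub>R\<^esub> r) s1 \<in> fsums K R S" "?d r v \<in> fsums K R S" "?d r1 s1 \<in> fsums K R S"
    "pure_sum ps \<in> fsums K R S"
    using w p v assms pure_sum_fsums[OF ps] by (auto intro!: delta_fsums)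
  have "eqv (?d r s) (fs_add K (?d r (psi c \<otimes>\<^bsub>S\<^esub> s1)) (?d r v))"
    unfolding cv(3) by (rule eqv_delta_add_right[OF assms w(2) v])
  moreover have "eqv (fs_add K (?d r (psi c \<otimes>\<^bsub>S\<^esub> s1)) (?d r v)) (fs_add K (?d (phi c \<otimes>\<^bsub>R\<^esub> r) s1) (?d r v))"
    by (intro eqv_add eqv_delta_move cv(1) assms p(3) eqv_refl fs(2))
  ultimately have "eqv (?d r s) (fs_add K (?d (phi c \<otimes>\<^bsub>R\<^esub> r) s1) (?d r v))" by (rule eqv_trans)
  hence 1: "eqv (fs_add K (?d r s) (pure_sum (p # ps)))
      (fs_add K (fs_add K (?d (phi c \<otimes>\<^bsub>R\<^esub> r) s1) (?d r v)) (fs_add K (?d r1 s1) (pure_sum ps)))"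
    unfolding p(1) pure_sum.simps by (intro eqv_add eqv_refl add_fsums fs(3,4))
  have 2: "fs_add K (fs_add K (?d (phi c \<otimes>\<^bsub>R\<^esub> r) s1) (?d r v)) (fs_add K (?d r1 s1) (pure_sum ps))
      = fs_add K (fs_add K (?d (phi c \<otimes>\<^bsub>R\<^esub> r) s1) (?d r1 s1)) (fs_add K (?d r v) (pure_sum ps))"
    using fs by (metis add_assoc_fs add_comm_fs add_fsums)
  have 3: "eqv (fs_add K (fs_add K (?d (phi c \<otimes>\<^bsub>R\<^esub> r) s1) (?d r1 s1)) (fs_add K (?d r v) (pure_sum ps)))
      (fs_add K (?d (phi c \<otimes>\<^bsub>R\<^esub> r \<oplus>\<^bsub>R\<^esub> r1) s1) (pure_sum qs))"
    by (intro eqv_add qs(3) eqv_sym[OF eqv_delta_add_left] w(1) p)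
  show ?case
    using eqv_trans[OF 1[unfolded 2] 3] qs w p
    by (intro exI[of _ "(phi c \<otimes>\<^bsub>R\<^esub> r \<oplus>\<^bsub>R\<^esub> r1, s1) # qs"]) auto
qed

text \<open>Induction on the length shows without bases that pairs of functionals separate points.
  If the second component of the head depends on the others, the head is absorbed and the list
  shortens. Otherwise some \<open>m\<close> is 1 there and 0 on the others, so every functional
  kills the first component, which is therefore zero.\<close>

lemma pure_sum_rel:
  assumes "set ps \<subseteq> carrier R \<times> carrier S"
    and "\<And>l m. R.linf l \<Longrightarrow> S.linf m \<Longrightarrow> ev (\<lambda>p. l (fst p) \<otimes>\<^bsub>K\<^esub> m (snd p)) (pure_sum ps) = \<zero>\<^bsub>K\<^esub>"
  shows "pure_sum ps \<in> rel"
  using assms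
proof (induction "length ps" arbitrary: ps)
  case 0
  thus ?case using tensor_rel.zero by simp
next
  case (Suc n)
  then obtain r s qs where ps: "ps = (r, s) # qs" "length qs = n" "r \<in> carrier R" "s \<in> carrier S"
    "set qs \<subseteq> carrier R \<times> carrier S" by (cases ps) auto
  have d: "fs_delta K (r, s) \<in> fsums K R S" "pure_sum qs \<in> fsums K R S"
    using ps delta_fsums pure_sum_fsums by auto
  show ?case
  proof (cases "s \<in> spn qs")
    case True
    obtain ts where ts: "length ts = length qs" "set ts \<subseteq> carrier R \<times> carrier S" "eqv (pure_sum ps) (pure_sum ts)"
      using absorb[OF ps(3,5) True] unfolding ps(1) by auto
    have "pure_sum ts \<in> rel"
    proof (rule Suc.hyps(1)[OF _ ts(2)])
      show "n = length ts" using ts ps by simp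
      fix l m assume "R.linf l" "S.linf m"
      thus "ev (\<lambda>p. l (fst p) \<otimes>\<^bsub>K\<^esub> m (snd p)) (pure_sum ts) = \<zero>\<^bsub>K\<^esub>"
        using Suc.prems(2) ev_eqv[OF ts(3) bilin_tensor] by simp
    qed
    thus ?thesis by (rule eqv_rel[OF _ ts(3)])
  next
    case False
    obtain m where m: "S.linf m" "\<forall>x\<in>spn qs. m x = \<zero>\<^bsub>K\<^esub>" "m s = \<one>\<^bsub>K\<^esub>"
      using S.functional_exists[OF spn_subsp[OF ps(5)] ps(4) False] by blast
    have evq: "ev (\<lambda>p. l (fst p) \<otimes>\<^bsub>K\<^esub> m (snd p)) (pure_sum qs') = \<zero>\<^bsub>K\<^esub>"
      if l: "R.linf l" and "set qs' \<subseteq> set qs" for l qs'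
      using that(2)
    proof (induction qs')
      case Nil thus ?case by (simp add: ev_zero)
    next
      case (Cons q qs')
      have q: "q \<in> carrier R \<times> carrier S" "set qs' \<subseteq> carrier R \<times> carrier S" "m (snd q) = \<zero>\<^bsub>K\<^esub>"
        using Cons.prems ps(5) snd_spn[OF ps(5), of q] m(2) by auto
      have "l (fst q) \<in> carrier K" using R.linfD(1)[OF l] q(1) by auto
      thus ?case using Cons q
        by (simp add: ev_add[OF delta_fsums pure_sum_fsums bilin_tensor[OF l m(1)]] ev_delta[OF _ bilin_tensor[OF l m(1)]])
    qed
    have r0: "r = \<zero>\<^bsub>R\<^esub>"
    proof (rule ccontr)
      assume "r \<noteq> \<zero>\<^bsub>R\<^esub>"
      moreover have "R.subsp {\<zero>\<^bsub>R\<^esub>}" unfolding R.subsp_def by auto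
      ultimately obtain l where l: "R.linf l" "l r = \<one>\<^bsub>K\<^esub>" using R.functional_exists[of "{\<zero>\<^bsub>R\<^esub>}" r] ps(3) by auto
      have "ev (\<lambda>p. l (fst p) \<otimes>\<^bsub>K\<^esub> m (snd p)) (pure_sum ps) = \<one>\<^bsub>K\<^esub>"
        unfolding ps(1) using ps(3,4) l m(3) evq[OF l(1) subset_refl]
        by (simp add: ev_add[OF d bilin_tensor[OF l(1) m(1)]] ev_delta[OF _ bilin_tensor[OF l(1) m(1)]])
      thus False using Suc.prems(2)[OF l(1) m(1)] by simp
    qed
    have e: "eqv (pure_sum ps) (pure_sum qs)"
    proof -
      have "eqv (pure_sum ps) (fs_add K (fs_zero K) (pure_sum qs))"
        unfolding ps(1) r0 pure_sum.simps by (intro eqv_add eqv_delta_zero(1) ps(4) eqv_refl d(2))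
      thus ?thesis using zero_fs(2)[OF d(2)] by simp
    qed
    have "pure_sum qs \<in> rel"
    proof (rule Suc.hyps(1)[OF _ ps(5)])
      show "n = length qs" using ps by simp
      fix l m assume "R.linf l" "S.linf m"
      thus "ev (\<lambda>p. l (fst p) \<otimes>\<^bsub>K\<^esub> m (snd p)) (pure_sum qs) = \<zero>\<^bsub>K\<^esub>"
        using Suc.prems(2) ev_eqv[OF e bilin_tensor] by simp
    qed
    thus ?thesis by (rule eqv_rel[OF _ e])
  qed
qed

theorem functionals_detect:
  assumes f: "f \<in> fsums K R S" "f \<notin> rel"
  shows "\<exists>l m. R.linf l \<and> S.linf m \<and> ev (\<lambda>p. l (fst p) \<otimes>\<^bsub>K\<^esub> m (snd p)) f \<noteq> \<zero>\<^bsub>K\<^esub>"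
proof (rule ccontr)
  assume neg: "\<not> ?thesis"
  obtain ps where ps: "set ps \<subseteq> carrier R \<times> carrier S" "eqv f (pure_sum ps)"
    using eqv_pure_sum[OF fsumsD(2)[OF f(1)] f(1) subset_refl] by blast
  have "pure_sum ps \<in> rel"
  proof (rule pure_sum_rel[OF ps(1)])
    fix l m assume "R.linf l" "S.linf m"
    thus "ev (\<lambda>p. l (fst p) \<otimes>\<^bsub>K\<^esub> m (snd p)) (pure_sum ps) = \<zero>\<^bsub>K\<^esub>"
      using neg ev_eqv[OF ps(2) bilin_tensor] by simp
  qed
  thus False using f(2) eqv_rel[OF _ ps(2)] by blast
qed

lemma self_tclass: "f \<in> fsums K R S \<Longrightarrow> f \<in> tclass K R S phi psi f"
  using eqv_refl[of f] unfolding tclass_def eqv_def by blast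

lemma tclass_eqv: "f \<in> fsums K R S \<Longrightarrow> g \<in> tclass K R S phi psi f \<longleftrightarrow> eqv g f"
  unfolding tclass_def eqv_def by blast

lemma tclass_zero: "f \<in> rel \<Longrightarrow> tclass K R S phi psi f = tclass K R S phi psi (fs_zero K)"
proof -
  assume f: "f \<in> rel"
  have "fs_add K f (fs_neg K (fs_zero K)) = f"
    unfolding fs_add_def fs_neg_def fs_zero_def using fsumsD(1)[OF rel_fsums[OF f]] by (intro ext) simp
  hence e: "eqv f (fs_zero K)" unfolding eqv_def using f rel_fsums zero_fsums by simp
  show ?thesis
  proof (rule Set.set_eqI)
    fix g
    show "g \<in> tclass K R S phi psi f \<longleftrightarrow> g \<in> tclass K R S phi psi (fs_zero K)"
      unfolding tclass_eqv[OF rel_fsums[OF f]] tclass_eqv[OF zero_fsums]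
      using eqv_trans[OF _ e, of g] eqv_trans[OF _ eqv_sym[OF e], of g] by blast
  qed
qed

end

section \<open>The completed tensor product\<close>

lemma (in abelian_monoid) finsum_fibers:
  assumes T: "finite T" "f \<in> T \<rightarrow> carrier G"
  shows "finsum G f T = (\<Oplus>u\<in>g ` T. \<Oplus>x\<in>{x \<in> T. g x = u}. f x)"
proof -
  let ?h = "\<lambda>x u. if g x = u then f x else \<zero>"
  have f: "f x \<in> carrier G" if "x \<in> T" for x using T that by blast
  have "finsum G f T = (\<Oplus>x\<in>T. \<Oplus>u\<in>g ` T. ?h x u)"
  proof (rule finsum_cong'[OF refl])
    show "(\<lambda>x. \<Oplus>u\<in>g ` T. ?h x u) \<in> T \<rightarrow> carrier G" using f by (intro Pi_I finsum_closed) auto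
    fix x assume x: "x \<in> T"
    have "(\<Oplus>u\<in>g ` T. ?h x u) = ?h x (g x)" using T x f by (intro finsum_single) auto
    thus "f x = (\<Oplus>u\<in>g ` T. ?h x u)" by simp
  qed
  also have "\<dots> = (\<Oplus>u\<in>g ` T. \<Oplus>x\<in>T. ?h x u)" using T f by (intro finsum_swap) auto
  also have "\<dots> = (\<Oplus>u\<in>g ` T. \<Oplus>x\<in>{x \<in> T. g x = u}. f x)"
  proof (rule finsum_cong'[OF refl])
    show "(\<lambda>u. \<Oplus>x\<in>{x \<in> T. g x = u}. f x) \<in> g ` T \<rightarrow> carrier G"
      using f by (intro Pi_I finsum_closed) auto
    fix u assume "u \<in> g ` T"
    have "(\<Oplus>x\<in>T. ?h x u) = (\<Oplus>x\<in>{x \<in> T. g x = u}. ?h x u)"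
      using T f by (intro finsum_neutral_subset) auto
    also have "\<dots> = (\<Oplus>x\<in>{x \<in> T. g x = u}. f x)" using f by (intro finsum_cong') auto
    finally show "(\<Oplus>x\<in>T. ?h x u) = (\<Oplus>x\<in>{x \<in> T. g x = u}. f x)" .
  qed
  finally show ?thesis .
qed

lemma (in abelian_monoid) finsum_product:
  assumes P: "finite P" "finite Q" "\<And>p q. p \<in> P \<Longrightarrow> q \<in> Q \<Longrightarrow> f p q \<in> carrier G"
  shows "(\<Oplus>z\<in>P \<times> Q. f (fst z) (snd z)) = (\<Oplus>q\<in>Q. \<Oplus>p\<in>P. f p q)"
proof (cases "P = {}")
  case False
  have "(\<Oplus>z\<in>P \<times> Q. f (fst z) (snd z))
      = (\<Oplus>u\<in>snd ` (P \<times> Q). \<Oplus>z\<in>{z \<in> P \<times> Q. snd z = u}. f (fst z) (snd z))"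
    using P by (intro finsum_fibers) auto
  also have "snd ` (P \<times> Q) = Q" using False by simp
  also have "(\<Oplus>u\<in>Q. \<Oplus>z\<in>{z \<in> P \<times> Q. snd z = u}. f (fst z) (snd z)) = (\<Oplus>q\<in>Q. \<Oplus>p\<in>P. f p q)"
  proof (rule finsum_cong'[OF refl])
    show "(\<lambda>q. \<Oplus>p\<in>P. f p q) \<in> Q \<rightarrow> carrier G" using P by (intro Pi_I finsum_closed) auto
    fix q assume q: "q \<in> Q"
    have "{z \<in> P \<times> Q. snd z = q} = (\<lambda>p. (p, q)) ` P" using q by auto
    hence "(\<Oplus>z\<in>{z \<in> P \<times> Q. snd z = q}. f (fst z) (snd z)) = (\<Oplus>z\<in>(\<lambda>p. (p, q)) ` P. f (fst z) (snd z))"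
      by simp
    also have "\<dots> = (\<Oplus>p\<in>P. f p q)"
      using P q by (subst finsum_reindex) (auto simp: inj_on_def)
    finally show "(\<Oplus>z\<in>{z \<in> P \<times> Q. snd z = q}. f (fst z) (snd z)) = (\<Oplus>p\<in>P. f p q)" .
  qed
  finally show ?thesis .
qed simp

context tensor_pair
begin

text \<open>\<open>fs_push\<close> and \<open>fs_mult\<close> both collect coefficients along the
  fibres of a map to pairs; this evaluates bilinear forms on either of them.\<close>

lemma fiber_sum:
  assumes fin: "finite T" "c \<in> T \<rightarrow> carrier K" "g \<in> T \<rightarrow> carrier R \<times> carrier S"
  defines "F \<equiv> \<lambda>u. \<Oplus>\<^bsub>K\<^esub>x\<in>{x \<in> T. g x = u}. c x"
  shows "F \<in> fsums K R S" "bilin b \<Longrightarrow> ev b F = (\<Oplus>\<^bsub>K\<^esub>x\<in>T. c x \<otimes>\<^bsub>K\<^esub> b (g x))"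
proof -
  have c: "c x \<in> carrier K" if "x \<in> T" for x using fin(2) that by blast
  have g: "g x \<in> carrier R \<times> carrier S" if "x \<in> T" for x using fin(3) that by blast
  have FK: "F u \<in> carrier K" for u unfolding F_def using c by (intro R.K.finsum_closed) auto
  have F0: "F u = \<zero>\<^bsub>K\<^esub>" if "u \<notin> g ` T" for u
  proof -
    have "{x \<in> T. g x = u} = {}" using that by blast
    thus ?thesis unfolding F_def by (simp only: R.K.finsum_empty)
  qed
  have T: "finite (g ` T)" "g ` T \<subseteq> carrier R \<times> carrier S" using fin(1) g by blast+
  show F: "F \<in> fsums K R S" by (rule fsumsI[OF FK T F0])
  assume b: "bilin b"
  have bg: "b (g x) \<in> carrier K" if "x \<in> T" for x using bilin_closed[OF b g[OF that]] .
  have "supp F \<subseteq> g ` T" using F0 unfolding supp_def by blast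
  hence "ev b F = (\<Oplus>\<^bsub>K\<^esub>u\<in>g ` T. F u \<otimes>\<^bsub>K\<^esub> b u)" by (rule ev_superset[OF F b T(1) _ T(2)])
  also have "\<dots> = (\<Oplus>\<^bsub>K\<^esub>u\<in>g ` T. \<Oplus>\<^bsub>K\<^esub>x\<in>{x \<in> T. g x = u}. c x \<otimes>\<^bsub>K\<^esub> b (g x))"
  proof (rule R.K.finsum_cong'[OF refl])
    show "(\<lambda>u. \<Oplus>\<^bsub>K\<^esub>x\<in>{x \<in> T. g x = u}. c x \<otimes>\<^bsub>K\<^esub> b (g x)) \<in> g ` T \<rightarrow> carrier K"
      using c bg by (intro Pi_I R.K.finsum_closed) auto
    fix u assume u: "u \<in> g ` T"
    have bu: "b u \<in> carrier K" using u bg by auto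
    have "F u \<otimes>\<^bsub>K\<^esub> b u = (\<Oplus>\<^bsub>K\<^esub>x\<in>{x \<in> T. g x = u}. c x \<otimes>\<^bsub>K\<^esub> b u)"
      unfolding F_def using fin(1) c bu by (intro R.K.finsum_ldistr) auto
    also have "\<dots> = (\<Oplus>\<^bsub>K\<^esub>x\<in>{x \<in> T. g x = u}. c x \<otimes>\<^bsub>K\<^esub> b (g x))"
      using c bg by (intro R.K.finsum_cong') auto
    finally show "F u \<otimes>\<^bsub>K\<^esub> b u = (\<Oplus>\<^bsub>K\<^esub>x\<in>{x \<in> T. g x = u}. c x \<otimes>\<^bsub>K\<^esub> b (g x))" .
  qed
  also have "\<dots> = (\<Oplus>\<^bsub>K\<^esub>x\<in>T. c x \<otimes>\<^bsub>K\<^esub> b (g x))"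
    using fin(1) c bg by (intro R.K.finsum_fibers[symmetric]) auto
  finally show "ev b F = (\<Oplus>\<^bsub>K\<^esub>x\<in>T. c x \<otimes>\<^bsub>K\<^esub> b (g x))" .
qed

lemma push_fsums_ev:
  assumes T: "finite {x. f x \<noteq> \<zero>\<^bsub>K\<^esub>}" "\<And>x. f x \<in> carrier K"
    and pq: "\<And>x. f x \<noteq> \<zero>\<^bsub>K\<^esub> \<Longrightarrow> p (fst x) \<in> carrier R \<and> q (snd x) \<in> carrier S"
  shows "fs_push K p q f \<in> fsums K R S"
    "bilin b \<Longrightarrow> ev b (fs_push K p q f) = (\<Oplus>\<^bsub>K\<^esub>x\<in>{x. f x \<noteq> \<zero>\<^bsub>K\<^esub>}. f x \<otimes>\<^bsub>K\<^esub> b (p (fst x), q (snd x)))"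
proof -
  have eq: "fs_push K p q f = (\<lambda>u. \<Oplus>\<^bsub>K\<^esub>x\<in>{x \<in> {x. f x \<noteq> \<zero>\<^bsub>K\<^esub>}. (p (fst x), q (snd x)) = u}. f x)"
    unfolding fs_push_def by (intro ext) (auto intro!: arg_cong[where f = "finsum K f"])
  have m: "f \<in> {x. f x \<noteq> \<zero>\<^bsub>K\<^esub>} \<rightarrow> carrier K"
    "(\<lambda>x. (p (fst x), q (snd x))) \<in> {x. f x \<noteq> \<zero>\<^bsub>K\<^esub>} \<rightarrow> carrier R \<times> carrier S" using assms by auto
  show "fs_push K p q f \<in> fsums K R S" unfolding eq by (rule fiber_sum(1)[OF T(1) m])
  show "bilin b \<Longrightarrow> ev b (fs_push K p q f) = (\<Oplus>\<^bsub>K\<^esub>x\<in>{x. f x \<noteq> \<zero>\<^bsub>K\<^esub>}. f x \<otimes>\<^bsub>K\<^esub> b (p (fst x), q (snd x)))"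
    unfolding eq by (rule fiber_sum(2)[OF T(1) m])
qed

lemma mult_fsums_ev:
  assumes f: "f \<in> fsums K R S" and g: "g \<in> fsums K R S"
  shows "fs_mult K R S f g \<in> fsums K R S"
    "bilin b \<Longrightarrow> ev b (fs_mult K R S f g) = (\<Oplus>\<^bsub>K\<^esub>z\<in>supp f \<times> supp g. (f (fst z) \<otimes>\<^bsub>K\<^esub> g (snd z))
      \<otimes>\<^bsub>K\<^esub> b (fst (fst z) \<otimes>\<^bsub>R\<^esub> fst (snd z), snd (fst z) \<otimes>\<^bsub>S\<^esub> snd (snd z)))"
proof -
  let ?c = "\<lambda>z. f (fst z) \<otimes>\<^bsub>K\<^esub> g (snd z)"
  let ?g = "\<lambda>z. (fst (fst z) \<otimes>\<^bsub>R\<^esub> fst (snd z), snd (fst z) \<otimes>\<^bsub>S\<^esub> snd (snd z))"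
  have eq: "fs_mult K R S f g = (\<lambda>u. \<Oplus>\<^bsub>K\<^esub>z\<in>{z \<in> supp f \<times> supp g. ?g z = u}. ?c z)"
  proof
    fix u :: "'r \<times> 's"
    obtain a b where u: "u = (a, b)" by (cases u)
    have s: "{(p, q). f p \<noteq> \<zero>\<^bsub>K\<^esub> \<and> g q \<noteq> \<zero>\<^bsub>K\<^esub> \<and> fst p \<otimes>\<^bsub>R\<^esub> fst q = a \<and> snd p \<otimes>\<^bsub>S\<^esub> snd q = b}
      = {z \<in> supp f \<times> supp g. ?g z = u}" unfolding u supp_def by auto
    have t: "(\<lambda>(p, q). f p \<otimes>\<^bsub>K\<^esub> g q) = ?c" by auto
    show "fs_mult K R S f g u = (\<Oplus>\<^bsub>K\<^esub>z\<in>{z \<in> supp f \<times> supp g. ?g z = u}. ?c z)"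
      unfolding fs_mult_def t[symmetric] s[symmetric] by (simp add: u)
  qed
  have T: "finite (supp f \<times> supp g)" using fsumsD(2)[OF f] fsumsD(2)[OF g] by simp
  have m: "?c \<in> supp f \<times> supp g \<rightarrow> carrier K" using fsumsD(1)[OF f] fsumsD(1)[OF g] by auto
  have n: "?g \<in> supp f \<times> supp g \<rightarrow> carrier R \<times> carrier S"
  proof
    fix z assume "z \<in> supp f \<times> supp g"
    hence "fst z \<in> carrier R \<times> carrier S" "snd z \<in> carrier R \<times> carrier S"
      using fsumsD(3)[OF f] fsumsD(3)[OF g] by auto
    thus "?g z \<in> carrier R \<times> carrier S" by auto
  qed
  show "fs_mult K R S f g \<in> fsums K R S" unfolding eq by (rule fiber_sum(1)[OF T m n])
  show "bilin b \<Longrightarrow> ev b (fs_mult K R S f g) = (\<Oplus>\<^bsub>K\<^esub>z\<in>supp f \<times> supp g. ?c z \<otimes>\<^bsub>K\<^esub> b (?g z))"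
    unfolding eq by (rule fiber_sum(2)[OF T m n])
qed

lemma fs_mult_comm:
  assumes f: "f \<in> fsums K R S" and g: "g \<in> fsums K R S"
  shows "fs_mult K R S f g = fs_mult K R S g f"
proof
  fix u :: "'r \<times> 's"
  obtain a b where u: "u = (a, b)" by (cases u)
  let ?s = "\<lambda>f g. {(p, q). f p \<noteq> \<zero>\<^bsub>K\<^esub> \<and> g q \<noteq> \<zero>\<^bsub>K\<^esub> \<and> fst p \<otimes>\<^bsub>R\<^esub> fst q = a \<and> snd p \<otimes>\<^bsub>S\<^esub> snd q = b}"
  have carr: "fst p \<in> carrier R" "snd p \<in> carrier S" if "k \<in> fsums K R S" "k p \<noteq> \<zero>\<^bsub>K\<^esub>" for k p
    using fsumsD(3)[OF that(1)] that(2) unfolding supp_def by auto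
  have sw: "?s g f = prod.swap ` ?s f g"
    using carr[OF f] carr[OF g] by (force simp: image_iff R.m_comm S.m_comm)
  have "(\<Oplus>\<^bsub>K\<^esub>z\<in>?s g f. case z of (p, q) \<Rightarrow> g p \<otimes>\<^bsub>K\<^esub> f q) = (\<Oplus>\<^bsub>K\<^esub>z\<in>?s f g. case prod.swap z of (p, q) \<Rightarrow> g p \<otimes>\<^bsub>K\<^esub> f q)"
    unfolding sw using fsumsD(1)[OF f] fsumsD(1)[OF g] by (intro R.K.finsum_reindex) auto
  also have "\<dots> = (\<Oplus>\<^bsub>K\<^esub>z\<in>?s f g. case z of (p, q) \<Rightarrow> f p \<otimes>\<^bsub>K\<^esub> g q)"
    using fsumsD(1)[OF f] fsumsD(1)[OF g] by (intro R.K.finsum_cong') (auto simp: R.K.m_comm)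
  finally show "fs_mult K R S f g u = fs_mult K R S g f u" unfolding fs_mult_def u by simp
qed

end

section \<open>Functionals on the quotients by powers of the ideal\<close>

context complete_domain
begin

abbreviation "quo n \<equiv> R Quot ipow n"
abbreviation "quo_h n \<equiv> \<lambda>c. ipow n +> h c"

text \<open>Any representative will do: a functional that vanishes on \<open>ipow n\<close> is
  constant on cosets of \<open>ipow n\<close>, so its value at \<open>lift U\<close> depends only on
  \<open>U\<close>.\<close>

definition lift :: "'a set \<Rightarrow> 'a" where "lift U = (SOME a. a \<in> U)"

lemma quo_hom: "(+>) (ipow n) \<in> ring_hom R (quo n)"
  by (rule ideal.rcos_ring_hom[OF ideal_pow_ideal[OF I(1)]])

lemma quo_scalars: "scalars K (quo n) (quo_h n)"
proof (intro scalars.intro scalars_axioms.intro K.field_axioms)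
  show "cring (quo n)" by (rule ideal.quotient_is_cring[OF ideal_pow_ideal[OF I(1)] cring_axioms])
  show "quo_h n \<in> ring_hom K (quo n)" using ring_hom_trans[OF h_hom quo_hom] by (simp add: comp_def)
qed

lemma quoE:
  assumes "U \<in> carrier (quo n)" obtains x where "x \<in> carrier R" "U = ipow n +> x"
  using assms unfolding FactRing_def A_RCOSETS_def' by auto

lemma coset_diff: "x \<in> carrier R \<Longrightarrow> a \<in> ipow n +> x \<Longrightarrow> a \<in> carrier R \<and> a \<ominus> x \<in> ipow n"
proof -
  assume x: "x \<in> carrier R" and "a \<in> ipow n +> x"
  then obtain i where i: "i \<in> ipow n" "a = i \<oplus> x" unfolding a_r_coset_def' by blast
  have ic: "i \<in> carrier R" using ideal_pow_carr[OF I(1) i(1)] .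
  have "a \<ominus> x = i" unfolding i(2) using ic x by algebra
  thus ?thesis using i x ic by simp
qed

lemma coset_self: "x \<in> carrier R \<Longrightarrow> x \<in> ipow n +> x"
  using ideal_zero[OF ideal_pow_ideal[OF I(1)]] unfolding a_r_coset_def' by force

lemma lift_coset:
  assumes "x \<in> carrier R"
  shows "lift (ipow n +> x) \<in> carrier R" "lift (ipow n +> x) \<ominus> x \<in> ipow n"
  using coset_diff[OF assms someI[of "\<lambda>a. a \<in> ipow n +> x", OF coset_self[OF assms]]]
  unfolding lift_def by auto

lemma lift_carr: "U \<in> carrier (quo n) \<Longrightarrow> lift U \<in> carrier R"
  by (elim quoE) (use lift_coset in blast)

lemma cont_eq:
  assumes "cont n l" "x \<in> carrier R" "y \<in> carrier R" "y \<ominus> x \<in> ipow n" shows "l y = l x"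
proof -
  have "l y \<ominus>\<^bsub>K\<^esub> l x = \<zero>\<^bsub>K\<^esub>" using assms linf_diff[of l y x] unfolding cont_def by simp
  thus ?thesis using assms linfD(1)[of l] unfolding cont_def by simp
qed

lemma cont_lift: "cont n l \<Longrightarrow> n \<le> k \<Longrightarrow> x \<in> carrier R \<Longrightarrow> l (lift (ipow k +> x)) = l x"
  using cont_eq[of n l x "lift (ipow k +> x)"] lift_coset[of x k] ideal_pow_antimono[OF I(1), of n k] by blast

lemma coset_lift: "U \<in> carrier (quo n) \<Longrightarrow> ipow n +> lift U = U"
proof (elim quoE)
  fix x assume x: "x \<in> carrier R" "U = ipow n +> x"
  have "lift U \<ominus> x \<in> ipow n" "lift U \<in> carrier R" using lift_coset[OF x(1)] x(2) by auto
  thus ?thesis using quotient_eq_iff_same_a_r_cos[OF ideal_pow_ideal[OF I(1)] _ x(1), of "lift U" n] x(2) by blast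
qed

lemma linf_quo:
  assumes l: "cont n l" shows "scalars.linf K (quo n) (quo_h n) (\<lambda>U. l (lift U))"
proof -
  interpret q: scalars K "quo n" "quo_h n" by (rule quo_scalars)
  have ll: "linf l" using l unfolding cont_def by blast
  show ?thesis unfolding q.linf_def
  proof (intro conjI ballI)
    fix U assume U: "U \<in> carrier (quo n)"
    show "l (lift U) \<in> carrier K" using linfD(1)[OF ll] lift_carr[OF U] by blast
    fix V assume V: "V \<in> carrier (quo n)"
    have "U \<oplus>\<^bsub>quo n\<^esub> V = ipow n +> (lift U \<oplus> lift V)"
      using ring_hom_add[OF quo_hom lift_carr[OF U] lift_carr[OF V]] coset_lift[OF U] coset_lift[OF V] by simp
    thus "l (lift (U \<oplus>\<^bsub>quo n\<^esub> V)) = l (lift U) \<oplus>\<^bsub>K\<^esub> l (lift V)"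
      using cont_lift[OF l order_refl] linfD(2)[OF ll] lift_carr[OF U] lift_carr[OF V] by simp
  next
    fix c U assume c: "c \<in> carrier K" and U: "U \<in> carrier (quo n)"
    have "quo_h n c \<otimes>\<^bsub>quo n\<^esub> U = ipow n +> (h c \<otimes> lift U)"
      using ring_hom_mult[OF quo_hom h.hom_closed[OF c] lift_carr[OF U]] coset_lift[OF U] by simp
    thus "l (lift (quo_h n c \<otimes>\<^bsub>quo n\<^esub> U)) = c \<otimes>\<^bsub>K\<^esub> l (lift U)"
      using cont_lift[OF l order_refl] linfD(3)[OF ll] lift_carr[OF U] c by simp
  qed
qed

text \<open>Together with \<open>linf_quo\<close> this identifies functionals on the quotient with
  those on \<open>R\<close> that vanish on \<open>ipow n\<close>, so different levels are compared
  through functionals on one fixed ring.\<close>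

lemma cont_of_quo:
  assumes l: "scalars.linf K (quo n) (quo_h n) l" shows "cont n (\<lambda>x. l (ipow n +> x))"
proof -
  interpret q: scalars K "quo n" "quo_h n" by (rule quo_scalars)
  have qc: "ipow n +> x \<in> carrier (quo n)" if "x \<in> carrier R" for x using ring_hom_closed[OF quo_hom that] .
  have "linf (\<lambda>x. l (ipow n +> x))" unfolding linf_def
    using q.linfD[OF l] qc ring_hom_add[OF quo_hom] ring_hom_mult[OF quo_hom] by simp
  moreover have "l (ipow n +> x) = \<zero>\<^bsub>K\<^esub>" if x: "x \<in> ipow n" for x
  proof -
    have "ipow n +> x = \<zero>\<^bsub>quo n\<^esub>"
      using quotient_eq_iff_same_a_r_cos[OF ideal_pow_ideal[OF I(1)] ideal_pow_carr[OF I(1) x] zero_closed, of n]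
        ring_hom_zero[OF quo_hom ring_axioms q.ring_axioms] x ideal_pow_carr[OF I(1) x] by (simp add: a_minus_def)
    thus ?thesis using q.linf_zero[OF l] by simp
  qed
  ultimately show ?thesis unfolding cont_def by blast
qed

lemma qproj_coset:
  assumes nk: "n \<le> k" and x: "x \<in> carrier R"
  shows "qproj R (ipow n) (ipow k +> x) = ipow n +> x"
proof -
  have "ipow n +> a = ipow n +> x" if "a \<in> ipow k +> x" for a
    using coset_diff[OF x that] ideal_pow_antimono[OF I(1) nk]
      quotient_eq_iff_same_a_r_cos[OF ideal_pow_ideal[OF I(1)] _ x, of a n] by blast
  thus ?thesis unfolding qproj_def using coset_self[OF x, of k] by blast
qed

end

lemma complete_domain_max_ideal:
  assumes "algebraically_closed K" "complete_noetherian_local_ring A" "phi \<in> ring_hom K A" "domain A"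
  shows "complete_domain K A phi (max_ideal A)"
proof -
  interpret K: algebraically_closed K by fact
  interpret A: domain A by fact
  have "\<exists>!m. maximalideal m A" using assms(2) unfolding complete_noetherian_local_ring_def local_ring_def by blast
  hence "maximalideal (max_ideal A) A" unfolding max_ideal_def by (rule theI')
  then interpret m: maximalideal "max_ideal A" A .
  have "\<one>\<^bsub>A\<^esub> \<notin> max_ideal A" using m.one_imp_carrier m.I_notcarr by blast
  thus ?thesis
    using assms(2) unfolding complete_noetherian_local_ring_def
    by (intro complete_domain.intro complete_domain_axioms.intro scalars.intro scalars_axioms.intro
        K.field_axioms A.is_cring assms(1,3,4) m.ideal_axioms) auto
qed

section \<open>The levels of the inverse limit\<close>

locale local_pair = complete_domain_pair K A B hA hB "max_ideal A" "max_ideal B"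
  for K :: "('k, 'c) ring_scheme" and A :: "('a, 'd) ring_scheme" and B :: "('b, 'e) ring_scheme" and hA hB
begin

abbreviation "C \<equiv> completed_tensor K A B hA hB"

lemma level_pair: "tensor_pair K (A.quo i) (B.quo j) (A.quo_h i) (B.quo_h j)"
  by (intro tensor_pair.intro A.quo_scalars B.quo_scalars)

text \<open>The same choice as in the operations of \<open>tensor_ring\<close>, so a product in
  \<open>C\<close> is by definition the class of \<open>fs_mult\<close> of these
  representatives.\<close>

definition rep :: "(nat \<Rightarrow> nat \<Rightarrow> ('a set \<times> 'b set \<Rightarrow> 'k) set) \<Rightarrow> nat \<Rightarrow> nat \<Rightarrow> 'a set \<times> 'b set \<Rightarrow> 'k" where
  "rep x i j = (SOME f. f \<in> x i j)"

definition lifted :: "('a \<Rightarrow> 'k) \<Rightarrow> ('b \<Rightarrow> 'k) \<Rightarrow> 'a set \<times> 'b set \<Rightarrow> 'k" where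
  "lifted l m = (\<lambda>p. l (A.lift (fst p)) \<otimes>\<^bsub>K\<^esub> m (B.lift (snd p)))"

abbreviation "cls i j \<equiv> tclass K (A.quo i) (B.quo j) (A.quo_h i) (B.quo_h j)"

abbreviation "eval_form b f \<equiv> tensor_pair.ev K b f"

lemma lifted_bilin: "A.cont i l \<Longrightarrow> B.cont j m \<Longrightarrow> tensor_pair.bilin K (A.quo i) (B.quo j) (A.quo_h i) (B.quo_h j) (lifted l m)"
  unfolding lifted_def
  using tensor_pair.bilin_tensor[OF level_pair A.linf_quo B.linf_quo] by blast

lemma rep_cls:
  assumes "f \<in> fsums K (A.quo i) (B.quo j)" "x i j = cls i j f"
  shows "rep x i j \<in> fsums K (A.quo i) (B.quo j)" "tensor_pair.eqv K (A.quo i) (B.quo j) (A.quo_h i) (B.quo_h j) (rep x i j) f"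
proof -
  interpret t: tensor_pair K "A.quo i" "B.quo j" "A.quo_h i" "B.quo_h j" by (rule level_pair)
  have "rep x i j \<in> x i j" unfolding rep_def using t.self_tclass[OF assms(1)] assms(2) by (metis someI)
  thus e: "t.eqv (rep x i j) f" using t.tclass_eqv[OF assms(1)] assms(2) by simp
  show "rep x i j \<in> fsums K (A.quo i) (B.quo j)" using e unfolding t.eqv_def by blast
qed

lemma carrier_level:
  assumes "x \<in> carrier C"
  shows "\<exists>f\<in>fsums K (A.quo i) (B.quo j). x i j = cls i j f"
proof -
  have "x i j \<in> cls i j ` fsums K (A.quo i) (B.quo j)"
    using assms unfolding completed_tensor_def level_def tensor_ring_def by simp
  thus ?thesis by blast
qed

lemma rep_fsums: "x \<in> carrier C \<Longrightarrow> rep x i j \<in> fsums K (A.quo i) (B.quo j)"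
  using carrier_level[of x i j] rep_cls(1) by metis

lemma zero_C: "\<zero>\<^bsub>C\<^esub> = (\<lambda>i j. cls i j (fs_zero K))"
  and one_C: "\<one>\<^bsub>C\<^esub> = (\<lambda>i j. cls i j (fs_delta K (\<one>\<^bsub>A.quo i\<^esub>, \<one>\<^bsub>B.quo j\<^esub>)))"
  and mult_C: "x \<otimes>\<^bsub>C\<^esub> y = (\<lambda>i j. cls i j (fs_mult K (A.quo i) (B.quo j) (rep x i j) (rep y i j)))"
  unfolding completed_tensor_def level_def tensor_ring_def rep_def by simp_all

text \<open>Being nonzero shows at some level, where \<open>functionals_detect\<close> supplies
  functionals on the two quotients; composed with the projections they become continuous functionals
  on \<open>A\<close> and \<open>B\<close>.\<close>

lemma nonzero_detected:
  assumes x: "x \<in> carrier C" "x \<noteq> \<zero>\<^bsub>C\<^esub>"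
  shows "\<exists>i j l m. A.cont i l \<and> B.cont j m \<and> eval_form (lifted l m) (rep x i j) \<noteq> \<zero>\<^bsub>K\<^esub>"
proof -
  obtain i j where ij: "x i j \<noteq> cls i j (fs_zero K)" using x(2) unfolding zero_C by blast
  interpret t: tensor_pair K "A.quo i" "B.quo j" "A.quo_h i" "B.quo_h j" by (rule level_pair)
  obtain f where f: "f \<in> fsums K (A.quo i) (B.quo j)" "x i j = cls i j f" using carrier_level[OF x(1)] by blast
  have "f \<notin> t.rel" using ij f(2) t.tclass_zero by metis
  then obtain l m where lm: "t.R.linf l" "t.S.linf m" "t.ev (\<lambda>p. l (fst p) \<otimes>\<^bsub>K\<^esub> m (snd p)) f \<noteq> \<zero>\<^bsub>K\<^esub>"
    using t.functionals_detect[OF f(1)] by blast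
  let ?l = "\<lambda>x. l (A.ipow i +>\<^bsub>A\<^esub> x)" and ?m = "\<lambda>x. m (B.ipow j +>\<^bsub>B\<^esub> x)"
  have cont: "A.cont i ?l" "B.cont j ?m" using A.cont_of_quo[OF lm(1)] B.cont_of_quo[OF lm(2)] by auto
  have r: "rep x i j \<in> fsums K (A.quo i) (B.quo j)" by (rule rep_fsums[OF x(1)])
  have "t.ev (lifted ?l ?m) (rep x i j) = t.ev (\<lambda>p. l (fst p) \<otimes>\<^bsub>K\<^esub> m (snd p)) (rep x i j)"
    unfolding t.ev_def
  proof (rule A.K.finsum_cong'[OF refl])
    show "(\<lambda>p. rep x i j p \<otimes>\<^bsub>K\<^esub> (l (fst p) \<otimes>\<^bsub>K\<^esub> m (snd p))) \<in> t.supp (rep x i j) \<rightarrow> carrier K"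
      using t.fsumsD[OF r] t.bilin_closed[OF t.bilin_tensor[OF lm(1,2)]] by blast
    fix p assume "p \<in> t.supp (rep x i j)"
    hence "fst p \<in> carrier (A.quo i)" "snd p \<in> carrier (B.quo j)" using t.fsumsD(3)[OF r] by auto
    thus "rep x i j p \<otimes>\<^bsub>K\<^esub> lifted ?l ?m p = rep x i j p \<otimes>\<^bsub>K\<^esub> (l (fst p) \<otimes>\<^bsub>K\<^esub> m (snd p))"
      unfolding lifted_def using A.coset_lift B.coset_lift by simp
  qed
  also have "\<dots> = t.ev (\<lambda>p. l (fst p) \<otimes>\<^bsub>K\<^esub> m (snd p)) f"
    by (rule t.ev_eqv[OF rep_cls(2)[where x = x, OF f] t.bilin_tensor[OF lm(1,2)]])
  finally show ?thesis using cont lm(3) by metis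
qed

text \<open>A transition map pushes formal sums forward along projections of cosets, and functionals
  continuous at the lower level take the same values on a coset and on its projection. The choice of
  representatives is invisible to bilinear forms.\<close>

lemma ev_compatible:
  assumes x: "x \<in> carrier C" and le: "i \<le> i'" "j \<le> j'" and l: "A.cont i l" and m: "B.cont j m"
  shows "eval_form (lifted l m) (rep x i' j') = eval_form (lifted l m) (rep x i j)"
proof -
  interpret t: tensor_pair K "A.quo i" "B.quo j" "A.quo_h i" "B.quo_h j" by (rule level_pair)
  interpret t': tensor_pair K "A.quo i'" "B.quo j'" "A.quo_h i'" "B.quo_h j'" by (rule level_pair)
  let ?f = "rep x i' j'" and ?p = "qproj A (A.ipow i)" and ?q = "qproj B (B.ipow j)"
  have f: "?f \<in> fsums K (A.quo i') (B.quo j')" by (rule rep_fsums[OF x])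
  have supp: "{z. ?f z \<noteq> \<zero>\<^bsub>K\<^esub>} = t'.supp ?f" unfolding t'.supp_def ..
  have "transition K A B hA hB i j (x i' j') = x i j"
    using x le unfolding completed_tensor_def by auto
  hence xij: "x i j = cls i j (fs_push K ?p ?q ?f)" unfolding transition_def tensor_map_def rep_def by simp
  have pq: "?p (fst z) \<in> carrier (A.quo i) \<and> l (A.lift (?p (fst z))) = l (A.lift (fst z))
      \<and> ?q (snd z) \<in> carrier (B.quo j) \<and> m (B.lift (?q (snd z))) = m (B.lift (snd z))"
    if "?f z \<noteq> \<zero>\<^bsub>K\<^esub>" for z
  proof -
    have z: "fst z \<in> carrier (A.quo i')" "snd z \<in> carrier (B.quo j')"
      using t'.fsumsD(3)[OF f] that unfolding t'.supp_def by auto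
    obtain a where a: "a \<in> carrier A" "fst z = A.ipow i' +>\<^bsub>A\<^esub> a" by (rule A.quoE[OF z(1)])
    obtain b where b: "b \<in> carrier B" "snd z = B.ipow j' +>\<^bsub>B\<^esub> b" by (rule B.quoE[OF z(2)])
    show ?thesis
      unfolding a(2) b(2) A.qproj_coset[OF le(1) a(1)] B.qproj_coset[OF le(2) b(1)]
      using A.cont_lift[OF l _ a(1)] B.cont_lift[OF m _ b(1)] le
        ring_hom_closed[OF A.quo_hom a(1)] ring_hom_closed[OF B.quo_hom b(1)] by simp
  qed
  have push: "fs_push K ?p ?q ?f \<in> fsums K (A.quo i) (B.quo j)"
    "t.ev (lifted l m) (fs_push K ?p ?q ?f) = (\<Oplus>\<^bsub>K\<^esub>z\<in>{z. ?f z \<noteq> \<zero>\<^bsub>K\<^esub>}. ?f z \<otimes>\<^bsub>K\<^esub> lifted l m (?p (fst z), ?q (snd z)))"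
    using t.push_fsums_ev(1)[of ?f ?p ?q] t.push_fsums_ev(2)[of ?f ?p ?q "lifted l m"]
      lifted_bilin[OF l m] t'.fsumsD(1,2)[OF f] pq
    unfolding supp[symmetric] by blast+
  have "t.ev (lifted l m) (rep x i j) = t.ev (lifted l m) (fs_push K ?p ?q ?f)"
    by (rule t.ev_eqv[OF rep_cls(2)[where x = x, OF push(1) xij] lifted_bilin[OF l m]])
  also have "\<dots> = t'.ev (lifted l m) ?f"
    unfolding push(2) supp t'.ev_def[of _ ?f]
  proof (rule A.K.finsum_cong'[OF refl])
    show "(\<lambda>z. ?f z \<otimes>\<^bsub>K\<^esub> lifted l m z) \<in> t'.supp ?f \<rightarrow> carrier K"
      using t'.fsumsD[OF f] t'.bilin_closed[OF lifted_bilin[OF A.cont_mono[OF l le(1)] B.cont_mono[OF m le(2)]]] by blast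
    fix z assume "z \<in> t'.supp ?f"
    hence "?f z \<noteq> \<zero>\<^bsub>K\<^esub>" unfolding t'.supp_def by blast
    thus "?f z \<otimes>\<^bsub>K\<^esub> lifted l m (?p (fst z), ?q (snd z)) = ?f z \<otimes>\<^bsub>K\<^esub> lifted l m z"
      using pq unfolding lifted_def by simp
  qed
  finally show ?thesis by simp
qed

definition index :: "(nat \<Rightarrow> nat \<Rightarrow> ('a set \<times> 'b set \<Rightarrow> 'k) set) \<Rightarrow> nat \<Rightarrow> nat \<Rightarrow> ('a set \<times> 'b set) set" where
  "index x i j = tensor_pair.supp K (rep x i j)"

text \<open>A \<open>family\<close> has no coefficients, so the coefficient of each summand is put
  into its left component.\<close>

definition left :: "(nat \<Rightarrow> nat \<Rightarrow> ('a set \<times> 'b set \<Rightarrow> 'k) set) \<Rightarrow> nat \<Rightarrow> nat \<Rightarrow> 'a set \<times> 'b set \<Rightarrow> 'a" where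
  "left x i j p = hA (rep x i j p) \<otimes>\<^bsub>A\<^esub> A.lift (fst p)"

definition right :: "nat \<Rightarrow> nat \<Rightarrow> 'a set \<times> 'b set \<Rightarrow> 'b" where
  "right i j p = B.lift (snd p)"

lemma index_mem:
  assumes "x \<in> carrier C" "p \<in> index x i j"
  shows "fst p \<in> carrier (A.quo i)" "snd p \<in> carrier (B.quo j)" "rep x i j p \<in> carrier K"
    "A.lift (fst p) \<in> carrier A" "B.lift (snd p) \<in> carrier B"
    "left x i j p \<in> carrier A" "right i j p \<in> carrier B"
proof -
  interpret t: tensor_pair K "A.quo i" "B.quo j" "A.quo_h i" "B.quo_h j" by (rule level_pair)
  note f = t.fsumsD[OF rep_fsums[OF assms(1)]]
  show 1: "fst p \<in> carrier (A.quo i)" "snd p \<in> carrier (B.quo j)" using f(3) assms(2) unfolding index_def by auto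
  show 2: "rep x i j p \<in> carrier K" by (rule f(1))
  show 3: "A.lift (fst p) \<in> carrier A" "B.lift (snd p) \<in> carrier B" using A.lift_carr[OF 1(1)] B.lift_carr[OF 1(2)] .
  show "left x i j p \<in> carrier A" "right i j p \<in> carrier B" unfolding left_def right_def using 2 3 by auto
qed

lemma index_finite: "x \<in> carrier C \<Longrightarrow> finite (index x i j)"
  unfolding index_def by (rule tensor_pair.fsumsD(2)[OF level_pair rep_fsums])

lemma pairing_ev:
  assumes x: "x \<in> carrier C" and l: "A.linf l" and m: "B.linf m"
  shows "pairing (index x i j) (left x i j) (right i j) l m = eval_form (lifted l m) (rep x i j)"
  unfolding pairing_def tensor_pair.ev_def[OF level_pair[of i j]] index_def[symmetric]
proof (rule A.K.finsum_cong'[OF refl])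
  have lm: "l (A.lift (fst p)) \<in> carrier K" "m (B.lift (snd p)) \<in> carrier K" if "p \<in> index x i j" for p
    using index_mem[OF x that] A.linfD(1)[OF l] B.linfD(1)[OF m] by auto
  show "(\<lambda>p. rep x i j p \<otimes>\<^bsub>K\<^esub> lifted l m p) \<in> index x i j \<rightarrow> carrier K"
    unfolding lifted_def using lm index_mem(3)[OF x] by (intro Pi_I A.K.m_closed) auto
  fix p assume p: "p \<in> index x i j"
  show "l (left x i j p) \<otimes>\<^bsub>K\<^esub> m (right i j p) = rep x i j p \<otimes>\<^bsub>K\<^esub> lifted l m p"
    unfolding left_def right_def lifted_def
    using A.linfD(3)[OF l index_mem(3,4)[OF x p]] lm[OF p] index_mem(3)[OF x p] by (simp add: A.K.m_assoc)
qed

lemma family_of: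
  assumes x: "x \<in> carrier C" shows "family (index x) (left x) right"
  unfolding family_def
proof (intro conjI allI impI)
  fix i j
  show "finite (index x i j)" by (rule index_finite[OF x])
  show "left x i j \<in> index x i j \<rightarrow> carrier A" "right i j \<in> index x i j \<rightarrow> carrier B"
    using index_mem(6,7)[OF x] by auto
  fix i' j' l m assume "i \<le> i'" "j \<le> j'" "A.cont i l" "B.cont j m"
  thus "pairing (index x i' j') (left x i' j') (right i' j') l m = pairing (index x i j) (left x i j) (right i j) l m"
    using pairing_ev[OF x] ev_compatible[OF x] unfolding A.cont_def B.cont_def by metis
qed

text \<open>The bridge to \<open>no_zero_divisors\<close>: the product formed by
  \<open>fs_mult\<close>, evaluated at t \<otimes> u, is the double sum in which one tensor
  multiplies inside the functionals.\<close>

lemma ev_product: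
  assumes x: "x \<in> carrier C" and y: "y \<in> carrier C" and t: "A.cont n t" and u: "B.cont n u"
  shows "eval_form (lifted t u) (fs_mult K (A.quo n) (B.quo n) (rep x n n) (rep y n n)) =
    (\<Oplus>\<^bsub>K\<^esub>q\<in>index y n n. pairing (index x n n) (left x n n) (right n n)
      (\<lambda>a. t (a \<otimes>\<^bsub>A\<^esub> left y n n q)) (\<lambda>b. u (b \<otimes>\<^bsub>B\<^esub> right n n q)))"
proof -
  interpret T: tensor_pair K "A.quo n" "B.quo n" "A.quo_h n" "B.quo_h n" by (rule level_pair)
  have tl: "A.linf t" and ul: "B.linf u" using t u unfolding A.cont_def B.cont_def by auto
  let ?g = "\<lambda>p q. t (left x n n p \<otimes>\<^bsub>A\<^esub> left y n n q) \<otimes>\<^bsub>K\<^esub> u (right n n p \<otimes>\<^bsub>B\<^esub> right n n q)"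
  have gK: "?g p q \<in> carrier K" if "p \<in> index x n n" "q \<in> index y n n" for p q
    using index_mem(6,7)[OF x that(1)] index_mem(6,7)[OF y that(2)] A.linfD(1)[OF tl] B.linfD(1)[OF ul] by simp
  have summand: "(rep x n n p \<otimes>\<^bsub>K\<^esub> rep y n n q) \<otimes>\<^bsub>K\<^esub>
      lifted t u (fst p \<otimes>\<^bsub>A.quo n\<^esub> fst q, snd p \<otimes>\<^bsub>B.quo n\<^esub> snd q) = ?g p q"
    if p: "p \<in> index x n n" and q: "q \<in> index y n n" for p q
  proof -
    note P = index_mem[OF x p] and Q = index_mem[OF y q]
    have "fst p \<otimes>\<^bsub>A.quo n\<^esub> fst q = A.ipow n +>\<^bsub>A\<^esub> (A.lift (fst p) \<otimes>\<^bsub>A\<^esub> A.lift (fst q))"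
      using ring_hom_mult[OF A.quo_hom P(4) Q(4)] A.coset_lift[OF P(1)] A.coset_lift[OF Q(1)] by simp
    hence 1: "t (A.lift (fst p \<otimes>\<^bsub>A.quo n\<^esub> fst q)) = t (A.lift (fst p) \<otimes>\<^bsub>A\<^esub> A.lift (fst q))"
      using A.cont_lift[OF t order_refl] P(4) Q(4) by simp
    have "snd p \<otimes>\<^bsub>B.quo n\<^esub> snd q = B.ipow n +>\<^bsub>B\<^esub> (B.lift (snd p) \<otimes>\<^bsub>B\<^esub> B.lift (snd q))"
      using ring_hom_mult[OF B.quo_hom P(5) Q(5)] B.coset_lift[OF P(2)] B.coset_lift[OF Q(2)] by simp
    hence 2: "u (B.lift (snd p \<otimes>\<^bsub>B.quo n\<^esub> snd q)) = u (B.lift (snd p) \<otimes>\<^bsub>B\<^esub> B.lift (snd q))"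
      using B.cont_lift[OF u order_refl] P(5) Q(5) by simp
    have "left x n n p \<otimes>\<^bsub>A\<^esub> left y n n q =
        hA (rep x n n p \<otimes>\<^bsub>K\<^esub> rep y n n q) \<otimes>\<^bsub>A\<^esub> (A.lift (fst p) \<otimes>\<^bsub>A\<^esub> A.lift (fst q))"
      unfolding left_def using P(3,4) Q(3,4) by (simp add: A.m_ac)
    hence "t (left x n n p \<otimes>\<^bsub>A\<^esub> left y n n q) =
        (rep x n n p \<otimes>\<^bsub>K\<^esub> rep y n n q) \<otimes>\<^bsub>K\<^esub> t (A.lift (fst p) \<otimes>\<^bsub>A\<^esub> A.lift (fst q))"
      using A.linfD(3)[OF tl A.K.m_closed[OF P(3) Q(3)] A.m_closed[OF P(4) Q(4)]] by (simp only:)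
    moreover have "t (A.lift (fst p) \<otimes>\<^bsub>A\<^esub> A.lift (fst q)) \<in> carrier K" "u (B.lift (snd p) \<otimes>\<^bsub>B\<^esub> B.lift (snd q)) \<in> carrier K"
      using A.linfD(1)[OF tl] B.linfD(1)[OF ul] P(4,5) Q(4,5) by auto
    ultimately show ?thesis unfolding lifted_def fst_conv snd_conv 1 2 right_def
      using P(3) Q(3) by (simp add: A.K.m_assoc)
  qed
  have "T.ev (lifted t u) (fs_mult K (A.quo n) (B.quo n) (rep x n n) (rep y n n)) =
    (\<Oplus>\<^bsub>K\<^esub>z\<in>index x n n \<times> index y n n. ?g (fst z) (snd z))"
    unfolding T.mult_fsums_ev(2)[OF rep_fsums[OF x] rep_fsums[OF y] lifted_bilin[OF t u]] index_def[symmetric]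
    by (rule A.K.finsum_cong'[OF refl]) (use summand gK in auto)
  also have "\<dots> = (\<Oplus>\<^bsub>K\<^esub>q\<in>index y n n. \<Oplus>\<^bsub>K\<^esub>p\<in>index x n n. ?g p q)"
    using index_finite[OF x] index_finite[OF y] gK by (intro A.K.finsum_product) auto
  finally show ?thesis unfolding pairing_def .
qed

text \<open>The nonvanishing sum from \<open>no_zero_divisors\<close> is a value of the product at
  one level, while every bilinear form vanishes on the class of zero.\<close>

theorem integral_C:
  assumes x: "x \<in> carrier C" "x \<noteq> \<zero>\<^bsub>C\<^esub>" and y: "y \<in> carrier C" "y \<noteq> \<zero>\<^bsub>C\<^esub>"
  shows "x \<otimes>\<^bsub>C\<^esub> y \<noteq> \<zero>\<^bsub>C\<^esub>"
proof
  assume eq: "x \<otimes>\<^bsub>C\<^esub> y = \<zero>\<^bsub>C\<^esub>"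
  obtain i j l m where 1: "A.cont i l" "B.cont j m" "eval_form (lifted l m) (rep x i j) \<noteq> \<zero>\<^bsub>K\<^esub>"
    using nonzero_detected[OF x] by blast
  obtain i' j' l' m' where 2: "A.cont i' l'" "B.cont j' m'" "eval_form (lifted l' m') (rep y i' j') \<noteq> \<zero>\<^bsub>K\<^esub>"
    using nonzero_detected[OF y] by blast
  have p1: "pairing (index x i j) (left x i j) (right i j) l m \<noteq> \<zero>\<^bsub>K\<^esub>"
    using pairing_ev[OF x(1)] 1 unfolding A.cont_def B.cont_def by metis
  have p2: "pairing (index y i' j') (left y i' j') (right i' j') l' m' \<noteq> \<zero>\<^bsub>K\<^esub>"
    using pairing_ev[OF y(1)] 2 unfolding A.cont_def B.cont_def by metis
  obtain n t u where tu: "A.cont n t" "B.cont n u"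
    "(\<Oplus>\<^bsub>K\<^esub>q\<in>index y n n. pairing (index x n n) (left x n n) (right n n)
      (\<lambda>a. t (a \<otimes>\<^bsub>A\<^esub> left y n n q)) (\<lambda>b. u (b \<otimes>\<^bsub>B\<^esub> right n n q))) \<noteq> \<zero>\<^bsub>K\<^esub>"
    using no_zero_divisors[OF family_of[OF x(1)] family_of[OF y(1)] 1(1,2) p1 2(1,2) p2] by blast
  interpret T: tensor_pair K "A.quo n" "B.quo n" "A.quo_h n" "B.quo_h n" by (rule level_pair)
  let ?f = "fs_mult K (A.quo n) (B.quo n) (rep x n n) (rep y n n)"
  have f: "?f \<in> fsums K (A.quo n) (B.quo n)" by (rule T.mult_fsums_ev(1)[OF rep_fsums[OF x(1)] rep_fsums[OF y(1)]])
  have "cls n n ?f = cls n n (fs_zero K)" using fun_cong[OF fun_cong[OF eq, of n], of n] unfolding mult_C zero_C .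
  hence "T.eqv ?f (fs_zero K)" using T.self_tclass[OF f] T.tclass_eqv[OF T.zero_fsums] by blast
  hence "T.ev (lifted t u) ?f = \<zero>\<^bsub>K\<^esub>" using T.ev_eqv[OF _ lifted_bilin[OF tu(1,2)]] T.ev_zero by metis
  thus False using ev_product[OF x(1) y(1) tu(1,2)] tu(3) by simp
qed

lemma commute_C:
  assumes "x \<in> carrier C" "y \<in> carrier C" shows "x \<otimes>\<^bsub>C\<^esub> y = y \<otimes>\<^bsub>C\<^esub> x"
  unfolding mult_C using tensor_pair.fs_mult_comm[OF level_pair rep_fsums[OF assms(1)] rep_fsums[OF assms(2)]] by simp

lemma one_nonzero_C: "\<one>\<^bsub>C\<^esub> \<noteq> \<zero>\<^bsub>C\<^esub>"
proof
  assume eq: "\<one>\<^bsub>C\<^esub> = \<zero>\<^bsub>C\<^esub>"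
  \<comment> \<open>Level 1 is the first usable one: the power 0 of an ideal is the whole ring, so
    the quotients at level 0 are zero rings. At level 1 properness of the maximal ideals gives
    functionals that vanish on them and are 1 at the unit.\<close>
  interpret T: tensor_pair K "A.quo 1" "B.quo 1" "A.quo_h 1" "B.quo_h 1" by (rule level_pair)
  obtain l where l: "A.linf l" "\<forall>x\<in>A.ipow 1. l x = \<zero>\<^bsub>K\<^esub>" "l \<one>\<^bsub>A\<^esub> = \<one>\<^bsub>K\<^esub>"
    using A.functional_exists[OF A.subsp_ideal[OF A.ideal_pow_ideal[OF A.I(1)]] A.one_closed, of 1]
      A.I A.ideal_pow_1[OF A.I(1)] by auto
  obtain m where m: "B.linf m" "\<forall>x\<in>B.ipow 1. m x = \<zero>\<^bsub>K\<^esub>" "m \<one>\<^bsub>B\<^esub> = \<one>\<^bsub>K\<^esub>"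
    using B.functional_exists[OF B.subsp_ideal[OF B.ideal_pow_ideal[OF B.I(1)]] B.one_closed, of 1]
      B.I B.ideal_pow_1[OF B.I(1)] by auto
  have cont: "A.cont 1 l" "B.cont 1 m" using l m unfolding A.cont_def B.cont_def by auto
  let ?p = "(\<one>\<^bsub>A.quo 1\<^esub>, \<one>\<^bsub>B.quo 1\<^esub>)"
  have p: "?p \<in> carrier (A.quo 1) \<times> carrier (B.quo 1)" by (intro SigmaI T.R.one_closed T.S.one_closed)
  have "cls 1 1 (fs_delta K ?p) = cls 1 1 (fs_zero K)"
    using fun_cong[OF fun_cong[OF eq, of 1], of 1] unfolding one_C zero_C .
  hence "T.eqv (fs_delta K ?p) (fs_zero K)"
    using T.self_tclass[OF T.delta_fsums[OF p]] T.tclass_eqv[OF T.zero_fsums] by blast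
  hence "T.ev (lifted l m) (fs_delta K ?p) = \<zero>\<^bsub>K\<^esub>" using T.ev_eqv[OF _ lifted_bilin[OF cont]] T.ev_zero by metis
  hence "lifted l m ?p = \<zero>\<^bsub>K\<^esub>" unfolding T.ev_delta[OF p lifted_bilin[OF cont]] .
  moreover have "l (A.lift \<one>\<^bsub>A.quo 1\<^esub>) = \<one>\<^bsub>K\<^esub>"
    using A.cont_lift[OF cont(1) order_refl A.one_closed] ring_hom_one[OF A.quo_hom, of 1] l(3) by simp
  moreover have "m (B.lift \<one>\<^bsub>B.quo 1\<^esub>) = \<one>\<^bsub>K\<^esub>"
    using B.cont_lift[OF cont(2) order_refl B.one_closed] ring_hom_one[OF B.quo_hom, of 1] m(3) by simp
  ultimately show False unfolding lifted_def by simp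
qed

end

theorem theorem3p9:
  fixes K :: "('k, 'c) ring_scheme" and A :: "('a, 'd) ring_scheme" and B :: "('b, 'e) ring_scheme"
    and phi :: "'k \<Rightarrow> 'a" and psi :: "'k \<Rightarrow> 'b"
  assumes "algebraically_closed K"
    and "complete_noetherian_local_ring A" and "complete_noetherian_local_ring B"
    and "phi \<in> ring_hom K A" and "psi \<in> ring_hom K B"
    and "noetherian_ring (completed_tensor K A B phi psi)"
    and "domain A" and "domain B"
  shows "domain (completed_tensor K A B phi psi)"
proof -
  interpret local_pair K A B phi psi
    by (intro local_pair.intro complete_domain_pair.intro complete_domain_max_ideal assms)
  \<comment> \<open>\<open>noetherian_ring\<close> extends \<open>ring\<close>, so the hypothesis on
    the completed tensor product supplies its ring axioms; commutativity, a unit different from zero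
    and integrality remain.\<close>
  interpret C: ring C using assms(6) by (rule noetherian_ring.axioms(1))
  have "cring C"
    by (intro cring.intro C.ring_axioms comm_monoid.intro C.monoid_axioms comm_monoid_axioms.intro commute_C)
  moreover have "domain_axioms C"
    by (rule domain_axioms.intro) (use one_nonzero_C integral_C in blast)+
  ultimately show ?thesis by (rule domain.intro)
qed

end
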